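(* Let $\Phi_{n,m}(\epsilon)$, $(n,m)\in\mathbb{Z}^2$, be the family of scalar vortex-cross solutions defined in the context, for small $\epsilon>0$. The linearized problem $$(1-2|\Phi_{n,m}|^2)a_{n,m}-\Phi_{n,m}^2 b_{n,m}-\epsilon(a_{n+1,m}+a_{n-1,m}+a_{n,m+1}+a_{n,m-1})=i\lambda a_{n,m},$$ $$(1-2|\Phi_{n,m}|^2)b_{n,m}-\bar\Phi_{n,m}^2 a_{n,m}-\epsilon(b_{n+1,m}+b_{n-1,m}+b_{n,m+1}+b_{n,m-1})=-i\lambda b_{n,m}$$ has zero eigenvalue of algebraic multiplicity two and geometric multiplicity one, and three small pairs of purely imaginary eigenvalues of negative Krein signature with the asymptotic approximations $$\lambda_{1,2},\lambda_{3,4}=\pm 2i\epsilon+O(\epsilon^2),\qquad \lambda_{5,6}=\pm 4i\epsilon^2+O(\epsilon^3).$$ The rest of the spectrum is bounded away from the origin as $\epsilon\to 0$ and it is located on the imaginary axis of $\lambda$.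
   Context: Let $S^{(0)}=\{(-1,0);(0,-1);(1,0);(0,1)\}\subset\mathbb{Z}^2$, enumerated in this order by $j=1,2,3,4$. For small $\epsilon\ge 0$, the scalar vortex cross $\Phi(\epsilon)$ is the unique (up to the gauge transformation $\Phi\mapsto e^{i\alpha}\Phi$) family of localized ($\ell^2(\mathbb{Z}^2)$) solutions, real analytic in $\epsilon$, of $$(1-|\Phi_{n,m}|^2)\Phi_{n,m}=\epsilon(\Phi_{n+1,m}+\Phi_{n-1,m}+\Phi_{n,m+1}+\Phi_{n,m-1}),$$ such that at $\epsilon=0$: $\Phi_{n,m}(0)=e^{i\pi(j-1)/2}$ at the $j$-th node of $S^{(0)}$ and $\Phi_{n,m}(0)=0$ for $(n,m)\notin S^{(0)}$. The linearized problem is written as $\mathcal{H}(\epsilon)\varphi=i\lambda\sigma\varphi$ for $\varphi=(a_{n,m},b_{n,m})_{(n,m)\in\mathbb{Z}^2}$, with $\sigma=\mathrm{diag}(1,-1)$ at each node and $\mathcal{H}(\epsilon)$ the self-adjoint operator on $\ell^2$ defined by the left-hand sides; spectrum and multiplicities refer to the spectral parameter $\lambda$ in $\ell^2$. A simple eigenvalue $\lambda$ has negative Krein signature if the quadratic form $(\mathcal{H}(\epsilon)\varphi,\varphi)$ is negative for the associated eigenvector $\varphi$. *)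

theory Defs
  imports "HOL-Analysis.Analysis" "HOL-Library.Function_Algebras" "HOL-Library.Landau_Symbols"
begin

section \<open>Square-summable families\<close>

definition ell2 :: "('i \<Rightarrow> 'b::real_normed_vector) set" where
  "ell2 = {f. (\<lambda>x. (norm (f x))\<^sup>2) summable_on UNIV}"

definition ell2_norm :: "('i \<Rightarrow> 'b::real_normed_vector) \<Rightarrow> real" where
  "ell2_norm f = sqrt (\<Sum>\<^sub>\<infinity>x. (norm (f x))\<^sup>2)"

text \<open>
  Perturbations are families of pairs \<open>(a x, b x)\<close>. The norm of the product type is
  \<open>sqrt (|a x|^2 + |b x|^2)\<close>, so \<^const>\<open>ell2\<close> and \<^const>\<open>ell2_norm\<close> at this
  type are the usual ones. The vector space operations are pointwise; complex scalars act by
  \<open>cscale\<close> below.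
\<close>

type_synonym 'i spinor = "'i \<Rightarrow> complex \<times> complex"

definition cscale :: "complex \<Rightarrow> 'i spinor \<Rightarrow> 'i spinor" where
  "cscale c \<phi> = (\<lambda>x. (c * fst (\<phi> x), c * snd (\<phi> x)))"

interpretation spinor: vector_space cscale
  by unfold_locales (auto simp: cscale_def fun_eq_iff prod_eq_iff algebra_simps)

definition ell2_inner :: "'i spinor \<Rightarrow> 'i spinor \<Rightarrow> complex" where
  "ell2_inner \<phi> \<psi> = (\<Sum>\<^sub>\<infinity>x. fst (\<phi> x) * cnj (fst (\<psi> x)) + snd (\<phi> x) * cnj (snd (\<psi> x)))"


section \<open>Spectrum and multiplicities of an operator on \<open>\<ell>\<^sup>2\<close>\<close>

definition spectrum :: "('i spinor \<Rightarrow> 'i spinor) \<Rightarrow> complex set" where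
  "spectrum T = {z. \<not> (bij_betw (\<lambda>\<phi>. T \<phi> - cscale z \<phi>) ell2 ell2 \<and>
      (\<exists>K. \<forall>\<phi>\<in>ell2. ell2_norm \<phi> \<le> K * ell2_norm (T \<phi> - cscale z \<phi>)))}"

definition eigenspace :: "('i spinor \<Rightarrow> 'i spinor) \<Rightarrow> complex \<Rightarrow> 'i spinor set" where
  "eigenspace T z = {\<phi>\<in>ell2. T \<phi> = cscale z \<phi>}"

definition gen_eigenspace :: "('i spinor \<Rightarrow> 'i spinor) \<Rightarrow> complex \<Rightarrow> 'i spinor set" where
  "gen_eigenspace T z = {\<phi>\<in>ell2. \<exists>k. ((\<lambda>\<psi>. T \<psi> - cscale z \<psi>) ^^ k) \<phi> = 0}"

text \<open>\<^term>\<open>spinor.dim\<close> is 0 on infinite-dimensional spaces, so only positive values of the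
  multiplicities carry their usual meaning.\<close>

definition geom_mult :: "('i spinor \<Rightarrow> 'i spinor) \<Rightarrow> complex \<Rightarrow> nat" where
  "geom_mult T z = spinor.dim (eigenspace T z)"

definition alg_mult :: "('i spinor \<Rightarrow> 'i spinor) \<Rightarrow> complex \<Rightarrow> nat" where
  "alg_mult T z = spinor.dim (gen_eigenspace T z)"

definition simple_eigenvalue :: "('i spinor \<Rightarrow> 'i spinor) \<Rightarrow> complex \<Rightarrow> bool" where
  "simple_eigenvalue T z \<longleftrightarrow> (\<exists>\<phi>\<in>eigenspace T z. \<phi> \<noteq> 0) \<and> alg_mult T z = 1"


section \<open>The scalar vortex cross\<close>

definition nbr_sum :: "(int \<times> int \<Rightarrow> complex) \<Rightarrow> int \<times> int \<Rightarrow> complex" where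
  "nbr_sum u = (\<lambda>(n, m). u (n + 1, m) + u (n - 1, m) + u (n, m + 1) + u (n, m - 1))"

definition stationary :: "real \<Rightarrow> (int \<times> int \<Rightarrow> complex) \<Rightarrow> bool" where
  "stationary \<epsilon> u \<longleftrightarrow>
     (\<forall>x. of_real (1 - (cmod (u x))\<^sup>2) * u x = of_real \<epsilon> * nbr_sum u x)"

text \<open>The nodes are numbered from 0 here, so that node \<open>j\<close> carries the phase \<open>\<pi> j / 2\<close>.\<close>

definition S0 :: "(int \<times> int) list" where
  "S0 = [(-1, 0), (0, -1), (1, 0), (0, 1)]"

text \<open>
  A family \<open>\<Phi>\<close> is real analytic in \<open>\<epsilon>\<close> as an \<open>\<ell>\<^sup>2\<close>-valued map for small \<open>\<epsilon> \<ge> 0\<close>: it is the sum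
  of an \<open>\<ell>\<^sup>2\<close>-convergent power series. The gauge is normalised at \<open>\<epsilon> = 0\<close> only, so every family
  \<open>exp (i \<alpha>(\<epsilon>)) \<Phi>(\<epsilon>)\<close> with \<open>\<alpha>\<close> analytic and \<open>\<alpha>(0) = 0\<close> is included as well. Values of
  \<open>\<Phi>\<close> at negative or large \<open>\<epsilon>\<close> are irrelevant.
\<close>

definition vortex_cross_family :: "(real \<Rightarrow> int \<times> int \<Rightarrow> complex) \<Rightarrow> bool" where
  "vortex_cross_family \<Phi> \<longleftrightarrow>
     (\<exists>r>0. (\<forall>\<epsilon>\<in>{0..<r}. \<Phi> \<epsilon> \<in> ell2 \<and> stationary \<epsilon> (\<Phi> \<epsilon>)) \<and>
       (\<exists>c. (\<forall>k. c k \<in> ell2) \<and>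
         (\<forall>\<epsilon>\<in>{0..<r}.
           (\<lambda>N. ell2_norm (\<lambda>x. \<Phi> \<epsilon> x - (\<Sum>k<N. of_real (\<epsilon> ^ k) * c k x))) \<longlonglongrightarrow> 0))) \<and>
     (\<forall>j<4. \<Phi> 0 (S0 ! j) = exp (\<i> * of_real pi * of_nat j / 2)) \<and>
     (\<forall>x. x \<notin> set S0 \<longrightarrow> \<Phi> 0 x = 0)"


section \<open>The linearized problem\<close>

definition hess :: "real \<Rightarrow> (int \<times> int \<Rightarrow> complex) \<Rightarrow> (int \<times> int) spinor \<Rightarrow> (int \<times> int) spinor" where
  "hess \<epsilon> u \<phi> = (\<lambda>x.
     (of_real (1 - 2 * (cmod (u x))\<^sup>2) * fst (\<phi> x) - (u x)\<^sup>2 * snd (\<phi> x)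
        - of_real \<epsilon> * nbr_sum (\<lambda>y. fst (\<phi> y)) x,
      of_real (1 - 2 * (cmod (u x))\<^sup>2) * snd (\<phi> x) - (cnj (u x))\<^sup>2 * fst (\<phi> x)
        - of_real \<epsilon> * nbr_sum (\<lambda>y. snd (\<phi> y)) x))"

definition pauli :: "'i spinor \<Rightarrow> 'i spinor" where
  "pauli \<phi> = (\<lambda>x. (fst (\<phi> x), - snd (\<phi> x)))"

text \<open>
  Since \<open>\<sigma>\<^sup>2 = 1\<close>, the problem \<open>H \<phi> = i \<lambda> \<sigma> \<phi>\<close> is the ordinary spectral problem
  \<open>L \<phi> = \<lambda> \<phi>\<close> for \<open>L = -i \<sigma> H\<close>.
\<close>

definition lin_op :: "real \<Rightarrow> (int \<times> int \<Rightarrow> complex) \<Rightarrow> (int \<times> int) spinor \<Rightarrow> (int \<times> int) spinor" where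
  "lin_op \<epsilon> u \<phi> = cscale (- \<i>) (pauli (hess \<epsilon> u \<phi>))"

lemma lin_op_eigen_iff:
  "lin_op \<epsilon> u \<phi> = cscale z \<phi> \<longleftrightarrow> hess \<epsilon> u \<phi> = cscale (\<i> * z) (pauli \<phi>)"
proof -
  have *: "- (\<i> * p) = l * q \<longleftrightarrow> p = \<i> * l * q" "\<i> * p = l * q \<longleftrightarrow> p = - (\<i> * l * q)"
    for p l q :: complex
    by (auto simp: complex_eq_iff)
  show ?thesis
    by (simp add: lin_op_def pauli_def cscale_def fun_eq_iff prod_eq_iff *)
qed

text \<open>The quadratic form is real because \<^term>\<open>hess \<epsilon> u\<close> is self-adjoint.\<close>

definition negative_krein :: "real \<Rightarrow> (int \<times> int \<Rightarrow> complex) \<Rightarrow> complex \<Rightarrow> bool" where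
  "negative_krein \<epsilon> u z \<longleftrightarrow> simple_eigenvalue (lin_op \<epsilon> u) z \<and>
     (\<forall>\<phi>\<in>eigenspace (lin_op \<epsilon> u) z. \<phi> \<noteq> 0 \<longrightarrow> Re (ell2_inner (hess \<epsilon> u \<phi>) \<phi>) < 0)"

end

theory Submission
  imports Defs
begin

text \<open>
  Write the spectral parameter as \<open>\<lambda> = -\<i>\<mu>\<close>; the problem becomes \<open>(H - \<mu>\<sigma>)\<phi> = 0\<close> with a self-adjoint
  operator \<open>H\<close>, and purely imaginary \<open>\<lambda>\<close> correspond to real \<open>\<mu>\<close>. At zero coupling each of the four
  nodes contributes a two-dimensional generalised kernel: the phase of the node is free, and the phase
  direction is mapped by \<open>\<sigma>\<close> to the amplitude direction, on which \<open>H\<close> is \<open>-2\<close>. So eight eigenvalues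
  emerge from the origin.

  Turning the lattice by a right angle multiplies the solution by \<open>\<i>\<close>. This is not assumed:
  the turned solution, multiplied by a suitable phase, is again a solution close to the cross, and two
  such solutions agree once one relative phase is fixed (lemma \<open>eventually_rot\<close>). Hence \<open>H\<close> commutes with
  an operator \<open>R\<close> of order four, and \<open>\<ell>\<^sup>2\<close> splits into four sectors \<open>R f = \<omega> f\<close>, \<open>\<omega>\<^sup>4 = 1\<close>. Each sector
  contains exactly one phase mode \<open>e\<^sub>\<omega>\<close>, supported on the nodes.

  Adding to \<open>H\<close> the projection onto the phase modes makes
  \<open>H - \<mu>\<sigma>\<close> invertible for small \<open>\<mu>\<close>. Solving with right-hand side \<open>e\<^sub>\<omega>\<close> gives \<open>\<psi>\<^sub>\<omega>(\<mu>)\<close> with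
  \<open>(H - \<mu>\<sigma>)\<psi>\<^sub>\<omega>(\<mu>) = p\<^sub>\<omega>(\<mu>) e\<^sub>\<omega>\<close>, so the small eigenvalues are the zeros of the four real functions \<open>p\<^sub>\<omega>\<close>
  (locale \<open>reg_pencil\<close>). Their second divided differences are at least \<open>1/4\<close>: if
  \<open>p\<^sub>\<omega>(0) < 0\<close>, there is exactly one negative and one positive zero, and the slope at a zero decides the
  Krein signature, which is therefore negative. For \<open>\<omega> = 1\<close> gauge invariance makes \<open>0\<close> a double zero. Complex conjugation
  gives \<open>p (-\<i>) (-\<mu>) = p \<i> \<mu>\<close> and makes \<open>p (-1)\<close> even. In each sector the negative directions of \<open>H\<close> are used up by these
  eigenvectors, which excludes non-real \<open>\<mu>\<close> (lemma \<open>index_bound\<close>). Lemma \<open>spectral_picture\<close> collects this; it needs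
  \<open>p \<i> 0 < 0\<close>, \<open>p (-1) 0 < 0\<close> and that no two of the zeros coincide.

  What remains is to expand in \<open>\<epsilon>\<close>. A site at lattice distance \<open>d\<close> from the origin carries only order
  \<open>\<epsilon>\<^bsup>d-1\<^esup>\<close>, so finitely many sites matter at any given order, and
  a mode is governed by a two-by-two system for its two components at one node, whose determinant can be expanded. One
  finds \<open>p \<i> 0 = -2\<epsilon>\<^sup>2 + O(\<epsilon>\<^sup>3)\<close> with zeros \<open>\<mu>\<^sup>2 = 4\<epsilon>\<^sup>2 + O(\<epsilon>\<^sup>4)\<close>, and \<open>p (-1) 0 = -8\<epsilon>\<^sup>4 + O(\<epsilon>\<^sup>5)\<close> with
  zeros \<open>\<mu>\<^sup>2 = 16\<epsilon>\<^sup>4 + O(\<epsilon>\<^sup>6)\<close>. The delicate point is that the two pairs near \<open>\<plusminus>2\<epsilon>\<close>, from the sectors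
  \<open>\<plusminus>\<i>\<close>, do not coincide. They would coincide exactly if \<open>p \<i>\<close> had opposite zeros \<open>\<plusminus>\<mu>\<close>; the odd part of the determinant is
  \<open>-32\<epsilon>\<^sup>4\<mu>\<^sup>3 - 352\<epsilon>\<^sup>6\<mu>\<close> up to \<open>O(\<epsilon>\<^sup>8)\<close>, which is of the size of \<open>\<epsilon>\<^sup>7\<close> at \<open>\<mu> \<approx> \<plusminus>2\<epsilon>\<close>. This is why the expansion is carried so far
  (lemmas \<open>det_i_odd\<close>, \<open>det_i_no_opposite_roots\<close>).
\<close>

section \<open>The Hilbert space of square-summable spinors\<close>

lemma ell2_iff_bounded:
  "f \<in> ell2 \<longleftrightarrow> (\<exists>B. \<forall>F. finite F \<longrightarrow> (\<Sum>x\<in>F. (norm (f x))\<^sup>2) \<le> B)"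
proof
  assume "f \<in> ell2"
  then have s: "(\<lambda>x. (norm (f x))\<^sup>2) summable_on UNIV" by (simp add: ell2_def)
  show "\<exists>B. \<forall>F. finite F \<longrightarrow> (\<Sum>x\<in>F. (norm (f x))\<^sup>2) \<le> B"
    by (rule exI[of _ "\<Sum>\<^sub>\<infinity>x. (norm (f x))\<^sup>2"]) (auto intro!: finite_sum_le_infsum[OF s])
next
  assume "\<exists>B. \<forall>F. finite F \<longrightarrow> (\<Sum>x\<in>F. (norm (f x))\<^sup>2) \<le> B"
  then obtain B where "\<And>F. finite F \<Longrightarrow> (\<Sum>x\<in>F. (norm (f x))\<^sup>2) \<le> B" by blast
  then have "(\<lambda>x. (norm (f x))\<^sup>2) summable_on UNIV"
    by (intro nonneg_bdd_above_summable_on bdd_aboveI[where M=B]) auto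
  then show "f \<in> ell2" by (simp add: ell2_def)
qed

lemma ell2_le:
  assumes "g \<in> ell2" "\<And>x. norm (f x) \<le> K * norm (g x)"
  shows "f \<in> ell2"
proof -
  obtain B where B: "\<And>F. finite F \<Longrightarrow> (\<Sum>x\<in>F. (norm (g x))\<^sup>2) \<le> B"
    using assms(1) unfolding ell2_iff_bounded by blast
  have "(\<Sum>x\<in>F. (norm (f x))\<^sup>2) \<le> K\<^sup>2 * B" if "finite F" for F
  proof -
    have "(\<Sum>x\<in>F. (norm (f x))\<^sup>2) \<le> (\<Sum>x\<in>F. K\<^sup>2 * (norm (g x))\<^sup>2)"
      using assms(2) by (intro sum_mono) (metis norm_ge_zero power_mono power_mult_distrib)
    also have "\<dots> \<le> K\<^sup>2 * B" using B[OF that] by (simp add: sum_distrib_left[symmetric] mult_left_mono)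
    finally show ?thesis .
  qed
  then show ?thesis unfolding ell2_iff_bounded by blast
qed

lemma ell2_add: assumes "f \<in> ell2" "g \<in> ell2" shows "(\<lambda>x. f x + g x) \<in> ell2"
proof -
  obtain B where B: "\<And>F. finite F \<Longrightarrow> (\<Sum>x\<in>F. (norm (f x))\<^sup>2) \<le> B"
    using assms(1) unfolding ell2_iff_bounded by blast
  obtain C where C: "\<And>F. finite F \<Longrightarrow> (\<Sum>x\<in>F. (norm (g x))\<^sup>2) \<le> C"
    using assms(2) unfolding ell2_iff_bounded by blast
  have *: "(norm (a + b))\<^sup>2 \<le> 2 * (norm a)\<^sup>2 + 2 * (norm b)\<^sup>2" for a b :: 'b
  proof -
    have "(norm (a + b))\<^sup>2 \<le> (norm a + norm b)\<^sup>2" by (intro power_mono norm_triangle_ineq) auto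
    also have "\<dots> \<le> 2 * (norm a)\<^sup>2 + 2 * (norm b)\<^sup>2"
      using sum_squares_bound[of "norm a" "norm b"] by (simp add: power2_sum)
    finally show ?thesis .
  qed
  have "(\<Sum>x\<in>F. (norm (f x + g x))\<^sup>2) \<le> 2 * B + 2 * C" if "finite F" for F
  proof -
    have "(\<Sum>x\<in>F. (norm (f x + g x))\<^sup>2) \<le> (\<Sum>x\<in>F. 2 * (norm (f x))\<^sup>2 + 2 * (norm (g x))\<^sup>2)"
      by (intro sum_mono *)
    also have "\<dots> \<le> 2 * B + 2 * C" using B[OF that] C[OF that]
      by (simp add: sum.distrib sum_distrib_left[symmetric])
    finally show ?thesis .
  qed
  then show ?thesis unfolding ell2_iff_bounded by blast
qed

lemma ell2_diff: assumes "f \<in> ell2" "g \<in> ell2" shows "(\<lambda>x. f x - g x) \<in> ell2"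
  using ell2_add[OF assms(1) ell2_le[OF assms(2), of "\<lambda>x. - g x" 1]] by simp

lemma ell2_inner_summable:
  fixes f g :: "'i \<Rightarrow> 'b::real_inner"
  assumes "f \<in> ell2" "g \<in> ell2" shows "(\<lambda>x. f x \<bullet> g x) summable_on UNIV"
proof (rule abs_summable_summable, rule summable_on_comparison_test)
  show "(\<lambda>x. (norm (f x))\<^sup>2 + (norm (g x))\<^sup>2) summable_on UNIV"
    using assms by (intro summable_on_add) (auto simp: ell2_def)
  show "norm (f x \<bullet> g x) \<le> (norm (f x))\<^sup>2 + (norm (g x))\<^sup>2" for x
  proof -
    have "norm (f x \<bullet> g x) \<le> norm (f x) * norm (g x)" using Cauchy_Schwarz_ineq2 by simp
    also have "\<dots> \<le> (norm (f x))\<^sup>2 + (norm (g x))\<^sup>2"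
      using sum_squares_bound[of "norm (f x)" "norm (g x)"]
        mult_nonneg_nonneg[OF norm_ge_zero[of "f x"] norm_ge_zero[of "g x"]] by linarith
    finally show ?thesis .
  qed
qed auto

text \<open>
  As a type, \<open>\<ell>\<^sup>2\<close> is an instance of the classes of real inner product spaces and complete spaces; the
  complex structure is the operator \<open>cs\<close> below.
\<close>

typedef hil = "ell2 :: (int \<times> int) spinor set"
  morphisms vl Abs_hil
  by (rule exI[of _ "\<lambda>x. 0"]) (simp add: ell2_def)

lemmas rep_ell2 [simp] = vl

lemma hil_eqI: "(\<And>x. vl f x = vl g x) \<Longrightarrow> f = g"
  using vl_inject by blast

instantiation hil :: real_inner
begin

definition "0 = Abs_hil (\<lambda>x. 0)"
definition "f + g = Abs_hil (\<lambda>x. vl f x + vl g x)"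
definition "f - g = Abs_hil (\<lambda>x. vl f x - vl g x)"
definition "- f = Abs_hil (\<lambda>x. - vl f x)"
definition "c *\<^sub>R f = Abs_hil (\<lambda>x. c *\<^sub>R vl f x)"
definition "inner f g = (\<Sum>\<^sub>\<infinity>x. vl f x \<bullet> vl g x)"
definition "norm (f::hil) = sqrt (inner f f)"
definition "dist (f::hil) g = norm (f - g)"
definition "sgn (f::hil) = inverse (norm f) *\<^sub>R f"
definition "uniformity = (INF e\<in>{0<..}. principal {(f, g::hil). dist f g < e})"
definition "open U = (\<forall>f::hil\<in>U. \<forall>\<^sub>F (f', g) in uniformity. f' = f \<longrightarrow> g \<in> U)"

lemma rep_hil_simps [simp]:
  "vl 0 x = 0" "vl (f + g) x = vl f x + vl g x" "vl (f - g) x = vl f x - vl g x"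
  "vl (- f) x = - vl f x" "vl (c *\<^sub>R f) x = c *\<^sub>R vl f x"
proof -
  show "vl 0 x = 0" by (simp add: zero_hil_def Abs_hil_inverse ell2_def)
  show "vl (f + g) x = vl f x + vl g x" by (simp add: plus_hil_def Abs_hil_inverse ell2_add)
  show "vl (f - g) x = vl f x - vl g x" by (simp add: minus_hil_def Abs_hil_inverse ell2_diff)
  show "vl (- f) x = - vl f x"
    using ell2_le[OF rep_ell2, of "\<lambda>x. - vl f x" 1 f] by (simp add: uminus_hil_def Abs_hil_inverse)
  show "vl (c *\<^sub>R f) x = c *\<^sub>R vl f x"
    using ell2_le[OF rep_ell2, of "\<lambda>x. c *\<^sub>R vl f x" "\<bar>c\<bar>" f]
    by (simp add: scaleR_hil_def Abs_hil_inverse)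
qed

lemma summable_rep: "(\<lambda>x. vl f x \<bullet> vl g x) summable_on UNIV"
  by (rule ell2_inner_summable) auto

instance
proof
  fix a b c :: hil and r s :: real
  show "a + b + c = a + (b + c)" "a + b = b + a" "0 + a = a" "- a + a = 0" "a - b = a + - b"
    "r *\<^sub>R (a + b) = r *\<^sub>R a + r *\<^sub>R b" "(r + s) *\<^sub>R a = r *\<^sub>R a + s *\<^sub>R a"
    "r *\<^sub>R s *\<^sub>R a = (r * s) *\<^sub>R a" "1 *\<^sub>R a = a"
    by (rule hil_eqI, simp add: algebra_simps)+
  show "dist a b = norm (a - b)" by (rule dist_hil_def)
  show "sgn a = scaleR (inverse (norm a)) a" by (rule sgn_hil_def)
  show "uniformity = (INF e\<in>{0<..}. principal {(x, y::hil). dist x y < e})" by (rule uniformity_hil_def)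
  show "open U = (\<forall>x\<in>U. \<forall>\<^sub>F (x', y) in uniformity. x' = x \<longrightarrow> y \<in> U)" for U :: "hil set"
    by (rule open_hil_def)
  show "inner a b = inner b a" by (simp add: inner_hil_def inner_commute)
  show "inner (a + b) c = inner a c + inner b c"
    by (simp add: inner_hil_def inner_add_left infsum_add summable_rep)
  show "inner (r *\<^sub>R a) b = r * inner a b"
    by (simp add: inner_hil_def infsum_cmult_right' )
  show "0 \<le> inner a a" by (simp add: inner_hil_def infsum_nonneg)
  show "inner a a = 0 \<longleftrightarrow> a = 0"
  proof
    assume "inner a a = 0"
    then have *: "(\<Sum>\<^sub>\<infinity>x. vl a x \<bullet> vl a x) \<le> 0" by (simp add: inner_hil_def)
    have "vl a x \<bullet> vl a x = 0" for x
      using nonneg_infsum_le_0D[OF * summable_rep] by auto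
    then show "a = 0" by (intro hil_eqI) simp
  qed (simp add: inner_hil_def)
  show "norm a = sqrt (inner a a)" by (rule norm_hil_def)
qed

end

lemma norm_hil_sq: "(norm (f::hil))\<^sup>2 = (\<Sum>\<^sub>\<infinity>x. (norm (vl f x))\<^sup>2)"
  by (simp add: norm_hil_def inner_hil_def power2_norm_eq_inner infsum_nonneg)

lemma norm_hil_ell2_norm: "norm f = ell2_norm (vl f)"
  by (simp add: norm_hil_def inner_hil_def ell2_norm_def power2_norm_eq_inner)

lemma sum_le_norm_hil: "finite F \<Longrightarrow> (\<Sum>x\<in>F. (norm (vl f x))\<^sup>2) \<le> (norm f)\<^sup>2"
  unfolding norm_hil_sq using rep_ell2[of f]
  by (intro finite_sum_le_infsum) (auto simp: ell2_def)

lemma norm_rep_le: "norm (vl f x) \<le> norm f"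
  using sum_le_norm_hil[of "{x}" f] by (simp add: power2_le_iff_abs_le)

lemma norm_hil_le:
  assumes "0 \<le> K" "\<And>F. finite F \<Longrightarrow> (\<Sum>x\<in>F. (norm (vl f x))\<^sup>2) \<le> K\<^sup>2"
  shows "norm f \<le> K"
proof -
  have "(norm f)\<^sup>2 \<le> K\<^sup>2" unfolding norm_hil_sq
    using rep_ell2[of f] assms(2) by (intro infsum_le_finite_sums) (auto simp: ell2_def)
  then show ?thesis using assms(1) by (simp add: power2_le_iff_abs_le)
qed

instance hil :: complete_space
proof
  fix X :: "nat \<Rightarrow> hil" assume X: "Cauchy X"
  have "Cauchy (\<lambda>n. vl (X n) x)" for x
  proof (rule metric_CauchyI)
    fix e :: real assume "0 < e"
    then obtain M where M: "\<And>m n. m \<ge> M \<Longrightarrow> n \<ge> M \<Longrightarrow> dist (X m) (X n) < e"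
      using X unfolding Cauchy_def by blast
    have "dist (vl (X m) x) (vl (X n) x) \<le> dist (X m) (X n)" for m n
      using norm_rep_le[of "X m - X n" x] by (simp add: dist_norm)
    then show "\<exists>M. \<forall>m\<ge>M. \<forall>n\<ge>M. dist (vl (X m) x) (vl (X n) x) < e" using M by (meson le_less_trans)
  qed
  then have "\<forall>x. \<exists>l. (\<lambda>n. vl (X n) x) \<longlonglongrightarrow> l" using Cauchy_convergent_iff convergent_def by blast
  then obtain l where l: "\<And>x. (\<lambda>n. vl (X n) x) \<longlonglongrightarrow> l x" by metis
  have *: "(\<Sum>x\<in>F. (norm (vl (X n) x - l x))\<^sup>2) \<le> e\<^sup>2"
    if "finite F" "\<And>m. m \<ge> M \<Longrightarrow> dist (X m) (X n) \<le> e" "e \<ge> 0" for F n M e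
  proof -
    have "(\<lambda>m. \<Sum>x\<in>F. (norm (vl (X n) x - vl (X m) x))\<^sup>2) \<longlonglongrightarrow> (\<Sum>x\<in>F. (norm (vl (X n) x - l x))\<^sup>2)"
      by (intro tendsto_intros l)
    moreover have "(\<Sum>x\<in>F. (norm (vl (X n) x - vl (X m) x))\<^sup>2) \<le> e\<^sup>2" if "m \<ge> M" for m
    proof -
      have "(\<Sum>x\<in>F. (norm (vl (X n - X m) x))\<^sup>2) \<le> (norm (X n - X m))\<^sup>2" by (rule sum_le_norm_hil) fact
      also have "\<dots> \<le> e\<^sup>2"
        using \<open>\<And>m. m \<ge> M \<Longrightarrow> dist (X m) (X n) \<le> e\<close>[OF that] by (intro power_mono) (auto simp: dist_norm norm_minus_commute)
      finally show ?thesis by simp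
    qed
    ultimately show ?thesis by (meson LIMSEQ_le_const2)
  qed
  obtain M where M: "\<And>m n. m \<ge> M \<Longrightarrow> n \<ge> M \<Longrightarrow> dist (X m) (X n) < 1"
    using X unfolding Cauchy_def by (meson zero_less_one)
  have "(\<lambda>x. vl (X M) x - l x) \<in> ell2" unfolding ell2_iff_bounded
    using *[where M=M and n=M and e=1] M by (auto intro!: exI[of _ 1] simp: less_imp_le)
  then have l2: "l \<in> ell2" using ell2_diff[of "vl (X M)" "\<lambda>x. vl (X M) x - l x"] by simp
  have "X \<longlonglongrightarrow> Abs_hil l"
  proof (rule metric_LIMSEQ_I)
    fix e :: real assume "0 < e"
    then obtain M where M: "\<And>m n. m \<ge> M \<Longrightarrow> n \<ge> M \<Longrightarrow> dist (X m) (X n) < e/2"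
      using X unfolding Cauchy_def by (meson half_gt_zero)
    have "dist (X n) (Abs_hil l) < e" if "n \<ge> M" for n
    proof -
      have "norm (X n - Abs_hil l) \<le> e/2"
        using *[where M=M and n=n and e="e/2"] M that \<open>0 < e\<close>
        by (intro norm_hil_le) (auto simp: Abs_hil_inverse l2 less_imp_le)
      then show ?thesis using \<open>0 < e\<close> by (simp add: dist_norm)
    qed
    then show "\<exists>no. \<forall>n\<ge>no. dist (X n) (Abs_hil l) < e" by blast
  qed
  then show "convergent X" by (auto simp: convergent_def)
qed

text \<open>
  A lower bound for the adjoint makes \<open>A B\<close> coercive; the contraction argument of Lax and Milgram then
  solves \<open>A (B x) = y\<close>.
\<close>

lemma surj_of_adjoint_bounded_below:
  fixes A B :: "'a::{real_inner,complete_space} \<Rightarrow> 'a"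
  assumes A: "bounded_linear A" and B: "bounded_linear B"
    and adj: "\<And>x y. A x \<bullet> y = x \<bullet> B y" and K: "\<And>x. norm x \<le> K * norm (B x)"
  shows "surj A"
proof -
  obtain C where C: "\<And>x. norm (A x) \<le> norm x * C" "C > 0"
    using bounded_linear.pos_bounded[OF A] by blast
  define K' where "K' = \<bar>K\<bar> + 1"
  have K': "K' > 0" "norm x \<le> K' * norm (B x)" for x
  proof -
    have "K * norm (B x) \<le> (\<bar>K\<bar> + 1) * norm (B x)" by (intro mult_right_mono) auto
    then show "norm x \<le> K' * norm (B x)" unfolding K'_def using K[of x] by linarith
  qed (auto simp: K'_def)
  interpret A: bounded_linear A by fact
  interpret B: bounded_linear B by fact
  define q where "q = 1 / (K'\<^sup>2 * C\<^sup>2)"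
  have q: "q > 0" using K' C by (simp add: q_def)
  have contr: "(norm (x - (1 / C\<^sup>2) *\<^sub>R A (B x)))\<^sup>2 \<le> (1 - q) * (norm x)\<^sup>2" for x
  proof -
    have e: "x \<bullet> A (B x) = (norm (B x))\<^sup>2"
      by (metis adj inner_commute power2_norm_eq_inner)
    have "(norm (A (B x)))\<^sup>2 \<le> (norm (B x) * C)\<^sup>2" by (intro power_mono C) auto
    then have 1: "(norm (A (B x)))\<^sup>2 / (C\<^sup>2)\<^sup>2 \<le> (norm (B x))\<^sup>2 / C\<^sup>2"
      using C(2) by (simp add: power_mult_distrib field_simps power2_eq_square)
    have "(norm x)\<^sup>2 \<le> (K' * norm (B x))\<^sup>2" by (intro power_mono K') auto
    then have 2: "q * (norm x)\<^sup>2 \<le> (norm (B x))\<^sup>2 / C\<^sup>2"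
      using K'(1) C(2) by (simp add: q_def field_simps power_mult_distrib)
    have "(norm (x - (1 / C\<^sup>2) *\<^sub>R A (B x)))\<^sup>2
        = (norm x)\<^sup>2 - 2 * (norm (B x))\<^sup>2 / C\<^sup>2 + (norm (A (B x)))\<^sup>2 / (C\<^sup>2)\<^sup>2"
    proof -
      have "(norm (x - c *\<^sub>R y))\<^sup>2 = (norm x)\<^sup>2 - 2 * c * (x \<bullet> y) + c\<^sup>2 * (norm y)\<^sup>2" for c and y :: 'a
        unfolding power2_norm_eq_inner
        by (simp add: inner_diff_left inner_diff_right inner_commute power2_eq_square algebra_simps)
      from this[of "1 / C\<^sup>2" "A (B x)"] show ?thesis unfolding e by (simp add: power_divide)
    qed
    with 1 2 show ?thesis by (simp add: algebra_simps)
  qed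
  have q1: "0 \<le> 1 - q \<or> (\<forall>x::'a. x = 0)"
  proof (rule disjCI)
    assume "\<not> (\<forall>x::'a. x = 0)"
    then obtain x :: 'a where "x \<noteq> 0" by blast
    then show "0 \<le> 1 - q" using contr[of x] zero_le_mult_iff[of "1 - q" "(norm x)\<^sup>2"]
      by (smt (verit) zero_le_power2 zero_less_norm_iff zero_less_power)
  qed
  show ?thesis
  proof (cases "\<forall>x::'a. x = 0")
    case True then show ?thesis by (metis surjI)
  next
    case False
    with q1 have q1: "0 \<le> 1 - q" by blast
    define r where "r = sqrt (1 - q)"
    have r: "0 \<le> r" "r < 1" "r\<^sup>2 = 1 - q" using q q1 by (auto simp: r_def)
    show ?thesis
    proof (unfold surj_def, intro allI)
      fix y
      define f where "f z = z - (1 / C\<^sup>2) *\<^sub>R (A (B z) - y)" for z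
      have "dist (f z) (f w) \<le> r * dist z w" for z w
      proof -
        have "f z - f w = (z - w) - (1 / C\<^sup>2) *\<^sub>R A (B (z - w))"
          by (simp add: f_def A.diff B.diff algebra_simps)
        then have "(norm (f z - f w))\<^sup>2 \<le> (r * norm (z - w))\<^sup>2"
          using contr[of "z - w"] by (simp add: power_mult_distrib r)
        then show ?thesis using r by (simp add: dist_norm power2_le_iff_abs_le)
      qed
      then have "\<exists>!z. f z = z" by (intro banach_fix_type[OF r(1,2)]) blast
      then obtain z where "f z = z" by blast
      then have "A (B z) = y" using C by (simp add: f_def)
      then show "\<exists>x. y = A x" by blast
    qed
  qed
qed

section \<open>Scalar reduction of a self-adjoint pencil\<close>

text \<open>
  An abstract self-adjoint pencil \<open>T\<^sub>0 - \<mu>\<sigma>\<close>. The operator \<open>E\<close> is the perturbation from zero coupling, where \<open>e\<close> is a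
  phase mode with \<open>T\<^sub>0 e = e\<close> and \<open>\<sigma> e\<close> the amplitude mode with \<open>T\<^sub>0 (\<sigma> e) = -2 \<sigma> e\<close>. The numerical constants
  are only margins.
\<close>

locale reg_pencil =
  fixes T0 \<sigma> E :: "'a::{real_inner,complete_space} \<Rightarrow> 'a" and e :: 'a and \<eta> :: real
  assumes lin: "bounded_linear T0" "bounded_linear \<sigma>"
    and sym: "\<And>x y. T0 x \<bullet> y = x \<bullet> T0 y" "\<And>x y. \<sigma> x \<bullet> y = x \<bullet> \<sigma> y"
    and iso: "\<And>x. norm (\<sigma> x) = norm x"
    and low0: "\<And>x. norm x \<le> norm (T0 x - E x)"
    and E: "\<And>x. norm (E x) \<le> \<eta> * norm x" and eta: "0 \<le> \<eta>" "\<eta> \<le> 1 / 100000"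
    and e: "e \<noteq> 0" "\<sigma> e \<bullet> e = 0" "T0 e = e + E e" "T0 (\<sigma> e) = - 2 *\<^sub>R \<sigma> e + E (\<sigma> e)"
begin

definition T where "T \<mu> x = T0 x - \<mu> *\<^sub>R \<sigma> x"
definition G where "G \<mu> = inv (T \<mu>)"
definition \<psi> where "\<psi> \<mu> = G \<mu> e"
definition N where "N = (norm e)\<^sup>2"
text \<open>
  \<open>p\<close> measures the failure of \<open>\<psi>\<close> to solve the unregularised equation; \<open>D\<close> and \<open>Q\<close> are the first and second
  divided differences of \<open>p\<close> by the resolvent identity.
\<close>

definition p where "p \<mu> = 1 - (\<psi> \<mu> \<bullet> e) / N"
definition D where "D \<mu> \<nu> = - (\<sigma> (\<psi> \<mu>) \<bullet> \<psi> \<nu>) / N"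
definition Q where "Q \<mu> \<nu> \<kappa> = - (\<sigma> (\<psi> \<mu>) \<bullet> G \<kappa> (\<sigma> (\<psi> \<nu>))) / N"

sublocale T0: bounded_linear T0 by (rule lin)
sublocale \<sigma>: bounded_linear \<sigma> by (rule lin)

lemma N_pos: "N > 0" using e by (simp add: N_def)

lemma T_linear: "bounded_linear (T \<mu>)"
  unfolding T_def[abs_def]
  by (intro bounded_linear_sub lin bounded_linear_compose[OF bounded_linear_scaleR_right])

lemma T_sym: "T \<mu> x \<bullet> y = x \<bullet> T \<mu> y"
  by (simp add: T_def inner_diff_left inner_diff_right sym)

lemma T_low: assumes "\<bar>\<mu>\<bar> \<le> 1/4" shows "norm x \<le> 2 * norm (T \<mu> x)"
proof -
  have "T0 x - E x = T \<mu> x + \<mu> *\<^sub>R \<sigma> x - E x" by (simp add: T_def)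
  then have "norm x \<le> norm (T \<mu> x + \<mu> *\<^sub>R \<sigma> x - E x)" using low0[of x] by simp
  also have "\<dots> \<le> norm (T \<mu> x) + \<bar>\<mu>\<bar> * norm x + \<eta> * norm x"
    using norm_triangle_ineq4[of "T \<mu> x + \<mu> *\<^sub>R \<sigma> x" "E x"] norm_triangle_ineq[of "T \<mu> x" "\<mu> *\<^sub>R \<sigma> x"] E[of x]
    by (simp add: iso)
  also have "\<dots> \<le> norm (T \<mu> x) + 1/4 * norm x + 1/100000 * norm x"
    using assms eta by (intro add_mono mult_right_mono) auto
  finally show ?thesis using norm_ge_zero[of x] by linarith
qed

lemma T_bij: assumes "\<bar>\<mu>\<bar> \<le> 1/4" shows "bij (T \<mu>)"
proof -
  interpret T: bounded_linear "T \<mu>" by (rule T_linear)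
  have "inj (T \<mu>)"
  proof (rule injI)
    fix x y assume "T \<mu> x = T \<mu> y"
    then have "T \<mu> (x - y) = 0" by (simp add: T.diff)
    then show "x = y" using T_low[OF assms, of "x - y"] by simp
  qed
  moreover have "surj (T \<mu>)"
    by (rule surj_of_adjoint_bounded_below[OF T_linear T_linear T_sym T_low[OF assms]])
  ultimately show ?thesis by (simp add: bij_def)
qed

context
  fixes \<mu> :: real assumes mu: "\<bar>\<mu>\<bar> \<le> 1/4"
begin

lemma TG [simp]: "T \<mu> (G \<mu> x) = x" and GT [simp]: "G \<mu> (T \<mu> x) = x"
  using T_bij[OF mu] by (simp_all add: G_def bij_is_surj surj_f_inv_f bij_is_inj)

lemma G_le: "norm (G \<mu> x) \<le> 2 * norm x" using T_low[OF mu, of "G \<mu> x"] by simp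

lemma T_psi [simp]: "T \<mu> (\<psi> \<mu>) = e" by (simp add: \<psi>_def)

lemma G_unique: "T \<mu> x = y \<Longrightarrow> G \<mu> y = x" by auto

lemma G_sym: "G \<mu> x \<bullet> y = x \<bullet> G \<mu> y"
  by (metis TG T_sym)

lemma G_linear: "G \<mu> (x + y) = G \<mu> x + G \<mu> y" "G \<mu> (x - y) = G \<mu> x - G \<mu> y"
  "G \<mu> (c *\<^sub>R x) = c *\<^sub>R G \<mu> x"
proof -
  interpret T: bounded_linear "T \<mu>" by (rule T_linear)
  show "G \<mu> (x + y) = G \<mu> x + G \<mu> y" "G \<mu> (x - y) = G \<mu> x - G \<mu> y"
  "G \<mu> (c *\<^sub>R x) = c *\<^sub>R G \<mu> x" by (intro G_unique; simp add: T.add T.diff T.scaleR)+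
qed

end

text \<open>The resolvent identity, applied to \<open>e\<close>.\<close>

lemma psi_diff: assumes "\<bar>\<mu>\<bar> \<le> 1/4" "\<bar>\<nu>\<bar> \<le> 1/4"
  shows "\<psi> \<mu> - \<psi> \<nu> = (\<mu> - \<nu>) *\<^sub>R G \<nu> (\<sigma> (\<psi> \<mu>))"
proof -
  have "T \<nu> (\<psi> \<mu>) = T \<mu> (\<psi> \<mu>) + (\<mu> - \<nu>) *\<^sub>R \<sigma> (\<psi> \<mu>)" by (simp add: T_def algebra_simps)
  then have "\<psi> \<mu> = G \<nu> (e + (\<mu> - \<nu>) *\<^sub>R \<sigma> (\<psi> \<mu>))" by (metis GT T_psi assms)
  then have "\<psi> \<mu> = \<psi> \<nu> + (\<mu> - \<nu>) *\<^sub>R G \<nu> (\<sigma> (\<psi> \<mu>))"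
    by (simp only: G_linear[OF assms(2)] \<psi>_def[of \<nu>])
  then show ?thesis by (metis add_diff_cancel_left')
qed

lemma p_diff: assumes "\<bar>\<mu>\<bar> \<le> 1/4" "\<bar>\<nu>\<bar> \<le> 1/4"
  shows "p \<mu> - p \<nu> = (\<mu> - \<nu>) * D \<mu> \<nu>"
proof -
  have "(\<psi> \<mu> - \<psi> \<nu>) \<bullet> e = (\<mu> - \<nu>) * (\<sigma> (\<psi> \<mu>) \<bullet> \<psi> \<nu>)"
    unfolding psi_diff[OF assms] inner_scaleR_left G_sym[OF assms(2)] by (simp only: \<psi>_def)
  then have "(\<psi> \<mu> \<bullet> e) - (\<psi> \<nu> \<bullet> e) = (\<mu> - \<nu>) * (\<sigma> (\<psi> \<mu>) \<bullet> \<psi> \<nu>)" by (simp add: inner_diff_left)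
  moreover have "p \<mu> - p \<nu> = - ((\<psi> \<mu> \<bullet> e) - (\<psi> \<nu> \<bullet> e)) / N" by (simp add: p_def diff_divide_distrib)
  ultimately show ?thesis by (simp add: D_def)
qed

lemma D_sym: "D \<mu> \<nu> = D \<nu> \<mu>" unfolding D_def by (metis sym(2) inner_commute)

lemma D_diff: assumes "\<bar>\<nu>\<bar> \<le> 1/4" "\<bar>\<kappa>\<bar> \<le> 1/4"
  shows "D \<mu> \<nu> - D \<mu> \<kappa> = (\<nu> - \<kappa>) * Q \<mu> \<nu> \<kappa>"
proof -
  have "\<sigma> (\<psi> \<mu>) \<bullet> (\<psi> \<nu> - \<psi> \<kappa>) = (\<nu> - \<kappa>) * (\<sigma> (\<psi> \<mu>) \<bullet> G \<kappa> (\<sigma> (\<psi> \<nu>)))"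
    by (simp add: psi_diff[OF assms])
  then have "\<sigma> (\<psi> \<mu>) \<bullet> \<psi> \<nu> - \<sigma> (\<psi> \<mu>) \<bullet> \<psi> \<kappa> = (\<nu> - \<kappa>) * (\<sigma> (\<psi> \<mu>) \<bullet> G \<kappa> (\<sigma> (\<psi> \<nu>)))"
    by (simp add: inner_diff_right)
  moreover have "D \<mu> \<nu> - D \<mu> \<kappa> = - (\<sigma> (\<psi> \<mu>) \<bullet> \<psi> \<nu> - \<sigma> (\<psi> \<mu>) \<bullet> \<psi> \<kappa>) / N"
    by (simp add: D_def diff_divide_distrib)
  ultimately show ?thesis by (simp add: Q_def)
qed

lemma psi_near: assumes "\<bar>\<mu>\<bar> \<le> 1/4" shows "norm (\<psi> \<mu> - e) \<le> 2 * (\<eta> + \<bar>\<mu>\<bar>) * norm e"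
proof -
  have "\<psi> \<mu> - e = G \<mu> (e - T \<mu> e)" using assms by (simp add: G_linear \<psi>_def)
  then have "norm (\<psi> \<mu> - e) \<le> 2 * norm (e - T \<mu> e)" using G_le[OF assms] by simp
  also have "e - T \<mu> e = \<mu> *\<^sub>R \<sigma> e - E e" by (simp add: T_def e)
  also have "norm \<dots> \<le> \<bar>\<mu>\<bar> * norm e + \<eta> * norm e"
    using norm_triangle_ineq4[of "\<mu> *\<^sub>R \<sigma> e" "E e"] E[of e] by (simp add: iso)
  finally show ?thesis by (simp add: algebra_simps)
qed

text \<open>
  At zero coupling \<open>\<psi> = e\<close> and \<open>G (\<sigma> e) = -\<sigma> e / 2\<close>, so \<open>Q = 1/2\<close>; the perturbation and the parameters
  cost at most half of this.
\<close>

lemma Q_ge: assumes "\<bar>\<mu>\<bar> \<le> 1/60" "\<bar>\<nu>\<bar> \<le> 1/60" "\<bar>\<kappa>\<bar> \<le> 1/60" shows "Q \<mu> \<nu> \<kappa> \<ge> 1/4"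
proof -
  define n where "n = norm e"
  define h :: real where "h = 1/100000 + 1/60"
  define r1 where "r1 = \<sigma> (\<psi> \<mu>) - \<sigma> e"
  define r2 where "r2 = G \<kappa> (\<sigma> (\<psi> \<nu>)) + (1/2) *\<^sub>R \<sigma> e"
  have n: "n > 0" using e by (simp add: n_def)
  have near: "norm (\<psi> \<mu> - e) \<le> 2 * h * n" if "\<bar>\<mu>\<bar> \<le> 1/60" for \<mu>
  proof -
    have "norm (\<psi> \<mu> - e) \<le> 2 * (\<eta> + \<bar>\<mu>\<bar>) * n" using psi_near[of \<mu>] that by (simp add: n_def)
    also have "\<dots> \<le> 2 * h * n" using that eta n by (intro mult_right_mono mult_left_mono) (auto simp: h_def)
    finally show ?thesis .
  qed
  have r1: "norm r1 \<le> 2 * h * n" using near[OF assms(1)] by (simp add: r1_def \<sigma>.diff[symmetric] iso)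
  have k: "\<bar>\<kappa>\<bar> \<le> 1/4" using assms by simp
  have "r2 = G \<kappa> (\<sigma> (\<psi> \<nu> - e)) + G \<kappa> (\<sigma> e + (1/2) *\<^sub>R T \<kappa> (\<sigma> e))"
    by (simp add: r2_def G_linear[OF k] \<sigma>.diff GT[OF k])
  also have "\<sigma> e + (1/2) *\<^sub>R T \<kappa> (\<sigma> e) = (1/2) *\<^sub>R (E (\<sigma> e) - \<kappa> *\<^sub>R \<sigma> (\<sigma> e))"
    by (simp add: T_def e algebra_simps)
  finally have r2eq: "r2 = G \<kappa> (\<sigma> (\<psi> \<nu> - e)) + G \<kappa> ((1/2) *\<^sub>R (E (\<sigma> e) - \<kappa> *\<^sub>R \<sigma> (\<sigma> e)))" .
  have "norm (G \<kappa> (\<sigma> (\<psi> \<nu> - e))) \<le> 2 * (2 * h * n)"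
    using G_le[OF k, of "\<sigma> (\<psi> \<nu> - e)"] near[OF assms(2)] by (simp add: iso)
  moreover have "norm (E (\<sigma> e) - \<kappa> *\<^sub>R \<sigma> (\<sigma> e)) \<le> h * n"
  proof -
    have "norm (E (\<sigma> e) - \<kappa> *\<^sub>R \<sigma> (\<sigma> e)) \<le> \<eta> * n + \<bar>\<kappa>\<bar> * n"
      using norm_triangle_ineq4[of "E (\<sigma> e)" "\<kappa> *\<^sub>R \<sigma> (\<sigma> e)"] E[of "\<sigma> e"] by (simp add: iso n_def)
    also have "\<dots> = (\<eta> + \<bar>\<kappa>\<bar>) * n" by (simp add: algebra_simps)
    also have "\<dots> \<le> h * n" using assms(3) eta(2) n by (intro mult_right_mono) (auto simp: h_def)
    finally show ?thesis .
  qed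
  then have "norm (G \<kappa> ((1/2) *\<^sub>R (E (\<sigma> e) - \<kappa> *\<^sub>R \<sigma> (\<sigma> e)))) \<le> h * n"
    using G_le[OF k, of "(1/2) *\<^sub>R (E (\<sigma> e) - \<kappa> *\<^sub>R \<sigma> (\<sigma> e))"] by simp
  ultimately have r2: "norm r2 \<le> 5 * h * n" unfolding r2eq by (intro norm_triangle_le) simp
  have expand: "- ((s + r1) \<bullet> (r2 - (1/2) *\<^sub>R s)) = s \<bullet> s / 2 - s \<bullet> r2 - r1 \<bullet> r2 + (1/2) * (r1 \<bullet> s)" for s
    by (simp add: inner_add_left inner_diff_right algebra_simps)
  have "\<sigma> (\<psi> \<mu>) = \<sigma> e + r1" "G \<kappa> (\<sigma> (\<psi> \<nu>)) = r2 - (1/2) *\<^sub>R \<sigma> e" by (simp_all add: r1_def r2_def)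
  then have "- (\<sigma> (\<psi> \<mu>) \<bullet> G \<kappa> (\<sigma> (\<psi> \<nu>))) = n\<^sup>2/2 - \<sigma> e \<bullet> r2 - r1 \<bullet> r2 + (1/2) * (r1 \<bullet> \<sigma> e)"
    using power2_norm_eq_inner[of "\<sigma> e"] expand[of "\<sigma> e"] unfolding iso n_def[symmetric] by simp
  moreover have "\<bar>\<sigma> e \<bullet> r2\<bar> \<le> n * (5 * h * n)"
    using Cauchy_Schwarz_ineq2[of "\<sigma> e" r2] mult_left_mono[OF r2, of n] n unfolding iso n_def[symmetric] by linarith
  moreover have "\<bar>r1 \<bullet> \<sigma> e\<bar> \<le> (2 * h * n) * n"
    using Cauchy_Schwarz_ineq2[of r1 "\<sigma> e"] mult_right_mono[OF r1, of n] n unfolding iso n_def[symmetric] by linarith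
  moreover have "\<bar>r1 \<bullet> r2\<bar> \<le> (2 * h * n) * (5 * h * n)"
    using Cauchy_Schwarz_ineq2[of r1 r2] mult_mono[OF r1 r2] n by (simp add: h_def)
  ultimately have "- (\<sigma> (\<psi> \<mu>) \<bullet> G \<kappa> (\<sigma> (\<psi> \<nu>))) \<ge> n\<^sup>2/2 - n * (5 * h * n) - (2 * h * n) * (5 * h * n) - (1/2) * ((2 * h * n) * n)"
    by linarith
  also have "n\<^sup>2/2 - n * (5 * h * n) - (2 * h * n) * (5 * h * n) - (1/2) * ((2 * h * n) * n)
      = (1/2 - 6 * h - 10 * h * h) * n\<^sup>2" by (simp add: power2_eq_square algebra_simps)
  also have "\<dots> \<ge> 1/4 * n\<^sup>2" by (intro mult_right_mono) (auto simp: h_def)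
  finally show ?thesis using n by (simp add: Q_def N_def n_def field_simps)
qed

lemma p0_bound: "\<bar>p 0\<bar> \<le> 2 * \<eta>"
proof -
  have "p 0 = ((e - \<psi> 0) \<bullet> e) / N" using N_pos by (simp add: p_def inner_diff_left N_def power2_norm_eq_inner diff_divide_distrib)
  moreover have "\<bar>(e - \<psi> 0) \<bullet> e\<bar> \<le> (2 * \<eta> * norm e) * norm e"
    using Cauchy_Schwarz_ineq2[of "e - \<psi> 0" e] psi_near[of 0] mult_right_mono[of "norm (\<psi> 0 - e)" "2 * \<eta> * norm e" "norm e"]
    by (simp add: norm_minus_commute)
  ultimately show ?thesis using N_pos by (simp add: N_def power2_eq_square field_simps)
qed

lemma D0_bound: "\<bar>D 0 0\<bar> \<le> 5 * \<eta>"
proof -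
  define r where "r = \<psi> 0 - e"
  have r: "norm r \<le> 2 * \<eta> * norm e" using psi_near[of 0] by (simp add: r_def)
  have "\<sigma> (\<psi> 0) \<bullet> \<psi> 0 = 2 * (\<sigma> e \<bullet> r) + \<sigma> r \<bullet> r"
    using e(2) by (simp add: r_def \<sigma>.diff inner_diff_left inner_diff_right sym inner_commute)
  moreover have "\<bar>\<sigma> e \<bullet> r\<bar> \<le> norm e * (2 * \<eta> * norm e)"
    using Cauchy_Schwarz_ineq2[of "\<sigma> e" r] mult_left_mono[OF r, of "norm e"] by (simp add: iso)
  moreover have "\<bar>\<sigma> r \<bullet> r\<bar> \<le> (2 * \<eta> * norm e) * (2 * \<eta> * norm e)"
    using Cauchy_Schwarz_ineq2[of "\<sigma> r" r] mult_mono[OF r r] eta by (simp add: iso)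
  ultimately have "\<bar>\<sigma> (\<psi> 0) \<bullet> \<psi> 0\<bar> \<le> (4 * \<eta> + 4 * \<eta> * \<eta>) * N"
    by (simp add: N_def power2_eq_square algebra_simps)
  also have "4 * \<eta> + 4 * \<eta> * \<eta> \<le> 5 * \<eta>" using eta mult_right_mono[OF eta(2) eta(1)] by simp
  finally show ?thesis using N_pos by (simp add: D_def field_simps)
qed

lemma p_quad: assumes "\<bar>\<mu>\<bar> \<le> 1/60" shows "p \<mu> = p 0 + \<mu> * D 0 0 + \<mu>\<^sup>2 * Q 0 \<mu> 0"
  using p_diff[of \<mu> 0] D_diff[of \<mu> 0 0] assms by (simp add: D_sym[of \<mu> 0] power2_eq_square algebra_simps)

lemma p_end_pos: assumes "\<bar>\<mu>\<bar> = 1/60" shows "p \<mu> > 0"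
proof -
  have "\<mu>\<^sup>2 = (1/60)\<^sup>2" using assms by (metis power2_abs)
  moreover have "Q 0 \<mu> 0 \<ge> 1/4" using assms by (intro Q_ge) auto
  ultimately have "\<mu>\<^sup>2 * Q 0 \<mu> 0 \<ge> (1/60)\<^sup>2 * (1/4)" by simp
  moreover have "\<bar>\<mu> * D 0 0\<bar> \<le> 1/60 * (5 * \<eta>)" using mult_left_mono[OF D0_bound, of "\<bar>\<mu>\<bar>"] unfolding abs_mult assms by simp
  moreover have "p \<mu> = p 0 + \<mu> * D 0 0 + \<mu>\<^sup>2 * Q 0 \<mu> 0" using assms by (intro p_quad) auto
  ultimately show ?thesis using p0_bound eta by (simp add: power2_eq_square)
qed

lemma p_cont: "continuous_on {-1/60..1/60} p"
proof (rule continuous_on_subset)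
  have psi: "norm (\<psi> \<mu>) \<le> 2 * norm e" if "\<bar>\<mu>\<bar> \<le> 1/4" for \<mu> using G_le[OF that] by (simp add: \<psi>_def)
  have "4-lipschitz_on {-1/4..1/4} p"
  proof (rule lipschitz_onI)
    fix x y :: real assume xy: "x \<in> {-1/4..1/4}" "y \<in> {-1/4..1/4}"
    then have xy: "\<bar>x\<bar> \<le> 1/4" "\<bar>y\<bar> \<le> 1/4" by auto
    have "\<bar>\<sigma> (\<psi> x) \<bullet> \<psi> y\<bar> \<le> (2 * norm e) * (2 * norm e)"
      using Cauchy_Schwarz_ineq2[of "\<sigma> (\<psi> x)" "\<psi> y"] mult_mono[OF psi[OF xy(1)] psi[OF xy(2)]] by (simp add: iso)
    then have "\<bar>D x y\<bar> \<le> 4" using N_pos by (simp add: D_def N_def field_simps power2_eq_square)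
    then show "dist (p x) (p y) \<le> 4 * dist x y"
      using p_diff[OF xy] mult_left_mono[of "\<bar>D x y\<bar>" 4 "\<bar>x - y\<bar>"]
      by (simp add: dist_real_def abs_mult mult.commute)
  qed simp
  then show "continuous_on {-1/4..1/4} p" by (rule lipschitz_on_continuous_on)
qed auto

text \<open>
  Strict convexity: \<open>p\<close> is negative at \<open>0\<close> and positive at \<open>\<plusminus>1/60\<close>, so the intermediate value theorem gives a zero
  on each side. A third zero, or a slope of the wrong sign at one of the two, would make a second divided difference nonpositive.
\<close>

lemma two_roots:
  assumes "p 0 < 0"
  obtains m1 m2 where "-1/60 < m1" "m1 < 0" "0 < m2" "m2 < 1/60" "p m1 = 0" "p m2 = 0"
    "\<And>m. \<bar>m\<bar> \<le> 1/60 \<Longrightarrow> p m = 0 \<Longrightarrow> m = m1 \<or> m = m2" "D m1 m1 < 0" "D m2 m2 > 0"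
proof -
  have "\<exists>m\<ge>0. m \<le> 1/60 \<and> p m = 0" using assms p_end_pos[of "1/60"]
    by (intro IVT') (auto intro: continuous_on_subset[OF p_cont])
  then obtain m2 where m2: "0 \<le> m2" "m2 \<le> 1/60" "p m2 = 0" by blast
  have "\<exists>m\<ge>-1/60. m \<le> 0 \<and> p m = 0" using assms p_end_pos[of "-1/60"]
    by (intro IVT2') (auto intro: continuous_on_subset[OF p_cont])
  then obtain m1 where m1: "-1/60 \<le> m1" "m1 \<le> 0" "p m1 = 0" by blast
  have ne: "m1 \<noteq> 0" "m2 \<noteq> 0" "m1 \<noteq> -1/60" "m2 \<noteq> 1/60"
    using m1(3) m2(3) assms p_end_pos[of "-1/60"] p_end_pos[of "1/60"] by force+
  then have lt: "-1/60 < m1" "m1 < 0" "0 < m2" "m2 < 1/60" using m1 m2 by auto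
  have D0: "D m1 m2 = 0" using p_diff[of m1 m2] lt m1 m2 by simp
  have fac: "p m = (m - m1) * (m - m2) * Q m1 m m2" if "\<bar>m\<bar> \<le> 1/60" for m
    using p_diff[of m m1] D_diff[of m m2 m1] that lt m1 D0 by (simp add: D_sym[of m m1])
  have uni: "m = m1 \<or> m = m2" if "\<bar>m\<bar> \<le> 1/60" "p m = 0" for m
  proof -
    have "Q m1 m m2 \<ge> 1/4" using that lt by (intro Q_ge) auto
    then show ?thesis using fac[OF that(1)] that(2) by auto
  qed
  have "Q m1 m1 m2 \<ge> 1/4" "Q m2 m2 m1 \<ge> 1/4" using lt by (intro Q_ge; linarith)+
  moreover have "D m1 m1 = (m1 - m2) * Q m1 m1 m2" "D m2 m2 = (m2 - m1) * Q m2 m2 m1"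
    using D_diff[of m1 m2 m1] D_diff[of m2 m1 m2] D0 D_sym[of m2 m1] lt by auto
  ultimately have "D m1 m1 < 0" "D m2 m2 > 0" using lt by (auto simp: mult_neg_pos)
  then show thesis using that[OF lt m1(3) m2(3) uni] by blast
qed

lemma double_root:
  assumes "p 0 = 0" "D 0 0 = 0" "\<bar>m\<bar> \<le> 1/60" "p m = 0" shows "m = 0"
  using p_quad[OF assms(3)] Q_ge[of 0 m 0] assms by auto

text \<open>
  An a priori bound for zeros, needed to feed them into expansions that assume that the zero is small with \<open>\<epsilon>\<close>.
\<close>

lemma root_bound:
  assumes "p m = 0" "\<bar>m\<bar> \<le> 1/60" shows "m\<^sup>2 \<le> 4 * \<bar>p 0\<bar> + 20 * \<eta> * \<bar>m\<bar>"
proof -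
  have "m\<^sup>2 * (1/4) \<le> m\<^sup>2 * Q 0 m 0" using Q_ge[of 0 m 0] assms by (intro mult_left_mono) auto
  also have "\<dots> = - p 0 - m * D 0 0" using p_quad[OF assms(2)] assms by simp
  also have "\<dots> \<le> \<bar>p 0\<bar> + \<bar>m\<bar> * (5 * \<eta>)"
  proof -
    have "\<bar>m * D 0 0\<bar> \<le> \<bar>m\<bar> * (5 * \<eta>)"
      using mult_left_mono[OF D0_bound, of "\<bar>m\<bar>"] by (simp add: abs_mult)
    then show ?thesis by linarith
  qed
  finally show ?thesis by (simp add: algebra_simps)
qed

end

section \<open>Operators on spinors\<close>

text \<open>
  All operators are built from two kinds: pointwise multiplication by a field of real-linear maps
  (\<open>lop\<close>) and relabelling of sites (\<open>tr\<close>).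
\<close>

definition lop :: "(int \<times> int \<Rightarrow> complex \<times> complex \<Rightarrow> complex \<times> complex) \<Rightarrow> hil \<Rightarrow> hil" where
  "lop A f = Abs_hil (\<lambda>x. A x (vl f x))"

definition tr :: "(int \<times> int \<Rightarrow> int \<times> int) \<Rightarrow> hil \<Rightarrow> hil" where
  "tr h f = Abs_hil (\<lambda>x. vl f (h x))"

lemma vl_lop:
  assumes "\<And>x v. norm (A x v) \<le> K * norm v"
  shows "vl (lop A f) x = A x (vl f x)"
proof -
  have "(\<lambda>x. A x (vl f x)) \<in> ell2" by (rule ell2_le[OF rep_ell2 assms])
  then show ?thesis by (simp add: lop_def Abs_hil_inverse)
qed

lemma norm_le_pointwise:
  assumes "\<And>x. norm (vl f x) \<le> K * norm (vl g x)" "K \<ge> 0"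
  shows "norm f \<le> K * norm g"
proof (rule norm_hil_le)
  fix F :: "(int \<times> int) set" assume "finite F"
  have "(\<Sum>x\<in>F. (norm (vl f x))\<^sup>2) \<le> (\<Sum>x\<in>F. K\<^sup>2 * (norm (vl g x))\<^sup>2)"
    using assms(1) by (intro sum_mono) (metis norm_ge_zero power_mono power_mult_distrib)
  also have "\<dots> \<le> K\<^sup>2 * (norm g)\<^sup>2"
    using sum_le_norm_hil[OF \<open>finite F\<close>, of g] by (simp add: sum_distrib_left[symmetric] mult_left_mono)
  finally show "(\<Sum>x\<in>F. (norm (vl f x))\<^sup>2) \<le> (K * norm g)\<^sup>2" by (simp add: power_mult_distrib)
qed (use assms in auto)

lemma norm_lop_le:
  assumes "\<And>x v. norm (A x v) \<le> K * norm v" "K \<ge> 0"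
  shows "norm (lop A f) \<le> K * norm f"
  by (rule norm_le_pointwise) (simp_all add: vl_lop[OF assms(1)] assms)

lemma norm_lop_ge:
  assumes "\<And>x v. norm (A x v) \<le> K * norm v" "\<And>x v. norm v \<le> norm (A x v)"
  shows "norm f \<le> norm (lop A f)"
  using norm_le_pointwise[of f 1 "lop A f"] by (simp add: vl_lop[OF assms(1)] assms(2))

lemma lop_bounded_linear:
  assumes "\<And>x v. norm (A x v) \<le> K * norm v" "\<And>x. linear (A x)"
  shows "bounded_linear (lop A)"
proof (rule bounded_linear_intro)
  have K: "K \<ge> 0"
  proof (rule ccontr)
    assume "\<not> K \<ge> 0"
    moreover have "norm (A (0,0) (1,1)) \<le> K * norm ((1,1)::complex\<times>complex)" by (rule assms)
    moreover have "norm ((1,1)::complex\<times>complex) > 0" by (simp add: zero_prod_def)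
    ultimately show False
      by (meson mult_neg_pos norm_ge_zero not_le order_le_less_trans order_less_irrefl)
  qed
  show "lop A (f + g) = lop A f + lop A g" for f g
    by (rule hil_eqI) (simp add: vl_lop[OF assms(1)] linear_add[OF assms(2)])
  show "lop A (c *\<^sub>R f) = c *\<^sub>R lop A f" for c f
    by (rule hil_eqI) (simp add: vl_lop[OF assms(1)] linear_scale[OF assms(2)])
  show "norm (lop A f) \<le> norm f * K" for f
    using norm_lop_le[OF assms(1) K] by (simp add: mult.commute)
qed

lemma inner_hil_cong: "(\<And>x. vl f x \<bullet> vl g x = vl f' x \<bullet> vl g' x) \<Longrightarrow> f \<bullet> g = f' \<bullet> g'"
  by (simp add: inner_hil_def)

lemma lop_adjoint:
  assumes "\<And>x v. norm (A x v) \<le> K * norm v" "\<And>x v. norm (B x v) \<le> L * norm v"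
    "\<And>x v w. A x v \<bullet> w = v \<bullet> B x w"
  shows "lop A f \<bullet> g = f \<bullet> lop B g"
  by (rule inner_hil_cong) (simp add: vl_lop[OF assms(1)] vl_lop[OF assms(2)] assms(3))

lemma vl_tr:
  assumes "inj h" shows "vl (tr h f) x = vl f (h x)"
proof -
  obtain B where B: "\<And>F. finite F \<Longrightarrow> (\<Sum>x\<in>F. (norm (vl f x))\<^sup>2) \<le> B"
    using rep_ell2[of f] unfolding ell2_iff_bounded by blast
  have "(\<Sum>x\<in>F. (norm (vl f (h x)))\<^sup>2) \<le> B" if "finite F" for F
    using B[of "h ` F"] that sum.reindex[of h F "\<lambda>x. (norm (vl f x))\<^sup>2"] inj_on_subset[OF assms]
    by simp
  then have "(\<lambda>x. vl f (h x)) \<in> ell2" unfolding ell2_iff_bounded by blast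
  then show ?thesis by (simp add: tr_def Abs_hil_inverse)
qed

lemma tr_adjoint:
  assumes "\<And>x. h (k x) = x" "\<And>x. k (h x) = x"
  shows "tr h f \<bullet> g = f \<bullet> tr k g"
proof -
  have i: "inj h" "inj k" and b: "bij_betw h UNIV UNIV"
    using assms by (metis injI)+ (metis assms bij_betw_byWitness subset_UNIV)
  have "tr h f \<bullet> g = (\<Sum>\<^sub>\<infinity>x. vl f (h x) \<bullet> vl g (k (h x)))"
    by (simp add: inner_hil_def vl_tr[OF i(1)] assms)
  also have "\<dots> = (\<Sum>\<^sub>\<infinity>x. vl f x \<bullet> vl g (k x))"
    by (rule infsum_reindex_bij_betw[OF b])
  finally show ?thesis by (simp add: inner_hil_def vl_tr[OF i(2)])
qed

lemma norm_tr: assumes "\<And>x. h (k x) = x" "\<And>x. k (h x) = x" shows "norm (tr h f) = norm f"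
proof -
  have i: "inj h" "inj k" using assms by (metis injI)+
  have "tr k (tr h f) = f" by (rule hil_eqI) (simp add: vl_tr i assms)
  then show ?thesis using tr_adjoint[OF assms, of f "tr h f"] by (simp add: norm_eq_sqrt_inner)
qed

lemma tr_bounded_linear: assumes "\<And>x. h (k x) = x" "\<And>x. k (h x) = x" shows "bounded_linear (tr h)"
proof (rule bounded_linear_intro)
  have i: "inj h" using assms by (metis injI)
  show "tr h (f + g) = tr h f + tr h g" "tr h (c *\<^sub>R f) = c *\<^sub>R tr h f" for f g c
    by (rule hil_eqI, simp add: vl_tr[OF i])+
  show "norm (tr h f) \<le> norm f * 1" for f by (simp add: norm_tr[OF assms])
qed

definition east where "east = (\<lambda>(n, m). (n + 1, m) :: int \<times> int)"
definition west where "west = (\<lambda>(n, m). (n - 1, m) :: int \<times> int)"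
definition north where "north = (\<lambda>(n, m). (n, m + 1) :: int \<times> int)"
definition south where "south = (\<lambda>(n, m). (n, m - 1) :: int \<times> int)"
definition rot where "rot = (\<lambda>(n, m). (- m, n) :: int \<times> int)"
definition rotinv where "rotinv = (\<lambda>(n, m). (m, - n) :: int \<times> int)"

lemmas moves = east_def west_def north_def south_def rot_def rotinv_def

lemma moves_inv [simp]:
  "east (west x) = x" "west (east x) = x" "north (south x) = x" "south (north x) = x"
  "rot (rotinv x) = x" "rotinv (rot x) = x"
  by (auto simp: moves split: prod.splits)

lemma inj_moves [simp]: "inj east" "inj west" "inj north" "inj south" "inj rot" "inj rotinv"
  by (metis injI moves_inv)+

definition lap :: "hil \<Rightarrow> hil" where "lap f = tr east f + tr west f + tr north f + tr south f"

lemma lap_bounded_linear: "bounded_linear lap"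
  unfolding lap_def[abs_def]
  by (intro bounded_linear_add tr_bounded_linear[where k=west] tr_bounded_linear[where k=east]
      tr_bounded_linear[where k=south] tr_bounded_linear[where k=north]) simp_all

lemma norm_lap: "norm (lap f) \<le> 4 * norm f"
proof -
  have "norm (tr east f) = norm f" "norm (tr west f) = norm f" "norm (tr north f) = norm f" "norm (tr south f) = norm f"
    using norm_tr[of east west] norm_tr[of west east] norm_tr[of north south] norm_tr[of south north] by simp_all
  then show ?thesis unfolding lap_def
    by (smt (verit) norm_triangle_ineq)
qed

lemma lap_sym: "lap f \<bullet> g = f \<bullet> lap g"
  using tr_adjoint[of east west f g] tr_adjoint[of west east f g] tr_adjoint[of north south f g] tr_adjoint[of south north f g]
  by (simp add: lap_def inner_add_left inner_add_right)

lemma vl_lap: "vl (lap f) x = vl f (east x) + vl f (west x) + vl f (north x) + vl f (south x)"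
  by (simp add: lap_def vl_tr)

lemma nbr_sum_moves: "nbr_sum g x = g (east x) + g (west x) + g (north x) + g (south x)"
  by (simp add: nbr_sum_def moves split: prod.splits)

definition sloc :: "int \<times> int \<Rightarrow> complex \<times> complex \<Rightarrow> complex \<times> complex" where "sloc x v = (fst v, - snd v)"
definition cloc :: "complex \<Rightarrow> int \<times> int \<Rightarrow> complex \<times> complex \<Rightarrow> complex \<times> complex" where "cloc c x v = (c * fst v, c * snd v)"
definition hloc :: "(int \<times> int \<Rightarrow> complex) \<Rightarrow> int \<times> int \<Rightarrow> complex \<times> complex \<Rightarrow> complex \<times> complex" where
  "hloc u x v = (of_real (1 - 2 * (cmod (u x))\<^sup>2) * fst v - (u x)\<^sup>2 * snd v,
     of_real (1 - 2 * (cmod (u x))\<^sup>2) * snd v - (cnj (u x))\<^sup>2 * fst v)"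
text \<open>The orthogonal projection onto the phase direction \<open>(\<i> u, -\<i> cnj u)\<close> at each node.\<close>

definition ploc :: "(int \<times> int \<Rightarrow> complex) \<Rightarrow> int \<times> int \<Rightarrow> complex \<times> complex \<Rightarrow> complex \<times> complex" where
  "ploc u x v = (if x \<in> set S0 then
     ((fst v - (sgn (u x))\<^sup>2 * snd v) / 2, (snd v - (cnj (sgn (u x)))\<^sup>2 * fst v) / 2) else 0)"

abbreviation sg where "sg \<equiv> lop sloc"
abbreviation cs where "cs c \<equiv> lop (cloc c)"

definition Hop :: "real \<Rightarrow> (int \<times> int \<Rightarrow> complex) \<Rightarrow> hil \<Rightarrow> hil" where
  "Hop \<epsilon> u f = lop (hloc u) f - \<epsilon> *\<^sub>R lap f"
definition Pop :: "(int \<times> int \<Rightarrow> complex) \<Rightarrow> hil \<Rightarrow> hil" where "Pop u = lop (ploc u)"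

lemma norm_pair_le_sum: "norm (v::complex \<times> complex) \<le> cmod (fst v) + cmod (snd v)"
  by (simp add: norm_prod_def sqrt_sum_squares_le_sum)

lemma norm_pair_bound:
  assumes "cmod a \<le> K * norm v" "cmod b \<le> K * norm v" shows "norm (a, b) \<le> (2 * K) * norm (v::complex\<times>complex)"
  using norm_pair_le_sum[of "(a, b)"] assms by simp

lemma cmod_lin2: "cmod (p * fst v + q * snd v) \<le> (cmod p + cmod q) * norm (v :: complex \<times> complex)"
proof -
  have "cmod (p * fst v + q * snd v) \<le> cmod p * cmod (fst v) + cmod q * cmod (snd v)"
    by (metis norm_mult norm_triangle_ineq)
  also have "\<dots> \<le> cmod p * norm v + cmod q * norm v"
    by (intro add_mono mult_left_mono norm_fst_le[of "fst v" "snd v", simplified] norm_snd_le[of "snd v" "fst v", simplified]) auto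
  finally show ?thesis by (simp add: algebra_simps)
qed

lemma mat_bound:
  assumes "cmod p + cmod q \<le> K" "cmod r + cmod s \<le> K"
  shows "norm (p * fst v + q * snd v, r * fst v + s * snd v) \<le> (2 * K) * norm (v :: complex \<times> complex)"
  using assms by (intro norm_pair_bound order_trans[OF cmod_lin2] mult_right_mono) auto

lemma sloc_norm: "norm (sloc x v) \<le> 1 * norm v" by (simp add: sloc_def norm_prod_def)
lemma cloc_norm: "norm (cloc c x v) \<le> cmod c * norm v"
  by (simp add: cloc_def norm_prod_def norm_mult power_mult_distrib distrib_left[symmetric] real_sqrt_mult)
lemma hloc_norm: assumes "cmod (u x) \<le> 2" shows "norm (hloc u x v) \<le> 40 * norm v"
proof -
  have 1: "(cmod (u x))\<^sup>2 \<le> 2\<^sup>2" using assms by (intro power_mono) auto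
  then have "(cmod (u x))\<^sup>2 \<le> 4" by simp
  then have "\<bar>1 - 2 * (cmod (u x))\<^sup>2\<bar> \<le> 16"
    using zero_le_power2[of "cmod (u x)"] unfolding abs_le_iff by linarith
  then show ?thesis
    using mat_bound[of "of_real (1 - 2 * (cmod (u x))\<^sup>2)" "- (u x)\<^sup>2" 20 "- (cnj (u x))\<^sup>2" "of_real (1 - 2 * (cmod (u x))\<^sup>2)" v] 1
    by (simp add: hloc_def norm_power norm_minus_commute del: of_real_diff)
qed
lemma ploc_norm: "norm (ploc u x v) \<le> 2 * norm v"
proof -
  have "cmod ((sgn (u x))\<^sup>2) \<le> 1" by (simp add: norm_power norm_sgn)
  then show ?thesis
    using mat_bound[of "1/2" "- (sgn (u x))\<^sup>2 / 2" 1 "- (cnj (sgn (u x)))\<^sup>2 / 2" "1/2" v]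
    by (auto simp: ploc_def norm_power norm_divide diff_divide_distrib)
qed

lemma loc_linear: "linear (sloc x)" "linear (cloc c x)" "linear (hloc u x)" "linear (ploc u x)"
  by (rule linearI; simp add: sloc_def cloc_def hloc_def ploc_def algebra_simps scaleR_conv_of_real prod_eq_iff
     add_divide_distrib diff_divide_distrib)+

lemma vl_sg [simp]: "vl (sg f) x = (fst (vl f x), - snd (vl f x))"
  by (simp add: vl_lop[OF sloc_norm]) (simp add: sloc_def)
lemma vl_cs [simp]: "vl (cs c f) x = (c * fst (vl f x), c * snd (vl f x))"
  by (simp add: vl_lop[OF cloc_norm]) (simp add: cloc_def)
lemma vl_Pop: "vl (Pop u f) x = ploc u x (vl f x)" unfolding Pop_def by (rule vl_lop[OF ploc_norm])

lemma sg_bounded_linear: "bounded_linear sg" by (rule lop_bounded_linear[OF sloc_norm loc_linear(1)])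
lemma cs_bounded_linear: "bounded_linear (cs c)" by (rule lop_bounded_linear[OF cloc_norm loc_linear(2)])
lemma Pop_bounded_linear: "bounded_linear (Pop u)" unfolding Pop_def by (rule lop_bounded_linear[OF ploc_norm loc_linear(4)])

lemma sg_sym: "sg f \<bullet> g = f \<bullet> sg g"
  by (rule lop_adjoint[OF sloc_norm sloc_norm]) (simp add: sloc_def inner_prod_def)
lemma cs_adj: "cs c f \<bullet> g = f \<bullet> cs (cnj c) g"
  by (rule lop_adjoint[OF cloc_norm cloc_norm]) (simp add: cloc_def inner_prod_def inner_complex_def algebra_simps)
lemma ploc_sym: "ploc u x v \<bullet> w = v \<bullet> ploc u x w"
proof -
  have "((fst v - t\<^sup>2 * snd v) / 2, (snd v - (cnj t)\<^sup>2 * fst v) / 2) \<bullet> w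
      = v \<bullet> ((fst w - t\<^sup>2 * snd w) / 2, (snd w - (cnj t)\<^sup>2 * fst w) / 2)" for t
    by (simp add: inner_prod_def inner_complex_def power2_eq_square algebra_simps
        add_divide_distrib diff_divide_distrib)
  then show ?thesis by (simp add: ploc_def)
qed
lemma hloc_sym: "hloc u x v \<bullet> w = v \<bullet> hloc u x w"
  by (simp add: hloc_def inner_prod_def inner_complex_def power2_eq_square algebra_simps)
lemma Pop_sym: "Pop u f \<bullet> g = f \<bullet> Pop u g" unfolding Pop_def
  by (rule lop_adjoint[OF ploc_norm ploc_norm ploc_sym])

lemma norm_sg [simp]: "norm (sg f) = norm f"
proof -
  have "sg f \<bullet> sg f = f \<bullet> f" by (rule inner_hil_cong) (simp add: inner_prod_def)
  then show ?thesis by (simp add: norm_eq_sqrt_inner)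
qed

lemma sg_sg [simp]: "sg (sg f) = f" by (rule hil_eqI) simp
lemma cs_cs: "cs c (cs d f) = cs (c * d) f" by (rule hil_eqI) (simp add: mult.assoc)
lemma cs_1 [simp]: "cs 1 f = f" by (rule hil_eqI) simp
lemma cs_add: "cs (c + d) f = cs c f + cs d f" by (rule hil_eqI) (simp add: algebra_simps)
lemma cs_of_real: "cs (of_real r) f = r *\<^sub>R f" by (rule hil_eqI) (simp add: prod_eq_iff scaleR_conv_of_real)
lemma cs_0 [simp]: "cs 0 f = 0" by (rule hil_eqI) (simp add: zero_prod_def)
lemma norm_cs: "norm (cs c f) = cmod c * norm f"
proof (rule antisym)
  have le: "norm (cs c f) \<le> cmod c * norm f" for c f by (rule norm_lop_le[OF cloc_norm]) auto
  show "norm (cs c f) \<le> cmod c * norm f" by (rule le)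
  show "cmod c * norm f \<le> norm (cs c f)"
  proof (cases "c = 0")
    case False
    then have "norm f \<le> cmod (inverse c) * norm (cs c f)" using le[of "inverse c" "cs c f"] by (simp add: cs_cs)
    then show ?thesis using False by (simp add: norm_inverse norm_divide field_simps)
  qed simp
qed

lemma sg_cs: "sg (cs c f) = cs c (sg f)" by (rule hil_eqI) simp
lemma Pop_cs: "Pop u (cs c f) = cs c (Pop u f)"
  by (rule hil_eqI) (simp add: vl_Pop ploc_def algebra_simps zero_prod_def)

lemma vl_Hop: assumes "\<And>x. cmod (u x) \<le> 2"
  shows "vl (Hop \<epsilon> u f) x = hloc u x (vl f x) - \<epsilon> *\<^sub>R (vl f (east x) + vl f (west x) + vl f (north x) + vl f (south x))"
  by (simp add: Hop_def vl_lop[OF hloc_norm[OF assms]] vl_lap)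

lemma vl_Hop_hess: assumes "\<And>x. cmod (u x) \<le> 2" shows "vl (Hop \<epsilon> u f) = hess \<epsilon> u (vl f)"
  by (rule ext) (simp add: vl_Hop[OF assms] hess_def hloc_def nbr_sum_moves prod_eq_iff scaleR_conv_of_real)

lemma Hop_bounded_linear: assumes "\<And>x. cmod (u x) \<le> 2" shows "bounded_linear (Hop \<epsilon> u)"
  unfolding Hop_def[abs_def]
  by (intro bounded_linear_sub lop_bounded_linear[OF hloc_norm[OF assms] loc_linear(3)]
      bounded_linear_compose[OF bounded_linear_scaleR_right lap_bounded_linear])

lemma Hop_sym: assumes "\<And>x. cmod (u x) \<le> 2" shows "Hop \<epsilon> u f \<bullet> g = f \<bullet> Hop \<epsilon> u g"
  using lop_adjoint[OF hloc_norm[OF assms] hloc_norm[OF assms] hloc_sym] lap_sym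
  by (simp add: Hop_def inner_diff_left inner_diff_right)

lemma Hop_cs: assumes "\<And>x. cmod (u x) \<le> 2" shows "Hop \<epsilon> u (cs c f) = cs c (Hop \<epsilon> u f)"
  by (rule hil_eqI) (simp add: vl_Hop[OF assms] hloc_def prod_eq_iff scaleR_conv_of_real algebra_simps)

section \<open>Rotation sectors of the vortex cross\<close>

text \<open>
  The weights of the phase mode \<open>e\<^sub>\<omega>\<close>: the four nodes are visited in the order of successive rotations.
\<close>

definition wt :: "complex \<Rightarrow> int \<times> int \<Rightarrow> complex" where
  "wt \<omega> x = (if x = (-1,0) then 1 else if x = (0,-1) then \<omega> else if x = (1,0) then \<omega>\<^sup>2
     else if x = (0,1) then \<omega>^3 else 0)"

lemma wt_rot: assumes "\<omega>^4 = 1" shows "wt \<omega> (rot x) = \<omega> * wt \<omega> x"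
  using assms by (cases x) (auto simp: wt_def rot_def power2_eq_square eval_nat_numeral)

lemma set_S0: "set S0 = {(-1,0), (0,-1), (1,0), (0,1)}" by (simp add: S0_def)

lemma wt_off: "x \<notin> set S0 \<Longrightarrow> wt \<omega> x = 0" by (auto simp: wt_def set_S0)

lemma rot_S0: "rot x \<in> set S0 \<longleftrightarrow> x \<in> set S0"
  by (cases x) (auto simp: set_S0 rot_def)

lemma cmod_root: assumes "\<omega>^4 = (1::complex)" shows "cmod \<omega> = 1"
proof -
  have "cmod \<omega> ^ 4 = 1 ^ 4" using assms by (metis norm_one norm_power power_one)
  then show ?thesis by (rule power_eq_imp_eq_base) auto
qed

lemma wt_cmod: assumes "\<omega>^4 = 1" shows "cmod (wt \<omega> x) \<le> 1"
  using cmod_root[OF assms] by (simp add: wt_def norm_power)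

text \<open>
  The rotation of a spinor, corrected by the phase that the solution picks up, so that it commutes with the linearisation.
\<close>

definition rloc :: "int \<times> int \<Rightarrow> complex \<times> complex \<Rightarrow> complex \<times> complex" where
  "rloc x v = (- \<i> * fst v, \<i> * snd v)"
lemma rloc_norm: "norm (rloc x v) \<le> 1 * norm v" by (simp add: rloc_def norm_prod_def norm_mult)
lemma rloc_linear: "linear (rloc x)" by (rule linearI) (simp_all add: rloc_def algebra_simps)

definition Rop where "Rop f = lop rloc (tr rot f)"
lemma vl_Rop: "vl (Rop f) x = (- \<i> * fst (vl f (rot x)), \<i> * snd (vl f (rot x)))"
  unfolding Rop_def vl_lop[OF rloc_norm] by (simp add: rloc_def vl_tr)
lemma Rop_bounded_linear: "bounded_linear Rop"
  unfolding Rop_def[abs_def]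
  by (intro bounded_linear_compose[OF lop_bounded_linear[OF rloc_norm rloc_linear]]
      tr_bounded_linear[where k=rotinv]) simp_all
lemma norm_Rop_le: "norm (Rop f) \<le> norm f"
  unfolding Rop_def using norm_lop_le[of rloc 1 "tr rot f", OF rloc_norm] norm_tr[of rot rotinv f] by simp
lemma Rop_cs: "Rop (cs c f) = cs c (Rop f)" by (rule hil_eqI) (simp add: vl_Rop)
lemma Rop_sg: "Rop (sg f) = sg (Rop f)" by (rule hil_eqI) (simp add: vl_Rop)
lemma rot4: "rot (rot (rot (rot x))) = x" by (cases x) (simp add: rot_def)
lemma Rop4: "Rop (Rop (Rop (Rop f))) = f" by (rule hil_eqI) (simp add: vl_Rop rot4 mult.assoc[symmetric])

text \<open>
  The spectral projection of \<open>Rop\<close> for the eigenvalue \<open>\<omega>\<close>; for \<open>\<omega>\<^sup>4 = 1\<close> the inverse powers of \<open>\<omega>\<close> are \<open>\<omega>\<^sup>3, \<omega>\<^sup>2, \<omega>\<close>.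
\<close>

definition Pr :: "complex \<Rightarrow> hil \<Rightarrow> hil" where
  "Pr \<omega> f = cs (1/4) (f + cs (\<omega>^3) (Rop f) + cs (\<omega>\<^sup>2) (Rop (Rop f)) + cs \<omega> (Rop (Rop (Rop f))))"

abbreviation "roots4 \<equiv> {1, \<i>, -1, -\<i>}"

lemma roots4: "\<omega> \<in> roots4 \<Longrightarrow> \<omega>^4 = 1" by auto

lemma cs_linear: "cs c (f + g) = cs c f + cs c g" "cs c (f - g) = cs c f - cs c g"
  by (rule hil_eqI, simp add: algebra_simps)+

lemma Pr_sum: "f = Pr 1 f + Pr \<i> f + Pr (-1) f + Pr (-\<i>) f"
proof -
  have p: "\<i>^3 = - \<i>" "(- \<i>)^3 = \<i>" "\<i>\<^sup>2 = -1" "(- \<i>)\<^sup>2 = -1" "(-1::complex)^3 = -1" "(-1::complex)\<^sup>2 = 1"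
    by (simp_all add: power3_eq_cube)
  have "a = 1/4 * (a + 1^3 * b + 1\<^sup>2 * c + 1 * d) + 1/4 * (a + \<i>^3 * b + \<i>\<^sup>2 * c + \<i> * d)
    + 1/4 * (a + (-1)^3 * b + (-1)\<^sup>2 * c + (-1) * d) + 1/4 * (a + (-\<i>)^3 * b + (-\<i>)\<^sup>2 * c + (-\<i>) * d)"
    for a b c d :: complex unfolding p by (simp add: field_simps)
  then show ?thesis
    by (intro hil_eqI) (simp only: Pr_def vl_cs rep_hil_simps prod_eq_iff fst_conv snd_conv fst_add snd_add simp_thms)
qed

lemma Pr_sect: assumes "\<omega>^4 = 1" shows "Rop (Pr \<omega> f) = cs \<omega> (Pr \<omega> f)"
proof -
  interpret R: bounded_linear Rop by (rule Rop_bounded_linear)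
  have "\<omega> * \<omega>^3 = 1" using assms by (simp add: eval_nat_numeral)
  then show ?thesis
  proof -
    have "Rop (Pr \<omega> f) = cs (1/4) (Rop f + cs (\<omega>^3) (Rop (Rop f)) + cs (\<omega>\<^sup>2) (Rop (Rop (Rop f))) + cs \<omega> f)"
      by (simp only: Pr_def Rop_cs R.add Rop4)
    moreover have "cs \<omega> (Pr \<omega> f) = cs (1/4) (cs \<omega> f + cs (\<omega> * \<omega>^3) (Rop f) + cs (\<omega> * \<omega>\<^sup>2) (Rop (Rop f)) + cs (\<omega> * \<omega>) (Rop (Rop (Rop f))))"
    proof -
      have "cs \<omega> (cs (1/4) g) = cs (1/4) (cs \<omega> g)" for g by (simp only: cs_cs mult.commute)
      then show ?thesis by (simp only: Pr_def cs_linear cs_cs mult.assoc mult.commute[of "1/4"])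
    qed
    ultimately show ?thesis
      using \<open>\<omega> * \<omega>^3 = 1\<close> by (simp add: power3_eq_cube power2_eq_square add_ac mult.assoc)
  qed
qed

lemma Pr_norm: assumes "\<omega>^4 = 1" shows "norm (Pr \<omega> f) \<le> norm f"
proof -
  have n: "cmod \<omega> = 1" by (rule cmod_root[OF assms])
  have R: "norm (Rop f) \<le> norm f" "norm (Rop (Rop f)) \<le> norm f" "norm (Rop (Rop (Rop f))) \<le> norm f"
    by (rule norm_Rop_le, rule order_trans[OF norm_Rop_le norm_Rop_le],
        rule order_trans[OF norm_Rop_le order_trans[OF norm_Rop_le norm_Rop_le]])
  have "norm (f + cs (\<omega>^3) (Rop f) + cs (\<omega>\<^sup>2) (Rop (Rop f)) + cs \<omega> (Rop (Rop (Rop f)))) \<le> norm f + norm f + norm f + norm f"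
    using R by (intro norm_triangle_le add_mono) (simp_all add: norm_cs n norm_power)
  then show ?thesis by (simp add: Pr_def norm_cs)
qed

text \<open>
  Complex conjugation with exchange of the two components. It commutes with \<open>H\<close> and anticommutes with \<open>\<sigma>\<close>, so it reverses the sign of \<open>\<mu>\<close>.
\<close>

definition cloc2 :: "complex \<times> complex \<Rightarrow> complex \<times> complex" where "cloc2 v = (cnj (snd v), cnj (fst v))"
definition Cop where "Cop f = lop (\<lambda>x. cloc2) f"
lemma cloc2_norm: "norm (cloc2 v) \<le> 1 * norm v" by (simp add: cloc2_def norm_prod_def add.commute)
lemma vl_Cop: "vl (Cop f) x = (cnj (snd (vl f x)), cnj (fst (vl f x)))"
  unfolding Cop_def vl_lop[OF cloc2_norm] by (simp add: cloc2_def)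
lemma Cop_linear: "Cop (f + g) = Cop f + Cop g" "Cop (f - g) = Cop f - Cop g" "Cop (r *\<^sub>R f) = r *\<^sub>R Cop f"
  by (rule hil_eqI, simp add: vl_Cop prod_eq_iff)+
lemma Cop_inner: "Cop f \<bullet> Cop g = f \<bullet> g"
  by (rule inner_hil_cong) (simp add: vl_Cop inner_prod_def inner_complex_def)
lemma Cop_sg: "Cop (sg f) = - sg (Cop f)" by (rule hil_eqI) (simp add: vl_Cop)

text \<open>
  The operator \<open>H + P\<close> at zero coupling, with the actual phases of the solution at the nodes: \<open>1\<close> on phase
  directions, \<open>-2\<close> on amplitude directions, \<open>1\<close> at all other sites.
\<close>

definition mloc :: "(int \<times> int \<Rightarrow> complex) \<Rightarrow> int \<times> int \<Rightarrow> complex \<times> complex \<Rightarrow> complex \<times> complex" where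
  "mloc u x v = (if x \<in> set S0 then
     (- (1/2) * fst v - (3/2) * (sgn (u x))\<^sup>2 * snd v, - (1/2) * snd v - (3/2) * (cnj (sgn (u x)))\<^sup>2 * fst v) else v)"

lemma mloc_norm: "norm (mloc u x v) \<le> 4 * norm v"
proof -
  have "cmod ((sgn (u x))\<^sup>2) \<le> 1" by (simp add: norm_power norm_sgn)
  then show ?thesis
    using mat_bound[of "-(1/2)" "- ((3/2) * (sgn (u x))\<^sup>2)" 2 "- ((3/2) * (cnj (sgn (u x)))\<^sup>2)" "-(1/2)" v] norm_ge_zero[of v]
    by (auto simp: mloc_def norm_power norm_mult norm_divide add.commute)
qed

lemma mloc_ge: assumes "x \<in> set S0 \<Longrightarrow> u x \<noteq> 0" shows "norm v \<le> norm (mloc u x v)"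
proof (cases "x \<in> set S0")
  case True
  define s where "s = (sgn (u x))\<^sup>2"
  have s: "cmod s = 1" "cnj s = (cnj (sgn (u x)))\<^sup>2" using assms[OF True] by (simp_all add: s_def norm_power norm_sgn)
  obtain a b where v: "v = (a, b)" by (cases v)
  have "(cmod (a + 3 * (s * b)))\<^sup>2 + (cmod (b + 3 * (cnj s * a)))\<^sup>2 \<ge> 4 * ((cmod a)\<^sup>2 + (cmod b)\<^sup>2)"
  proof -
    define t where "t = s * b"
    have "s * cnj s = 1" using complex_norm_square[of s] s(1) by simp
    then have "cnj s * t = b" by (metis t_def mult.assoc mult.commute mult.left_neutral)
    then have "cmod (b + 3 * (cnj s * a)) = cmod (cnj s * (t + 3 * a))" by (simp add: algebra_simps)
    also have "\<dots> = cmod (t + 3 * a)" by (simp only: norm_mult complex_mod_cnj s(1) mult_1_left)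
    finally have 1: "cmod (b + 3 * (cnj s * a)) = cmod (t + 3 * a)" .
    have 2: "cmod b = cmod t" by (simp add: t_def norm_mult s)
    have "(cmod (a + 3 * t))\<^sup>2 + (cmod (t + 3 * a))\<^sup>2 - 4 * ((cmod a)\<^sup>2 + (cmod t)\<^sup>2) = 6 * (cmod (a + t))\<^sup>2"
      unfolding cmod_power2 by (simp add: power2_eq_square algebra_simps)
    then show ?thesis using zero_le_power2[of "cmod (a + t)"] unfolding 1 2 t_def[symmetric] by linarith
  qed
  then have "(norm v)\<^sup>2 \<le> (norm (mloc u x v))\<^sup>2"
  proof -
    have "mloc u x v = (- (1/2) * (a + 3 * (s * b)), - (1/2) * (b + 3 * (cnj s * a)))"
      using True by (simp add: mloc_def v s s_def[symmetric] algebra_simps)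
    then have "norm (mloc u x v) = sqrt ((cmod (a + 3 * (s * b)) / 2)\<^sup>2 + (cmod (b + 3 * (cnj s * a)) / 2)\<^sup>2)"
      by (simp only: norm_Pair norm_mult) simp
    then have "(norm (mloc u x v))\<^sup>2 = ((cmod (a + 3 * (s * b)))\<^sup>2 + (cmod (b + 3 * (cnj s * a)))\<^sup>2) / 4"
      by (simp add: power_divide add_divide_distrib)
    moreover have "(norm v)\<^sup>2 = (cmod a)\<^sup>2 + (cmod b)\<^sup>2" by (simp add: v norm_Pair)
    ultimately show ?thesis
      using \<open>(cmod (a + 3 * (s * b)))\<^sup>2 + (cmod (b + 3 * (cnj s * a)))\<^sup>2 \<ge> 4 * ((cmod a)\<^sup>2 + (cmod b)\<^sup>2)\<close> by simp
  qed
  then show ?thesis by (simp add: power2_le_iff_abs_le)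
qed (simp add: mloc_def)

text \<open>A rotation symmetric solution whose moduli are within \<open>h\<close> of those at zero coupling.\<close>

locale cross =
  fixes \<epsilon> h :: real and u :: "int \<times> int \<Rightarrow> complex"
  assumes eps: "0 < \<epsilon>" and ell: "u \<in> ell2" and stat: "stationary \<epsilon> u"
    and rot: "\<And>x. u (rot x) = \<i> * u x"
    and off: "\<And>x. x \<notin> set S0 \<Longrightarrow> (cmod (u x))\<^sup>2 \<le> h"
    and on: "\<And>x. x \<in> set S0 \<Longrightarrow> \<bar>1 - (cmod (u x))\<^sup>2\<bar> \<le> h"
    and small: "0 \<le> h" "6 * h + 4 * \<epsilon> \<le> 1 / 100000"
begin

lemma u_le: "cmod (u x) \<le> 2"
proof -
  have "(cmod (u x))\<^sup>2 \<le> 2\<^sup>2" using off[of x] on[of x] small eps by (cases "x \<in> set S0") auto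
  then show ?thesis by (rule power2_le_imp_le) simp
qed

lemma u_node: "x \<in> set S0 \<Longrightarrow> u x \<noteq> 0" using on[of x] small eps by auto

abbreviation "H \<equiv> Hop \<epsilon> u"
definition "T0 f = H f + Pop u f"
definition "E f = T0 f - lop (mloc u) f"
definition "\<eta> = 6 * h + 4 * \<epsilon>"

lemmas vl_H = vl_Hop[of u \<epsilon>, OF u_le]
lemmas H_lin = Hop_bounded_linear[of u \<epsilon>, OF u_le]
lemmas H_sym = Hop_sym[of u \<epsilon>, OF u_le]
lemmas H_cs = Hop_cs[of u \<epsilon>, OF u_le]

lemma T0_lin: "bounded_linear T0"
  unfolding T0_def[abs_def] by (intro bounded_linear_add H_lin Pop_bounded_linear)
lemma T0_sym: "T0 f \<bullet> g = f \<bullet> T0 g" by (simp add: T0_def inner_add_left inner_add_right H_sym Pop_sym)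
lemma T0_cs: "T0 (cs c f) = cs c (T0 f)" by (simp add: T0_def H_cs Pop_cs cs_linear)

text \<open>
  The diagonal part differs from its value at zero coupling by \<open>6h\<close>; the coupling to the four neighbours costs \<open>4\<epsilon>\<close>.
\<close>

lemma E_bound: "norm (E f) \<le> \<eta> * norm f"
proof -
  define A where "A x v = hloc u x v + ploc u x v - mloc u x v" for x v
  have A: "norm (A x v) \<le> 6 * h * norm v" for x v
  proof (cases "x \<in> set S0")
    case True
    define t where "t = (cmod (u x))\<^sup>2"
    define s where "s = (sgn (u x))\<^sup>2"
    have s: "cmod s = 1" "cnj s = (cnj (sgn (u x)))\<^sup>2" using u_node[OF True] by (simp_all add: s_def norm_power norm_sgn)
    have us: "(u x)\<^sup>2 = of_real t * s" "(cnj (u x))\<^sup>2 = of_real t * cnj s"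
      using u_node[OF True] by (simp_all add: t_def s_def sgn_eq power_divide)
    have "A x v = (of_real (2 * (1 - t)) * fst v + of_real (1 - t) * s * snd v,
        of_real (1 - t) * cnj s * fst v + of_real (2 * (1 - t)) * snd v)"
      unfolding A_def hloc_def ploc_def mloc_def us t_def[symmetric] s_def[symmetric] s(2)[symmetric]
      using True by (simp add: prod_eq_iff field_simps)
    also have "norm \<dots> \<le> (2 * (3 * h)) * norm v"
    proof (rule mat_bound)
      have t: "\<bar>1 - t\<bar> \<le> h" "\<bar>2 * (1 - t)\<bar> \<le> 2 * h" using on[OF True] by (simp_all add: t_def)
      have "cmod (of_real (2 * (1 - t))) + cmod (of_real (1 - t) * s) = \<bar>2 * (1 - t)\<bar> + \<bar>1 - t\<bar>"
        "cmod (of_real (1 - t) * cnj s) + cmod (of_real (2 * (1 - t))) = \<bar>2 * (1 - t)\<bar> + \<bar>1 - t\<bar>"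
        by (simp_all only: norm_mult norm_of_real complex_mod_cnj s(1) mult_1_right add.commute)
      then show "cmod (of_real (2 * (1 - t))) + cmod (of_real (1 - t) * s) \<le> 3 * h"
        "cmod (of_real (1 - t) * cnj s) + cmod (of_real (2 * (1 - t))) \<le> 3 * h" using t by simp_all
    qed
    finally show ?thesis by simp
  next
    case False
    have "A x v = (of_real (- 2 * (cmod (u x))\<^sup>2) * fst v + (- (u x)\<^sup>2) * snd v,
        (- (cnj (u x))\<^sup>2) * fst v + of_real (- 2 * (cmod (u x))\<^sup>2) * snd v)"
      unfolding A_def hloc_def ploc_def mloc_def using False by (simp add: prod_eq_iff algebra_simps)
    also have "norm \<dots> \<le> (2 * (3 * h)) * norm v"
      using off[OF False] by (intro mat_bound) (simp_all add: norm_mult norm_power)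
    finally show ?thesis by simp
  qed
  have "E f = lop A f - \<epsilon> *\<^sub>R lap f"
    by (rule hil_eqI) (simp add: E_def T0_def vl_H vl_Pop vl_lop[OF A] vl_lop[OF mloc_norm] vl_lap A_def algebra_simps)
  also have "norm \<dots> \<le> 6 * h * norm f + \<epsilon> * (4 * norm f)"
  proof -
    have "\<epsilon> * norm (lap f) \<le> \<epsilon> * (4 * norm f)" using eps by (intro mult_left_mono norm_lap) auto
    moreover have "norm (lop A f) \<le> 6 * h * norm f" using small(1) by (intro norm_lop_le A) auto
    moreover have "norm (\<epsilon> *\<^sub>R lap f) = \<epsilon> * norm (lap f)" using eps by simp
    ultimately show ?thesis using norm_triangle_ineq4[of "lop A f" "\<epsilon> *\<^sub>R lap f"] by linarith
  qed
  finally show ?thesis by (simp add: \<eta>_def algebra_simps)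
qed

text \<open>The phase mode of the sector \<open>\<omega>\<close>.\<close>

definition "ev \<omega> = Abs_hil (\<lambda>x. (wt \<omega> x * (\<i> * u x), wt \<omega> x * (- \<i> * cnj (u x))))"

lemma vl_ev: assumes "\<omega>^4 = 1"
  shows "vl (ev \<omega>) x = (wt \<omega> x * (\<i> * u x), wt \<omega> x * (- \<i> * cnj (u x)))"
proof -
  have "(\<lambda>x. (wt \<omega> x * (\<i> * u x), wt \<omega> x * (- \<i> * cnj (u x)))) \<in> ell2"
  proof (rule ell2_le[OF ell, of _ 2])
    fix x
    have "cmod (wt \<omega> x) * cmod (u x) \<le> 1 * cmod (u x)" by (intro mult_right_mono wt_cmod[OF assms]) auto
    then show "norm (wt \<omega> x * (\<i> * u x), wt \<omega> x * (- \<i> * cnj (u x))) \<le> 2 * norm (u x)"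
      using norm_pair_le_sum[of "(wt \<omega> x * (\<i> * u x), wt \<omega> x * (- \<i> * cnj (u x)))"] by (simp add: norm_mult mult.commute)
  qed
  then show ?thesis by (simp add: ev_def Abs_hil_inverse)
qed

lemma sgn_cnj: "x \<in> set S0 \<Longrightarrow> (sgn (u x))\<^sup>2 * cnj (u x) = u x"
  "x \<in> set S0 \<Longrightarrow> (cnj (sgn (u x)))\<^sup>2 * u x = cnj (u x)"
proof -
  assume x: "x \<in> set S0"
  have n: "of_real (cmod (u x)) * of_real (cmod (u x)) = u x * cnj (u x)"
    by (metis complex_norm_square of_real_power power2_eq_square)
  show 1: "(sgn (u x))\<^sup>2 * cnj (u x) = u x"
    using u_node[OF x] n by (simp add: sgn_eq power2_eq_square)
  show "(cnj (sgn (u x)))\<^sup>2 * u x = cnj (u x)" using arg_cong[OF 1, of cnj] by simp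
qed

lemma reg: assumes "\<omega>^4 = 1" shows "reg_pencil T0 sg E (ev \<omega>) \<eta>"
proof (rule reg_pencil.intro)
  show "bounded_linear T0" by (rule T0_lin)
  show "bounded_linear sg" by (rule sg_bounded_linear)
  show "T0 x \<bullet> y = x \<bullet> T0 y" for x y by (rule T0_sym)
  show "sg x \<bullet> y = x \<bullet> sg y" for x y by (rule sg_sym)
  show "norm (sg x) = norm x" for x by simp
  show "norm x \<le> norm (T0 x - E x)" for x
    unfolding E_def by (simp add: norm_lop_ge[OF mloc_norm mloc_ge[OF u_node]])
  show "norm (E x) \<le> \<eta> * norm x" for x by (rule E_bound)
  show "0 \<le> \<eta>" "\<eta> \<le> 1 / 100000" using small eps by (simp_all add: \<eta>_def)
  have "vl (ev \<omega>) (-1,0) \<noteq> 0" using u_node[of "(-1,0)"] by (simp add: vl_ev[OF assms] wt_def set_S0 zero_prod_def)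
  then show "ev \<omega> \<noteq> 0" by auto
  have "vl (sg (ev \<omega>)) x \<bullet> vl (ev \<omega>) x = 0" for x
  proof -
    have "cmod (fst (vl (ev \<omega>) x)) = cmod (snd (vl (ev \<omega>) x))" by (simp add: vl_ev[OF assms] norm_mult)
    then have "fst (vl (ev \<omega>) x) \<bullet> fst (vl (ev \<omega>) x) = snd (vl (ev \<omega>) x) \<bullet> snd (vl (ev \<omega>) x)"
      by (metis power2_norm_eq_inner)
    then show ?thesis by (simp add: inner_prod_def)
  qed
  then show "sg (ev \<omega>) \<bullet> ev \<omega> = 0" by (simp add: inner_hil_def)
  have "lop (mloc u) (ev \<omega>) = ev \<omega>"
  proof (rule hil_eqI)
    fix x show "vl (lop (mloc u) (ev \<omega>)) x = vl (ev \<omega>) x"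
      using sgn_cnj[of x] by (simp add: vl_lop[OF mloc_norm] mloc_def vl_ev[OF assms] field_simps)
  qed
  then show "T0 (ev \<omega>) = ev \<omega> + E (ev \<omega>)" by (simp add: E_def)
  have "lop (mloc u) (sg (ev \<omega>)) = - 2 *\<^sub>R sg (ev \<omega>)"
  proof (rule hil_eqI)
    fix x show "vl (lop (mloc u) (sg (ev \<omega>))) x = vl (- 2 *\<^sub>R sg (ev \<omega>)) x"
      using sgn_cnj[of x] wt_off[of x \<omega>]
      by (cases "x \<in> set S0") (simp_all add: vl_lop[OF mloc_norm] mloc_def vl_ev[OF assms] field_simps scaleR_conv_of_real)
  qed
  then show "T0 (sg (ev \<omega>)) = - 2 *\<^sub>R sg (ev \<omega>) + E (sg (ev \<omega>))" by (simp add: E_def)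
qed

end

text \<open>The complex inner product, recovered from the real one.\<close>

definition cip :: "hil \<Rightarrow> hil \<Rightarrow> complex" where "cip f g = Complex (f \<bullet> g) (f \<bullet> cs \<i> g)"

lemma cs_split: "cs c g = Re c *\<^sub>R g + Im c *\<^sub>R cs \<i> g"
proof -
  have "cs c g = cs (of_real (Re c)) g + cs (of_real (Im c)) (cs \<i> g)"
    unfolding cs_cs cs_add[symmetric] by (subst complex_eq) (simp add: mult.commute)
  then show ?thesis by (simp add: cs_of_real)
qed

lemma inner_cs_right: "f \<bullet> cs c g = Re c * (f \<bullet> g) + Im c * (f \<bullet> cs \<i> g)"
  by (subst cs_split) (simp add: inner_add_right)

lemma cip_add: "cip (f + g) k = cip f k + cip g k" "cip (f - g) k = cip f k - cip g k"
  by (simp_all add: cip_def inner_add_left inner_diff_left complex_eq_iff)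

lemma inner_cs_ii: "f \<bullet> cs \<i> (cs \<i> g) = - (f \<bullet> g)"
  using cs_of_real[of "-1" g] by (simp add: cs_cs)

lemma cip_cs_right: "cip f (cs c g) = cnj c * cip f g"
proof -
  have "f \<bullet> cs \<i> (cs c g) = Re c * (f \<bullet> cs \<i> g) + Im c * (f \<bullet> cs \<i> (cs \<i> g))"
    using inner_cs_right[of f c "cs \<i> g"] by (simp add: cs_cs mult.commute)
  then show ?thesis by (simp add: cip_def inner_cs_right[of f c g] inner_cs_ii complex_eq_iff)
qed

lemma cip_cs_left: "cip (cs c f) g = c * cip f g"
proof -
  have "cs c f \<bullet> g = f \<bullet> cs (cnj c) g" "cs c f \<bullet> cs \<i> g = f \<bullet> cs (cnj c) (cs \<i> g)" by (rule cs_adj)+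
  then show ?thesis
    by (simp add: cip_def inner_cs_right[of f "cnj c"] inner_cs_ii complex_eq_iff)
qed

lemma Re_cip [simp]: "Re (cip f g) = f \<bullet> g" by (simp add: cip_def)

lemma norm_cip: "cmod (cip f g) \<le> 2 * (norm f * norm g)"
proof -
  have "cmod (cip f g) \<le> \<bar>f \<bullet> g\<bar> + \<bar>f \<bullet> cs \<i> g\<bar>" using cmod_le[of "cip f g"] by (simp add: cip_def)
  also have "\<dots> \<le> norm f * norm g + norm f * norm (cs \<i> g)" by (intro add_mono Cauchy_Schwarz_ineq2)
  finally show ?thesis by (simp add: norm_cs)
qed

lemma cip_sym:
  assumes "\<And>f g. A f \<bullet> g = f \<bullet> A g" "\<And>f c. A (cs c f) = cs c (A f)"
  shows "cip (A f) g = cip f (A g)"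
  unfolding cip_def assms(2)[symmetric] by (simp only: assms(1))

lemma cip_sg: "cip (sg f) g = cip f (sg g)" by (rule cip_sym[OF sg_sym sg_cs])

context cross
begin

abbreviation "G \<equiv> reg_pencil.G T0 sg"
abbreviation "psi \<omega> \<equiv> reg_pencil.\<psi> T0 sg (ev \<omega>)"
abbreviation "p \<omega> \<equiv> reg_pencil.p T0 sg (ev \<omega>)"
abbreviation "D \<omega> \<equiv> reg_pencil.D T0 sg (ev \<omega>)"
abbreviation "T \<equiv> reg_pencil.T T0 sg"
abbreviation "NN \<equiv> (-1::int, 0::int)"
abbreviation "sect \<omega> f \<equiv> Rop f = cs \<omega> f"

lemma one4: "(1::complex)^4 = 1" by simp

lemmas T_eq = reg_pencil.T_def[OF reg[OF one4]]
lemmas TGs = reg_pencil.TG[OF reg[OF one4]]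
lemmas GTs = reg_pencil.GT[OF reg[OF one4]]
lemmas G_lins = reg_pencil.G_linear[OF reg[OF one4]]
lemmas G_les = reg_pencil.G_le[OF reg[OF one4]]
lemmas G_syms = reg_pencil.G_sym[OF reg[OF one4]]
lemmas psi_eq = reg_pencil.\<psi>_def[OF reg]

sublocale R: bounded_linear Rop by (rule Rop_bounded_linear)
sublocale Sg: bounded_linear sg by (rule sg_bounded_linear)
sublocale Hl: bounded_linear H by (rule H_lin)
sublocale Pl: bounded_linear "Pop u" by (rule Pop_bounded_linear)

lemma cs_scaleR: "cs c (r *\<^sub>R f) = r *\<^sub>R cs c f"
  using bounded_linear.axioms(1)[OF cs_bounded_linear] by (simp add: linear_scale)

lemma T_cs: "T \<mu> (cs c f) = cs c (T \<mu> f)"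
  by (simp add: T_eq T0_cs sg_cs cs_linear cs_scaleR)

lemma G_cs: "\<bar>\<mu>\<bar> \<le> 1/4 \<Longrightarrow> G \<mu> (cs c f) = cs c (G \<mu> f)"
  by (metis GTs TGs T_cs)

lemma rot_moves: "rot (east x) = north (rot x)" "rot (west x) = south (rot x)"
  "rot (north x) = west (rot x)" "rot (south x) = east (rot x)"
  by (cases x, simp add: moves)+

lemma Rop_H: "Rop (H f) = H (Rop f)"
proof (rule hil_eqI)
  fix x
  have "cmod (u (rot x)) = cmod (u x)" by (simp add: rot norm_mult)
  then show "vl (Rop (H f)) x = vl (H (Rop f)) x"
    by (simp add: vl_Rop vl_H hloc_def rot rot_moves prod_eq_iff power_mult_distrib algebra_simps scaleR_conv_of_real)
qed

lemma Rop_P: "Rop (Pop u f) = Pop u (Rop f)"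
proof (rule hil_eqI)
  fix x
  have "sgn (u (rot x)) = \<i> * sgn (u x)" by (simp add: rot sgn_mult) (simp add: sgn_eq)
  then show "vl (Rop (Pop u f)) x = vl (Pop u (Rop f)) x"
    by (simp add: vl_Rop vl_Pop ploc_def rot_S0 prod_eq_iff power_mult_distrib algebra_simps)
qed

lemma Rop_T: "Rop (T \<mu> f) = T \<mu> (Rop f)"
  by (simp add: T_eq T0_def R.diff R.add R.scaleR Rop_H Rop_P Rop_sg)

lemma Rop_G: "\<bar>\<mu>\<bar> \<le> 1/4 \<Longrightarrow> Rop (G \<mu> f) = G \<mu> (Rop f)"
  by (metis GTs TGs Rop_T)

lemma Rop_ev: assumes "\<omega>^4 = 1" shows "sect \<omega> (ev \<omega>)"
  by (rule hil_eqI) (simp add: vl_Rop vl_ev[OF assms] wt_rot[OF assms] rot)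

lemma sect_psi: assumes "\<omega>^4 = 1" "\<bar>\<mu>\<bar> \<le> 1/4" shows "sect \<omega> (psi \<omega> \<mu>)"
  unfolding psi_eq[OF assms(1)] Rop_G[OF assms(2)] Rop_ev[OF assms(1)] G_cs[OF assms(2)] ..

lemma sect_rot: assumes "sect \<omega> f"
  shows "fst (vl f (rot x)) = \<i> * \<omega> * fst (vl f x)" "snd (vl f (rot x)) = - \<i> * \<omega> * snd (vl f x)"
proof -
  have "vl (Rop f) x = vl (cs \<omega> f) x" using assms by simp
  then have "- \<i> * fst (vl f (rot x)) = \<omega> * fst (vl f x)" "\<i> * snd (vl f (rot x)) = \<omega> * snd (vl f x)"
    by (simp_all add: vl_Rop)
  then show "fst (vl f (rot x)) = \<i> * \<omega> * fst (vl f x)" "snd (vl f (rot x)) = - \<i> * \<omega> * snd (vl f x)"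
    by (simp_all add: complex_eq_iff)
qed

lemma sect_zero: assumes "sect \<omega> f" "vl f NN = 0" "x \<in> set S0" shows "vl f x = 0"
proof -
  have r: "vl f (rot x) = 0" if "vl f x = 0" for x
    using that sect_rot[OF assms(1), of x] by (simp add: prod_eq_iff)
  have "rot NN = (0,-1)" "rot (0,-1) = (1,0)" "rot (1,0) = (0,1)" by (simp_all add: rot_def)
  then have "vl f (0,-1) = 0" "vl f (1,0) = 0" "vl f (0,1) = 0" using r assms(2) by metis+
  then show ?thesis using assms(2,3) by (auto simp: set_S0)
qed

lemma uN: "u NN \<noteq> 0" by (rule u_node) (simp add: set_S0)

text \<open>
  Within a sector the values at all nodes are determined by those at the node \<open>NN\<close>. There \<open>al\<close> and \<open>be\<close>
  are the two components relative to the phase direction, and \<open>pc\<close> is the resulting coefficient of the projection onto the phase mode.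
\<close>

definition "al f = fst (vl f NN) / (\<i> * u NN)"
definition "be f = snd (vl f NN) / (- \<i> * cnj (u NN))"
definition "pc f = (al f + be f) / 2"

lemma al_lin: "al (f + g) = al f + al g" "al (f - g) = al f - al g" "al (cs c f) = c * al f"
  "be (f + g) = be f + be g" "be (f - g) = be f - be g" "be (cs c f) = c * be f"
  "pc (f + g) = pc f + pc g" "pc (f - g) = pc f - pc g" "pc (cs c f) = c * pc f"
  by (simp_all add: al_def be_def pc_def add_divide_distrib diff_divide_distrib algebra_simps)

lemma al_le: "cmod (al f) \<le> norm f / cmod (u NN)" "cmod (pc f) \<le> norm f / cmod (u NN)"
proof -
  have "cmod (fst (vl f NN)) \<le> norm f" "cmod (snd (vl f NN)) \<le> norm f"
    using norm_fst_le[of "fst (vl f NN)" "snd (vl f NN)"] norm_snd_le[of "snd (vl f NN)" "fst (vl f NN)"] norm_rep_le[of f NN]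
    by auto
  then have *: "cmod (al f) \<le> norm f / cmod (u NN)" "cmod (be f) \<le> norm f / cmod (u NN)"
    using uN by (simp_all add: al_def be_def norm_divide norm_mult divide_right_mono)
  then show "cmod (al f) \<le> norm f / cmod (u NN)" by blast
  show "cmod (pc f) \<le> norm f / cmod (u NN)"
  proof -
    have "cmod (pc f) = cmod (al f + be f) / 2" by (simp add: pc_def norm_divide)
    then show ?thesis using * norm_triangle_ineq[of "al f" "be f"] by linarith
  qed
qed

text \<open>Both sides lie in the same sector, so they only have to be compared at the node \<open>NN\<close>.\<close>

lemma P_sect: assumes "\<omega>^4 = 1" "sect \<omega> f" shows "Pop u f = cs (pc f) (ev \<omega>)"
proof -
  define kk where "kk = Pop u f - cs (pc f) (ev \<omega>)"
  have s: "sect \<omega> kk"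
    by (simp add: kk_def R.diff Rop_P assms(2) Pop_cs Rop_cs Rop_ev[OF assms(1)] cs_linear cs_cs mult.commute)
  have "vl kk NN = 0"
  proof -
    define a b where "a = fst (vl f NN)" and "b = snd (vl f NN)"
    have S: "NN \<in> set S0" by (simp add: set_S0)
    have pc: "pc f = (a / (\<i> * u NN) + b / (- \<i> * cnj (u NN))) / 2" by (simp add: pc_def al_def be_def a_def b_def)
    have "(sgn (u NN))\<^sup>2 = u NN / cnj (u NN)" "(cnj (sgn (u NN)))\<^sup>2 = cnj (u NN) / u NN"
      using sgn_cnj[OF S] uN by (simp_all add: field_simps)
    then show ?thesis using uN S
      by (simp add: kk_def vl_Pop vl_ev[OF assms(1)] wt_def ploc_def pc a_def[symmetric] b_def[symmetric] zero_prod_def field_simps)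
  qed
  note z = sect_zero[OF s this]
  have "kk = 0"
  proof (rule hil_eqI)
    fix x show "vl kk x = vl 0 x"
      using z[of x] wt_off[of x \<omega>] by (cases "x \<in> set S0") (auto simp: kk_def vl_Pop vl_ev[OF assms(1)] ploc_def zero_prod_def)
  qed
  then show ?thesis by (simp add: kk_def)
qed

lemma P_ev: assumes "\<omega>^4 = 1" shows "pc (ev \<omega>) = 1" "Pop u (ev \<omega>) = ev \<omega>"
proof -
  show 1: "pc (ev \<omega>) = 1" using uN by (simp add: pc_def al_def be_def vl_ev[OF assms] wt_def)
  show "Pop u (ev \<omega>) = ev \<omega>" using P_sect[OF assms Rop_ev[OF assms]] by (simp add: 1)
qed

lemma ev_nz: "\<omega>^4 = 1 \<Longrightarrow> ev \<omega> \<noteq> 0" using reg_pencil.e(1)[OF reg] .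

text \<open>
  The projection coefficient of \<open>\<psi>\<close> is an inner product with \<open>e\<^sub>\<omega>\<close>, and its imaginary part vanishes because
  the regularised pencil is self-adjoint.
\<close>

lemma pc_psi: assumes "\<omega>^4 = 1" "\<bar>\<mu>\<bar> \<le> 1/4" shows "pc (psi \<omega> \<mu>) = of_real (1 - p \<omega> \<mu>)"
proof -
  interpret rp: reg_pencil T0 sg E "ev \<omega>" \<eta> by (rule reg[OF assms(1)])
  define c where "c = pc (psi \<omega> \<mu>)"
  define N where "N = (norm (ev \<omega>))\<^sup>2"
  have N: "N \<noteq> 0" using ev_nz[OF assms(1)] by (simp add: N_def)
  have P: "Pop u (psi \<omega> \<mu>) = cs c (ev \<omega>)" unfolding c_def by (intro P_sect sect_psi assms)
  have "cip (psi \<omega> \<mu>) (ev \<omega>) = cip (Pop u (psi \<omega> \<mu>)) (ev \<omega>)"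
    using cip_sym[OF Pop_sym Pop_cs, of u "psi \<omega> \<mu>" "ev \<omega>"] by (simp add: P_ev[OF assms(1)])
  then have 1: "cip (psi \<omega> \<mu>) (ev \<omega>) = c * cip (ev \<omega>) (ev \<omega>)" by (simp add: P cip_cs_left)
  have anti: "f \<bullet> cs \<i> f = 0" for f
    using cs_adj[of \<i> f f] inner_cs_right[of f "-\<i>" f] by (simp add: inner_commute)
  have e: "cip (ev \<omega>) (ev \<omega>) = of_real N"
    by (simp add: cip_def anti N_def power2_norm_eq_inner complex_eq_iff)
  have "psi \<omega> \<mu> \<bullet> cs \<i> (ev \<omega>) = psi \<omega> \<mu> \<bullet> cs \<i> (T \<mu> (psi \<omega> \<mu>))" by (simp add: rp.T_psi[OF assms(2)])
  also have "\<dots> = T \<mu> (psi \<omega> \<mu>) \<bullet> cs \<i> (psi \<omega> \<mu>)"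
    by (simp add: T_cs[symmetric] rp.T_sym)
  also have "\<dots> = - (psi \<omega> \<mu> \<bullet> cs \<i> (ev \<omega>))"
    using cs_adj[of \<i> "psi \<omega> \<mu>" "ev \<omega>"] inner_cs_right[of "psi \<omega> \<mu>" "-\<i>" "ev \<omega>"]
    by (simp add: rp.T_psi[OF assms(2)] inner_commute)
  finally have "psi \<omega> \<mu> \<bullet> cs \<i> (ev \<omega>) = 0" by simp
  then have "cip (psi \<omega> \<mu>) (ev \<omega>) = of_real (psi \<omega> \<mu> \<bullet> ev \<omega>)" by (simp add: cip_def complex_eq_iff)
  with 1 e have "c = of_real ((psi \<omega> \<mu> \<bullet> ev \<omega>) / N)" using N by (simp add: field_simps)
  then show ?thesis by (simp add: c_def rp.p_def rp.N_def N_def)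
qed

text \<open>
  Removing the projection from the regularised equation subtracts \<open>(1 - p) e\<close> from the right-hand side \<open>e\<close>.
\<close>

lemma eig: assumes "\<omega>^4 = 1" "\<bar>\<mu>\<bar> \<le> 1/4"
  shows "H (psi \<omega> \<mu>) - \<mu> *\<^sub>R sg (psi \<omega> \<mu>) = p \<omega> \<mu> *\<^sub>R ev \<omega>"
proof -
  interpret rp: reg_pencil T0 sg E "ev \<omega>" \<eta> by (rule reg[OF assms(1)])
  have "T \<mu> (psi \<omega> \<mu>) = ev \<omega>" by (rule rp.T_psi[OF assms(2)])
  moreover have "Pop u (psi \<omega> \<mu>) = (1 - p \<omega> \<mu>) *\<^sub>R ev \<omega>"
    using P_sect[OF assms(1) sect_psi[OF assms]] pc_psi[OF assms] by (simp add: cs_of_real del: of_real_diff)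
  ultimately show ?thesis by (simp add: T_eq T0_def algebra_simps)
qed

text \<open>
  A sector element that vanishes at one node vanishes at all of them, and away from the nodes \<open>H\<close> is a small
  perturbation of the identity. Hence \<open>H\<close> is positive on a subspace of complex codimension two in the sector.
\<close>

lemma H_pos: assumes "sect \<omega> y" "vl y NN = 0" shows "H y \<bullet> y \<ge> (norm y)\<^sup>2 / 2"
proof -
  have z: "vl y x = 0" if "x \<in> set S0" for x by (rule sect_zero[OF assms that])
  have P: "Pop u y = 0" by (rule hil_eqI) (simp add: vl_Pop ploc_def z zero_prod_def)
  have M: "lop (mloc u) y = y" by (rule hil_eqI) (simp add: vl_lop[OF mloc_norm] mloc_def z zero_prod_def)
  have "H y = y + E y" using P M by (simp add: E_def T0_def)
  moreover have "\<bar>E y \<bullet> y\<bar> \<le> 1/2 * norm y * norm y"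
  proof -
    have "norm (E y) \<le> \<eta> * norm y" by (rule E_bound)
    also have "\<dots> \<le> 1/2 * norm y" using small by (intro mult_right_mono) (auto simp: \<eta>_def)
    finally show ?thesis using Cauchy_Schwarz_ineq2[of "E y" y] mult_right_mono[of "norm (E y)" "1/2 * norm y" "norm y"] by simp
  qed
  ultimately show ?thesis by (simp add: inner_add_left power2_norm_eq_inner[symmetric]) (simp add: power2_eq_square)
qed

definition "B \<mu> f = H f - cs \<mu> (sg f)"

lemma B_lin: "B \<mu> (f + g) = B \<mu> f + B \<mu> g" "B \<mu> (f - g) = B \<mu> f - B \<mu> g" "B \<mu> (cs c f) = cs c (B \<mu> f)"
  by (simp_all add: B_def Hl.add Hl.diff Sg.add Sg.diff cs_linear H_cs sg_cs cs_cs mult.commute algebra_simps)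

lemma B_bounded_linear: "bounded_linear (B \<mu>)"
  unfolding B_def[abs_def] by (intro bounded_linear_sub H_lin bounded_linear_compose[OF cs_bounded_linear sg_bounded_linear])

lemma B_real: "B (of_real m) f = H f - m *\<^sub>R sg f" by (simp add: B_def cs_of_real)

lemma B_Pr: "B \<mu> (Pr \<omega> f) = Pr \<omega> (B \<mu> f)"
proof -
  have "Rop (B \<mu> f) = B \<mu> (Rop f)" for f by (simp add: B_def R.diff Rop_H Rop_cs Rop_sg)
  then show ?thesis by (simp add: Pr_def B_lin)
qed

lemma sect_combine:
  assumes "\<And>\<omega>. \<omega> \<in> roots4 \<Longrightarrow> \<exists>K. \<forall>f. sect \<omega> f \<longrightarrow> norm f \<le> K * norm (B \<mu> f)"
  shows "\<exists>K. \<forall>f. norm f \<le> K * norm (B \<mu> f)"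
proof -
  have "\<exists>K. \<forall>f. norm (Pr \<omega> f) \<le> K * norm (B \<mu> f)" if \<omega>: "\<omega> \<in> roots4" for \<omega>
  proof -
    obtain K where K: "\<And>f. sect \<omega> f \<Longrightarrow> norm f \<le> K * norm (B \<mu> f)" using assms[OF \<omega>] by blast
    have "norm (Pr \<omega> f) \<le> \<bar>K\<bar> * norm (B \<mu> f)" for f
    proof -
      have "norm (Pr \<omega> f) \<le> K * norm (Pr \<omega> (B \<mu> f))" using K[OF Pr_sect[OF roots4[OF \<omega>]], of f] by (simp add: B_Pr)
      also have "\<dots> \<le> \<bar>K\<bar> * norm (Pr \<omega> (B \<mu> f))" by (intro mult_right_mono) auto
      also have "\<dots> \<le> \<bar>K\<bar> * norm (B \<mu> f)" by (intro mult_left_mono Pr_norm[OF roots4[OF \<omega>]]) auto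
      finally show ?thesis .
    qed
    then show ?thesis by blast
  qed
  then obtain K where K: "\<And>\<omega> f. \<omega> \<in> roots4 \<Longrightarrow> norm (Pr \<omega> f) \<le> K \<omega> * norm (B \<mu> f)" by metis
  have "norm f \<le> (K 1 + K \<i> + K (-1) + K (-\<i>)) * norm (B \<mu> f)" for f
  proof -
    have "norm f \<le> norm (Pr 1 f) + norm (Pr \<i> f) + norm (Pr (-1) f) + norm (Pr (-\<i>) f)"
      using Pr_sum[of f] by (metis norm_triangle_le norm_triangle_ineq add_mono order_refl)
    also have "\<dots> \<le> K 1 * norm (B \<mu> f) + K \<i> * norm (B \<mu> f) + K (-1) * norm (B \<mu> f) + K (-\<i>) * norm (B \<mu> f)"
      by (intro add_mono K) auto
    finally show ?thesis by (simp add: algebra_simps)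
  qed
  then show ?thesis by blast
qed

text \<open>
  Every element of a sector is recovered from \<open>B f\<close> up to its projection coefficient, which in turn is controlled when \<open>p m\<close> is not zero.
\<close>

lemma sect_solve:
  assumes "\<omega>^4 = 1" "\<bar>m\<bar> \<le> 1/60" "sect \<omega> f"
  shows "f = G m (B (of_real m) f) + cs (pc f) (psi \<omega> m)" "pc f * of_real (p \<omega> m) = pc (G m (B (of_real m) f))"
proof -
  interpret rp: reg_pencil T0 sg E "ev \<omega>" \<eta> by (rule reg[OF assms(1)])
  have m: "\<bar>m\<bar> \<le> 1/4" using assms(2) by simp
  have "T m f = B (of_real m) f + cs (pc f) (ev \<omega>)"
    by (simp add: T_eq T0_def B_real P_sect[OF assms(1,3)])
  then have "f = G m (B (of_real m) f + cs (pc f) (ev \<omega>))" by (metis GTs m)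
  then show 1: "f = G m (B (of_real m) f) + cs (pc f) (psi \<omega> m)"
    by (simp add: G_lins[OF m] G_cs[OF m] psi_eq[OF assms(1)])
  have "pc f = pc (G m (B (of_real m) f)) + pc f * of_real (1 - p \<omega> m)"
    by (subst 1) (simp only: al_lin pc_psi[OF assms(1) m])
  then show "pc f * of_real (p \<omega> m) = pc (G m (B (of_real m) f))" by (simp add: algebra_simps)
qed

lemma real_bounded_below:
  assumes "\<bar>m\<bar> \<le> 1/60" "\<And>\<omega>. \<omega> \<in> roots4 \<Longrightarrow> p \<omega> m \<noteq> 0"
  shows "\<exists>K. \<forall>f. norm f \<le> K * norm (B (of_real m) f)"
proof (rule sect_combine)
  fix \<omega> assume \<omega>: "\<omega> \<in> roots4"
  note w4 = roots4[OF \<omega>]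
  have m: "\<bar>m\<bar> \<le> 1/4" using assms(1) by simp
  define n where "n = norm (psi \<omega> m)"
  have "norm f \<le> (2 + 2 / cmod (u NN) / \<bar>p \<omega> m\<bar> * n) * norm (B (of_real m) f)" if "sect \<omega> f" for f
  proof -
    define g where "g = B (of_real m) f"
    note s = sect_solve[OF w4 assms(1) that, folded g_def]
    have "cmod (pc f) * \<bar>p \<omega> m\<bar> = cmod (pc (G m g))" using arg_cong[OF s(2), of cmod] by (simp add: norm_mult)
    also have "\<dots> \<le> 2 * norm g / cmod (u NN)"
      by (rule order_trans[OF al_le(2)]) (intro divide_right_mono G_les[OF m], simp)
    finally have "cmod (pc f) \<le> 2 * norm g / cmod (u NN) / \<bar>p \<omega> m\<bar>"
      using assms(2)[OF \<omega>] by (subst pos_le_divide_eq) auto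
    then have c: "cmod (pc f) \<le> 2 / cmod (u NN) / \<bar>p \<omega> m\<bar> * norm g" by simp
    have "norm f \<le> norm (G m g) + cmod (pc f) * n"
      by (subst s(1)) (simp add: norm_triangle_le norm_cs n_def)
    also have "\<dots> \<le> 2 * norm g + (2 / cmod (u NN) / \<bar>p \<omega> m\<bar> * norm g) * n"
      by (intro add_mono G_les[OF m] mult_right_mono c) (simp add: n_def)
    finally show ?thesis by (simp add: g_def algebra_simps)
  qed
  then show "\<exists>K. \<forall>f. sect \<omega> f \<longrightarrow> norm f \<le> K * norm (B (of_real m) f)" by blast
qed

end

lemma cip_commute: "cip g f = cnj (cip f g)"
proof -
  have "g \<bullet> cs \<i> f = - (f \<bullet> cs \<i> g)"
    using cs_adj[of \<i> f g] inner_cs_right[of f "-\<i>" g] by (simp add: inner_commute)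
  then show ?thesis by (simp add: cip_def complex_eq_iff inner_commute)
qed

lemma cip_real:
  assumes "\<And>f g. A f \<bullet> g = f \<bullet> A g" "\<And>f c. A (cs c f) = cs c (A f)"
  shows "cip (A f) f = of_real (A f \<bullet> f)"
proof -
  have "cip (A f) f = cnj (cip (A f) f)" using cip_sym[OF assms] cip_commute by metis
  then show ?thesis by (simp add: complex_eq_iff)
qed

lemma cip_add_right: "cip k (f + g) = cip k f + cip k g"
  by (simp add: cip_def inner_add_right cs_linear complex_eq_iff)

context cross
begin

lemma cip_H: "cip (H f) g = cip f (H g)" by (rule cip_sym[OF H_sym H_cs])
lemma cip_H_real: "cip (H f) f = of_real (H f \<bullet> f)" by (rule cip_real[OF H_sym H_cs])
lemma cip_sg_real: "cip (sg f) f = of_real (sg f \<bullet> f)" by (rule cip_real[OF sg_sym sg_cs])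

lemma cip_0 [simp]: "cip 0 f = 0" "cip f 0 = 0"
  using cip_add(2)[of 0 0 f] cip_commute[of f 0] by simp_all

section \<open>Absence of non-real spectral parameters\<close>

text \<open>
  An index argument. If \<open>H - \<mu>\<sigma>\<close> is not bounded below, there are unit vectors \<open>f\<close> with \<open>(H - \<mu>\<sigma>)f \<rightarrow> 0\<close>. Since \<open>\<mu>\<close> is
  not real, both forms \<open>(\<sigma> f, f)\<close> and \<open>(H f, f)\<close> tend to zero. By the hypothesis \<open>app\<close>, \<open>f\<close> becomes \<open>H\<close>-orthogonal to the span
  of \<open>n1, n2\<close>, on which \<open>H\<close> is nonpositive, while \<open>H\<close> is positive on the complement
  given by \<open>dec\<close>. Expanding the form at \<open>f\<close> minus its part in that span forces the \<open>y\<close> part and the \<open>n2\<close> part to zero, and the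
  \<open>n1\<close> part too if \<open>H\<close> is negative there. If \<open>H n1 = 0\<close>, then \<open>f\<close> approaches a multiple of \<open>n1\<close>, for which
  \<open>H - \<mu>\<sigma>\<close> is not small.
\<close>

lemma index_bound:
  assumes mu: "Im \<mu> \<noteq> 0"
    and dec: "\<And>f. sect \<omega> f \<Longrightarrow> \<exists>c1 c2 y. f = y + (cs c1 n1 + cs c2 n2) \<and> vl y NN = 0 \<and> sect \<omega> y \<and>
      cmod c1 \<le> K * norm f \<and> cmod c2 \<le> K * norm f"
    and app: "\<And>f. sect \<omega> f \<Longrightarrow> cmod (cip (H f) n1) \<le> L * norm (B \<mu> f) \<and> cmod (cip (H f) n2) \<le> L * norm (B \<mu> f)"
    and gram: "cip (H n1) n2 = 0" "H n2 \<bullet> n2 < 0" "H n1 \<bullet> n1 < 0 \<or> H n1 = 0"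
  shows "\<exists>K. \<forall>f. sect \<omega> f \<longrightarrow> norm f \<le> K * norm (B \<mu> f)"
proof (rule ccontr)
  assume "\<not> ?thesis"
  then have "\<forall>n::nat. \<exists>f. sect \<omega> f \<and> norm f > real (Suc n) * norm (B \<mu> f)" by (meson not_le)
  then obtain F where F: "\<And>n. sect \<omega> (F n)" "\<And>n. norm (F n) > real (Suc n) * norm (B \<mu> (F n))" by metis
  define f where "f n = cs (of_real (1 / norm (F n))) (F n)" for n
  have Fpos: "norm (F n) > 0" for n
    using F(2)[of n] by (rule le_less_trans[rotated]) simp
  have f1: "norm (f n) = 1" for n using Fpos[of n] by (simp add: f_def norm_cs norm_divide)
  have fs: "sect \<omega> (f n)" for n by (simp add: f_def Rop_cs F(1) cs_cs mult.commute)
  have Bf: "norm (B \<mu> (f n)) \<le> inverse (real (Suc n))" for n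
  proof -
    have "norm (B \<mu> (f n)) = norm (B \<mu> (F n)) / norm (F n)" by (simp add: f_def B_lin norm_cs norm_divide)
    also have "\<dots> \<le> inverse (real (Suc n))" using F(2)[of n] Fpos[of n]
      by (simp add: field_simps)
    finally show ?thesis .
  qed
  have B0: "(\<lambda>n. norm (B \<mu> (f n))) \<longlonglongrightarrow> 0"
    by (rule tendsto_sandwich[OF _ _ tendsto_const LIMSEQ_inverse_real_of_nat]) (auto intro!: always_eventually Bf[unfolded of_nat_Suc])
  define M where "M = 2 + \<bar>Re \<mu>\<bar> * (2 / \<bar>Im \<mu>\<bar>)"
  have Hf: "\<bar>H (f n) \<bullet> f n\<bar> \<le> M * norm (B \<mu> (f n))" for n
  proof -
    define w where "w = cip (B \<mu> (f n)) (f n)"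
    define s where "s = sg (f n) \<bullet> f n"
    have w: "w = of_real (H (f n) \<bullet> f n) - \<mu> * of_real s"
      by (simp add: w_def B_def cip_add cip_cs_left cip_H_real cip_sg_real s_def)
    have wn: "cmod w \<le> 2 * norm (B \<mu> (f n))" using norm_cip[of "B \<mu> (f n)" "f n"] by (simp add: w_def f1)
    have "Im w = - (Im \<mu> * s)" "Re w = H (f n) \<bullet> f n - Re \<mu> * s" by (simp_all add: w)
    then have "\<bar>Im \<mu>\<bar> * \<bar>s\<bar> \<le> 2 * norm (B \<mu> (f n))" "\<bar>H (f n) \<bullet> f n\<bar> \<le> 2 * norm (B \<mu> (f n)) + \<bar>Re \<mu>\<bar> * \<bar>s\<bar>"
      using abs_Im_le_cmod[of w] abs_Re_le_cmod[of w] wn abs_mult[of "Im \<mu>" s] abs_mult[of "Re \<mu>" s] by linarith+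
    moreover have "\<bar>s\<bar> \<le> 2 / \<bar>Im \<mu>\<bar> * norm (B \<mu> (f n))"
      using calculation(1) mu by (simp add: field_simps)
    ultimately show ?thesis
      using mult_left_mono[of "\<bar>s\<bar>" "2 / \<bar>Im \<mu>\<bar> * norm (B \<mu> (f n))" "\<bar>Re \<mu>\<bar>"] by (simp add: M_def distrib_right)
  qed
  have "\<forall>n. \<exists>c1 c2 y. f n = y + (cs c1 n1 + cs c2 n2) \<and> vl y NN = 0 \<and> sect \<omega> y \<and> cmod c1 \<le> K \<and> cmod c2 \<le> K"
    using dec[OF fs] by (simp add: f1)
  then obtain c1 c2 y where d: "\<And>n. f n = y n + (cs (c1 n) n1 + cs (c2 n) n2)" "\<And>n. vl (y n) NN = 0"
      "\<And>n. sect \<omega> (y n)" "\<And>n. cmod (c1 n) \<le> K" "\<And>n. cmod (c2 n) \<le> K" by metis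
  define r where "r n = (M + 4 * K * L) * norm (B \<mu> (f n))" for n
  have r0: "r \<longlonglongrightarrow> 0" unfolding r_def[abs_def] using tendsto_mult_right_zero[OF B0] by simp
  define k1 k2 where "k1 = - (H n1 \<bullet> n1)" and "k2 = - (H n2 \<bullet> n2)"
  have k: "k1 \<ge> 0" "k2 > 0" using gram by (auto simp: k1_def k2_def)
  have main: "(norm (y n))\<^sup>2 / 2 + (cmod (c1 n))\<^sup>2 * k1 + (cmod (c2 n))\<^sup>2 * k2 \<le> r n" for n
  proof -
    define w where "w = cs (c1 n) n1 + cs (c2 n) n2"
    have g21: "cip (H n2) n1 = 0" using gram(1) cip_H[of n1 n2] cip_commute[of "H n2" n1] by simp
    have "H w \<bullet> w = Re (cip (H w) w)" by simp
    also have "cip (H w) w = c1 n * cnj (c1 n) * cip (H n1) n1 + c2 n * cnj (c2 n) * cip (H n2) n2"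
      by (simp add: w_def Hl.add H_cs cip_add cip_add_right cip_cs_left cip_cs_right gram(1) g21 algebra_simps)
    finally have Hw: "H w \<bullet> w = - ((cmod (c1 n))\<^sup>2 * k1 + (cmod (c2 n))\<^sup>2 * k2)"
      by (simp add: cip_H_real complex_norm_square[symmetric] k1_def k2_def)
    have y: "y n = f n - w" using d(1)[of n] by (simp add: w_def)
    have "H (y n) \<bullet> y n = H (f n) \<bullet> f n - 2 * (H (f n) \<bullet> w) + H w \<bullet> w"
      unfolding y by (simp add: Hl.diff inner_diff_left inner_diff_right H_sym[of w "f n"] inner_commute[of w])
    moreover have "\<bar>H (f n) \<bullet> w\<bar> \<le> 2 * K * L * norm (B \<mu> (f n))"
    proof -
      have "\<bar>H (f n) \<bullet> w\<bar> \<le> cmod (cip (H (f n)) w)" using abs_Re_le_cmod[of "cip (H (f n)) w"] by simp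
      also have "\<dots> \<le> cmod (c1 n) * cmod (cip (H (f n)) n1) + cmod (c2 n) * cmod (cip (H (f n)) n2)"
        by (simp add: w_def cip_add_right cip_cs_right) (metis complex_mod_cnj norm_mult norm_triangle_ineq)
      also have "\<dots> \<le> K * (L * norm (B \<mu> (f n))) + K * (L * norm (B \<mu> (f n)))"
        using app[OF fs] d(4,5)[of n] by (intro add_mono mult_mono) (auto intro: order_trans[OF norm_ge_zero])
      finally show ?thesis by simp
    qed
    ultimately show ?thesis using H_pos[OF d(3,2), of n] Hf[of n] Hw by (simp add: r_def distrib_right)
  qed
  have sq0: "g \<longlonglongrightarrow> 0" if "\<And>n. (g n)\<^sup>2 * q \<le> r n" "q > 0" for g :: "nat \<Rightarrow> real" and q
  proof -
    have "(\<lambda>n. (g n)\<^sup>2) \<longlonglongrightarrow> 0"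
    proof (rule tendsto_sandwich[where f="\<lambda>_. 0" and h="\<lambda>n. r n / q"])
      show "(\<lambda>n. r n / q) \<longlonglongrightarrow> 0" using tendsto_divide_zero[OF r0] by simp
      show "\<forall>\<^sub>F n in sequentially. (g n)\<^sup>2 \<le> r n / q" using that by (auto simp: field_simps intro!: always_eventually)
    qed auto
    then have "(\<lambda>n. sqrt ((g n)\<^sup>2)) \<longlonglongrightarrow> sqrt 0" by (rule tendsto_real_sqrt)
    then show ?thesis by (simp add: tendsto_rabs_zero_iff)
  qed
  have y0: "(\<lambda>n. norm (y n)) \<longlonglongrightarrow> 0"
  proof (rule sq0[where q="1/2"])
    fix n show "(norm (y n))\<^sup>2 * (1/2) \<le> r n"
      using main[of n] mult_nonneg_nonneg[OF zero_le_power2[of "cmod (c1 n)"] k(1)]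
        mult_nonneg_nonneg[OF zero_le_power2[of "cmod (c2 n)"] less_imp_le[OF k(2)]] by linarith
  qed simp
  have c20: "(\<lambda>n. cmod (c2 n)) \<longlonglongrightarrow> 0"
  proof (rule sq0[where q=k2])
    fix n show "(cmod (c2 n))\<^sup>2 * k2 \<le> r n"
      using main[of n] k mult_nonneg_nonneg[OF zero_le_power2[of "cmod (c1 n)"] k(1)]
        zero_le_power2[of "norm (y n)"] by linarith
  qed (rule k)
  have c10: "(\<lambda>n. cmod (c1 n) * norm n1) \<longlonglongrightarrow> 0"
  proof (cases "H n1 = 0")
    case False
    then have k1: "k1 > 0" using gram(3) by (simp add: k1_def)
    have "(\<lambda>n. cmod (c1 n)) \<longlonglongrightarrow> 0"
    proof (rule sq0[where q=k1])
      fix n show "(cmod (c1 n))\<^sup>2 * k1 \<le> r n"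
        using main[of n] mult_nonneg_nonneg[OF zero_le_power2[of "cmod (c2 n)"] less_imp_le[OF k(2)]]
          zero_le_power2[of "norm (y n)"] by linarith
    qed (rule k1)
    then show ?thesis by (rule tendsto_mult_left_zero)
  next
    case True
    interpret Bl: bounded_linear "B \<mu>" by (rule B_bounded_linear)
    obtain b where b: "\<And>x. norm (B \<mu> x) \<le> norm x * b" using Bl.bounded by blast
    have mu0: "cmod \<mu> > 0" using mu by auto
    have le: "cmod (c1 n) * norm n1 \<le> (norm (B \<mu> (f n)) + (norm (y n) + cmod (c2 n) * norm n2) * \<bar>b\<bar>) / cmod \<mu>" for n
    proof -
      define g where "g = y n + cs (c2 n) n2"
      have "f n = g + cs (c1 n) n1" using d(1)[of n] by (simp add: g_def)
      then have "B \<mu> (f n) - B \<mu> g = cs (c1 n) (B \<mu> n1)" by (simp add: B_lin)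
      also have "norm \<dots> = cmod (c1 n) * (cmod \<mu> * norm n1)" by (simp add: norm_cs B_def True)
      finally have "cmod (c1 n) * (cmod \<mu> * norm n1) \<le> norm (B \<mu> (f n)) + norm (B \<mu> g)"
        by (metis norm_triangle_ineq4)
      also have "norm (B \<mu> g) \<le> norm g * \<bar>b\<bar>" using mult_left_mono[OF abs_ge_self[of b] norm_ge_zero[of g]] b[of g] by linarith
      also have "norm g * \<bar>b\<bar> \<le> (norm (y n) + cmod (c2 n) * norm n2) * \<bar>b\<bar>"
        unfolding g_def by (intro mult_right_mono norm_triangle_le) (simp_all add: norm_cs)
      finally show ?thesis using mu0 by (simp add: field_simps)
    qed
    have "(\<lambda>n. (norm (B \<mu> (f n)) + (norm (y n) + cmod (c2 n) * norm n2) * \<bar>b\<bar>) / cmod \<mu>) \<longlonglongrightarrow> (0 + (0 + 0 * norm n2) * \<bar>b\<bar>) / cmod \<mu>"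
      using mu0 by (intro tendsto_intros B0 y0 c20) auto
    then have lim: "(\<lambda>n. (norm (B \<mu> (f n)) + (norm (y n) + cmod (c2 n) * norm n2) * \<bar>b\<bar>) / cmod \<mu>) \<longlonglongrightarrow> 0" by simp
    show ?thesis
      by (rule tendsto_sandwich[OF _ _ tendsto_const lim]; rule always_eventually) (simp, use le in blast)
  qed
  have "(\<lambda>n. norm (y n) + (cmod (c1 n) * norm n1 + cmod (c2 n) * norm n2)) \<longlonglongrightarrow> 0 + (0 + 0 * norm n2)"
    by (intro tendsto_intros y0 c10 c20)
  moreover have "1 \<le> norm (y n) + (cmod (c1 n) * norm n1 + cmod (c2 n) * norm n2)" for n
  proof -
    have "norm (f n) \<le> norm (y n) + (norm (cs (c1 n) n1) + norm (cs (c2 n) n2))"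
      unfolding d(1)[of n] by (metis norm_triangle_le norm_triangle_ineq add_left_mono)
    then show ?thesis by (simp add: f1 norm_cs)
  qed
  ultimately have "1 \<le> (0::real)" by (intro LIMSEQ_le_const) auto
  then show False by simp
qed

text \<open>
  Two conditions at one node are solved with two vectors: \<open>n1\<close> adjusts the projection coefficient, \<open>d\<close> the remaining component.
\<close>

lemma dec_basis:
  assumes "sect \<omega> n1" "sect \<omega> d" "pc n1 = 1" "pc d = 0" "al d \<noteq> 0"
  shows "\<exists>K. \<forall>f. sect \<omega> f \<longrightarrow> (\<exists>s t y. f = y + (cs s n1 + cs t d) \<and> vl y NN = 0 \<and> sect \<omega> y \<and>
      cmod s \<le> K * norm f \<and> cmod t \<le> K * norm f)"
proof -
  define k where "k = 1 / cmod (u NN)"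
  define K where "K = k + (k + k * cmod (al n1)) / cmod (al d)"
  have k: "k \<ge> 0" by (simp add: k_def)
  have "\<exists>s t y. f = y + (cs s n1 + cs t d) \<and> vl y NN = 0 \<and> sect \<omega> y \<and> cmod s \<le> K * norm f \<and> cmod t \<le> K * norm f"
    if f: "sect \<omega> f" for f
  proof -
    define s where "s = pc f"
    define t where "t = (al f - s * al n1) / al d"
    define y where "y = f - (cs s n1 + cs t d)"
    have "al y = 0" using assms(5) by (simp add: y_def al_lin t_def)
    moreover have "pc y = 0" by (simp add: y_def al_lin assms s_def)
    ultimately have "al y = 0" "be y = 0" by (simp_all add: pc_def)
    then have 1: "vl y NN = 0" using uN by (simp add: al_def be_def prod_eq_iff)
    have 2: "sect \<omega> y" by (simp add: y_def R.diff R.add Rop_cs assms f cs_linear cs_cs mult.commute)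
    have s: "cmod s \<le> k * norm f" using al_le(2)[of f] by (simp add: s_def k_def)
    have "cmod (al f - s * al n1) \<le> k * norm f + (k * norm f) * cmod (al n1)"
      using al_le(1)[of f] mult_right_mono[OF s, of "cmod (al n1)"] norm_triangle_ineq4[of "al f" "s * al n1"]
      by (simp add: norm_mult k_def)
    then have t: "cmod t \<le> (k * norm f + (k * norm f) * cmod (al n1)) / cmod (al d)"
      unfolding t_def norm_divide by (rule divide_right_mono) simp
    have "(k + k * cmod (al n1)) / cmod (al d) * norm f \<ge> 0" using k by simp
    then have "cmod s \<le> K * norm f" using s by (simp add: K_def distrib_right)
    moreover have "cmod t \<le> K * norm f"
    proof -
      have "(k * norm f + (k * norm f) * cmod (al n1)) / cmod (al d) = (k + k * cmod (al n1)) / cmod (al d) * norm f"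
        by (simp add: distrib_left mult_ac)
      note t[unfolded this]
      then show ?thesis using mult_nonneg_nonneg[OF k norm_ge_zero[of f]] unfolding K_def distrib_right[of k] by linarith
    qed
    ultimately show ?thesis using 1 2 by (intro exI[of _ s] exI[of _ t] exI[of _ y]) (simp add: y_def)
  qed
  then show ?thesis by blast
qed

text \<open>
  Here \<open>n1, n2\<close> are the eigenvectors for the two real zeros. They are orthogonal for both forms because
  their eigenvalues differ, and \<open>H\<close> is negative on them; if their difference vanished at the node \<open>NN\<close>, it would violate \<open>H_pos\<close>.
\<close>

lemma nonreal_two_roots:
  assumes w: "\<omega>^4 = 1" and p0: "p \<omega> 0 < 0" and mu: "Im \<mu> \<noteq> 0"
  shows "\<exists>K. \<forall>f. sect \<omega> f \<longrightarrow> norm f \<le> K * norm (B \<mu> f)"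
proof -
  interpret rp: reg_pencil T0 sg E "ev \<omega>" \<eta> by (rule reg[OF w])
  obtain m1 m2 where m: "-1/60 < m1" "m1 < 0" "0 < m2" "m2 < 1/60" "p \<omega> m1 = 0" "p \<omega> m2 = 0"
    "D \<omega> m1 m1 < 0" "D \<omega> m2 m2 > 0" using rp.two_roots[OF p0] by metis
  have m4: "\<bar>m1\<bar> \<le> 1/4" "\<bar>m2\<bar> \<le> 1/4" using m by auto
  define n1 n2 where "n1 = psi \<omega> m1" and "n2 = psi \<omega> m2"
  have s: "sect \<omega> n1" "sect \<omega> n2" by (simp_all only: n1_def n2_def sect_psi[OF w] m4)
  have pcs: "pc n1 = 1" "pc n2 = 1" using m pc_psi[OF w m4(1)] pc_psi[OF w m4(2)] by (simp_all add: n1_def n2_def)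
  have Hn: "H n1 = m1 *\<^sub>R sg n1" "H n2 = m2 *\<^sub>R sg n2"
    using m eig[OF w m4(1)] eig[OF w m4(2)] by (simp_all add: n1_def n2_def)
  have cipR: "cip (r *\<^sub>R f) g = of_real r * cip f g" "cip f (r *\<^sub>R g) = of_real r * cip f g" for r f g
    using cip_cs_left[of "of_real r"] cip_cs_right[of _ "of_real r"] by (simp_all add: cs_of_real)
  have "of_real m1 * cip (sg n1) n2 = of_real m2 * cip (sg n1) n2"
    using cip_H[of n1 n2] by (simp add: Hn cipR cip_sg)
  then have x: "cip (sg n1) n2 = 0" using m by auto
  then have g12: "cip (H n1) n2 = 0" by (simp add: Hn cipR)
  have neg: "H n1 \<bullet> n1 < 0" "H n2 \<bullet> n2 < 0"
  proof -
    have "sg n1 \<bullet> n1 = - D \<omega> m1 m1 * rp.N" "sg n2 \<bullet> n2 = - D \<omega> m2 m2 * rp.N"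
      using rp.N_pos by (simp_all add: n1_def n2_def rp.D_def)
    then have "H n1 \<bullet> n1 = - (m1 * D \<omega> m1 m1 * rp.N)" "H n2 \<bullet> n2 = - (m2 * D \<omega> m2 m2 * rp.N)"
      by (simp_all add: Hn)
    moreover have "m1 * D \<omega> m1 m1 * rp.N > 0" "m2 * D \<omega> m2 m2 * rp.N > 0"
      by (intro mult_pos_pos[OF mult_neg_neg[OF m(2) m(7)] rp.N_pos] mult_pos_pos[OF mult_pos_pos[OF m(3) m(8)] rp.N_pos])+
    ultimately show "H n1 \<bullet> n1 < 0" "H n2 \<bullet> n2 < 0" by linarith+
  qed
  define d where "d = n1 - n2"
  have sd: "sect \<omega> d" by (simp add: d_def R.diff s cs_linear)
  have pd: "pc d = 0" by (simp add: d_def al_lin pcs)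
  have "al d \<noteq> 0"
  proof
    assume "al d = 0"
    then have "al d = 0" "be d = 0" using pd by (simp_all add: pc_def)
    then have "vl d NN = 0" using uN by (simp add: al_def be_def prod_eq_iff)
    from H_pos[OF sd this] have "H d \<bullet> d \<ge> 0" using zero_le_power2[of "norm d"] by linarith
    moreover have "H n1 \<bullet> n2 = 0" using arg_cong[OF g12, of Re] by simp
    then have "H d \<bullet> d = H n1 \<bullet> n1 + H n2 \<bullet> n2"
      using H_sym[of n2 n1] by (simp add: d_def Hl.diff inner_diff_left inner_diff_right inner_commute)
    ultimately show False using neg by simp
  qed
  then obtain K where K: "\<And>f. sect \<omega> f \<Longrightarrow> \<exists>s t y. f = y + (cs s n1 + cs t d) \<and> vl y NN = 0 \<and> sect \<omega> y \<and>
      cmod s \<le> K * norm f \<and> cmod t \<le> K * norm f"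
    using dec_basis[OF s(1) sd pcs(1) pd] by metis
  have app: "cmod (cip (H f) n) \<le> \<bar>m\<bar> * (2 * norm n) / cmod (of_real m - \<mu>) * norm (B \<mu> f)"
    if "H n = m *\<^sub>R sg n" for f n m
  proof -
    have "cip (B \<mu> f) n = (of_real m - \<mu>) * cip (sg f) n"
      using that cip_H[of f n] by (simp add: B_def cip_add cip_cs_left cipR cip_sg algebra_simps)
    moreover have nz: "of_real m - \<mu> \<noteq> 0" using mu by (auto simp: complex_eq_iff)
    ultimately have "cip (sg f) n = cip (B \<mu> f) n / (of_real m - \<mu>)" by simp
    moreover have "cip (H f) n = of_real m * cip (sg f) n" using that cip_H[of f n] by (simp add: cipR cip_sg)
    ultimately have "cmod (cip (H f) n) = \<bar>m\<bar> * (cmod (cip (B \<mu> f) n) / cmod (of_real m - \<mu>))"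
      by (simp add: norm_mult norm_divide)
    also have "\<dots> \<le> \<bar>m\<bar> * (2 * (norm (B \<mu> f) * norm n) / cmod (of_real m - \<mu>))"
      by (intro mult_left_mono divide_right_mono norm_cip) auto
    finally show ?thesis by (simp add: mult_ac)
  qed
  define L where "L = \<bar>m1\<bar> * (2 * norm n1) / cmod (of_real m1 - \<mu>) + \<bar>m2\<bar> * (2 * norm n2) / cmod (of_real m2 - \<mu>)"
  show ?thesis
  proof (rule index_bound[OF mu _ _ g12 neg(2)])
    show "H n1 \<bullet> n1 < 0 \<or> H n1 = 0" using neg by blast
    fix f assume f: "sect \<omega> f"
    have nn: "0 \<le> \<bar>m\<bar> * (2 * norm n) / cmod (of_real m - \<mu>) * norm (B \<mu> f)" for m n by simp
    have L: "L * norm (B \<mu> f) = \<bar>m1\<bar> * (2 * norm n1) / cmod (of_real m1 - \<mu>) * norm (B \<mu> f)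
        + \<bar>m2\<bar> * (2 * norm n2) / cmod (of_real m2 - \<mu>) * norm (B \<mu> f)" by (simp add: L_def distrib_right)
    show "cmod (cip (H f) n1) \<le> L * norm (B \<mu> f) \<and> cmod (cip (H f) n2) \<le> L * norm (B \<mu> f)"
      using app[OF Hn(1), of f] app[OF Hn(2), of f] nn[of m1 n1] nn[of m2 n2] unfolding L by linarith
    obtain s t y where y: "f = y + (cs s n1 + cs t d)" "vl y NN = 0" "sect \<omega> y" "cmod s \<le> K * norm f" "cmod t \<le> K * norm f"
      using K[OF f] by blast
    have "cs s n1 + cs t d = cs (s + t) n1 + cs (- t) n2"
      by (rule hil_eqI) (simp add: d_def algebra_simps)
    moreover have "cmod (s + t) \<le> 2 * K * norm f" using y(4,5) norm_triangle_ineq[of s t] by simp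
    moreover have "cmod (- t) \<le> 2 * K * norm f" using y(5) order_trans[OF norm_ge_zero y(5)] unfolding norm_minus_cancel mult.assoc by linarith
    ultimately show "\<exists>c1 c2 y. f = y + (cs c1 n1 + cs c2 n2) \<and> vl y NN = 0 \<and> sect \<omega> y \<and>
      cmod c1 \<le> 2 * K * norm f \<and> cmod c2 \<le> 2 * K * norm f" using y by metis
  qed
qed

text \<open>
  The gauge mode, the derivative of \<open>exp (\<i>\<alpha>) u\<close> with respect to \<open>\<alpha>\<close>.
\<close>

definition "ga = Abs_hil (\<lambda>x. (\<i> * u x, - \<i> * cnj (u x)))"

lemma vl_ga: "vl ga x = (\<i> * u x, - \<i> * cnj (u x))"
proof -
  have "(\<lambda>x. (\<i> * u x, - \<i> * cnj (u x))) \<in> ell2"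
  proof (rule ell2_le[OF ell, of _ 2])
    show "norm (\<i> * u x, - \<i> * cnj (u x)) \<le> 2 * norm (u x)" for x
      using norm_pair_le_sum[of "(\<i> * u x, - \<i> * cnj (u x))"] by (simp add: norm_mult)
  qed
  then show ?thesis by (simp add: ga_def Abs_hil_inverse)
qed

lemma H_ga: "H ga = 0"
proof (rule hil_eqI)
  fix x
  have st: "of_real (1 - (cmod (u x))\<^sup>2) * u x = of_real \<epsilon> * nbr_sum u x" using stat unfolding stationary_def by blast
  have c: "u x * cnj (u x) = of_real ((cmod (u x))\<^sup>2)" by (metis complex_norm_square of_real_power)
  have f: "fst (vl (H ga) x) = 0"
  proof -
    have "fst (vl (H ga) x) = \<i> * (of_real (1 - 2 * (cmod (u x))\<^sup>2) * u x + u x * (u x * cnj (u x)) - of_real \<epsilon> * nbr_sum u x)"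
      by (simp add: vl_H hloc_def vl_ga nbr_sum_moves power2_eq_square scaleR_conv_of_real algebra_simps)
    also have "\<dots> = 0" unfolding st[symmetric] c by (simp add: algebra_simps)
    finally show ?thesis .
  qed
  have "snd (vl (H ga) x) = cnj (fst (vl (H ga) x))"
    by (simp add: vl_H hloc_def vl_ga scaleR_conv_of_real algebra_simps)
  then show "vl (H ga) x = vl 0 x" using f by (simp add: prod_eq_iff)
qed

lemma sect_ga: "sect 1 ga" by (rule hil_eqI) (simp add: vl_Rop vl_ga rot)
lemma pc_ga: "pc ga = 1" using uN by (simp add: pc_def al_def be_def vl_ga)
lemma ga_nz: "ga \<noteq> 0" using pc_ga by (auto simp: pc_def al_def be_def)

lemma psi_ga: "psi 1 0 = ga"
proof -
  have "T 0 ga = ev 1" by (simp add: T_eq T0_def H_ga P_sect[OF one4 sect_ga] pc_ga)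
  then show ?thesis unfolding psi_eq[OF one4] by (metis GTs abs_zero zero_le_divide_1_iff zero_le_numeral)
qed

lemma p_one_0: "p 1 0 = 0" using pc_psi[OF one4, of 0] by (simp add: psi_ga pc_ga)

lemma sg_ga_ga: "sg ga \<bullet> ga = 0"
proof -
  have "vl (sg ga) x \<bullet> vl ga x = 0" for x
    using power2_norm_eq_inner[of "\<i> * u x"] power2_norm_eq_inner[of "- \<i> * cnj (u x)"]
    by (simp add: vl_ga inner_prod_def norm_mult)
  then show ?thesis by (simp add: inner_hil_def)
qed

lemma D_one_0: "D 1 0 0 = 0"
  unfolding reg_pencil.D_def[OF reg[OF one4]] psi_ga sg_ga_ga by simp

text \<open>The second vector of the Jordan chain at \<open>0\<close>, over the gauge mode.\<close>

definition "xi = G 0 (sg ga)"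

lemma sect_xi: "sect 1 xi" by (simp add: xi_def Rop_G Rop_sg sect_ga)

lemma pc_xi: "pc xi = 0"
proof -
  have "cip (Pop u xi) (ev 1) = cip xi (ev 1)" using cip_sym[OF Pop_sym Pop_cs, of u xi "ev 1"] by (simp add: P_ev)
  also have "\<dots> = cip (sg ga) (G 0 (ev 1))" unfolding xi_def by (rule cip_sym[OF G_syms G_cs]) simp_all
  also have "G 0 (ev 1) = ga" using psi_ga by (simp add: psi_eq[OF one4])
  also have "cip (sg ga) ga = 0" by (simp add: cip_sg_real sg_ga_ga)
  finally have "pc xi * cip (ev 1) (ev 1) = 0" by (simp add: P_sect[OF one4 sect_xi] cip_cs_left)
  moreover have "cip (ev 1) (ev 1) \<noteq> 0" using ev_nz[OF one4] by (simp add: cip_def complex_eq_iff)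
  ultimately show ?thesis by simp
qed

lemma H_xi: "H xi = sg ga"
proof -
  have "T 0 xi = sg ga" by (simp add: xi_def TGs)
  then show ?thesis by (simp add: T_eq T0_def P_sect[OF one4 sect_xi] pc_xi)
qed

text \<open>
  The form at \<open>xi\<close> is \<open>-Q 0 0 0\<close> up to a positive factor, and \<open>Q\<close> is positive.
\<close>

lemma xi_neg: "H xi \<bullet> xi < 0"
proof -
  interpret rp: reg_pencil T0 sg E "ev 1" \<eta> by (rule reg[OF one4])
  have "rp.Q 0 0 0 \<ge> 1/4" by (rule rp.Q_ge) auto
  moreover have "H xi \<bullet> xi = - rp.Q 0 0 0 * rp.N" unfolding H_xi using rp.N_pos by (simp add: xi_def rp.Q_def psi_ga)
  ultimately show ?thesis using rp.N_pos by (simp add: mult_less_0_iff)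
qed

text \<open>
  In the gauge sector the gauge mode, which is in the kernel of \<open>H\<close>, and \<open>xi\<close> play the roles of \<open>n1\<close> and \<open>n2\<close>.
\<close>

lemma nonreal_one:
  assumes mu: "Im \<mu> \<noteq> 0"
  shows "\<exists>K. \<forall>f. sect 1 f \<longrightarrow> norm f \<le> K * norm (B \<mu> f)"
proof -
  have mu0: "\<mu> \<noteq> 0" using mu by auto
  have "al xi \<noteq> 0"
  proof
    assume "al xi = 0"
    then have "al xi = 0" "be xi = 0" using pc_xi by (simp_all add: pc_def)
    then have "vl xi NN = 0" using uN by (simp add: al_def be_def prod_eq_iff)
    from H_pos[OF sect_xi this] show False using xi_neg zero_le_power2[of "norm xi"] by linarith
  qed
  then obtain K where K: "\<And>f. sect 1 f \<Longrightarrow> \<exists>s t y. f = y + (cs s ga + cs t xi) \<and> vl y NN = 0 \<and> sect 1 y \<and>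
      cmod s \<le> K * norm f \<and> cmod t \<le> K * norm f"
    using dec_basis[OF sect_ga sect_xi pc_ga pc_xi] by metis
  define L where "L = 2 * norm ga / cmod \<mu>"
  show ?thesis
  proof (rule index_bound[OF mu K _ _ xi_neg])
    show "cip (H ga) xi = 0" "H ga \<bullet> ga < 0 \<or> H ga = 0" by (simp_all add: H_ga)
    fix f assume f: "sect 1 f"
    have 1: "cip (H f) ga = 0" by (simp add: cip_H H_ga)
    then have "cip (B \<mu> f) ga = - \<mu> * cip (sg f) ga" by (simp add: B_def cip_add cip_cs_left)
    then have "cip (sg f) ga = - cip (B \<mu> f) ga / \<mu>" using mu0 by simp
    moreover have "cip (H f) xi = cip (sg f) ga" by (simp add: cip_H H_xi cip_sg)
    ultimately have "cmod (cip (H f) xi) = cmod (cip (B \<mu> f) ga) / cmod \<mu>" by (simp add: norm_divide)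
    also have "\<dots> \<le> 2 * (norm (B \<mu> f) * norm ga) / cmod \<mu>" by (intro divide_right_mono norm_cip) auto
    finally show "cmod (cip (H f) ga) \<le> L * norm (B \<mu> f) \<and> cmod (cip (H f) xi) \<le> L * norm (B \<mu> f)"
      by (simp add: 1 L_def mult_ac)
  qed
qed

lemma Cop_T0: "T0 (Cop f) = Cop (T0 f)"
  by (rule hil_eqI) (simp add: T0_def vl_H vl_Pop hloc_def ploc_def vl_Cop prod_eq_iff zero_prod_def scaleR_conv_of_real algebra_simps)

lemma Cop_ev: assumes "\<omega>^4 = 1" shows "Cop (ev \<omega>) = ev (cnj \<omega>)"
proof (rule hil_eqI)
  have c: "(cnj \<omega>)^4 = 1" using arg_cong[OF assms, of cnj] by simp
  fix x
  have "cnj (wt \<omega> x) = wt (cnj \<omega>) x" by (simp add: wt_def)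
  then show "vl (Cop (ev \<omega>)) x = vl (ev (cnj \<omega>)) x" by (simp add: vl_Cop vl_ev[OF assms] vl_ev[OF c])
qed

text \<open>
  Conjugation exchanges the sectors \<open>\<omega>\<close> and \<open>cnj \<omega>\<close> and reverses \<open>\<sigma>\<close>.
\<close>

lemma p_conj: assumes "\<omega>^4 = 1" "\<bar>m\<bar> \<le> 1/4" shows "p (cnj \<omega>) (- m) = p \<omega> m"
proof -
  have c: "(cnj \<omega>)^4 = 1" using arg_cong[OF assms(1), of cnj] by simp
  have m: "\<bar>- m\<bar> \<le> 1/4" using assms by simp
  have "T (- m) (Cop (psi \<omega> m)) = Cop (T m (psi \<omega> m))"
    by (simp add: T_eq Cop_T0 Cop_linear Cop_sg)
  also have "\<dots> = ev (cnj \<omega>)" by (simp add: reg_pencil.T_psi[OF reg[OF assms(1)] assms(2)] Cop_ev[OF assms(1)])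
  finally have "Cop (psi \<omega> m) = psi (cnj \<omega>) (- m)" unfolding psi_eq[OF c] by (metis GTs m)
  then have "psi (cnj \<omega>) (- m) \<bullet> ev (cnj \<omega>) = psi \<omega> m \<bullet> ev \<omega>" by (metis Cop_ev[OF assms(1)] Cop_inner)
  moreover have "norm (ev (cnj \<omega>)) = norm (ev \<omega>)" by (metis Cop_ev[OF assms(1)] Cop_inner norm_eq_sqrt_inner)
  ultimately show ?thesis by (simp add: reg_pencil.p_def[OF reg[OF c]] reg_pencil.p_def[OF reg[OF assms(1)]]
    reg_pencil.N_def[OF reg[OF c]] reg_pencil.N_def[OF reg[OF assms(1)]])
qed

end

section \<open>Multiplicities, Krein signature and spectrum\<close>

lemma spinor_dim_eq:
  assumes "spinor.independent S" shows "spinor.dim (spinor.span S) = card S"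
  using spinor.dim_eq_card_independent[OF assms] by (simp add: spinor.dim_span)

lemma vl_Abs: "\<phi> \<in> ell2 \<Longrightarrow> vl (Abs_hil \<phi>) = \<phi>" by (rule Abs_hil_inverse)

lemma collect_ell2: "{\<phi> \<in> ell2. P \<phi>} = vl ` {f. P (vl f)}"
proof -
  have "ell2 = range vl" by (rule type_definition.Rep_range[OF type_definition_hil, symmetric])
  then show ?thesis by auto
qed

lemma vl_eq_iff: "vl f = vl g \<longleftrightarrow> f = g" by (rule vl_inject)

lemma vl_0: "vl 0 = 0" by (rule ext) simp

lemma vl_cscale: "vl (cs c f) = cscale c (vl f)" by (rule ext) (simp add: cscale_def)

lemma vl_pauli: "vl (sg f) = pauli (vl f)" by (rule ext) (simp add: pauli_def)

lemma vl_minus: "vl (f - g) = vl f - vl g" by (rule ext) simp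

lemma vl_plus: "vl (f + g) = vl f + vl g" by (rule ext) simp

context cross
begin

lemma vl_hess: "vl (H f) = hess \<epsilon> u (vl f)" by (rule vl_Hop_hess[OF u_le])

lemma vl_lin: "vl (cs (- \<i>) (sg (H f))) = lin_op \<epsilon> u (vl f)"
  by (simp add: lin_op_def vl_cscale vl_pauli vl_hess)

definition "Lz z f = cs (- \<i>) (sg (B (\<i> * z) f))"

lemma vl_Lz: "vl (Lz z f) = lin_op \<epsilon> u (vl f) - cscale z (vl f)"
proof -
  have "Lz z f = cs (- \<i>) (sg (H f)) - cs z f"
    by (simp add: Lz_def B_def Sg.diff cs_linear sg_cs cs_cs mult.assoc[symmetric])
  then show ?thesis unfolding vl_lin[symmetric] vl_cscale[symmetric] vl_minus[symmetric] by (rule arg_cong)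
qed

lemma norm_Lz: "norm (Lz z f) = norm (B (\<i> * z) f)" by (simp add: Lz_def norm_cs)

lemma Lz_inv: "Lz z f = g \<longleftrightarrow> B (\<i> * z) f = cs \<i> (sg g)"
proof -
  have "cs \<i> (sg (Lz z f)) = B (\<i> * z) f" by (simp add: Lz_def sg_cs cs_cs)
  moreover have "cs (- \<i>) (sg (cs \<i> (sg g))) = g" by (simp add: sg_cs cs_cs)
  ultimately show ?thesis unfolding Lz_def by auto
qed

lemma eigenspace_eq: "eigenspace (lin_op \<epsilon> u) z = vl ` {f. B (\<i> * z) f = 0}"
proof -
  have "lin_op \<epsilon> u (vl f) = cscale z (vl f) \<longleftrightarrow> B (\<i> * z) f = 0" for f
  proof -
    have "lin_op \<epsilon> u (vl f) = cscale z (vl f) \<longleftrightarrow> vl (Lz z f) = 0" by (simp add: vl_Lz)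
    also have "\<dots> \<longleftrightarrow> Lz z f = 0" by (metis vl_0 vl_eq_iff)
    also have "\<dots> \<longleftrightarrow> B (\<i> * z) f = 0" by (metis norm_Lz norm_eq_zero)
    finally show ?thesis .
  qed
  then show ?thesis unfolding eigenspace_def collect_ell2 by simp
qed

lemma Lz_pow: "((\<lambda>\<psi>. lin_op \<epsilon> u \<psi> - cscale z \<psi>) ^^ k) (vl f) = vl ((Lz z ^^ k) f)"
  by (induction k) (simp_all add: vl_Lz)

lemma gen_eigenspace_eq: "gen_eigenspace (lin_op \<epsilon> u) z = vl ` {f. \<exists>k. (Lz z ^^ k) f = 0}"
proof -
  have "(\<exists>k. ((\<lambda>\<psi>. lin_op \<epsilon> u \<psi> - cscale z \<psi>) ^^ k) (vl f) = 0) \<longleftrightarrow> (\<exists>k. (Lz z ^^ k) f = 0)" for f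
    unfolding Lz_pow by (metis vl_0 vl_eq_iff)
  then show ?thesis unfolding gen_eigenspace_def collect_ell2 by simp
qed

text \<open>
  An element of the kernel has its projections to the four sectors in the kernel; only the sector with \<open>p \<omega> m = 0\<close> can contribute, and there \<open>sect_solve\<close> leaves the multiples of \<open>\<psi>\<close>.
\<close>

lemma kernel_one:
  assumes w: "\<omega> \<in> roots4" and m: "\<bar>m\<bar> \<le> 1/60" and p0: "p \<omega> m = 0"
    and other: "\<And>\<omega>'. \<omega>' \<in> roots4 \<Longrightarrow> \<omega>' \<noteq> \<omega> \<Longrightarrow> p \<omega>' m \<noteq> 0"
  shows "B (of_real m) f = 0 \<longleftrightarrow> (\<exists>c. f = cs c (psi \<omega> m))"
proof
  have m4: "\<bar>m\<bar> \<le> 1/4" using m by simp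
  assume f: "B (of_real m) f = 0"
  have G0: "G m 0 = 0" using G_lins(3)[OF m4, of 0 0] by simp
  have pr: "Pr \<omega>' f = cs (pc (Pr \<omega>' f)) (psi \<omega>' m)" "pc (Pr \<omega>' f) * of_real (p \<omega>' m) = 0" if "\<omega>' \<in> roots4" for \<omega>'
  proof -
    interpret Bl: bounded_linear "B (of_real m)" by (rule B_bounded_linear)
    have "B (of_real m) (Pr \<omega>' f) = 0" unfolding B_Pr f by (simp add: Pr_def R.zero) (rule hil_eqI, simp add: zero_prod_def)
    then show "Pr \<omega>' f = cs (pc (Pr \<omega>' f)) (psi \<omega>' m)" "pc (Pr \<omega>' f) * of_real (p \<omega>' m) = 0"
      using sect_solve[OF roots4[OF that] m Pr_sect[OF roots4[OF that]], of f] by (simp_all add: G0 al_lin pc_def al_def be_def)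
  qed
  have z: "Pr \<omega>' f = 0" if "\<omega>' \<in> roots4" "\<omega>' \<noteq> \<omega>" for \<omega>'
    using pr[OF that(1)] other[OF that] by simp
  have sum: "Pr 1 f + Pr \<i> f + Pr (-1) f + Pr (-\<i>) f = f" by (rule Pr_sum[symmetric])
  consider "\<omega> = 1" | "\<omega> = \<i>" | "\<omega> = -1" | "\<omega> = -\<i>" using w by blast
  then have "f = Pr \<omega> f"
  proof cases
    case 1
    then have "Pr \<i> f = 0" "Pr (-1) f = 0" "Pr (-\<i>) f = 0" by (auto intro!: z simp: complex_eq_iff)
    then show ?thesis using sum unfolding 1 by (simp only: add_0_right add_0_left)
  next
    case 2
    then have "Pr 1 f = 0" "Pr (-1) f = 0" "Pr (-\<i>) f = 0" by (auto intro!: z simp: complex_eq_iff)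
    then show ?thesis using sum unfolding 2 by (simp only: add_0_right add_0_left)
  next
    case 3
    then have "Pr 1 f = 0" "Pr \<i> f = 0" "Pr (-\<i>) f = 0" by (auto intro!: z simp: complex_eq_iff)
    then show ?thesis using sum unfolding 3 by (simp only: add_0_right add_0_left)
  next
    case 4
    then have "Pr 1 f = 0" "Pr \<i> f = 0" "Pr (-1) f = 0" by (auto intro!: z simp: complex_eq_iff)
    then show ?thesis using sum unfolding 4 by (simp only: add_0_right add_0_left)
  qed
  then show "\<exists>c. f = cs c (psi \<omega> m)" using pr(1)[OF w] by metis
next
  have m4: "\<bar>m\<bar> \<le> 1/4" using m by simp
  assume "\<exists>c. f = cs c (psi \<omega> m)"
  then obtain c where f: "f = cs c (psi \<omega> m)" by blast
  show "B (of_real m) f = 0" unfolding f B_lin B_real eig[OF roots4[OF w] m4] p0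
    by (rule hil_eqI) (simp add: zero_prod_def)
qed

lemma psi_nz: assumes "\<omega> \<in> roots4" "\<bar>m\<bar> \<le> 1/60" "p \<omega> m = 0" shows "psi \<omega> m \<noteq> 0"
proof
  assume "psi \<omega> m = 0"
  then have "pc (psi \<omega> m) = 0" by (simp add: pc_def al_def be_def)
  then show False using pc_psi[OF roots4[OF assms(1)], of m] assms by simp
qed

lemma dim_one: assumes "f \<noteq> 0" shows "spinor.dim (vl ` {g. \<exists>c. g = cs c f}) = 1"
proof -
  have "vl ` {g. \<exists>c. g = cs c f} = spinor.span {vl f}"
    by (auto simp: spinor.span_singleton vl_cscale[symmetric])
  moreover have "vl f \<noteq> 0" using assms by (metis vl_0 vl_eq_iff)
  then have "spinor.independent {vl f}" by (simp add: spinor.independent_insert)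
  ultimately show ?thesis using spinor_dim_eq[of "{vl f}"] by simp
qed

text \<open>
  The form at the eigenvector is \<open>m (\<sigma>\<psi>, \<psi>)\<close>, that is \<open>-m D m m\<close> up to a positive factor. Since \<open>(\<sigma>\<psi>, \<psi>) \<noteq> 0\<close>, the
  equation for a further Jordan vector is not solvable, so the eigenvalue is algebraically simple.
\<close>

lemma simple_negative:
  assumes w: "\<omega> \<in> roots4" and m: "\<bar>m\<bar> \<le> 1/60" and p0: "p \<omega> m = 0"
    and other: "\<And>\<omega>'. \<omega>' \<in> roots4 \<Longrightarrow> \<omega>' \<noteq> \<omega> \<Longrightarrow> p \<omega>' m \<noteq> 0" and D: "m * D \<omega> m m > 0"
  shows "negative_krein \<epsilon> u (- \<i> * of_real m)"
proof -
  interpret rp: reg_pencil T0 sg E "ev \<omega>" \<eta> by (rule reg[OF roots4[OF w]])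
  have m4: "\<bar>m\<bar> \<le> 1/4" using m by simp
  define z where "z = - \<i> * complex_of_real m"
  have iz: "\<i> * z = of_real m" by (simp add: z_def)
  define n where "n = psi \<omega> m"
  have n0: "n \<noteq> 0" unfolding n_def by (rule psi_nz[OF w m p0])
  have ker: "B (of_real m) f = 0 \<longleftrightarrow> (\<exists>c. f = cs c n)" for f unfolding n_def by (rule kernel_one[OF w m p0 other])
  have sn: "m * (sg n \<bullet> n) < 0"
  proof -
    have "m * (sg n \<bullet> n) = - (m * D \<omega> m m * rp.N)" using rp.N_pos by (simp add: n_def rp.D_def)
    then show ?thesis using mult_pos_pos[OF D rp.N_pos] by simp
  qed
  have Hn: "H n = m *\<^sub>R sg n" using eig[OF roots4[OF w] m4] p0 by (simp add: n_def)
  have bn: "B (of_real m) n = 0" using ker[of n] by (metis cs_1)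
  have step: "Lz z f = 0" if "Lz z (Lz z f) = 0" for f
  proof -
    have "B (of_real m) (Lz z f) = 0" using that norm_Lz[of z "Lz z f"] by (simp add: iz)
    then obtain c where c: "Lz z f = cs c n" using ker by blast
    then have Bf: "B (of_real m) f = cs (\<i> * c) (sg n)" unfolding Lz_inv iz by (simp add: sg_cs cs_cs)
    have "cip (B (of_real m) f) n = cip f (B (of_real m) n)"
      unfolding B_real by (rule cip_sym)
        (simp_all add: inner_diff_left inner_diff_right H_sym sg_sym H_cs sg_cs cs_linear cs_scaleR)
    then have "\<i> * c * of_real (sg n \<bullet> n) = 0" by (simp add: Bf bn cip_cs_left cip_sg_real)
    then have "c = 0" using sn by auto
    then show ?thesis using c by simp
  qed
  have "(Lz z ^^ k) f = 0 \<Longrightarrow> Lz z f = 0" for k f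
  proof (induction k arbitrary: f)
    case 0
    then have "Lz z f = cs 0 (Lz z f)" unfolding Lz_def by (simp add: B_def Hl.zero Sg.zero) (rule hil_eqI, simp add: zero_prod_def)
    then show ?case by simp
  next
    case (Suc k)
    then have "(Lz z ^^ k) (Lz z f) = 0" by (simp add: funpow_swap1)
    then show ?case using Suc.IH step by blast
  qed
  then have "{f. \<exists>k. (Lz z ^^ k) f = 0} = {f. B (of_real m) f = 0}"
  proof -
    have "Lz z f = 0 \<longleftrightarrow> B (of_real m) f = 0" for f using norm_Lz[of z f] by (metis iz norm_eq_zero)
    moreover have "Lz z f = 0 \<Longrightarrow> (Lz z ^^ 1) f = 0" for f by simp
    ultimately show ?thesis using \<open>\<And>k f. (Lz z ^^ k) f = 0 \<Longrightarrow> Lz z f = 0\<close> by blast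
  qed
  then have gen: "gen_eigenspace (lin_op \<epsilon> u) z = vl ` {f. \<exists>c. f = cs c n}" unfolding gen_eigenspace_eq by (simp add: ker)
  have eig: "eigenspace (lin_op \<epsilon> u) z = vl ` {f. \<exists>c. f = cs c n}" unfolding eigenspace_eq iz by (simp add: ker)
  have simple: "simple_eigenvalue (lin_op \<epsilon> u) z"
    unfolding simple_eigenvalue_def
  proof
    have "vl n \<in> eigenspace (lin_op \<epsilon> u) z" unfolding eig by (auto intro!: exI[of _ 1])
    moreover have "vl n \<noteq> 0" using n0 by (metis vl_0 vl_eq_iff)
    ultimately show "\<exists>\<phi>\<in>eigenspace (lin_op \<epsilon> u) z. \<phi> \<noteq> 0" by blast
    show "alg_mult (lin_op \<epsilon> u) z = 1" unfolding alg_mult_def gen by (rule dim_one[OF n0])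
  qed
  have kr: "Re (ell2_inner (hess \<epsilon> u \<phi>) \<phi>) < 0" if phi: "\<phi> \<in> eigenspace (lin_op \<epsilon> u) z" "\<phi> \<noteq> 0" for \<phi>
  proof -
    obtain c where c: "\<phi> = vl (cs c n)" using phi(1) unfolding eig by blast
    have c0: "c \<noteq> 0" using phi(2) unfolding c by (metis cs_0 vl_0)
    define f where "f = cs c n"
    have "Re (ell2_inner (hess \<epsilon> u \<phi>) \<phi>) = H f \<bullet> f"
    proof -
      define g where "g = (\<lambda>x. fst (vl (H f) x) * cnj (fst (vl f x)) + snd (vl (H f) x) * cnj (snd (vl f x)))"
      have re: "Re (g x) = vl (H f) x \<bullet> vl f x" for x by (simp add: g_def inner_prod_def inner_complex_def)
      have im: "Im (g x) = vl (H f) x \<bullet> vl (cs \<i> f) x" for x by (simp add: g_def inner_prod_def inner_complex_def algebra_simps)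
      have s1: "(\<lambda>x. complex_of_real (Re (g x))) summable_on UNIV" and s2: "(\<lambda>x. complex_of_real (Im (g x))) summable_on UNIV"
        unfolding re im by (intro summable_on_of_real summable_rep)+
      have "g = (\<lambda>x. of_real (Re (g x)) + \<i> * of_real (Im (g x)))" by (rule ext) (simp add: complex_eq)
      then have gs: "g summable_on UNIV"
        using summable_on_add[OF s1 summable_on_cmult_right[OF s2, of \<i>]] by simp
      have "Re (\<Sum>\<^sub>\<infinity>x. g x) = (\<Sum>\<^sub>\<infinity>x. Re (g x))" by (rule infsum_Re[OF gs, symmetric])
      then show ?thesis unfolding re
        by (simp add: ell2_inner_def c f_def[symmetric] vl_hess[symmetric] g_def inner_hil_def)
    qed
    also have "H f \<bullet> f = (cmod c)\<^sup>2 * (H n \<bullet> n)"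
    proof -
      have "H f \<bullet> f = Re (cip (H f) f)" by simp
      also have "cip (H f) f = c * cnj c * cip (H n) n" by (simp add: f_def H_cs cip_cs_left cip_cs_right)
      also have "\<dots> = of_real ((cmod c)\<^sup>2 * (H n \<bullet> n))" by (simp add: cip_H_real complex_norm_square[symmetric])
      finally show ?thesis by simp
    qed
    also have "\<dots> < 0" using c0 sn by (simp add: Hn mult_less_0_iff)
    finally show ?thesis .
  qed
  show ?thesis unfolding negative_krein_def z_def[symmetric] using simple kr by blast
qed

text \<open>
  The kernel is spanned by the gauge mode and the chain continues with \<open>xi\<close>. It stops there: a third vector would require
  \<open>\<sigma> xi\<close> to be orthogonal to the gauge mode, but \<open>(\<sigma> xi, ga) = (xi, H xi) < 0\<close>.
\<close>

lemma zero_mult: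
  assumes other: "\<And>\<omega>. \<omega> \<in> roots4 \<Longrightarrow> \<omega> \<noteq> 1 \<Longrightarrow> p \<omega> 0 \<noteq> 0"
  shows "geom_mult (lin_op \<epsilon> u) 0 = 1" "alg_mult (lin_op \<epsilon> u) 0 = 2"
proof -
  have ker: "B 0 f = 0 \<longleftrightarrow> (\<exists>c. f = cs c ga)" for f
    using kernel_one[of 1 0 f] other p_one_0 by (simp add: psi_ga)
  have "eigenspace (lin_op \<epsilon> u) 0 = vl ` {f. \<exists>c. f = cs c ga}" unfolding eigenspace_eq by (simp add: ker)
  then show "geom_mult (lin_op \<epsilon> u) 0 = 1" unfolding geom_mult_def using dim_one[OF ga_nz] by simp
  define V where "V = {f. \<exists>a b. f = cs a ga + cs b xi}"
  have B0: "B 0 f = H f" for f by (simp add: B_def)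
  have L: "Lz 0 f = cs (- \<i>) (sg (H f))" for f by (simp add: Lz_def B0)
  have xineg: "cip xi (sg ga) \<noteq> 0"
  proof
    assume "cip xi (sg ga) = 0"
    then have "Re (cip xi (sg ga)) = 0" by simp
    then show False using xi_neg by (simp add: H_xi inner_commute)
  qed
  have pull: "g \<in> V" if gV: "Lz 0 g \<in> V" for g
  proof -
    obtain a b where "Lz 0 g = cs a ga + cs b xi" using gV by (auto simp: V_def)
    then have "B (\<i> * 0) g = cs \<i> (sg (cs a ga + cs b xi))" unfolding Lz_inv .
    then have Hg: "H g = cs (\<i> * a) (sg ga) + cs (\<i> * b) (sg xi)" by (simp add: B0 Sg.add sg_cs cs_linear cs_cs)
    have "cip (H g) ga = 0" by (simp add: cip_H H_ga)
    then have "\<i> * b * cip xi (sg ga) = 0" by (simp add: Hg cip_add cip_cs_left cip_sg_real sg_ga_ga) (simp add: cip_sg)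
    then have "b = 0" using xineg by simp
    then have "H (g - cs (\<i> * a) xi) = 0" by (simp add: Hl.diff H_cs H_xi Hg)
    then obtain c where "g - cs (\<i> * a) xi = cs c ga" using ker by (auto simp: B0)
    then have "g = cs c ga + cs (\<i> * a) xi" by (simp add: algebra_simps)
    then show ?thesis unfolding V_def by blast
  qed
  have "(Lz 0 ^^ k) f = 0 \<Longrightarrow> f \<in> V" for k f
  proof (induction k arbitrary: f)
    case 0
    then have "f = cs 0 ga + cs 0 xi" by simp
    then show ?case unfolding V_def by blast
  next
    case (Suc k)
    then have "(Lz 0 ^^ k) (Lz 0 f) = 0" by (simp add: funpow_swap1)
    then show ?case using Suc.IH pull by blast
  qed
  moreover have "(Lz 0 ^^ 2) f = 0" if fV: "f \<in> V" for f
  proof -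
    obtain a b where f: "f = cs a ga + cs b xi" using fV by (auto simp: V_def)
    have "H f = cs b (sg ga)" unfolding f by (simp add: Hl.add H_cs H_ga H_xi) (rule hil_eqI, simp add: zero_prod_def)
    then have "Lz 0 f = cs (- \<i> * b) ga" by (simp add: L sg_cs cs_cs)
    then have "H (Lz 0 f) = 0" by (simp add: H_cs H_ga) (rule hil_eqI, simp add: zero_prod_def)
    then show ?thesis by (simp add: numeral_2_eq_2 L[of "Lz 0 f"] Sg.zero) (rule hil_eqI, simp add: zero_prod_def)
  qed
  ultimately have "{f. \<exists>k. (Lz 0 ^^ k) f = 0} = V" by blast
  then have "gen_eigenspace (lin_op \<epsilon> u) 0 = vl ` V" by (simp add: gen_eigenspace_eq)
  also have "\<dots> = spinor.span {vl ga, vl xi}"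
    by (auto simp: V_def spinor.span_insert spinor.span_singleton vl_cscale vl_plus image_iff algebra_simps)
      (metis add_diff_cancel_left' add.commute diff_add_cancel vl_cscale vl_plus)+
  finally have gen: "gen_eigenspace (lin_op \<epsilon> u) 0 = spinor.span {vl ga, vl xi}" .
  have nin: "vl xi \<notin> spinor.span {vl ga}"
  proof
    assume "vl xi \<in> spinor.span {vl ga}"
    then obtain c where "vl xi = vl (cs c ga)" by (auto simp: spinor.span_singleton vl_cscale)
    then have "xi = cs c ga" by (simp add: vl_eq_iff)
    then have "H xi = 0" by (simp add: H_cs H_ga) (rule hil_eqI, simp add: zero_prod_def)
    then show False using xi_neg by simp
  qed
  have "vl ga \<noteq> 0" using ga_nz by (metis vl_0 vl_eq_iff)
  then have "spinor.independent {vl xi, vl ga}" using nin by (simp add: spinor.independent_insert)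
  moreover have "card {vl xi, vl ga} = 2" using nin spinor.span_base[of "vl ga" "{vl ga}"] by (auto simp: card_insert_if)
  ultimately show "alg_mult (lin_op \<epsilon> u) 0 = 2"
    unfolding alg_mult_def gen using spinor_dim_eq[of "{vl xi, vl ga}"] by (simp add: insert_commute)
qed

text \<open>The adjoint problem has the conjugate parameter, so surjectivity comes from the second bound.\<close>

lemma not_in_spectrum:
  assumes "\<exists>K. \<forall>f. norm f \<le> K * norm (B (\<i> * z) f)" "\<exists>K. \<forall>f. norm f \<le> K * norm (B (cnj (\<i> * z)) f)"
  shows "z \<notin> spectrum (lin_op \<epsilon> u)"
proof -
  obtain K where K: "\<And>f. norm f \<le> K * norm (B (\<i> * z) f)" using assms(1) by blast
  obtain K' where K': "\<And>f. norm f \<le> K' * norm (B (cnj (\<i> * z)) f)" using assms(2) by blast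
  have adj: "B (\<i> * z) f \<bullet> g = f \<bullet> B (cnj (\<i> * z)) g" for f g
    by (simp only: B_def inner_diff_left inner_diff_right H_sym cs_adj sg_sym sg_cs)
  have sj: "surj (B (\<i> * z))"
    by (rule surj_of_adjoint_bounded_below[OF B_bounded_linear B_bounded_linear adj K'])
  define T where "T = (\<lambda>\<phi>. lin_op \<epsilon> u \<phi> - cscale z \<phi>)"
  have T: "T (vl f) = vl (Lz z f)" for f by (simp add: T_def vl_Lz)
  have "bij_betw T ell2 ell2"
    unfolding bij_betw_def
  proof
    show "inj_on T ell2"
    proof (rule inj_onI)
      fix a b assume ab: "a \<in> ell2" "b \<in> ell2" "T a = T b"
      define f g where "f = Abs_hil a" and "g = Abs_hil b"
      have fg: "a = vl f" "b = vl g" using ab by (simp_all add: f_def g_def vl_Abs)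
      have "Lz z f = Lz z g" using ab(3) by (simp add: fg T vl_eq_iff)
      then have "B (\<i> * z) f = B (\<i> * z) g" using Lz_inv by metis
      then have "B (\<i> * z) (f - g) = 0" by (simp add: B_lin)
      then show "a = b" using K[of "f - g"] by (simp add: fg)
    qed
    show "T ` ell2 = ell2"
    proof
      show "T ` ell2 \<subseteq> ell2"
      proof
        fix y assume "y \<in> T ` ell2"
        then obtain a where "a \<in> ell2" "y = T a" by blast
        then have "y = vl (Lz z (Abs_hil a))" using T[of "Abs_hil a"] by (simp add: vl_Abs)
        then show "y \<in> ell2" by simp
      qed
      show "ell2 \<subseteq> T ` ell2"
      proof
        fix y :: "(int \<times> int) spinor" assume y: "y \<in> ell2"
        obtain f where "B (\<i> * z) f = cs \<i> (sg (Abs_hil y))" using sj by (metis surj_def)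
        then have "Lz z f = Abs_hil y" by (simp add: Lz_inv)
        then have "y = T (vl f)" by (simp add: T vl_Abs y)
        then show "y \<in> T ` ell2" by simp
      qed
    qed
  qed
  moreover have "\<forall>\<phi>\<in>ell2. ell2_norm \<phi> \<le> K * ell2_norm (T \<phi>)"
  proof
    fix a :: "(int \<times> int) spinor" assume a: "a \<in> ell2"
    have "ell2_norm (vl (Abs_hil a)) \<le> K * ell2_norm (T (vl (Abs_hil a)))"
      using K[of "Abs_hil a"] unfolding T norm_hil_ell2_norm[symmetric] norm_Lz .
    then show "ell2_norm a \<le> K * ell2_norm (T a)" by (simp add: vl_Abs a)
  qed
  ultimately show ?thesis unfolding spectrum_def T_def by blast
qed

lemma spectrum_outside:
  assumes p0: "p \<i> 0 < 0" "p (-1) 0 < 0"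
    and z: "z \<in> spectrum (lin_op \<epsilon> u)"
    and roots: "\<And>m \<omega>. \<bar>m\<bar> < 1/60 \<Longrightarrow> z = - \<i> * of_real m \<Longrightarrow> \<omega> \<in> roots4 \<Longrightarrow> p \<omega> m \<noteq> 0"
  shows "1/60 \<le> cmod z \<and> Re z = 0"
proof -
  have pmi: "p (- \<i>) 0 < 0" using p_conj[of \<i> 0] p0 by simp
  have nonreal: "\<exists>K. \<forall>f. norm f \<le> K * norm (B \<mu> f)" if mu: "Im \<mu> \<noteq> 0" for \<mu>
  proof (rule sect_combine)
    fix \<omega> assume "\<omega> \<in> roots4"
    then consider "\<omega> = 1" | "\<omega>^4 = 1" "p \<omega> 0 < 0" using p0 pmi by auto
    then show "\<exists>K. \<forall>f. sect \<omega> f \<longrightarrow> norm f \<le> K * norm (B \<mu> f)"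
      by cases (use nonreal_one[OF mu] nonreal_two_roots[OF _ _ mu] in auto)
  qed
  have re: "Re z = 0"
  proof (rule ccontr)
    assume "Re z \<noteq> 0"
    then have "Im (\<i> * z) \<noteq> 0" "Im (cnj (\<i> * z)) \<noteq> 0" by simp_all
    then show False using not_in_spectrum[OF nonreal nonreal] z by blast
  qed
  moreover have "1/60 \<le> cmod z"
  proof (rule ccontr)
    assume "\<not> 1/60 \<le> cmod z"
    then have small: "cmod z < 1/60" by simp
    define m where "m = - Im z"
    have m: "\<i> * z = of_real m" "z = - \<i> * of_real m" using re by (simp_all add: m_def complex_eq_iff)
    have "\<bar>m\<bar> < 1/60" using small abs_Im_le_cmod[of z] by (simp add: m_def)
    then have "\<exists>K. \<forall>f. norm f \<le> K * norm (B (of_real m) f)"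
      using roots[OF _ m(2)] by (intro real_bounded_below) auto
    then show False using not_in_spectrum[of z] z unfolding m(1) complex_cnj_complex_of_real by blast
  qed
  ultimately show ?thesis by blast
qed

text \<open>
  The sector \<open>-\<i>\<close> contributes the negatives of the zeros \<open>a, b\<close> of the sector \<open>\<i>\<close>, and the sector \<open>-1\<close> the pair
  \<open>c, -c\<close>. The hypothesis \<open>simple\<close> makes these six numbers distinct.
\<close>

lemma spectral_picture:
  assumes p0: "p \<i> 0 < 0" "p (-1) 0 < 0"
    and simple: "\<And>m. \<bar>m\<bar> \<le> 1/60 \<Longrightarrow> m \<noteq> 0 \<Longrightarrow> p \<i> m = 0 \<Longrightarrow> p \<i> (- m) \<noteq> 0 \<and> p (-1) m \<noteq> 0"
  obtains a b c where "a < 0" "0 < b" "0 < c" "\<bar>a\<bar> \<le> 1/60" "\<bar>b\<bar> \<le> 1/60" "\<bar>c\<bar> \<le> 1/60"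
    "p \<i> a = 0" "p \<i> b = 0" "p (-1) c = 0" "distinct [a, -a, b, -b, c, -c]"
    "\<And>m. m \<in> {a, -a, b, -b, c, -c} \<Longrightarrow> negative_krein \<epsilon> u (- \<i> * of_real m)"
    "\<And>z. z \<in> spectrum (lin_op \<epsilon> u) \<Longrightarrow> z \<noteq> 0 \<Longrightarrow> z \<notin> (\<lambda>m. - \<i> * of_real m) ` {a, -a, b, -b, c, -c}
       \<Longrightarrow> 1/60 \<le> cmod z \<and> Re z = 0"
    "alg_mult (lin_op \<epsilon> u) 0 = 2" "geom_mult (lin_op \<epsilon> u) 0 = 1"
proof -
  interpret ri: reg_pencil T0 sg E "ev \<i>" \<eta> by (rule reg) simp
  interpret rm: reg_pencil T0 sg E "ev (-1)" \<eta> by (rule reg) simp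
  interpret r1: reg_pencil T0 sg E "ev 1" \<eta> by (rule reg) simp
  interpret rj: reg_pencil T0 sg E "ev (-\<i>)" \<eta> by (rule reg) simp
  have cm: "p (-1) (- m) = p (-1) m" if "\<bar>m\<bar> \<le> 1/60" for m using p_conj[of "-1" m] that by simp
  have ci: "p (- \<i>) m = p \<i> (- m)" if "\<bar>m\<bar> \<le> 1/60" for m using p_conj[of "\<i>" "- m"] that by simp
  have pj: "p (- \<i>) 0 < 0" using ci[of 0] p0 by simp
  obtain a b where ab: "-1/60 < a" "a < 0" "0 < b" "b < 1/60" "p \<i> a = 0" "p \<i> b = 0"
    "\<And>m. \<bar>m\<bar> \<le> 1/60 \<Longrightarrow> p \<i> m = 0 \<Longrightarrow> m = a \<or> m = b" "D \<i> a a < 0" "D \<i> b b > 0"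
    by (rule ri.two_roots[OF p0(1)], rule that; (assumption | blast))
  obtain c' c where c: "-1/60 < c'" "c' < 0" "0 < c" "c < 1/60" "p (-1) c' = 0" "p (-1) c = 0"
    "\<And>m. \<bar>m\<bar> \<le> 1/60 \<Longrightarrow> p (-1) m = 0 \<Longrightarrow> m = c' \<or> m = c" "D (-1) c' c' < 0" "D (-1) c c > 0"
    by (rule rm.two_roots[OF p0(2)], rule that; (assumption | blast))
  obtain a' b' where ab': "-1/60 < a'" "a' < 0" "0 < b'" "b' < 1/60" "p (-\<i>) a' = 0" "p (-\<i>) b' = 0"
    "\<And>m. \<bar>m\<bar> \<le> 1/60 \<Longrightarrow> p (-\<i>) m = 0 \<Longrightarrow> m = a' \<or> m = b'" "D (-\<i>) a' a' < 0" "D (-\<i>) b' b' > 0"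
    by (rule rj.two_roots[OF pj], rule that; (assumption | blast))
  have "c' = - c" using c(7)[of "- c"] cm[of c] c by auto
  note c = c[unfolded this]
  have "b' = - a" using ab'(7)[of "- a"] ci[of "- a"] ab ab' by auto
  moreover have "a' = - b" using ab'(7)[of "- b"] ci[of "- b"] ab ab' by auto
  ultimately have ab'': "p (-\<i>) (- b) = 0" "p (-\<i>) (- a) = 0" "D (-\<i>) (-b) (-b) < 0" "D (-\<i>) (-a) (-a) > 0"
    "\<And>m. \<bar>m\<bar> \<le> 1/60 \<Longrightarrow> p (-\<i>) m = 0 \<Longrightarrow> m = - b \<or> m = - a"
    using ab' by auto
  have p1: "m = 0" if "\<bar>m\<bar> \<le> 1/60" "p 1 m = 0" for m
    using r1.double_root[OF p_one_0 D_one_0 that] .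
  have sa: "p \<i> (- a) \<noteq> 0" "p (-1) a \<noteq> 0" and sb: "p \<i> (- b) \<noteq> 0" "p (-1) b \<noteq> 0"
    using simple[of a] simple[of b] ab by auto
  have dist: "distinct [a, -a, b, -b, c, -c]"
    using ab c sa sb cm[of c] by auto
  have neg: "negative_krein \<epsilon> u (- \<i> * of_real m)" if m: "m \<in> {a, -a, b, -b, c, -c}" for m
  proof -
    have n: "m \<noteq> 0" "\<bar>m\<bar> \<le> 1/60" using m ab c by auto
    have q1: "p 1 m \<noteq> 0" using p1[of m] n by blast
    consider "m = a \<or> m = b" | "m = - a \<or> m = - b" | "m = c \<or> m = - c" using m by blast
    then show ?thesis
    proof cases
      case 1
      have "p (- \<i>) m \<noteq> 0" "p (-1) m \<noteq> 0" using 1 sa sb ci[of m] n by auto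
      then show ?thesis using 1 n q1 ab by (intro simple_negative[of \<i>]) (auto intro: mult_neg_neg mult_pos_pos)
    next
      case 2
      have "p \<i> m \<noteq> 0" "p (-1) m \<noteq> 0" using 2 sa sb cm[of a] cm[of b] ab by auto
      then show ?thesis using 2 n q1 ab'' ab by (intro simple_negative[of "-\<i>"]) (auto intro: mult_neg_neg mult_pos_pos)
    next
      case 3
      have "p \<i> m \<noteq> 0" using 3 ab(7)[of m] dist n by auto
      moreover have "p (- \<i>) m \<noteq> 0" using 3 ab''(5)[of m] dist n by auto
      ultimately show ?thesis using 3 n q1 c by (intro simple_negative[of "-1"]) (auto intro: mult_neg_neg mult_pos_pos)
    qed
  qed
  have zm: "alg_mult (lin_op \<epsilon> u) 0 = 2" "geom_mult (lin_op \<epsilon> u) 0 = 1"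
    by (rule zero_mult; use p0 pj in auto)+
  have out: "1/60 \<le> cmod z \<and> Re z = 0"
    if z: "z \<in> spectrum (lin_op \<epsilon> u)" "z \<noteq> 0" "z \<notin> (\<lambda>m. - \<i> * of_real m) ` {a, -a, b, -b, c, -c}" for z
  proof (rule spectrum_outside[OF p0 z(1)])
    fix m \<omega> assume m: "\<bar>m\<bar> < 1/60" "z = - \<i> * of_real m" "\<omega> \<in> roots4"
    have m60: "\<bar>m\<bar> \<le> 1/60" using m by simp
    have "m \<noteq> 0" "m \<notin> {a, -a, b, -b, c, -c}" using z m by auto
    then show "p \<omega> m \<noteq> 0" using m(3) p1[OF m60] ab(7)[OF m60] ab''(5)[OF m60] c(7)[OF m60] by auto
  qed
  show thesis
    by (rule that[of a b c]) (use ab c dist neg zm out in auto)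
qed

end

section \<open>Orders of smallness along a filter\<close>

text \<open>
  Orders of smallness are taken along a filter \<open>F\<close> below \<open>at_right 0\<close> rather than along \<open>at_right 0\<close> itself. Statements of the form
  "for all small \<open>\<epsilon>\<close>" are then proved by contradiction: assume that \<open>F\<close> is concentrated on the exceptional \<open>\<epsilon>\<close>, expand
  there, and conclude that \<open>F\<close> is trivial.
\<close>

definition ord :: "real filter \<Rightarrow> nat \<Rightarrow> (real \<Rightarrow> complex) \<Rightarrow> bool" where
  "ord F k f \<longleftrightarrow> f \<in> O[F](\<lambda>e. of_real (e ^ k))"

locale germ =
  fixes F :: "real filter"
  assumes F: "F \<le> at_right 0"
begin

lemma ev: "eventually P (at_right 0) \<Longrightarrow> eventually P F"
  using F by (rule filter_leD)

lemma ev_small: "eventually (\<lambda>e. 0 < e \<and> e < 1) F"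
  by (rule ev) (auto simp: eventually_at_right_field intro!: exI[of _ 1])

lemma ord_le: assumes "ord F m f" "n \<le> m" shows "ord F n f"
proof -
  have "(\<lambda>e. complex_of_real (e ^ m)) \<in> O[F](\<lambda>e. of_real (e ^ n))"
  proof (rule bigoI[of _ 1])
    show "eventually (\<lambda>e. norm (complex_of_real (e ^ m)) \<le> 1 * norm (complex_of_real (e ^ n))) F"
      using ev_small
    proof eventually_elim
      case (elim e)
      then show ?case using assms(2) by (simp add: norm_power power_decreasing del: of_real_power)
    qed
  qed
  then show ?thesis using assms(1) unfolding ord_def by (rule landau_o.big_trans[rotated])
qed

lemma ord_cong: assumes "ord F k g" "eventually (\<lambda>e. f e = g e) F" shows "ord F k f"
  using assms landau_o.big.in_cong[of f g F] unfolding ord_def by blast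

lemma ord_add: "ord F j f \<Longrightarrow> ord F k g \<Longrightarrow> ord F (min j k) (\<lambda>e. f e + g e)"
  using ord_le[of j f "min j k"] ord_le[of k g "min j k"] sum_in_bigo(1) unfolding ord_def by fastforce

lemma ord_diff: "ord F j f \<Longrightarrow> ord F k g \<Longrightarrow> ord F (min j k) (\<lambda>e. f e - g e)"
  using ord_le[of j f "min j k"] ord_le[of k g "min j k"] sum_in_bigo(2) unfolding ord_def by fastforce

lemma ord_minus: "ord F j f \<Longrightarrow> ord F j (\<lambda>e. - f e)"
  unfolding ord_def by simp

lemma ord_mult: "ord F j f \<Longrightarrow> ord F k g \<Longrightarrow> ord F (j + k) (\<lambda>e. f e * g e)"
  unfolding ord_def power_add of_real_mult by (rule landau_o.big.mult)

lemma ord_const: "ord F 0 (\<lambda>e. c)"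
  unfolding ord_def by simp

lemma ord_power: "ord F j f \<Longrightarrow> ord F (n * j) (\<lambda>e. f e ^ n)"
  by (induction n) (auto simp: ord_const intro: ord_mult)

lemma ord_eps: "ord F 1 (\<lambda>e. of_real e)"
  unfolding ord_def by simp

lemma ord_norm_le: assumes "ord F k g" "eventually (\<lambda>e. norm (f e) \<le> norm (g e)) F" shows "ord F k f"
proof -
  have "f \<in> O[F](g)" using assms(2) by (intro bigoI[of _ 1]) simp
  then show ?thesis using assms(1) unfolding ord_def by (rule landau_o.big_trans)
qed

lemma ord_cnj: assumes "ord F k f" shows "ord F k (\<lambda>e. cnj (f e))"
  by (rule ord_norm_le[OF assms]) simp

lemma ordI: assumes "eventually (\<lambda>e. norm (f e) \<le> C * e ^ k) F" shows "ord F k f"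
  unfolding ord_def
proof (rule bigoI[of _ C])
  show "eventually (\<lambda>e. norm (f e) \<le> C * norm (complex_of_real (e ^ k))) F"
    using assms ev_small by eventually_elim (simp add: norm_power del: of_real_power)
qed

lemma ordD: assumes "ord F k f" obtains C where "C > 0" "eventually (\<lambda>e. norm (f e) \<le> C * e ^ k) F"
proof -
  obtain C where C: "C > 0" "eventually (\<lambda>e. norm (f e) \<le> C * norm (complex_of_real (e ^ k))) F"
    using assms unfolding ord_def by (elim landau_o.bigE)
  have "eventually (\<lambda>e. norm (f e) \<le> C * e ^ k) F"
    using C(2) ev_small by eventually_elim (simp add: norm_power del: of_real_power)
  then show thesis using that C by blast
qed

lemma ord1_small: assumes "ord F 1 f" "q > 0" shows "eventually (\<lambda>e. norm (f e) \<le> q) F"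
proof -
  obtain C where C: "C > 0" "eventually (\<lambda>e. norm (f e) \<le> C * e ^ 1) F" using ordD[OF assms(1)] .
  have "eventually (\<lambda>e. e < q / C) (at_right 0)"
    using C assms(2) by (auto simp: eventually_at_right_field intro!: exI[of _ "q / C"])
  from ev[OF this] C(2) show ?thesis
    by eventually_elim (use C in \<open>auto simp: field_simps\<close>)
qed

lemma ord_inverse: assumes "ord F 1 (\<lambda>e. g e - c)" "c \<noteq> 0"
  shows "ord F 0 (\<lambda>e. inverse (g e))" "eventually (\<lambda>e. g e \<noteq> 0) F"
proof -
  have *: "eventually (\<lambda>e. norm (g e - c) \<le> norm c / 2) F" using assms by (intro ord1_small) auto
  then have b: "eventually (\<lambda>e. norm (g e) \<ge> norm c / 2) F"
  proof eventually_elim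
    case (elim e)
    then show ?case using norm_triangle_ineq2[of c "g e"] by (simp add: norm_minus_commute)
  qed
  then show "eventually (\<lambda>e. g e \<noteq> 0) F" by eventually_elim (use assms(2) in auto)
  show "ord F 0 (\<lambda>e. inverse (g e))"
  proof (rule ordI[of _ "2 / norm c"])
    show "eventually (\<lambda>e. norm (inverse (g e)) \<le> 2 / norm c * e ^ 0) F"
      using b
    proof eventually_elim
      case (elim e)
      then show ?case using le_imp_inverse_le[OF elim] assms(2) by (simp add: norm_inverse)
    qed
  qed
qed

text \<open>Division by a factor that tends to a nonzero constant.\<close>

lemma ord_cancel:
  assumes "ord F k (\<lambda>e. g e * f e)" "ord F 1 (\<lambda>e. g e - c)" "c \<noteq> 0" shows "ord F k f"
proof (rule ord_cong)
  show "ord F k (\<lambda>e. inverse (g e) * (g e * f e))"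
    using ord_mult[OF ord_inverse(1)[OF assms(2,3)] assms(1)] by simp
  show "eventually (\<lambda>e. f e = inverse (g e) * (g e * f e)) F"
    using ord_inverse(2)[OF assms(2,3)] by eventually_elim simp
qed

lemma ord_div_eps: assumes "ord F (k + j) (\<lambda>e. of_real e ^ j * f e)" shows "ord F k f"
proof -
  obtain C where C: "C > 0" "eventually (\<lambda>e. norm (of_real e ^ j * f e) \<le> C * e ^ (k + j)) F"
    using ordD[OF assms] .
  have "eventually (\<lambda>e. norm (f e) \<le> C * e ^ k) F"
    using C(2) ev_small
  proof eventually_elim
    case (elim e)
    then have "e ^ j * norm (f e) \<le> e ^ j * (C * e ^ k)" by (simp add: norm_mult norm_power power_add mult_ac)
    then show ?case using elim by simp
  qed
  then show ?thesis by (rule ordI)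
qed

lemma ord_div: "ord F m (\<lambda>e. of_real e ^ j * f e) \<Longrightarrow> m = k + j \<Longrightarrow> ord F k f"
  using ord_div_eps by simp

lemma not_ord: assumes "F \<noteq> bot" "ord F 1 (\<lambda>e. c)" shows "c = 0"
proof (rule ccontr)
  assume "c \<noteq> 0"
  then have "eventually (\<lambda>e. norm c \<le> norm c / 2) F" using assms(2) by (intro ord1_small) auto
  then have "eventually (\<lambda>e. False) F" by eventually_elim (use \<open>c \<noteq> 0\<close> in auto)
  then show False using assms(1) by (simp add: eventually_False)
qed

lemma ord_ev: assumes "eventually P F" "\<And>e. P e \<Longrightarrow> f e = g e" "ord F k g" shows "ord F k f"
  by (rule ord_cong[OF assms(3) eventually_mono[OF assms(1,2)]])

text \<open>
  These rules compute an order of any expression; \<open>ord_le\<close> then weakens it to the one that is wanted. Known orders of differences are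
  tried before them, so that cancellation is taken into account.
\<close>

lemmas ord_rules = ord_const ord_eps ord_mult ord_add ord_diff ord_minus ord_power ord_cnj

end

section \<open>Families close to the cross at zero coupling\<close>

lemma norm_le_ell2_norm:
  assumes "f \<in> ell2" shows "norm (f x) \<le> ell2_norm f"
proof -
  have s: "(\<lambda>x. (norm (f x))\<^sup>2) summable_on UNIV" using assms by (simp add: ell2_def)
  have "(\<Sum>y\<in>{x}. (norm (f y))\<^sup>2) \<le> (\<Sum>\<^sub>\<infinity>y. (norm (f y))\<^sup>2)"
    by (rule finite_sum_le_infsum[OF s]) auto
  then show ?thesis unfolding ell2_norm_def by (intro real_le_rsqrt) simp
qed

lemma ell2_sum: assumes "\<And>k. c k \<in> ell2" shows "(\<lambda>x. \<Sum>k<N::nat. of_real (r k) * (c k x :: complex)) \<in> ell2"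
proof (induction N)
  case 0
  then show ?case by (simp add: ell2_def)
next
  case (Suc N)
  have "(\<lambda>x. of_real (r N) * c N x) \<in> ell2" by (rule ell2_le[OF assms[of N], of _ "\<bar>r N\<bar>"]) (simp add: norm_mult)
  from ell2_add[OF Suc this] show ?case by simp
qed

definition base :: "int \<times> int \<Rightarrow> complex" where
  "base x = (if x = (-1,0) then 1 else if x = (0,-1) then \<i> else if x = (1,0) then -1 else if x = (0,1) then -\<i> else 0)"

lemma base_rot: "base (rot x) = \<i> * base x"
  by (cases x) (auto simp: base_def rot_def)

text \<open>
  A power series in \<open>\<ell>\<^sup>2\<close> that converges at some positive parameter converges absolutely at smaller ones, so that the difference to its
  constant term is \<open>O(\<epsilon>)\<close>, uniformly in the site. This bound and the equation are the starting point of all expansions.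
\<close>

lemma vortex_cross_near:
  assumes "vortex_cross_family \<Phi>"
  obtains C r where "C > 0" "r > 0" "\<And>\<epsilon> x. 0 < \<epsilon> \<Longrightarrow> \<epsilon> < r \<Longrightarrow> cmod (\<Phi> \<epsilon> x - base x) \<le> C * \<epsilon>"
    "\<And>\<epsilon>. 0 < \<epsilon> \<Longrightarrow> \<epsilon> < r \<Longrightarrow> \<Phi> \<epsilon> \<in> ell2 \<and> stationary \<epsilon> (\<Phi> \<epsilon>)"
proof -
  obtain r c where r: "r > 0" and st: "\<And>\<epsilon>. \<epsilon> \<in> {0..<r} \<Longrightarrow> \<Phi> \<epsilon> \<in> ell2 \<and> stationary \<epsilon> (\<Phi> \<epsilon>)"
    and c: "\<And>k. c k \<in> ell2"
    and lim: "\<And>\<epsilon>. \<epsilon> \<in> {0..<r} \<Longrightarrow> (\<lambda>N. ell2_norm (\<lambda>x. \<Phi> \<epsilon> x - (\<Sum>k<N. of_real (\<epsilon> ^ k) * c k x))) \<longlonglongrightarrow> 0"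
    using assms unfolding vortex_cross_family_def by (elim conjE exE bexE) blast
  have base: "\<Phi> 0 x = base x" for x
  proof -
    have n: "\<Phi> 0 (S0 ! j) = exp (\<i> * of_real pi * of_nat j / 2)" if "j < 4" for j
      using assms that unfolding vortex_cross_family_def by blast
    have z: "x \<notin> set S0 \<Longrightarrow> \<Phi> 0 x = 0"
      using assms unfolding vortex_cross_family_def by blast
    have e1: "exp (\<i> * of_real pi / 2) = \<i>" by (simp add: exp_eq_polar cis.ctr complex_eq_iff cis_pi_half[unfolded cis_conv_exp] flip: cis_conv_exp)
    have e2: "exp (\<i> * of_real pi * 2 / 2) = -1" by simp
    have e3: "exp (\<i> * of_real pi * 3 / 2) = -\<i>"
    proof -
      have "exp (\<i> * of_real pi * 3 / 2) = exp (\<i> * of_real pi / 2) * exp (\<i> * of_real pi)"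
        unfolding exp_add[symmetric] by (simp add: field_simps)
      then show ?thesis by (simp only: e1 exp_pi_i) simp
    qed
    have "\<Phi> 0 (-1,0) = 1" using n[of 0] by (simp add: S0_def)
    moreover have "\<Phi> 0 (0,-1) = \<i>" using n[of 1] e1 by (simp add: S0_def)
    moreover have "\<Phi> 0 (1,0) = -1" using n[of 2] e2 by (simp add: S0_def)
    moreover have "\<Phi> 0 (0,1) = -\<i>" using n[of 3] e3 by (simp add: S0_def)
    ultimately show ?thesis using z by (simp add: base_def set_S0)
  qed
  have ptw: "(\<lambda>N. \<Sum>k<N. of_real (\<epsilon> ^ k) * c k x) \<longlonglongrightarrow> \<Phi> \<epsilon> x" if e: "\<epsilon> \<in> {0..<r}" for \<epsilon> x
  proof -
    have "(\<lambda>x. \<Phi> \<epsilon> x - (\<Sum>k<N. of_real (\<epsilon> ^ k) * c k x)) \<in> ell2" for N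
      using ell2_diff[OF conjunct1[OF st[OF e]] ell2_sum[OF c]] .
    then have le: "norm (\<Phi> \<epsilon> x - (\<Sum>k<N. of_real (\<epsilon> ^ k) * c k x)) \<le> ell2_norm (\<lambda>x. \<Phi> \<epsilon> x - (\<Sum>k<N. of_real (\<epsilon> ^ k) * c k x))" for N
      by (rule norm_le_ell2_norm)
    have "(\<lambda>N. \<Phi> \<epsilon> x - (\<Sum>k<N. of_real (\<epsilon> ^ k) * c k x)) \<longlonglongrightarrow> 0"
      by (rule Lim_null_comparison[OF always_eventually lim[OF e]]) (use le in blast)
    from tendsto_diff[OF tendsto_const[of "\<Phi> \<epsilon> x"] this] show ?thesis by simp
  qed
  have c0: "c 0 x = base x" for x
  proof -
    have "(\<Sum>k<Suc N. of_real (0 ^ k) * c k x) = c 0 x" for N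
      by (induction N) auto
    moreover have "(\<lambda>N. \<Sum>k<Suc N. of_real (0 ^ k) * c k x) \<longlonglongrightarrow> \<Phi> 0 x"
      using ptw[of 0 x] r by (intro filterlim_compose[OF _ filterlim_Suc]) auto
    ultimately have "(\<lambda>N::nat. c 0 x) \<longlonglongrightarrow> \<Phi> 0 x" by (simp only:)
    then show ?thesis using LIMSEQ_unique[OF tendsto_const] base by metis
  qed
  define q where "q = r / 2"
  have q: "q > 0" "q \<in> {0..<r}" using r by (auto simp: q_def)
  obtain M where M: "\<And>N. \<bar>ell2_norm (\<lambda>x. \<Phi> q x - (\<Sum>k<N. of_real (q ^ k) * c k x))\<bar> \<le> M"
    using convergent_imp_Bseq[OF convergentI[OF lim[OF q(2)]]] by (auto simp: Bseq_def)
  have trm: "q ^ k * cmod (c k x) \<le> 2 * M" for k x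
  proof -
    define P where "P N = \<Phi> q x - (\<Sum>k<N. of_real (q ^ k) * c k x)" for N
    have P: "norm (P N) \<le> M" for N
    proof -
      have "(\<lambda>x. \<Phi> q x - (\<Sum>k<N. of_real (q ^ k) * c k x)) \<in> ell2"
        using ell2_diff[OF conjunct1[OF st[OF q(2)]] ell2_sum[OF c]] .
      from norm_le_ell2_norm[OF this, of x] M[of N] show ?thesis unfolding P_def by linarith
    qed
    have "of_real (q ^ k) * c k x = P k - P (Suc k)" by (simp add: P_def)
    then have "norm (of_real (q ^ k) * c k x) \<le> M + M"
      using norm_triangle_ineq4[of "P k" "P (Suc k)"] P[of k] P[of "Suc k"] by (metis add_mono order_trans)
    then show ?thesis using q by (simp add: norm_mult norm_power)
  qed
  have M0: "M \<ge> 0" using M[of 0] by linarith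
  have near: "cmod (\<Phi> \<epsilon> x - base x) \<le> (4 * M / q + 1) * \<epsilon>" if e: "0 < \<epsilon>" "\<epsilon> < q / 2" for \<epsilon> x
  proof -
    have er: "\<epsilon> \<in> {0..<r}" using e q by auto
    define t where "t = \<epsilon> / q"
    have t: "0 < t" "t < 1/2" using e q by (auto simp: t_def field_simps)
    have tk: "cmod (of_real (\<epsilon> ^ k) * c k x) \<le> 2 * M * t ^ k" for k
    proof -
      have "cmod (of_real (\<epsilon> ^ k) * c k x) = t ^ k * (q ^ k * cmod (c k x))"
        using e q by (simp add: norm_mult norm_power t_def power_divide)
      also have "\<dots> \<le> t ^ k * (2 * M)" using t trm by (intro mult_left_mono) auto
      finally show ?thesis by (simp add: mult.commute)
    qed
    have bnd: "norm ((\<Sum>k<Suc N. of_real (\<epsilon> ^ k) * c k x) - base x) \<le> 4 * M * t" for N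
    proof -
      have "(\<Sum>k<Suc N. of_real (\<epsilon> ^ k) * c k x) - base x = (\<Sum>k<N. of_real (\<epsilon> ^ Suc k) * c (Suc k) x)"
        by (subst sum.lessThan_Suc_shift) (simp add: c0)
      also have "norm \<dots> \<le> (\<Sum>k<N. 2 * M * t ^ Suc k)" by (rule order_trans[OF norm_sum sum_mono]) (rule tk)
      also have "\<dots> = 2 * M * t * (\<Sum>k<N. t ^ k)" by (simp add: sum_distrib_left mult_ac)
      also have "\<dots> \<le> 2 * M * t * 2"
      proof (rule mult_left_mono)
        have "(\<Sum>k<N. t ^ k) = (1 - t ^ N) / (1 - t)" using t by (simp add: sum_gp_strict)
        also have "\<dots> \<le> 1 / (1 - t)" using t by (intro divide_right_mono) auto
        also have "\<dots> \<le> 2" using t by (simp add: field_simps)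
        finally show "(\<Sum>k<N. t ^ k) \<le> 2" .
      qed (use M0 t in auto)
      finally show ?thesis by simp
    qed
    have "(\<lambda>N. (\<Sum>k<Suc N. of_real (\<epsilon> ^ k) * c k x) - base x) \<longlonglongrightarrow> \<Phi> \<epsilon> x - base x"
      using filterlim_compose[OF ptw[OF er, of x] filterlim_Suc] by (intro tendsto_intros)
    then have "norm (\<Phi> \<epsilon> x - base x) \<le> 4 * M * t"
      by (intro Lim_norm_ubound[OF sequentially_bot _ always_eventually]) (use bnd in auto)
    also have "\<dots> \<le> (4 * M / q + 1) * \<epsilon>" using e by (simp add: t_def field_simps)
    finally show ?thesis .
  qed
  have "4 * M / q + 1 > 0" using M0 q by (simp add: add_nonneg_pos)
  moreover have "q / 2 > 0" using q by simp
  moreover have "\<Phi> \<epsilon> \<in> ell2 \<and> stationary \<epsilon> (\<Phi> \<epsilon>)" if "0 < \<epsilon>" "\<epsilon> < q / 2" for \<epsilon>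
    using st[of \<epsilon>] that r by (simp add: q_def)
  ultimately show thesis using that near by blast
qed

lemma cube_diff: "v * v * cnj v - u * u * cnj u = (v + u) * cnj v * (v - u) + u * u * cnj (v - u)"
  by (simp add: algebra_simps)

lemma stationary_eq: assumes "stationary \<epsilon> u"
  shows "u x = of_real \<epsilon> * nbr_sum u x + u x * u x * cnj (u x)"
proof -
  have "of_real (1 - (cmod (u x))\<^sup>2) * u x = of_real \<epsilon> * nbr_sum u x" using assms unfolding stationary_def by blast
  moreover have "of_real ((cmod (u x))\<^sup>2) = u x * cnj (u x)" by (metis complex_norm_square of_real_power)
  ultimately show ?thesis by (simp add: algebra_simps)
qed

definition node_dist :: "(int \<times> int \<Rightarrow> complex) \<Rightarrow> (int \<times> int \<Rightarrow> complex) \<Rightarrow> real" where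
  "node_dist u v = (\<Sum>x\<in>set S0. cmod (v x - u x))"

lemma node_le: "x \<in> set S0 \<Longrightarrow> cmod (v x - u x) \<le> node_dist u v"
  unfolding node_dist_def by (rule member_le_sum) auto

lemma base_off: "x \<notin> set S0 \<Longrightarrow> base x = 0"
  by (auto simp: base_def set_S0)

text \<open>
  Away from the nodes the equation reads \<open>u = \<epsilon> nbr_sum u + cubic\<close> and its right-hand side is a contraction there, so the
  difference of two solutions is controlled by its values at the nodes.
\<close>

lemma off_node_dist:
  assumes st: "stationary \<epsilon> u" "stationary \<epsilon> v" and near: "\<And>x. cmod (u x - base x) \<le> C * \<epsilon>" "\<And>x. cmod (v x - base x) \<le> C * \<epsilon>"
    and e: "\<epsilon> > 0" "4 * \<epsilon> + 3 * (C * \<epsilon>)\<^sup>2 \<le> 1/2" and x: "x \<notin> set S0"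
  shows "cmod (v x - u x) \<le> 8 * \<epsilon> * node_dist u v"
proof -
  define d where "d x = v x - u x" for x
  define J where "J = node_dist u v"
  have C: "C * \<epsilon> \<ge> 0" using near(1)[of 0] by (meson norm_ge_zero order_trans)
  have b: "cmod (u x) \<le> C * \<epsilon>" "cmod (v x) \<le> C * \<epsilon>" if "x \<notin> set S0" for x
    using near[of x] base_off[OF that] by auto
  have bdd: "bdd_above ((\<lambda>x. cmod (d x)) ` (- set S0))"
  proof (rule bdd_aboveI2)
    fix x assume "x \<in> - set S0"
    then show "cmod (d x) \<le> C * \<epsilon> + C * \<epsilon>"
      unfolding d_def using b[of x] norm_triangle_ineq4[of "v x" "u x"] by auto
  qed
  define K where "K = (SUP x\<in>- set S0. cmod (d x))"
  have K: "cmod (d x) \<le> K" if "x \<notin> set S0" for x unfolding K_def using that by (intro cSUP_upper bdd) auto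
  have J0: "J \<ge> 0" unfolding J_def node_dist_def by (simp add: sum_nonneg)
  have K0: "K \<ge> 0" by (rule order_trans[OF norm_ge_zero K[of "(0,0)"]]) (simp add: set_S0)
  have all: "cmod (d y) \<le> J + K" for y
    using K[of y] node_le[of y v u] J0 K0 unfolding J_def d_def by (cases "y \<in> set S0") auto
  have "cmod (d x) \<le> 4 * \<epsilon> * (J + K) + 3 * (C * \<epsilon>)\<^sup>2 * K" if x: "x \<notin> set S0" for x
  proof -
    have "d x = of_real \<epsilon> * nbr_sum d x + (v x * v x * cnj (v x) - u x * u x * cnj (u x))"
      using stationary_eq[OF st(1), of x] stationary_eq[OF st(2), of x]
      by (simp add: d_def nbr_sum_moves algebra_simps)
    also have "\<dots> = of_real \<epsilon> * nbr_sum d x + ((v x + u x) * cnj (v x) * d x + u x * u x * cnj (d x))"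
      by (simp only: cube_diff d_def)
    also have "cmod \<dots> \<le> cmod (of_real \<epsilon> * nbr_sum d x) + (cmod ((v x + u x) * cnj (v x) * d x) + cmod (u x * u x * cnj (d x)))"
      by (meson norm_triangle_ineq norm_triangle_le add_left_mono order_trans)
    also have "\<dots> \<le> \<epsilon> * (4 * (J + K)) + ((C * \<epsilon> + C * \<epsilon>) * (C * \<epsilon>) * K + (C * \<epsilon>) * (C * \<epsilon>) * K)"
    proof (intro add_mono)
      have "cmod (nbr_sum d x) \<le> cmod (d (east x)) + cmod (d (west x)) + cmod (d (north x)) + cmod (d (south x))"
        unfolding nbr_sum_moves by (intro norm_triangle_le add_mono norm_triangle_ineq order_refl)
      also have "\<dots> \<le> (J + K) + (J + K) + (J + K) + (J + K)" by (intro add_mono all)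
      finally have "cmod (nbr_sum d x) \<le> 4 * (J + K)" by simp
      then show "cmod (of_real \<epsilon> * nbr_sum d x) \<le> \<epsilon> * (4 * (J + K))" using e by (simp add: norm_mult)
      have "cmod (v x + u x) \<le> C * \<epsilon> + C * \<epsilon>" using b[OF x] norm_triangle_ineq[of "v x" "u x"] by linarith
      then show "cmod ((v x + u x) * cnj (v x) * d x) \<le> (C * \<epsilon> + C * \<epsilon>) * (C * \<epsilon>) * K"
        unfolding norm_mult complex_mod_cnj using b[OF x] K[OF x] C K0 by (intro mult_mono) auto
      show "cmod (u x * u x * cnj (d x)) \<le> (C * \<epsilon>) * (C * \<epsilon>) * K"
        unfolding norm_mult complex_mod_cnj using b[OF x] K[OF x] C K0 by (intro mult_mono) auto
    qed
    also have "\<dots> = 4 * \<epsilon> * (J + K) + 3 * (C * \<epsilon>)\<^sup>2 * K" by (simp add: power2_eq_square algebra_simps)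
    finally show ?thesis .
  qed
  then have "K \<le> 4 * \<epsilon> * (J + K) + 3 * (C * \<epsilon>)\<^sup>2 * K"
  proof -
    have "(0,0) \<in> - set S0" by (simp add: set_S0)
    then have "- set S0 \<noteq> {}" by blast
    then show "(\<And>x. x \<notin> set S0 \<Longrightarrow> cmod (d x) \<le> 4 * \<epsilon> * (J + K) + 3 * (C * \<epsilon>)\<^sup>2 * K) \<Longrightarrow> ?thesis"
      by (subst K_def, intro cSUP_least) auto
  qed
  also have "\<dots> = 4 * \<epsilon> * J + (4 * \<epsilon> + 3 * (C * \<epsilon>)\<^sup>2) * K" by (simp add: algebra_simps)
  also have "\<dots> \<le> 4 * \<epsilon> * J + 1/2 * K" using e(2) K0 by (intro add_left_mono mult_right_mono)
  finally have "K \<le> 8 * \<epsilon> * J" by simp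
  then show ?thesis using K[OF x] by (simp add: d_def J_def)
qed

text \<open>Quantifiers over sites stay quantifiers over sites: splitting them into coordinates blocks instantiation.\<close>

declare split_paired_All [simp del] split_paired_Ex [simp del]

definition l1 :: "int \<times> int \<Rightarrow> nat" where "l1 x = nat (\<bar>fst x\<bar> + \<bar>snd x\<bar>)"

lemma l1_S0: "l1 x \<ge> 2 \<Longrightarrow> x \<notin> set S0" by (auto simp: l1_def set_S0)

lemma l1_moves: "l1 (east x) + 1 \<ge> l1 x" "l1 (west x) + 1 \<ge> l1 x" "l1 (north x) + 1 \<ge> l1 x" "l1 (south x) + 1 \<ge> l1 x"
  by (cases x; simp add: l1_def moves)+

section \<open>Uniqueness and rotation symmetry\<close>

locale near_cross = germ F for F +
  fixes u :: "real \<Rightarrow> int \<times> int \<Rightarrow> complex" and C :: real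
  assumes st_u: "eventually (\<lambda>e. stationary e (u e)) F"
    and near_u: "eventually (\<lambda>e. \<forall>x. cmod (u e x - base x) \<le> C * e) F"
begin

lemma u_base: "ord F 1 (\<lambda>e. u e x - base x)"
  by (rule ordI[of _ C]) (use near_u in \<open>auto elim: eventually_mono\<close>)

lemma u_off: "x \<notin> set S0 \<Longrightarrow> ord F 1 (\<lambda>e. u e x)"
  using u_base[of x] by (simp add: base_off)

lemma u0: "ord F 0 (\<lambda>e. u e x)"
proof -
  have "ord F 0 (\<lambda>e. (u e x - base x) + base x)" by (rule ord_le, (rule u_base ord_rules)+, simp)
  then show ?thesis by simp
qed

lemma eq_u: "eventually (\<lambda>e. \<forall>x. u e x = of_real e * nbr_sum (u e) x + u e x * u e x * cnj (u e x)) F"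
  using st_u by eventually_elim (blast intro: stationary_eq)

text \<open>Each step away from the nodes costs a factor \<open>\<epsilon>\<close>, by induction on the distance.\<close>

lemma u_far: "l1 x \<ge> n + 1 \<Longrightarrow> ord F n (\<lambda>e. u e x)"
proof (induction n arbitrary: x)
  case 0
  show ?case by (rule u0)
next
  case (Suc n)
  have x: "x \<notin> set S0" using Suc.prems by (intro l1_S0) simp
  have nb: "ord F n (\<lambda>e. u e (east x))" "ord F n (\<lambda>e. u e (west x))" "ord F n (\<lambda>e. u e (north x))" "ord F n (\<lambda>e. u e (south x))"
    by (rule Suc.IH; use l1_moves[of x] Suc.prems in linarith)+
  have "ord F (Suc n) (\<lambda>e. of_real e * (u e (east x) + u e (west x) + u e (north x) + u e (south x)) + u e x * u e x * cnj (u e x))"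
  proof (cases "n = 0")
    case True
    then show ?thesis by - (rule ord_le, (rule nb u_off[OF x] ord_rules)+, simp)
  next
    case False
    have s: "ord F n (\<lambda>e. u e x)" by (rule Suc.IH) (use Suc.prems in simp)
    show ?thesis by (rule ord_le, (rule nb s ord_rules)+, use False in simp)
  qed
  then show ?case by (rule ord_ev[OF eq_u, rotated]) (simp add: nbr_sum_moves)
qed

text \<open>
  The imaginary part of \<open>cnj u\<close> times the equation: at every site the currents along the four edges balance.
\<close>

lemma current: "eventually (\<lambda>e. \<forall>x. cnj (u e x) * nbr_sum (u e) x = u e x * cnj (nbr_sum (u e) x)) F"
  using st_u ev_small
proof eventually_elim
  case (elim e)
  show ?case
  proof
    fix x
    have "of_real (1 - (cmod (u e x))\<^sup>2) * u e x = of_real e * nbr_sum (u e) x" using elim(1) unfolding stationary_def by blast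
    then have n: "nbr_sum (u e) x = of_real ((1 - (cmod (u e x))\<^sup>2) / e) * u e x" using elim by (simp add: field_simps)
    show "cnj (u e x) * nbr_sum (u e) x = u e x * cnj (nbr_sum (u e) x)" unfolding n by simp
  qed
qed

end

text \<open>
  Two families of solutions that differ along the whole filter. Their difference \<open>q\<close>, normalised by its size at the nodes,
  satisfies linear equations whose coefficients are known to low order.
\<close>

locale two_solutions = near_cross F u C + v: near_cross F v C for F u v C +
  assumes J: "eventually (\<lambda>e. node_dist (u e) (v e) \<noteq> 0) F" and nbot: "F \<noteq> bot"
begin

definition "q e x = (v e x - u e x) / of_real (node_dist (u e) (v e))"

lemma J_pos: "eventually (\<lambda>e. node_dist (u e) (v e) > 0) F"
  using J by eventually_elim (use node_dist_def sum_nonneg[of "set S0" "\<lambda>x. cmod (_ x - _ x)"] in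
    \<open>metis (no_types, lifting) less_eq_real_def norm_ge_zero sum_nonneg\<close>)

lemma q_bounds: "eventually (\<lambda>e. \<forall>x. (x \<in> set S0 \<longrightarrow> cmod (q e x) \<le> 1) \<and> (x \<notin> set S0 \<longrightarrow> cmod (q e x) \<le> 8 * e)) F"
proof -
  have "eventually (\<lambda>e. 4 * e + 3 * (C * e)\<^sup>2 \<le> 1/2) (at_right 0)"
  proof -
    have "((\<lambda>e::real. 4 * e + 3 * (C * e)\<^sup>2) \<longlongrightarrow> 4 * 0 + 3 * (C * 0)\<^sup>2) (at_right 0)" by (intro tendsto_intros)
    then have "eventually (\<lambda>e::real. 4 * e + 3 * (C * e)\<^sup>2 < 1/2) (at_right 0)" by (rule order_tendstoD) simp
    then show ?thesis by eventually_elim simp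
  qed
  from ev[OF this] J_pos st_u v.st_u near_u v.near_u ev_small show ?thesis
  proof eventually_elim
    case (elim e)
    show ?case
    proof (intro allI conjI impI)
      fix x
      show "cmod (q e x) \<le> 1" if "x \<in> set S0" using node_le[OF that, of "v e" "u e"] elim(2) by (simp add: q_def norm_divide)
      show "cmod (q e x) \<le> 8 * e" if "x \<notin> set S0"
        using off_node_dist[OF elim(3,4) _ _ _ elim(1) that, of] elim by (simp add: q_def norm_divide field_simps)
    qed
  qed
qed

lemma q_off: "x \<notin> set S0 \<Longrightarrow> ord F 1 (\<lambda>e. q e x)"
  by (rule ordI[of _ 8]) (use q_bounds in \<open>auto elim: eventually_mono\<close>)

lemma q0: "ord F 0 (\<lambda>e. q e x)"
proof (cases "x \<in> set S0")
  case True
  then show ?thesis by (intro ordI[of _ 1]) (use q_bounds in \<open>auto elim: eventually_mono\<close>)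
next
  case False
  then show ?thesis by (intro ord_le[OF q_off]) auto
qed

lemma eq_q: "eventually (\<lambda>e. \<forall>x. q e x = of_real e * nbr_sum (q e) x + ((v e x + u e x) * cnj (v e x) * q e x + u e x * u e x * cnj (q e x))) F"
  using eq_u v.eq_u J_pos
proof eventually_elim
  case (elim e)
  show ?case
  proof
    fix x
    define j where "j = complex_of_real (node_dist (u e) (v e))"
    have j: "j \<noteq> 0" "cnj j = j" using elim(3) by (simp_all add: j_def)
    have d: "v e y - u e y = j * q e y" for y using j by (simp add: q_def j_def)
    have "j * q e x = of_real e * (nbr_sum (v e) x - nbr_sum (u e) x) + (v e x * v e x * cnj (v e x) - u e x * u e x * cnj (u e x))"
      using elim(1)[rule_format, of x] elim(2)[rule_format, of x] unfolding d[symmetric] by (simp add: algebra_simps)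
    also have "nbr_sum (v e) x - nbr_sum (u e) x = j * nbr_sum (q e) x"
      using d by (simp add: nbr_sum_moves algebra_simps)
    also have "v e x * v e x * cnj (v e x) - u e x * u e x * cnj (u e x) = (v e x + u e x) * cnj (v e x) * (j * q e x) + u e x * u e x * (j * cnj (q e x))"
      unfolding cube_diff d by (simp add: j)
    finally have "j * q e x = j * (of_real e * nbr_sum (q e) x + ((v e x + u e x) * cnj (v e x) * q e x + u e x * u e x * cnj (q e x)))"
      by (simp add: algebra_simps)
    then show "q e x = of_real e * nbr_sum (q e) x + ((v e x + u e x) * cnj (v e x) * q e x + u e x * u e x * cnj (q e x))"
      using j by simp
  qed
qed

lemma current_q: "eventually (\<lambda>e. \<forall>x. cnj (q e x) * nbr_sum (u e) x + cnj (v e x) * nbr_sum (q e) x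
   = q e x * cnj (nbr_sum (u e) x) + v e x * cnj (nbr_sum (q e) x)) F"
  using current v.current J_pos
proof eventually_elim
  case (elim e)
  show ?case
  proof
    fix x
    define j where "j = complex_of_real (node_dist (u e) (v e))"
    have j: "j \<noteq> 0" "cnj j = j" using elim(3) by (simp_all add: j_def)
    have d: "v e y = u e y + j * q e y" for y using j by (simp add: q_def j_def)
    have n: "nbr_sum (v e) x = nbr_sum (u e) x + j * nbr_sum (q e) x"
      by (simp add: nbr_sum_moves d algebra_simps)
    have a: "cnj (u e x) * nbr_sum (u e) x = u e x * cnj (nbr_sum (u e) x)" using elim(1) by blast
    have b: "cnj (v e x) * nbr_sum (v e) x = v e x * cnj (nbr_sum (v e) x)" using elim(2) by blast
    have cv: "cnj (v e x) = cnj (u e x) + j * cnj (q e x)" by (simp add: d j)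
    have cn: "cnj (nbr_sum (v e) x) = cnj (nbr_sum (u e) x) + j * cnj (nbr_sum (q e) x)" by (simp add: n j)
    have "j * (cnj (q e x) * nbr_sum (u e) x + cnj (v e x) * nbr_sum (q e) x)
       = j * (q e x * cnj (nbr_sum (u e) x) + v e x * cnj (nbr_sum (q e) x))"
      using a b n cn cv d[of x] by algebra
    then show "cnj (q e x) * nbr_sum (u e) x + cnj (v e x) * nbr_sum (q e) x
       = q e x * cnj (nbr_sum (u e) x) + v e x * cnj (nbr_sum (q e) x)" using j by simp
  qed
qed

lemma q_far: "n \<le> 3 \<Longrightarrow> l1 x \<ge> n + 1 \<Longrightarrow> ord F n (\<lambda>e. q e x)"
proof (induction n arbitrary: x)
  case 0
  show ?case by (rule q0)
next
  case (Suc n)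
  have x: "x \<notin> set S0" using Suc.prems by (intro l1_S0) simp
  have nb: "ord F n (\<lambda>e. q e (east x))" "ord F n (\<lambda>e. q e (west x))" "ord F n (\<lambda>e. q e (north x))" "ord F n (\<lambda>e. q e (south x))"
    by (rule Suc.IH; use l1_moves[of x] Suc.prems in linarith)+
  have "ord F (Suc n) (\<lambda>e. of_real e * (q e (east x) + q e (west x) + q e (north x) + q e (south x)) +
     ((v e x + u e x) * cnj (v e x) * q e x + u e x * u e x * cnj (q e x)))"
    by (rule ord_le, (rule nb u_off[OF x] v.u_off[OF x] q_off[OF x] ord_rules)+, use Suc.prems in simp)
  then show ?case by (rule ord_ev[OF eq_q, rotated]) (drule spec[of _ x], simp only: nbr_sum_moves)
qed

text \<open>The normalisation keeps some node value of \<open>q\<close> away from zero.\<close>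

lemma nodes_contra:
  assumes "\<And>x. x \<in> set S0 \<Longrightarrow> ord F 1 (\<lambda>e. q e x)" shows False
proof -
  have "eventually (\<lambda>e. \<forall>x\<in>set S0. cmod (q e x) \<le> 1/8) F"
    by (intro eventually_ball_finite ballI ord1_small[OF assms]) simp_all
  then have "eventually (\<lambda>e. False) F" using J_pos
  proof eventually_elim
    case (elim e)
    have "node_dist (u e) (v e) = (\<Sum>x\<in>set S0. cmod (q e x) * node_dist (u e) (v e))"
    proof -
      have "cmod (q e x) * node_dist (u e) (v e) = cmod (v e x - u e x)" for x
        using elim(2) by (simp add: q_def norm_divide)
      then show ?thesis by (simp only: node_dist_def)
    qed
    also have "\<dots> \<le> (\<Sum>x\<in>set S0. 1/8 * node_dist (u e) (v e))"
      using elim by (intro sum_mono mult_right_mono) auto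
    also have "\<dots> = 4 * (1/8 * node_dist (u e) (v e))" by (simp add: set_S0)
    finally show False using elim(2) by simp
  qed
  then show False using nbot by (simp add: eventually_False)
qed

end

lemma nb_sites:
  "nbr_sum g (-1,0) = g (0,0) + g (-2,0) + g (-1,1) + g (-1,-1)"
  "nbr_sum g (0,-1) = g (1,-1) + g (-1,-1) + g (0,0) + g (0,-2)"
  "nbr_sum g (-2,0) = g (-1,0) + g (-3,0) + g (-2,1) + g (-2,-1)"
  "nbr_sum g (-1,-1) = g (0,-1) + g (-2,-1) + g (-1,0) + g (-1,-2)"
  "nbr_sum g (-1,1) = g (0,1) + g (-2,1) + g (-1,2) + g (-1,0)"
  "nbr_sum g (0,0) = g (1,0) + g (-1,0) + g (0,1) + g (0,-1)"
  "nbr_sum g (0,-2) = g (1,-2) + g (-1,-2) + g (0,-1) + g (0,-3)"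
  "nbr_sum g (1,-1) = g (2,-1) + g (0,-1) + g (1,0) + g (1,-2)"
  "nbr_sum g (-3,0) = g (-2,0) + g (-4,0) + g (-3,1) + g (-3,-1)"
  "nbr_sum g (-2,-1) = g (-1,-1) + g (-3,-1) + g (-2,0) + g (-2,-2)"
  "nbr_sum g (-2,1) = g (-1,1) + g (-3,1) + g (-2,2) + g (-2,0)"
  "nbr_sum g (-1,-2) = g (0,-2) + g (-2,-2) + g (-1,-1) + g (-1,-3)"
  "nbr_sum g (-1,2) = g (0,2) + g (-2,2) + g (-1,3) + g (-1,1)"
  "nbr_sum g (-4,0) = g (-3,0) + g (-5,0) + g (-4,1) + g (-4,-1)"
  "nbr_sum g (-3,-1) = g (-2,-1) + g (-4,-1) + g (-3,0) + g (-3,-2)"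
  "nbr_sum g (-3,1) = g (-2,1) + g (-4,1) + g (-3,2) + g (-3,0)"
  "nbr_sum g (-2,-2) = g (-1,-2) + g (-3,-2) + g (-2,-1) + g (-2,-3)"
  "nbr_sum g (-2,2) = g (-1,2) + g (-3,2) + g (-2,3) + g (-2,1)"
  by (simp_all add: nbr_sum_def)

context near_cross
begin

lemma base_nodes: "ord F 1 (\<lambda>e. u e (-1,0) - 1)" "ord F 1 (\<lambda>e. u e (0,-1) - \<i>)"
  "ord F 1 (\<lambda>e. u e (1,0) + 1)" "ord F 1 (\<lambda>e. u e (0,1) + \<i>)"
  using u_base[of "(-1,0)"] u_base[of "(0,-1)"] u_base[of "(1,0)"] u_base[of "(0,1)"] by (simp_all add: base_def)

lemma off_sites: "(-2,0) \<notin> set S0" "(-1,-1) \<notin> set S0" "(-1,1) \<notin> set S0" "(0,0) \<notin> set S0"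
  "(0,-2) \<notin> set S0" "(1,-1) \<notin> set S0" "(1,1) \<notin> set S0" "(-3,0) \<notin> set S0" "(-2,-1) \<notin> set S0" "(-2,1) \<notin> set S0"
  "(-1,-2) \<notin> set S0" "(1,-2) \<notin> set S0" "(0,-3) \<notin> set S0" "(2,-1) \<notin> set S0" "(-1,2) \<notin> set S0" "(1,2) \<notin> set S0" "(2,1) \<notin> set S0"
  by (simp_all add: set_S0)

lemma u1_near: "ord F 2 (\<lambda>e. u e (-2,0) - of_real e * u e (-1,0))"
  "ord F 2 (\<lambda>e. u e (-1,-1) - of_real e * (u e (-1,0) + u e (0,-1)))"
  "ord F 2 (\<lambda>e. u e (-1,1) - of_real e * (u e (-1,0) + u e (0,1)))"
  "ord F 2 (\<lambda>e. u e (0,0) - of_real e * (u e (-1,0) + u e (0,-1) + u e (1,0) + u e (0,1)))"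
  "ord F 2 (\<lambda>e. u e (0,-2) - of_real e * u e (0,-1))"
  "ord F 2 (\<lambda>e. u e (1,-1) - of_real e * (u e (1,0) + u e (0,-1)))"
proof -
  note b = u_off[OF off_sites(1)] u_off[OF off_sites(2)] u_off[OF off_sites(3)] u_off[OF off_sites(4)]
    u_off[OF off_sites(5)] u_off[OF off_sites(6)] u_off[OF off_sites(8)] u_off[OF off_sites(9)] u_off[OF off_sites(10)]
    u_off[OF off_sites(11)] u_off[OF off_sites(12)] u_off[OF off_sites(13)] u_off[OF off_sites(14)]
    u_off[OF off_sites(15)]
  show "ord F 2 (\<lambda>e. u e (-2,0) - of_real e * u e (-1,0))"
  proof (rule ord_ev[OF eq_u])
    show "ord F 2 (\<lambda>e. of_real e * (u e (-3,0) + u e (-2,1) + u e (-2,-1)) + u e (-2,0) * u e (-2,0) * cnj (u e (-2,0)))"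
      by (rule ord_le, (rule b ord_rules)+, simp)
  qed (drule spec[of _ "(-2,0)"], unfold nb_sites, algebra)
  show "ord F 2 (\<lambda>e. u e (-1,-1) - of_real e * (u e (-1,0) + u e (0,-1)))"
  proof (rule ord_ev[OF eq_u])
    show "ord F 2 (\<lambda>e. of_real e * (u e (-2,-1) + u e (-1,-2)) + u e (-1,-1) * u e (-1,-1) * cnj (u e (-1,-1)))"
      by (rule ord_le, (rule b ord_rules)+, simp)
  qed (drule spec[of _ "(-1,-1)"], unfold nb_sites, algebra)
  show "ord F 2 (\<lambda>e. u e (-1,1) - of_real e * (u e (-1,0) + u e (0,1)))"
  proof (rule ord_ev[OF eq_u])
    show "ord F 2 (\<lambda>e. of_real e * (u e (-2,1) + u e (-1,2)) + u e (-1,1) * u e (-1,1) * cnj (u e (-1,1)))"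
      by (rule ord_le, (rule b ord_rules)+, simp)
  qed (drule spec[of _ "(-1,1)"], unfold nb_sites, algebra)
  show "ord F 2 (\<lambda>e. u e (0,0) - of_real e * (u e (-1,0) + u e (0,-1) + u e (1,0) + u e (0,1)))"
  proof (rule ord_ev[OF eq_u])
    show "ord F 2 (\<lambda>e. u e (0,0) * u e (0,0) * cnj (u e (0,0)))"
      by (rule ord_le, (rule b ord_rules)+, simp)
  qed (drule spec[of _ "(0,0)"], unfold nb_sites, algebra)
  show "ord F 2 (\<lambda>e. u e (0,-2) - of_real e * u e (0,-1))"
  proof (rule ord_ev[OF eq_u])
    show "ord F 2 (\<lambda>e. of_real e * (u e (0,-3) + u e (1,-2) + u e (-1,-2)) + u e (0,-2) * u e (0,-2) * cnj (u e (0,-2)))"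
      by (rule ord_le, (rule b ord_rules)+, simp)
  qed (drule spec[of _ "(0,-2)"], unfold nb_sites, algebra)
  show "ord F 2 (\<lambda>e. u e (1,-1) - of_real e * (u e (1,0) + u e (0,-1)))"
  proof (rule ord_ev[OF eq_u])
    show "ord F 2 (\<lambda>e. of_real e * (u e (2,-1) + u e (1,-2)) + u e (1,-1) * u e (1,-1) * cnj (u e (1,-1)))"
      by (rule ord_le, (rule b ord_rules)+, simp)
  qed (drule spec[of _ "(1,-1)"], unfold nb_sites, algebra)
qed

lemma nbr_node1: "ord F 2 (\<lambda>e. nbr_sum (u e) (-1,0) - 3 * of_real e)"
proof -
  have "ord F 2 (\<lambda>e. (u e (-2,0) - of_real e * u e (-1,0)) + (u e (-1,-1) - of_real e * (u e (-1,0) + u e (0,-1)))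
     + (u e (-1,1) - of_real e * (u e (-1,0) + u e (0,1)))
     + (u e (0,0) - of_real e * (u e (-1,0) + u e (0,-1) + u e (1,0) + u e (0,1)))
     + of_real e * (4 * (u e (-1,0) - 1) + 2 * (u e (0,-1) - \<i>) + (u e (1,0) + 1) + 2 * (u e (0,1) + \<i>)))"
    by (rule ord_le, (rule u1_near base_nodes ord_rules)+, simp)
  moreover have "(u e (-2,0) - of_real e * u e (-1,0)) + (u e (-1,-1) - of_real e * (u e (-1,0) + u e (0,-1)))
     + (u e (-1,1) - of_real e * (u e (-1,0) + u e (0,1)))
     + (u e (0,0) - of_real e * (u e (-1,0) + u e (0,-1) + u e (1,0) + u e (0,1)))
     + of_real e * (4 * (u e (-1,0) - 1) + 2 * (u e (0,-1) - \<i>) + (u e (1,0) + 1) + 2 * (u e (0,1) + \<i>))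
     = nbr_sum (u e) (-1,0) - 3 * of_real e" for e by (simp add: nbr_sum_def algebra_simps)
  ultimately show ?thesis by simp
qed

lemma nbr_node2: "ord F 2 (\<lambda>e. nbr_sum (u e) (0,-1) - 3 * \<i> * of_real e)"
proof -
  have "ord F 2 (\<lambda>e. (u e (0,-2) - of_real e * u e (0,-1)) + (u e (-1,-1) - of_real e * (u e (-1,0) + u e (0,-1)))
     + (u e (1,-1) - of_real e * (u e (1,0) + u e (0,-1)))
     + (u e (0,0) - of_real e * (u e (-1,0) + u e (0,-1) + u e (1,0) + u e (0,1)))
     + of_real e * (2 * (u e (-1,0) - 1) + 4 * (u e (0,-1) - \<i>) + 2 * (u e (1,0) + 1) + (u e (0,1) + \<i>)))"
    by (rule ord_le, (rule u1_near base_nodes ord_rules)+, simp)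
  moreover have "(u e (0,-2) - of_real e * u e (0,-1)) + (u e (-1,-1) - of_real e * (u e (-1,0) + u e (0,-1)))
     + (u e (1,-1) - of_real e * (u e (1,0) + u e (0,-1)))
     + (u e (0,0) - of_real e * (u e (-1,0) + u e (0,-1) + u e (1,0) + u e (0,1)))
     + of_real e * (2 * (u e (-1,0) - 1) + 4 * (u e (0,-1) - \<i>) + 2 * (u e (1,0) + 1) + (u e (0,1) + \<i>))
     = nbr_sum (u e) (0,-1) - 3 * \<i> * of_real e" for e by (simp add: nbr_sum_def algebra_simps)
  ultimately show ?thesis by simp
qed

end

context two_solutions
begin

text \<open>
  The equation at a node fixes the modulus: the derivative of \<open>(1 - |u|\<^sup>2) u\<close> is \<open>-2\<close> in the direction of \<open>u\<close>.
\<close>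

lemma amplitude: "ord F 1 (\<lambda>e. q e (-1,0) + cnj (q e (-1,0)))" "ord F 1 (\<lambda>e. q e (0,-1) - cnj (q e (0,-1)))"
proof -
  note b = q_off[OF off_sites(1)] q_off[OF off_sites(2)] q_off[OF off_sites(3)] q_off[OF off_sites(4)]
    q_off[OF off_sites(5)] q_off[OF off_sites(6)] base_nodes v.base_nodes
  show "ord F 1 (\<lambda>e. q e (-1,0) + cnj (q e (-1,0)))"
  proof (rule ord_ev[OF eq_q])
    let ?a = "\<lambda>e. u e (-1,0) - 1" and ?c = "\<lambda>e. v e (-1,0) - 1"
    show "ord F 1 (\<lambda>e. - (of_real e * (q e (-2,0) + q e (-1,-1) + q e (-1,1) + q e (0,0)))
       - ((?c e + ?a e) * cnj (v e (-1,0)) + 2 * cnj (?c e)) * q e (-1,0) - (?a e * u e (-1,0) + ?a e) * cnj (q e (-1,0)))"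
      by (rule ord_le, (rule b u0 v.u0 q0 ord_rules)+, simp)
    fix e assume "\<forall>x. q e x = of_real e * nbr_sum (q e) x + ((v e x + u e x) * cnj (v e x) * q e x + u e x * u e x * cnj (q e x))"
    then have h: "q e (-1,0) = of_real e * nbr_sum (q e) (-1,0) + ((v e (-1,0) + u e (-1,0)) * cnj (v e (-1,0)) * q e (-1,0) + u e (-1,0) * u e (-1,0) * cnj (q e (-1,0)))"
      by blast
    have n: "nbr_sum (q e) (-1,0) = q e (-2,0) + q e (-1,-1) + q e (-1,1) + q e (0,0)" by (simp add: nbr_sum_def)
    have c: "cnj (v e (-1,0) - 1) = cnj (v e (-1,0)) - 1" by simp
    show "q e (-1,0) + cnj (q e (-1,0)) = - (of_real e * (q e (-2,0) + q e (-1,-1) + q e (-1,1) + q e (0,0)))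
       - ((?c e + ?a e) * cnj (v e (-1,0)) + 2 * cnj (?c e)) * q e (-1,0) - (?a e * u e (-1,0) + ?a e) * cnj (q e (-1,0))"
      using h unfolding n c by algebra
  qed
  show "ord F 1 (\<lambda>e. q e (0,-1) - cnj (q e (0,-1)))"
  proof (rule ord_ev[OF eq_q])
    let ?a = "\<lambda>e. u e (0,-1) - \<i>" and ?c = "\<lambda>e. v e (0,-1) - \<i>"
    show "ord F 1 (\<lambda>e. - (of_real e * (q e (0,-2) + q e (-1,-1) + q e (1,-1) + q e (0,0)))
       - ((?c e + ?a e) * cnj (v e (0,-1)) + 2 * \<i> * cnj (?c e)) * q e (0,-1) - (?a e * u e (0,-1) + \<i> * ?a e) * cnj (q e (0,-1)))"
      by (rule ord_le, (rule b u0 v.u0 q0 ord_rules)+, simp)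
    fix e assume "\<forall>x. q e x = of_real e * nbr_sum (q e) x + ((v e x + u e x) * cnj (v e x) * q e x + u e x * u e x * cnj (q e x))"
    then have h: "q e (0,-1) = of_real e * nbr_sum (q e) (0,-1) + ((v e (0,-1) + u e (0,-1)) * cnj (v e (0,-1)) * q e (0,-1) + u e (0,-1) * u e (0,-1) * cnj (q e (0,-1)))"
      by blast
    have n: "nbr_sum (q e) (0,-1) = q e (0,-2) + q e (-1,-1) + q e (1,-1) + q e (0,0)" by (simp add: nbr_sum_def)
    have c: "cnj (v e (0,-1) - \<i>) = cnj (v e (0,-1)) + \<i>" by simp
    have i: "\<i> * \<i> = -1" by simp
    show "q e (0,-1) - cnj (q e (0,-1)) = - (of_real e * (q e (0,-2) + q e (-1,-1) + q e (1,-1) + q e (0,0)))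
       - ((?c e + ?a e) * cnj (v e (0,-1)) + 2 * \<i> * cnj (?c e)) * q e (0,-1) - (?a e * u e (0,-1) + \<i> * ?a e) * cnj (q e (0,-1))"
      using h i unfolding n c by algebra
  qed
qed

lemma q1_near: "ord F 2 (\<lambda>e. q e (-2,0) - of_real e * q e (-1,0))"
  "ord F 2 (\<lambda>e. q e (-1,-1) - of_real e * (q e (-1,0) + q e (0,-1)))"
  "ord F 2 (\<lambda>e. q e (-1,1) - of_real e * (q e (-1,0) + q e (0,1)))"
  "ord F 2 (\<lambda>e. q e (0,0) - of_real e * (q e (-1,0) + q e (0,-1) + q e (1,0) + q e (0,1)))"
  "ord F 2 (\<lambda>e. q e (0,-2) - of_real e * q e (0,-1))"
  "ord F 2 (\<lambda>e. q e (1,-1) - of_real e * (q e (1,0) + q e (0,-1)))"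
proof -
  note b = q_off[OF off_sites(1)] q_off[OF off_sites(2)] q_off[OF off_sites(3)] q_off[OF off_sites(4)]
    q_off[OF off_sites(5)] q_off[OF off_sites(6)] q_off[OF off_sites(8)] q_off[OF off_sites(9)] q_off[OF off_sites(10)]
    q_off[OF off_sites(11)] q_off[OF off_sites(12)] q_off[OF off_sites(13)] q_off[OF off_sites(14)]
    q_off[OF off_sites(15)]
  define cub where "cub e x = (v e x + u e x) * cnj (v e x) * q e x + u e x * u e x * cnj (q e x)" for e x
  have cub: "ord F 2 (\<lambda>e. cub e x)" if "x \<notin> set S0" for x unfolding cub_def
    by (rule ord_le, (rule u_off[OF that] v.u_off[OF that] q_off[OF that] ord_rules)+, simp)
  note c = cub[OF off_sites(1)] cub[OF off_sites(2)] cub[OF off_sites(3)] cub[OF off_sites(4)] cub[OF off_sites(5)] cub[OF off_sites(6)]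
  note eq = eq_q[folded cub_def]
  show "ord F 2 (\<lambda>e. q e (-2,0) - of_real e * q e (-1,0))"
  proof (rule ord_ev[OF eq])
    show "ord F 2 (\<lambda>e. of_real e * (q e (-3,0) + q e (-2,1) + q e (-2,-1)) + cub e (-2,0))"
      by (rule ord_le, (rule b c ord_rules)+, simp)
  qed (drule spec[of _ "(-2,0)"], unfold nb_sites, algebra)
  show "ord F 2 (\<lambda>e. q e (-1,-1) - of_real e * (q e (-1,0) + q e (0,-1)))"
  proof (rule ord_ev[OF eq])
    show "ord F 2 (\<lambda>e. of_real e * (q e (-2,-1) + q e (-1,-2)) + cub e (-1,-1))"
      by (rule ord_le, (rule b c ord_rules)+, simp)
  qed (drule spec[of _ "(-1,-1)"], unfold nb_sites, algebra)
  show "ord F 2 (\<lambda>e. q e (-1,1) - of_real e * (q e (-1,0) + q e (0,1)))"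
  proof (rule ord_ev[OF eq])
    show "ord F 2 (\<lambda>e. of_real e * (q e (-2,1) + q e (-1,2)) + cub e (-1,1))"
      by (rule ord_le, (rule b c ord_rules)+, simp)
  qed (drule spec[of _ "(-1,1)"], unfold nb_sites, algebra)
  show "ord F 2 (\<lambda>e. q e (0,0) - of_real e * (q e (-1,0) + q e (0,-1) + q e (1,0) + q e (0,1)))"
  proof (rule ord_ev[OF eq])
    show "ord F 2 (\<lambda>e. cub e (0,0))" by (rule c)
  qed (drule spec[of _ "(0,0)"], unfold nb_sites, algebra)
  show "ord F 2 (\<lambda>e. q e (0,-2) - of_real e * q e (0,-1))"
  proof (rule ord_ev[OF eq])
    show "ord F 2 (\<lambda>e. of_real e * (q e (0,-3) + q e (1,-2) + q e (-1,-2)) + cub e (0,-2))"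
      by (rule ord_le, (rule b c ord_rules)+, simp)
  qed (drule spec[of _ "(0,-2)"], unfold nb_sites, algebra)
  show "ord F 2 (\<lambda>e. q e (1,-1) - of_real e * (q e (1,0) + q e (0,-1)))"
  proof (rule ord_ev[OF eq])
    show "ord F 2 (\<lambda>e. of_real e * (q e (2,-1) + q e (1,-2)) + cub e (1,-1))"
      by (rule ord_le, (rule b c ord_rules)+, simp)
  qed (drule spec[of _ "(1,-1)"], unfold nb_sites, algebra)
qed

end

text \<open>
  The combination of the expansions at the node \<open>(-1,0)\<close> that isolates its current balance; \<open>p\<close> and \<open>q\<close> stand for the differences at the two kinds of nodes.
\<close>

lemma current_balance1: fixes E :: complex
  assumes "qb * n + vb * m = q * nb + v * mb"
  shows "E ^ 1 * (2 * (q - qb) + 4 * (p - pb)) =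
    q * (nb - 3 * E) - qb * (n - 3 * E) - (m - E * (5 * q + 4 * p)) - (vb - 1) * ((m - E * (5 * q + 4 * p)) + E * (5 * q + 4 * p))
    + (mb - E * (5 * qb + 4 * pb)) + (v - 1) * ((mb - E * (5 * qb + 4 * pb)) + E * (5 * qb + 4 * pb))"
proof -
  have "q * nb + v * mb - qb * n - vb * m = 0" by (simp add: assms[symmetric])
  then have "2 * (q - qb) * E + 4 * (p - pb) * E = q * nb + v * mb - qb * n - vb * m + 2 * (q - qb) * E + 4 * (p - pb) * E"
    by simp
  then show ?thesis by (simp add: algebra_simps)
qed
lemma current_balance2: fixes E :: complex
  assumes "qb * n + vb * m = q * nb + v * mb"
  shows "E ^ 1 * (- 2 * (q + qb) - 4 * (p + pb)) =
    - \<i> * (q * (nb + 3 * \<i> * E) - qb * (n - 3 * \<i> * E) + \<i> * (m - E * (5 * q + 4 * p)) - (vb + \<i>) * ((m - E * (5 * q + 4 * p)) + E * (5 * q + 4 * p))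
    + \<i> * (mb - E * (5 * qb + 4 * pb)) + (v - \<i>) * ((mb - E * (5 * qb + 4 * pb)) + E * (5 * qb + 4 * pb)))"
proof -
  have "q * nb + v * mb - qb * n - vb * m = 0" by (simp add: assms[symmetric])
  then have "- 2 * (q + qb) * E - 4 * (p + pb) * E = - \<i> * (q * nb + v * mb - qb * n - vb * m) + (- 2 * (q + qb) * E - 4 * (p + pb) * E)"
    by (simp only: mult_zero_right add_0_left)
  then show ?thesis by (simp add: algebra_simps)
qed
lemma cubic_balance: fixes t :: complex assumes "4 * c = \<i>"
  shows "t * (y + yb) = c * ((K - t * (10 * x + xb + 4 * \<i> * yb)) - (Kb - t * (10 * xb + x - 4 * \<i> * y)) - (K - Kb) + t * 9 * (x - xb))"
proof -
  have "c * ((K - t * (10 * x + xb + 4 * \<i> * yb)) - (Kb - t * (10 * xb + x - 4 * \<i> * y)) - (K - Kb) + t * 9 * (x - xb)) = - (4 * c) * \<i> * (t * (y + yb))"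
   by (simp add: algebra_simps)
  then show ?thesis unfolding assms by simp
qed
context two_solutions
begin

text \<open>
  If \<open>q\<close> agrees at opposite nodes, the current balance is at leading order a nondegenerate linear system for the phases of \<open>q\<close> at the nodes:
  the phases interact through the four sites adjacent to two nodes and through the origin. So the phases vanish as well.
\<close>

lemma phase_balance:
  assumes sym: "eventually (\<lambda>e. q e (1,0) = q e (-1,0) \<and> q e (0,1) = q e (0,-1)) F"
  shows False
proof -
  have n1: "ord F 2 (\<lambda>e. nbr_sum (q e) (-1,0) - of_real e * (5 * q e (-1,0) + 4 * q e (0,-1)))"
  proof (rule ord_ev[OF sym])
    show "ord F 2 (\<lambda>e. (q e (-2,0) - of_real e * q e (-1,0)) + (q e (-1,-1) - of_real e * (q e (-1,0) + q e (0,-1)))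
      + (q e (-1,1) - of_real e * (q e (-1,0) + q e (0,1)))
      + (q e (0,0) - of_real e * (q e (-1,0) + q e (0,-1) + q e (1,0) + q e (0,1))))"
      by (rule ord_le, (rule q1_near ord_rules)+, simp)
  qed (simp add: nb_sites algebra_simps)
  have n2: "ord F 2 (\<lambda>e. nbr_sum (q e) (0,-1) - of_real e * (5 * q e (0,-1) + 4 * q e (-1,0)))"
  proof (rule ord_ev[OF sym])
    show "ord F 2 (\<lambda>e. (q e (0,-2) - of_real e * q e (0,-1)) + (q e (-1,-1) - of_real e * (q e (-1,0) + q e (0,-1)))
      + (q e (1,-1) - of_real e * (q e (1,0) + q e (0,-1)))
      + (q e (0,0) - of_real e * (q e (-1,0) + q e (0,-1) + q e (1,0) + q e (0,1))))"
      by (rule ord_le, (rule q1_near ord_rules)+, simp)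
  qed (simp add: nb_sites algebra_simps)
  have ph1: "ord F 1 (\<lambda>e. q e (-1,0) - cnj (q e (-1,0)))"
  proof -
    let ?w = "\<lambda>e. nbr_sum (u e) (-1,0) - 3 * of_real e" and ?z = "\<lambda>e. nbr_sum (q e) (-1,0) - of_real e * (5 * q e (-1,0) + 4 * q e (0,-1))"
    let ?c = "\<lambda>e. v e (-1,0) - 1" and ?l = "\<lambda>e. of_real e * (5 * q e (-1,0) + 4 * q e (0,-1))"
    have "ord F 2 (\<lambda>e. of_real e ^ 1 * (2 * (q e (-1,0) - cnj (q e (-1,0))) + 4 * (q e (0,-1) - cnj (q e (0,-1)))))"
    proof (rule ord_ev[OF current_q])
      show "ord F 2 (\<lambda>e. q e (-1,0) * cnj (?w e) - cnj (q e (-1,0)) * ?w e - ?z e - cnj (?c e) * (?z e + ?l e)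
        + cnj (?z e) + ?c e * cnj (?z e + ?l e))"
        by (rule ord_le, (rule n1 nbr_node1 v.base_nodes q0 ord_rules)+, simp)
      fix e assume "\<forall>x. cnj (q e x) * nbr_sum (u e) x + cnj (v e x) * nbr_sum (q e) x = q e x * cnj (nbr_sum (u e) x) + v e x * cnj (nbr_sum (q e) x)"
      then have h: "cnj (q e (-1,0)) * nbr_sum (u e) (-1,0) + cnj (v e (-1,0)) * nbr_sum (q e) (-1,0)
         = q e (-1,0) * cnj (nbr_sum (u e) (-1,0)) + v e (-1,0) * cnj (nbr_sum (q e) (-1,0))" by blast
      then show "of_real e ^ 1 * (2 * (q e (-1,0) - cnj (q e (-1,0))) + 4 * (q e (0,-1) - cnj (q e (0,-1))))
       = q e (-1,0) * cnj (?w e) - cnj (q e (-1,0)) * ?w e - ?z e - cnj (?c e) * (?z e + ?l e)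
        + cnj (?z e) + ?c e * cnj (?z e + ?l e)"
        unfolding complex_cnj_diff complex_cnj_add complex_cnj_mult complex_cnj_complex_of_real complex_cnj_numeral complex_cnj_one
        by (rule current_balance1)
    qed
    then have a: "ord F 1 (\<lambda>e. 2 * (q e (-1,0) - cnj (q e (-1,0))) + 4 * (q e (0,-1) - cnj (q e (0,-1))))"
      by (rule ord_div) simp
    have "ord F 1 (\<lambda>e. (1/2) * ((2 * (q e (-1,0) - cnj (q e (-1,0))) + 4 * (q e (0,-1) - cnj (q e (0,-1)))) - 4 * (q e (0,-1) - cnj (q e (0,-1)))))"
      by (rule ord_le, (rule a amplitude ord_rules)+, simp)
    then show ?thesis by (simp add: diff_divide_distrib add_divide_distrib)
  qed
  have ph2: "ord F 1 (\<lambda>e. q e (0,-1) + cnj (q e (0,-1)))"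
  proof -
    let ?w = "\<lambda>e. nbr_sum (u e) (0,-1) - 3 * \<i> * of_real e" and ?z = "\<lambda>e. nbr_sum (q e) (0,-1) - of_real e * (5 * q e (0,-1) + 4 * q e (-1,0))"
    let ?c = "\<lambda>e. v e (0,-1) - \<i>" and ?l = "\<lambda>e. of_real e * (5 * q e (0,-1) + 4 * q e (-1,0))"
    have "ord F 2 (\<lambda>e. of_real e ^ 1 * (- 2 * (q e (0,-1) + cnj (q e (0,-1))) - 4 * (q e (-1,0) + cnj (q e (-1,0)))))"
    proof (rule ord_ev[OF current_q])
      show "ord F 2 (\<lambda>e. - \<i> * (q e (0,-1) * cnj (?w e) - cnj (q e (0,-1)) * ?w e + \<i> * ?z e - cnj (?c e) * (?z e + ?l e)
        + \<i> * cnj (?z e) + ?c e * cnj (?z e + ?l e)))"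
        by (rule ord_le, (rule n2 nbr_node2 v.base_nodes q0 ord_rules)+, simp)
      fix e assume "\<forall>x. cnj (q e x) * nbr_sum (u e) x + cnj (v e x) * nbr_sum (q e) x = q e x * cnj (nbr_sum (u e) x) + v e x * cnj (nbr_sum (q e) x)"
      then have h: "cnj (q e (0,-1)) * nbr_sum (u e) (0,-1) + cnj (v e (0,-1)) * nbr_sum (q e) (0,-1)
         = q e (0,-1) * cnj (nbr_sum (u e) (0,-1)) + v e (0,-1) * cnj (nbr_sum (q e) (0,-1))" by blast
      have i: "\<i> * \<i> = -1" by simp
      show "of_real e ^ 1 * (- 2 * (q e (0,-1) + cnj (q e (0,-1))) - 4 * (q e (-1,0) + cnj (q e (-1,0))))
       = - \<i> * (q e (0,-1) * cnj (?w e) - cnj (q e (0,-1)) * ?w e + \<i> * ?z e - cnj (?c e) * (?z e + ?l e)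
        + \<i> * cnj (?z e) + ?c e * cnj (?z e + ?l e))"
        using current_balance2[OF h]
        unfolding complex_cnj_diff complex_cnj_add complex_cnj_mult complex_cnj_complex_of_real complex_cnj_numeral complex_cnj_one complex_cnj_i
        by (simp only: minus_mult_minus mult_minus_left mult_minus_right diff_minus_eq_add minus_minus)
    qed
    then have a: "ord F 1 (\<lambda>e. - 2 * (q e (0,-1) + cnj (q e (0,-1))) - 4 * (q e (-1,0) + cnj (q e (-1,0))))"
      by (rule ord_div) simp
    have "ord F 1 (\<lambda>e. (-1/2) * ((- 2 * (q e (0,-1) + cnj (q e (0,-1))) - 4 * (q e (-1,0) + cnj (q e (-1,0)))) + 4 * (q e (-1,0) + cnj (q e (-1,0)))))"
      by (rule ord_le, (rule a amplitude ord_rules)+, simp)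
    then show ?thesis by (simp add: diff_divide_distrib add_divide_distrib add.commute)
  qed
  have "ord F 1 (\<lambda>e. (1/2) * ((q e (-1,0) + cnj (q e (-1,0))) + (q e (-1,0) - cnj (q e (-1,0)))))"
    by (rule ord_le, (rule amplitude ph1 ord_rules)+, simp)
  then have 1: "ord F 1 (\<lambda>e. q e (-1,0))" by simp
  have "ord F 1 (\<lambda>e. (1/2) * ((q e (0,-1) - cnj (q e (0,-1))) + (q e (0,-1) + cnj (q e (0,-1)))))"
    by (rule ord_le, (rule amplitude ph2 ord_rules)+, simp)
  then have 2: "ord F 1 (\<lambda>e. q e (0,-1))" by simp
  have 3: "ord F 1 (\<lambda>e. q e (1,0))" by (rule ord_ev[OF sym _ 1]) simp
  have 4: "ord F 1 (\<lambda>e. q e (0,1))" by (rule ord_ev[OF sym _ 2]) simp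
  show False by (rule nodes_contra) (use 1 2 3 4 in \<open>auto simp: set_S0\<close>)
qed

end

context near_cross
begin

lemma u_near3:
  shows "ord F 3 (\<lambda>e. u e (-2,0) - of_real e * u e (-1,0))"
  "ord F 3 (\<lambda>e. u e (-1,-1) - of_real e * (u e (-1,0) + u e (0,-1)))"
  "ord F 3 (\<lambda>e. u e (-1,1) - of_real e * (u e (-1,0) + u e (0,1)))"
proof -
  have f: "ord F 2 (\<lambda>e. u e (-3,0))" "ord F 2 (\<lambda>e. u e (-2,1))" "ord F 2 (\<lambda>e. u e (-2,-1))" "ord F 2 (\<lambda>e. u e (-1,-2))"
     "ord F 2 (\<lambda>e. u e (-1,2))" by (rule u_far; simp add: l1_def)+
  note b = f u_off[OF off_sites(1)] u_off[OF off_sites(2)] u_off[OF off_sites(3)]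
  show "ord F 3 (\<lambda>e. u e (-2,0) - of_real e * u e (-1,0))"
  proof (rule ord_ev[OF eq_u])
    show "ord F 3 (\<lambda>e. of_real e * (u e (-3,0) + u e (-2,1) + u e (-2,-1)) + u e (-2,0) * u e (-2,0) * cnj (u e (-2,0)))"
      by (rule ord_le, (rule b ord_rules)+, simp)
  qed (drule spec[of _ "(-2,0)"], unfold nb_sites, algebra)
  show "ord F 3 (\<lambda>e. u e (-1,-1) - of_real e * (u e (-1,0) + u e (0,-1)))"
  proof (rule ord_ev[OF eq_u])
    show "ord F 3 (\<lambda>e. of_real e * (u e (-2,-1) + u e (-1,-2)) + u e (-1,-1) * u e (-1,-1) * cnj (u e (-1,-1)))"
      by (rule ord_le, (rule b ord_rules)+, simp)
  qed (drule spec[of _ "(-1,-1)"], unfold nb_sites, algebra)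
  show "ord F 3 (\<lambda>e. u e (-1,1) - of_real e * (u e (-1,0) + u e (0,1)))"
  proof (rule ord_ev[OF eq_u])
    show "ord F 3 (\<lambda>e. of_real e * (u e (-2,1) + u e (-1,2)) + u e (-1,1) * u e (-1,1) * cnj (u e (-1,1)))"
      by (rule ord_le, (rule b ord_rules)+, simp)
  qed (drule spec[of _ "(-1,1)"], unfold nb_sites, algebra)
qed

end

context two_solutions
begin

text \<open>
  Two solutions that change sign under the half turn have four node values determined by two. Their currents through the origin cancel, and the phase differences
  between adjacent nodes first interact at the third order in \<open>\<epsilon>\<close>, through the cubic terms at the sites next to the nodes. One relative phase
  is removed by the normalisation \<open>gauge\<close>; the other is determined by the current balance at that order.
\<close>

lemma odd_unique:
  assumes odd: "eventually (\<lambda>e. \<forall>x. u e (rot (rot x)) = - u e x \<and> v e (rot (rot x)) = - v e x) F"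
    and gauge: "eventually (\<lambda>e. cnj (u e (-1,0)) * v e (-1,0) = u e (-1,0) * cnj (v e (-1,0))) F"
  shows False
proof -
  have "eventually (\<lambda>e. (u e (0,0) = 0 \<and> q e (0,0) = 0) \<and> u e (0,1) = - u e (0,-1) \<and> q e (0,1) = - q e (0,-1)
     \<and> v e (0,1) = - v e (0,-1)
     \<and> q e (1,0) = - q e (-1,0) \<and> q e (0,2) = - q e (0,-2)) F"
    using odd
  proof eventually_elim
    case (elim e)
    have qo: "q e (rot (rot x)) = - q e x" for x using elim by (simp add: q_def minus_divide_left)
    have r: "rot (rot (0,0)) = (0,0)" "rot (rot (0,-1)) = (0,1)" "rot (rot (-1,0)) = (1,0)" "rot (rot (0,-2)) = (0,2)"
      by (simp_all add: rot_def)
    have eq0: "z = - z \<Longrightarrow> z = 0" for z :: complex by (simp add: eq_neg_iff_add_eq_0 flip: mult_2)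
    show ?case
      using eq0[of "u e (0,0)"] eq0[of "q e (0,0)"] elim[rule_format, of "(0,0)"] qo[of "(0,0)"]
        elim[rule_format, of "(0,-1)"] qo[of "(0,-1)"] qo[of "(-1,0)"] qo[of "(0,-2)"] unfolding r by auto
  qed
  note sym = this
  have ph1: "ord F 1 (\<lambda>e. q e (-1,0) - cnj (q e (-1,0)))"
  proof -
    let ?a = "\<lambda>e. u e (-1,0) - 1"
    show ?thesis
    proof (rule ord_ev[OF eventually_conj[OF gauge J_pos]])
      show "ord F 1 (\<lambda>e. ?a e * cnj (q e (-1,0)) - cnj (?a e) * q e (-1,0))"
        by (rule ord_le, (rule base_nodes q0 ord_rules)+, simp)
      fix e assume g: "cnj (u e (-1,0)) * v e (-1,0) = u e (-1,0) * cnj (v e (-1,0)) \<and> 0 < node_dist (u e) (v e)"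
      define j where "j = complex_of_real (node_dist (u e) (v e))"
      have j: "j \<noteq> 0" "cnj j = j" using g by (simp_all add: j_def)
      have d: "v e (-1,0) = u e (-1,0) + j * q e (-1,0)" using j by (simp add: q_def j_def)
      have "j * (cnj (u e (-1,0)) * q e (-1,0)) = j * (u e (-1,0) * cnj (q e (-1,0)))"
        using g unfolding d by (simp add: j algebra_simps)
      then have "cnj (u e (-1,0)) * q e (-1,0) = u e (-1,0) * cnj (q e (-1,0))" using j by simp
      then show "q e (-1,0) - cnj (q e (-1,0)) = ?a e * cnj (q e (-1,0)) - cnj (?a e) * q e (-1,0)"
        unfolding complex_cnj_diff complex_cnj_one by algebra
    qed
  qed
  have "ord F 1 (\<lambda>e. (1/2) * ((q e (-1,0) + cnj (q e (-1,0))) + (q e (-1,0) - cnj (q e (-1,0)))))"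
    by (rule ord_le, (rule amplitude ph1 ord_rules)+, simp)
  then have q1: "ord F 1 (\<lambda>e. q e (-1,0))" by simp
  define cub where "cub e x = (v e x + u e x) * cnj (v e x) * q e x + u e x * u e x * cnj (q e x)" for e x
  note eq = eq_q[folded cub_def]
  have f2: "ord F 2 (\<lambda>e. u e (-3,0))" "ord F 2 (\<lambda>e. u e (-2,1))" "ord F 2 (\<lambda>e. u e (-2,-1))" "ord F 2 (\<lambda>e. u e (-1,-2))" "ord F 2 (\<lambda>e. u e (-1,2))"
    by (rule u_far; simp add: l1_def)+
  have g2: "ord F 2 (\<lambda>e. v e (-3,0))" "ord F 2 (\<lambda>e. v e (-2,1))" "ord F 2 (\<lambda>e. v e (-2,-1))" "ord F 2 (\<lambda>e. v e (-1,-2))" "ord F 2 (\<lambda>e. v e (-1,2))"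
    by (rule v.u_far; simp add: l1_def)+
  have h2: "ord F 2 (\<lambda>e. q e (-3,0))" "ord F 2 (\<lambda>e. q e (-2,1))" "ord F 2 (\<lambda>e. q e (-2,-1))" "ord F 2 (\<lambda>e. q e (-1,-2))" "ord F 2 (\<lambda>e. q e (-1,2))"
    by (rule q_far; simp add: l1_def)+
  have h3: "ord F 3 (\<lambda>e. q e (-4,0))" "ord F 3 (\<lambda>e. q e (-3,1))" "ord F 3 (\<lambda>e. q e (-3,-1))" "ord F 3 (\<lambda>e. q e (-2,2))"
    "ord F 3 (\<lambda>e. q e (-2,-2))" "ord F 3 (\<lambda>e. q e (-1,-3))" "ord F 3 (\<lambda>e. q e (-1,3))"
    by (rule q_far; simp add: l1_def)+
  note o1 = u_off[OF off_sites(1)] u_off[OF off_sites(2)] u_off[OF off_sites(3)] v.u_off[OF off_sites(1)] v.u_off[OF off_sites(2)] v.u_off[OF off_sites(3)]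
    q_off[OF off_sites(1)] q_off[OF off_sites(2)] q_off[OF off_sites(3)]
  have c6: "ord F 4 (\<lambda>e. cub e (-3,0))" "ord F 4 (\<lambda>e. cub e (-2,1))" "ord F 4 (\<lambda>e. cub e (-2,-1))" "ord F 4 (\<lambda>e. cub e (-1,-2))" "ord F 4 (\<lambda>e. cub e (-1,2))"
    unfolding cub_def by (rule ord_le, (rule f2 g2 h2 ord_rules)+, simp)+
  have C: "ord F 4 (\<lambda>e. q e (-3,0) - of_real e * q e (-2,0))"
  proof (rule ord_ev[OF eq])
    show "ord F 4 (\<lambda>e. of_real e * (q e (-4,0) + q e (-3,1) + q e (-3,-1)) + cub e (-3,0))"
      by (rule ord_le, (rule h3 c6 ord_rules)+, simp)
  qed (drule spec[of _ "(-3,0)"], unfold nb_sites, algebra)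
  have D: "ord F 4 (\<lambda>e. q e (-2,-1) - of_real e * (q e (-2,0) + q e (-1,-1)))"
  proof (rule ord_ev[OF eq])
    show "ord F 4 (\<lambda>e. of_real e * (q e (-3,-1) + q e (-2,-2)) + cub e (-2,-1))"
      by (rule ord_le, (rule h3 c6 ord_rules)+, simp)
  qed (drule spec[of _ "(-2,-1)"], unfold nb_sites, algebra)
  have E: "ord F 4 (\<lambda>e. q e (-2,1) - of_real e * (q e (-2,0) + q e (-1,1)))"
  proof (rule ord_ev[OF eq])
    show "ord F 4 (\<lambda>e. of_real e * (q e (-3,1) + q e (-2,2)) + cub e (-2,1))"
      by (rule ord_le, (rule h3 c6 ord_rules)+, simp)
  qed (drule spec[of _ "(-2,1)"], unfold nb_sites, algebra)
  have D': "ord F 4 (\<lambda>e. q e (-1,-2) - of_real e * (q e (0,-2) + q e (-1,-1)))"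
  proof (rule ord_ev[OF eq])
    show "ord F 4 (\<lambda>e. of_real e * (q e (-2,-2) + q e (-1,-3)) + cub e (-1,-2))"
      by (rule ord_le, (rule h3 c6 ord_rules)+, simp)
  qed (drule spec[of _ "(-1,-2)"], unfold nb_sites, algebra)
  have E': "ord F 4 (\<lambda>e. q e (-1,2) - of_real e * (q e (0,2) + q e (-1,1)))"
  proof (rule ord_ev[OF eq])
    show "ord F 4 (\<lambda>e. of_real e * (q e (-2,2) + q e (-1,3)) + cub e (-1,2))"
      by (rule ord_le, (rule h3 c6 ord_rules)+, simp)
  qed (drule spec[of _ "(-1,2)"], unfold nb_sites, algebra)
  have c3: "ord F 3 (\<lambda>e. cub e (-2,0))" "ord F 3 (\<lambda>e. cub e (-1,-1))" "ord F 3 (\<lambda>e. cub e (-1,1))"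
    unfolding cub_def by (rule ord_le, (rule o1 ord_rules)+, simp)+
  have qA: "ord F 3 (\<lambda>e. q e (-2,0) - of_real e * q e (-1,0))"
  proof (rule ord_ev[OF eq])
    show "ord F 3 (\<lambda>e. of_real e * (q e (-3,0) + q e (-2,1) + q e (-2,-1)) + cub e (-2,0))"
      by (rule ord_le, (rule h2 c3 ord_rules)+, simp)
  qed (drule spec[of _ "(-2,0)"], unfold nb_sites, algebra)
  have qB: "ord F 3 (\<lambda>e. q e (-1,-1) - of_real e * (q e (-1,0) + q e (0,-1)))"
  proof (rule ord_ev[OF eq])
    show "ord F 3 (\<lambda>e. of_real e * (q e (-2,-1) + q e (-1,-2)) + cub e (-1,-1))"
      by (rule ord_le, (rule h2 c3 ord_rules)+, simp)
  qed (drule spec[of _ "(-1,-1)"], unfold nb_sites, algebra)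
  have qB': "ord F 3 (\<lambda>e. q e (-1,1) - of_real e * (q e (-1,0) + q e (0,1)))"
  proof (rule ord_ev[OF eq])
    show "ord F 3 (\<lambda>e. of_real e * (q e (-2,1) + q e (-1,2)) + cub e (-1,1))"
      by (rule ord_le, (rule h2 c3 ord_rules)+, simp)
  qed (drule spec[of _ "(-1,1)"], unfold nb_sites, algebra)
  define K where "K e = cub e (-2,0) + cub e (-1,-1) + cub e (-1,1)" for e
  have nq: "ord F 4 (\<lambda>e. nbr_sum (q e) (-1,0) - 3 * of_real e * q e (-1,0) - K e)"
  proof (rule ord_ev[OF eventually_conj[OF eq sym]])
    show "ord F 4 (\<lambda>e. of_real e * ((q e (-3,0) - of_real e * q e (-2,0)) + 2 * (q e (-2,-1) - of_real e * (q e (-2,0) + q e (-1,-1)))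
       + 2 * (q e (-2,1) - of_real e * (q e (-2,0) + q e (-1,1))) + (q e (-1,-2) - of_real e * (q e (0,-2) + q e (-1,-1)))
       + (q e (-1,2) - of_real e * (q e (0,2) + q e (-1,1))))
       + of_real e ^ 2 * (5 * (q e (-2,0) - of_real e * q e (-1,0)) + 3 * (q e (-1,-1) - of_real e * (q e (-1,0) + q e (0,-1)))
         + 3 * (q e (-1,1) - of_real e * (q e (-1,0) + q e (0,1)))) + 11 * of_real e ^ 3 * q e (-1,0))"
      by (rule ord_le, (rule C D E D' E' qA qB qB' q1 ord_rules)+, simp)
    fix e assume a: "(\<forall>x. q e x = of_real e * nbr_sum (q e) x + cub e x) \<and> (u e (0,0) = 0 \<and> q e (0,0) = 0) \<and> u e (0,1) = - u e (0,-1) \<and> q e (0,1) = - q e (0,-1)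
     \<and> v e (0,1) = - v e (0,-1) \<and> q e (1,0) = - q e (-1,0) \<and> q e (0,2) = - q e (0,-2)"
    then have h: "q e (-2,0) = of_real e * nbr_sum (q e) (-2,0) + cub e (-2,0)" "q e (-1,-1) = of_real e * nbr_sum (q e) (-1,-1) + cub e (-1,-1)"
      "q e (-1,1) = of_real e * nbr_sum (q e) (-1,1) + cub e (-1,1)" by blast+
    from a have s: "q e (0,0) = 0" "q e (0,1) = - q e (0,-1)" "q e (0,2) = - q e (0,-2)" by blast+
    show "nbr_sum (q e) (-1,0) - 3 * of_real e * q e (-1,0) - K e = of_real e * ((q e (-3,0) - of_real e * q e (-2,0)) + 2 * (q e (-2,-1) - of_real e * (q e (-2,0) + q e (-1,-1)))
       + 2 * (q e (-2,1) - of_real e * (q e (-2,0) + q e (-1,1))) + (q e (-1,-2) - of_real e * (q e (0,-2) + q e (-1,-1)))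
       + (q e (-1,2) - of_real e * (q e (0,2) + q e (-1,1))))
       + of_real e ^ 2 * (5 * (q e (-2,0) - of_real e * q e (-1,0)) + 3 * (q e (-1,-1) - of_real e * (q e (-1,0) + q e (0,-1)))
         + 3 * (q e (-1,1) - of_real e * (q e (-1,0) + q e (0,1)))) + 11 * of_real e ^ 3 * q e (-1,0)"
      using h s unfolding K_def nb_sites by algebra
  qed
  have nu: "ord F 3 (\<lambda>e. nbr_sum (u e) (-1,0) - 3 * of_real e * u e (-1,0))"
  proof (rule ord_ev[OF sym])
    show "ord F 3 (\<lambda>e. (u e (-2,0) - of_real e * u e (-1,0)) + (u e (-1,-1) - of_real e * (u e (-1,0) + u e (0,-1))) + (u e (-1,1) - of_real e * (u e (-1,0) + u e (0,1))))"
      by (rule ord_le, (rule u_near3 ord_rules)+, simp)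
  qed (unfold nb_sites, elim conjE, algebra)
  have K3: "ord F 3 K" unfolding K_def[abs_def] by (rule ord_le, (rule c3 ord_rules)+, simp)
  have Kbal: "ord F 4 (\<lambda>e. K e - cnj (K e))"
  proof (rule ord_ev[OF eventually_conj[OF current_q J_pos]])
    let ?w = "\<lambda>e. nbr_sum (u e) (-1,0) - 3 * of_real e * u e (-1,0)" and ?z = "\<lambda>e. nbr_sum (q e) (-1,0) - 3 * of_real e * q e (-1,0) - K e"
    let ?c = "\<lambda>e. v e (-1,0) - 1"
    show "ord F 4 (\<lambda>e. q e (-1,0) * cnj (?w e) - cnj (q e (-1,0)) * ?w e - cnj (v e (-1,0)) * ?z e + v e (-1,0) * cnj (?z e)
       - cnj (?c e) * K e + ?c e * cnj (K e))"
      by (rule ord_le, (rule nq nu q1 K3 v.base_nodes v.u0 ord_rules)+, simp)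
    fix e assume a: "(\<forall>x. cnj (q e x) * nbr_sum (u e) x + cnj (v e x) * nbr_sum (q e) x = q e x * cnj (nbr_sum (u e) x) + v e x * cnj (nbr_sum (q e) x)) \<and> 0 < node_dist (u e) (v e)"
    then have h: "cnj (q e (-1,0)) * nbr_sum (u e) (-1,0) + cnj (v e (-1,0)) * nbr_sum (q e) (-1,0)
         = q e (-1,0) * cnj (nbr_sum (u e) (-1,0)) + v e (-1,0) * cnj (nbr_sum (q e) (-1,0))" by blast
    define j where "j = complex_of_real (node_dist (u e) (v e))"
    have j: "cnj j = j" by (simp add: j_def)
    have d: "v e (-1,0) = u e (-1,0) + j * q e (-1,0)" using a by (simp add: q_def j_def)
    have dc: "cnj (v e (-1,0)) = cnj (u e (-1,0)) + j * cnj (q e (-1,0))" by (simp add: d j)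
    show "K e - cnj (K e) = q e (-1,0) * cnj (?w e) - cnj (q e (-1,0)) * ?w e - cnj (v e (-1,0)) * ?z e + v e (-1,0) * cnj (?z e)
       - cnj (?c e) * K e + ?c e * cnj (K e)"
      using h d dc
      unfolding complex_cnj_diff complex_cnj_add complex_cnj_mult complex_cnj_complex_of_real complex_cnj_numeral complex_cnj_one by algebra
  qed
  have cubA: "ord F 4 (\<lambda>e. cub e (-2,0) - of_real e ^ 3 * (2 * q e (-1,0) + cnj (q e (-1,0))))"
  proof -
    have "ord F 3 (\<lambda>e. cub e (-2,0))" by (rule c3)
    let ?E = "complex_of_real"
    have a: "ord F 2 (\<lambda>e. u e (-2,0) - ?E e)" "ord F 2 (\<lambda>e. v e (-2,0) - ?E e)"
    proof -
      have "ord F 2 (\<lambda>e. (u e (-2,0) - ?E e * u e (-1,0)) + ?E e * (u e (-1,0) - 1))" "ord F 2 (\<lambda>e. (v e (-2,0) - ?E e * v e (-1,0)) + ?E e * (v e (-1,0) - 1))"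
        by (rule ord_le, (rule u_near3 v.u_near3 base_nodes v.base_nodes ord_rules)+, simp)+
      then show "ord F 2 (\<lambda>e. u e (-2,0) - ?E e)" "ord F 2 (\<lambda>e. v e (-2,0) - ?E e)" by (simp_all add: algebra_simps)
    qed
    let ?a = "\<lambda>e. u e (-2,0) - ?E e" and ?c = "\<lambda>e. v e (-2,0) - ?E e" and ?q = "\<lambda>e. q e (-2,0) - ?E e * q e (-1,0)"
    have "ord F 4 (\<lambda>e. (?c e + ?a e) * cnj (v e (-2,0)) * q e (-2,0) + 2 * ?E e * cnj (?c e) * q e (-2,0) + 2 * ?E e ^ 2 * ?q e
      + ?a e * u e (-2,0) * cnj (q e (-2,0)) + ?E e * ?a e * cnj (q e (-2,0)) + ?E e ^ 2 * cnj (?q e))"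
      by (rule ord_le, (rule a qA o1 ord_rules)+, simp)
    moreover have "(?c e + ?a e) * cnj (v e (-2,0)) * q e (-2,0) + 2 * ?E e * cnj (?c e) * q e (-2,0) + 2 * ?E e ^ 2 * ?q e
      + ?a e * u e (-2,0) * cnj (q e (-2,0)) + ?E e * ?a e * cnj (q e (-2,0)) + ?E e ^ 2 * cnj (?q e) = cub e (-2,0) - ?E e ^ 3 * (2 * q e (-1,0) + cnj (q e (-1,0)))" for e
      unfolding cub_def complex_cnj_diff complex_cnj_mult complex_cnj_complex_of_real by algebra
    ultimately show ?thesis by simp
  qed
  have ab: "ord F 2 (\<lambda>e. w e (-1,-1) - of_real e * (1 + \<i>))" "ord F 2 (\<lambda>e. w e (-1,1) - of_real e * (1 - \<i>))"
    if "near_cross F w C" for w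
  proof -
    interpret w: near_cross F w C by fact
    have "ord F 2 (\<lambda>e. (w e (-1,-1) - of_real e * (w e (-1,0) + w e (0,-1))) + of_real e * ((w e (-1,0) - 1) + (w e (0,-1) - \<i>)))"
      "ord F 2 (\<lambda>e. (w e (-1,1) - of_real e * (w e (-1,0) + w e (0,1))) + of_real e * ((w e (-1,0) - 1) + (w e (0,1) + \<i>)))"
      by (rule ord_le, (rule w.u_near3 w.base_nodes ord_rules)+, simp)+
    then show "ord F 2 (\<lambda>e. w e (-1,-1) - of_real e * (1 + \<i>))" "ord F 2 (\<lambda>e. w e (-1,1) - of_real e * (1 - \<i>))" by (simp_all add: algebra_simps)
  qed
  note abu = ab[OF near_cross_axioms] and abv = ab[OF v.near_cross_axioms]
  have i: "\<i> * \<i> = -1" by simp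
  have cubB: "ord F 4 (\<lambda>e. cub e (-1,-1) - of_real e ^ 3 * (4 * (q e (-1,0) + q e (0,-1)) + 2 * \<i> * cnj (q e (-1,0) + q e (0,-1))))"
  proof -
    let ?E = "complex_of_real"
    let ?a = "\<lambda>e. u e (-1,-1) - ?E e * (1 + \<i>)" and ?c = "\<lambda>e. v e (-1,-1) - ?E e * (1 + \<i>)" and ?q = "\<lambda>e. q e (-1,-1) - ?E e * (q e (-1,0) + q e (0,-1))"
    have "ord F 4 (\<lambda>e. (?c e + ?a e) * cnj (v e (-1,-1)) * q e (-1,-1) + 2 * ?E e * (1 + \<i>) * cnj (?c e) * q e (-1,-1) + 4 * ?E e ^ 2 * ?q e
      + ?a e * u e (-1,-1) * cnj (q e (-1,-1)) + ?E e * (1 + \<i>) * ?a e * cnj (q e (-1,-1)) + 2 * \<i> * ?E e ^ 2 * cnj (?q e))"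
      by (rule ord_le, (rule abu abv qB o1 ord_rules)+, simp)
    moreover have "(?c e + ?a e) * cnj (v e (-1,-1)) * q e (-1,-1) + 2 * ?E e * (1 + \<i>) * cnj (?c e) * q e (-1,-1) + 4 * ?E e ^ 2 * ?q e
      + ?a e * u e (-1,-1) * cnj (q e (-1,-1)) + ?E e * (1 + \<i>) * ?a e * cnj (q e (-1,-1)) + 2 * \<i> * ?E e ^ 2 * cnj (?q e)
      = cub e (-1,-1) - ?E e ^ 3 * (4 * (q e (-1,0) + q e (0,-1)) + 2 * \<i> * cnj (q e (-1,0) + q e (0,-1)))" for e
      using i unfolding cub_def complex_cnj_diff complex_cnj_add complex_cnj_mult complex_cnj_complex_of_real complex_cnj_i complex_cnj_one by algebra
    ultimately show ?thesis by simp
  qed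
  have cubB': "ord F 4 (\<lambda>e. cub e (-1,1) - of_real e ^ 3 * (4 * (q e (-1,0) + q e (0,1)) - 2 * \<i> * cnj (q e (-1,0) + q e (0,1))))"
  proof -
    let ?E = "complex_of_real"
    let ?a = "\<lambda>e. u e (-1,1) - ?E e * (1 - \<i>)" and ?c = "\<lambda>e. v e (-1,1) - ?E e * (1 - \<i>)" and ?q = "\<lambda>e. q e (-1,1) - ?E e * (q e (-1,0) + q e (0,1))"
    have "ord F 4 (\<lambda>e. (?c e + ?a e) * cnj (v e (-1,1)) * q e (-1,1) + 2 * ?E e * (1 - \<i>) * cnj (?c e) * q e (-1,1) + 4 * ?E e ^ 2 * ?q e
      + ?a e * u e (-1,1) * cnj (q e (-1,1)) + ?E e * (1 - \<i>) * ?a e * cnj (q e (-1,1)) - 2 * \<i> * ?E e ^ 2 * cnj (?q e))"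
      by (rule ord_le, (rule abu abv qB' o1 ord_rules)+, simp)
    moreover have "(?c e + ?a e) * cnj (v e (-1,1)) * q e (-1,1) + 2 * ?E e * (1 - \<i>) * cnj (?c e) * q e (-1,1) + 4 * ?E e ^ 2 * ?q e
      + ?a e * u e (-1,1) * cnj (q e (-1,1)) + ?E e * (1 - \<i>) * ?a e * cnj (q e (-1,1)) - 2 * \<i> * ?E e ^ 2 * cnj (?q e)
      = cub e (-1,1) - ?E e ^ 3 * (4 * (q e (-1,0) + q e (0,1)) - 2 * \<i> * cnj (q e (-1,0) + q e (0,1)))" for e
      using i unfolding cub_def complex_cnj_diff complex_cnj_add complex_cnj_mult complex_cnj_complex_of_real complex_cnj_i complex_cnj_one by algebra
    ultimately show ?thesis by simp
  qed
  define c where "c = \<i> / 4"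
  have c: "4 * c = \<i>" by (simp add: c_def)
  have "ord F 4 (\<lambda>e. of_real e ^ 3 * (q e (0,-1) + cnj (q e (0,-1))))"
  proof (rule ord_ev[OF sym])
    let ?k = "\<lambda>e. (cub e (-2,0) - of_real e ^ 3 * (2 * q e (-1,0) + cnj (q e (-1,0))))
       + (cub e (-1,-1) - of_real e ^ 3 * (4 * (q e (-1,0) + q e (0,-1)) + 2 * \<i> * cnj (q e (-1,0) + q e (0,-1))))
       + (cub e (-1,1) - of_real e ^ 3 * (4 * (q e (-1,0) + q e (0,1)) - 2 * \<i> * cnj (q e (-1,0) + q e (0,1))))"
    show "ord F 4 (\<lambda>e. c * (?k e - cnj (?k e) - (K e - cnj (K e)) + of_real e ^ 3 * 9 * (q e (-1,0) - cnj (q e (-1,0)))))"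
      by (rule ord_le, (rule cubA cubB cubB' Kbal q1 ord_rules)+, simp)
    fix e assume a: "(u e (0,0) = 0 \<and> q e (0,0) = 0) \<and> u e (0,1) = - u e (0,-1) \<and> q e (0,1) = - q e (0,-1)
     \<and> v e (0,1) = - v e (0,-1) \<and> q e (1,0) = - q e (-1,0) \<and> q e (0,2) = - q e (0,-2)"
    then have s: "q e (0,1) = - q e (0,-1)" by blast
    show "of_real e ^ 3 * (q e (0,-1) + cnj (q e (0,-1))) = c * (?k e - cnj (?k e) - (K e - cnj (K e)) + of_real e ^ 3 * 9 * (q e (-1,0) - cnj (q e (-1,0))))"
    proof -
      define x y t where "x = q e (-1,0)" and "y = q e (0,-1)" and "t = complex_of_real e ^ 3"
      have t: "cnj t = t" by (simp add: t_def)
      define kk where "kk = ?k e"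
      have k: "kk = K e - t * (10 * x + cnj x + 4 * \<i> * cnj y)"
        unfolding kk_def K_def s x_def[symmetric] y_def[symmetric] t_def[symmetric] by (simp add: algebra_simps)
      have kc: "cnj kk = cnj (K e) - t * (10 * cnj x + x - 4 * \<i> * y)"
        unfolding k complex_cnj_diff complex_cnj_mult t by simp
      have "t * (y + cnj y) = c * (kk - cnj kk - (K e - cnj (K e)) + t * 9 * (x - cnj x))"
        by (subst kc, subst k) (rule cubic_balance[OF c])
      then show ?thesis unfolding x_def y_def t_def kk_def .
    qed
  qed
  then have ph2: "ord F 1 (\<lambda>e. q e (0,-1) + cnj (q e (0,-1)))"
    by (rule ord_div) simp
  have "ord F 1 (\<lambda>e. (1/2) * ((q e (0,-1) - cnj (q e (0,-1))) + (q e (0,-1) + cnj (q e (0,-1)))))"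
    by (rule ord_le, (rule amplitude ph2 ord_rules)+, simp)
  then have q2: "ord F 1 (\<lambda>e. q e (0,-1))" by simp
  have 3: "ord F 1 (\<lambda>e. q e (1,0))" by (rule ord_ev[OF sym _ ord_minus[OF q1]]) blast
  have 4: "ord F 1 (\<lambda>e. q e (0,1))" by (rule ord_ev[OF sym _ ord_minus[OF q2]]) blast
  show False by (rule nodes_contra) (use q1 q2 3 4 in \<open>auto simp: set_S0\<close>)
qed

end

lemma near_cross_mono:
  assumes "near_cross F u C" "F' \<le> F" "C \<le> C'" shows "near_cross F' u C'"
proof -
  interpret near_cross F u C by fact
  show ?thesis
  proof unfold_locales
    show F': "F' \<le> at_right 0" using assms(2) F by order
    show "eventually (\<lambda>e. stationary e (u e)) F'" using st_u assms(2) by (rule filter_leD[rotated])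
    have "eventually (\<lambda>e. \<forall>x. cmod (u e x - base x) \<le> C' * e) F"
      using near_u ev_small
    proof eventually_elim
      case (elim e)
      have "C * e \<le> C' * e" using assms(3) elim(2) by (intro mult_right_mono) auto
      then show ?case using elim(1) order_trans by blast
    qed
    then show "eventually (\<lambda>e. \<forall>x. cmod (u e x - base x) \<le> C' * e) F'" using assms(2) by (rule filter_leD[rotated])
  qed
qed

lemma stationary_rot: assumes "stationary e u" "cmod c = 1" shows "stationary e (\<lambda>x. c * u (rot x))"
proof -
  have rm: "rot (east x) = north (rot x)" "rot (west x) = south (rot x)"
    "rot (north x) = west (rot x)" "rot (south x) = east (rot x)" for x by (cases x, simp add: moves)+
  have "of_real (1 - (cmod (c * u (rot x)))\<^sup>2) * (c * u (rot x)) = of_real e * nbr_sum (\<lambda>x. c * u (rot x)) x" for x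
  proof -
    have "of_real (1 - (cmod (u (rot x)))\<^sup>2) * u (rot x) = of_real e * nbr_sum u (rot x)"
      using assms(1) unfolding stationary_def by blast
    moreover have "nbr_sum (\<lambda>x. c * u (rot x)) x = c * nbr_sum u (rot x)"
      by (simp add: nbr_sum_moves rm algebra_simps)
    ultimately show ?thesis using assms(2) by (simp only: norm_mult mult_1_left) (simp only: mult.left_commute[of _ c])
  qed
  then show ?thesis unfolding stationary_def by blast
qed

text \<open>
  If the solutions differed for arbitrarily small \<open>\<epsilon>\<close>, the filter concentrated on those \<open>\<epsilon>\<close> would be nontrivial.
\<close>

lemma eventually_unique:
  assumes u: "near_cross (at_right 0) u C" and v: "near_cross (at_right 0) v C"
    and contra: "\<And>F. F \<le> at_right 0 \<Longrightarrow> two_solutions F u v C \<Longrightarrow> False"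
  shows "eventually (\<lambda>e. v e = u e) (at_right 0)"
proof -
  interpret u: near_cross "at_right 0" u C by fact
  interpret v: near_cross "at_right 0" v C by fact
  define F where "F = inf (at_right 0) (principal {e. node_dist (u e) (v e) \<noteq> 0})"
  have F: "F \<le> at_right 0" by (simp add: F_def)
  have "F = bot"
  proof (rule ccontr)
    assume nb: "F \<noteq> bot"
    have "two_solutions F u v C"
      unfolding two_solutions_def two_solutions_axioms_def
      using near_cross_mono[OF u F order_refl] near_cross_mono[OF v F order_refl] nb
      by (simp add: F_def eventually_inf_principal)
    then show False by (rule contra[OF F])
  qed
  then have "eventually (\<lambda>e. node_dist (u e) (v e) = 0) (at_right 0)"
    using eventually_inf_principal[of "\<lambda>e. False" "at_right 0" "{e. node_dist (u e) (v e) \<noteq> 0}"]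
    by (simp add: F_def eventually_False)
  moreover have "eventually (\<lambda>e. 4 * e + 3 * (C * e)\<^sup>2 \<le> 1/2) (at_right (0::real))"
  proof -
    have "((\<lambda>e::real. 4 * e + 3 * (C * e)\<^sup>2) \<longlongrightarrow> 4 * 0 + 3 * (C * 0)\<^sup>2) (at_right 0)" by (intro tendsto_intros)
    then have "eventually (\<lambda>e::real. 4 * e + 3 * (C * e)\<^sup>2 < 1/2) (at_right 0)" by (rule order_tendstoD) simp
    then show ?thesis by eventually_elim simp
  qed
  ultimately show ?thesis using u.st_u v.st_u u.near_u v.near_u u.ev_small
  proof eventually_elim
    case (elim e)
    show ?case
    proof
      fix x
      have "cmod (v e x - u e x) \<le> 0"
      proof (cases "x \<in> set S0")
        case True
        then show ?thesis using node_le[OF True, of "v e" "u e"] elim(1) by simp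
      next
        case False
        then show ?thesis using off_node_dist[OF elim(3,4) _ _ _ elim(2) False] elim by simp
      qed
      then show "v e x = u e x" by simp
    qed
  qed
qed

text \<open>
  The negative of the solution after a half turn is a second solution, and its difference to the first takes the same value at opposite nodes, so \<open>phase_balance\<close> applies.
\<close>

lemma eventually_odd:
  assumes u: "near_cross (at_right 0) u C"
  shows "eventually (\<lambda>e. \<forall>x. u e (rot (rot x)) = - u e x) (at_right 0)"
proof -
  interpret u: near_cross "at_right 0" u C by fact
  define v where "v e x = - u e (rot (rot x))" for e x
  have v: "near_cross (at_right 0) v C"
  proof unfold_locales
    show "eventually (\<lambda>e. stationary e (v e)) (at_right 0)"
      using u.st_u
    proof eventually_elim
      case (elim e)
      have "stationary e (\<lambda>x. \<i> * (\<i> * u e (rot (rot x))))"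
        by (rule stationary_rot[OF stationary_rot[OF elim]]) simp_all
      then show ?case by (simp add: v_def[abs_def] mult.assoc[symmetric])
    qed
    show "eventually (\<lambda>e. \<forall>x. cmod (v e x - base x) \<le> C * e) (at_right 0)"
      using u.near_u
    proof eventually_elim
      case (elim e)
      show ?case
      proof
        fix x
        have "base (rot (rot x)) = - base x" by (simp add: base_rot mult.assoc[symmetric])
        then have "cmod (v e x - base x) = cmod (u e (rot (rot x)) - base (rot (rot x)))"
          unfolding v_def by (metis (no_types, lifting) minus_diff_eq minus_diff_minus minus_minus norm_minus_cancel)
        then show "cmod (v e x - base x) \<le> C * e" using elim by simp
      qed
    qed
  qed
  have "eventually (\<lambda>e. v e = u e) (at_right 0)"
  proof (rule eventually_unique[OF u v])
    fix F assume F: "F \<le> at_right 0" and "two_solutions F u v C"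
    then interpret two_solutions F u v C by simp
    show False
    proof (rule phase_balance, rule always_eventually, intro allI)
      fix e
      have "rot (rot (1,0)) = (-1,0)" "rot (rot (-1,0)) = (1,0)" "rot (rot (0,1)) = (0,-1)" "rot (rot (0,-1)) = (0,1)" by (simp_all add: rot_def)
      then show "q e (1,0) = q e (-1,0) \<and> q e (0,1) = q e (0,-1)" by (simp add: q_def v_def add.commute)
    qed
  qed
  then show ?thesis
  proof eventually_elim
    case (elim e)
    then show ?case unfolding v_def fun_eq_iff by (metis minus_minus)
  qed
qed

text \<open>
  The solution after a quarter turn, multiplied by a suitable phase, agrees with the original by \<open>odd_unique\<close>. Applying this
  twice shows that the square of the phase is fixed, and closeness to the cross determines its sign.
\<close>

lemma eventually_rot:
  assumes u: "near_cross (at_right 0) u C"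
  shows "eventually (\<lambda>e. \<forall>x. u e (rot x) = \<i> * u e x) (at_right 0)"
proof -
  interpret u: near_cross "at_right 0" u C by fact
  have C: "C \<ge> 0"
  proof -
    have "\<not> eventually (\<lambda>e::real. False) (at_right 0)" by (simp add: eventually_False)
    moreover have "eventually (\<lambda>e. C \<ge> 0) (at_right (0::real))"
      using u.near_u u.ev_small by eventually_elim (meson norm_ge_zero order_trans zero_le_mult_iff not_le)
    ultimately show ?thesis by (meson eventually_mono)
  qed
  \<comment> \<open>\<open>c\<close> is a gauge factor that makes the first node value of the rotated solution a positive multiple of the original one.\<close>
  define r where "r e = u e (-1,0) / u e (0,-1)" for e
  define c where "c e = \<i> * sgn (r e)" for e
  define v where "v e x = (- \<i> * c e) * u e (rot x)" for e x
  have small: "eventually (\<lambda>e. C * e \<le> 1/8) (at_right (0::real))"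
  proof -
    have "((\<lambda>e::real. C * e) \<longlongrightarrow> C * 0) (at_right 0)" by (intro tendsto_intros)
    then have "eventually (\<lambda>e::real. C * e < 1/8) (at_right 0)" by (rule order_tendstoD) simp
    then show ?thesis by eventually_elim simp
  qed
  have node: "eventually (\<lambda>e. u e (-1,0) \<noteq> 0 \<and> u e (0,-1) \<noteq> 0 \<and> cmod (c e) = 1 \<and> cmod (c e - 1) \<le> 8 * (C * e)) (at_right 0)"
    using u.near_u small u.ev_small
  proof eventually_elim
    case (elim e)
    define a b where "a = u e (-1,0)" and "b = u e (0,-1)"
    define s where "s = C * e"
    have s: "0 \<le> s" "s \<le> 1/8" using elim C by (simp_all add: s_def)
    have ab: "cmod (a - 1) \<le> s" "cmod (b - \<i>) \<le> s"
      using elim(1)[rule_format, of "(-1,0)"] elim(1)[rule_format, of "(0,-1)"] by (simp_all add: a_def b_def base_def s_def)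
    have nb: "cmod b \<ge> 1 - s" using norm_triangle_ineq2[of \<i> "b"] ab by (simp add: norm_minus_commute)
    have na: "cmod a \<ge> 1 - s" using norm_triangle_ineq2[of 1 "a"] ab by (simp add: norm_minus_commute)
    have nz: "a \<noteq> 0" "b \<noteq> 0" using na nb s by auto
    define z where "z = \<i> * (a / b)"
    have "z - 1 = (\<i> * (a - 1) - (b - \<i>)) / b" using nz by (simp add: z_def field_simps)
    then have "cmod (z - 1) = cmod (\<i> * (a - 1) - (b - \<i>)) / cmod b" by (simp add: norm_divide)
    also have "\<dots> \<le> (s + s) / (1/2)"
    proof (rule frac_le)
      show "cmod (\<i> * (a - 1) - (b - \<i>)) \<le> s + s"
        using norm_triangle_ineq4[of "\<i> * (a - 1)" "b - \<i>"] ab by (simp add: norm_mult)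
      show "1/2 \<le> cmod b" using nb s by simp
    qed (use s in auto)
    finally have z: "cmod (z - 1) \<le> 4 * s" by simp
    have zn: "z \<noteq> 0" using nz by (simp add: z_def)
    have "c e = sgn z" by (simp add: c_def r_def z_def a_def b_def sgn_mult) (simp add: sgn_eq)
    have "cmod (sgn z - z) \<le> 4 * s"
    proof -
      have "sgn z - z = sgn z * of_real (1 - cmod z)" using zn by (simp add: sgn_eq field_simps)
      then have "cmod (sgn z - z) = \<bar>1 - cmod z\<bar>" using zn by (simp add: norm_mult norm_sgn del: of_real_diff)
      also have "\<dots> \<le> cmod (z - 1)" using norm_triangle_ineq3[of z 1] by (simp add: abs_minus_commute)
      finally show ?thesis using z by simp
    qed
    then have "cmod (sgn z - 1) \<le> 8 * s" using norm_triangle_ineq[of "sgn z - z" "z - 1"] z by simp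
    then show ?case using nz zn \<open>c e = sgn z\<close> by (simp add: a_def b_def s_def norm_sgn)
  qed
  have nb: "near_cross (at_right 0) v (17 * C)"
  proof unfold_locales
    show "eventually (\<lambda>e. stationary e (v e)) (at_right 0)"
      using u.st_u node
    proof eventually_elim
      case (elim e)
      show ?case unfolding v_def[abs_def] by (rule stationary_rot[OF elim(1)]) (use elim in \<open>simp add: norm_mult\<close>)
    qed
    show "eventually (\<lambda>e. \<forall>x. cmod (v e x - base x) \<le> 17 * C * e) (at_right 0)"
      using u.near_u node small u.ev_small
    proof eventually_elim
      case (elim e)
      show ?case
      proof
        fix x
        have bx: "cmod (base x) \<le> 1" by (simp add: base_def)
        have b: "base x = - \<i> * base (rot x)" by (simp add: base_rot mult.assoc[symmetric])
        have "v e x - base x = (- \<i> * c e) * (u e (rot x) - base (rot x)) + (c e - 1) * base x"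
          unfolding v_def by (subst (2) b, subst b) (simp add: algebra_simps)
        also have "cmod \<dots> \<le> cmod (u e (rot x) - base (rot x)) + cmod (c e - 1) * cmod (base x)"
          by (rule norm_triangle_le) (use elim in \<open>simp add: norm_mult\<close>)
        also have "\<dots> \<le> C * e + (8 * (C * e)) * 1"
          using elim bx mult_nonneg_nonneg[OF C, of e] by (intro add_mono mult_mono) auto
        also have "\<dots> \<le> 17 * C * e" using mult_nonneg_nonneg[OF C, of e] elim by simp
        finally show "cmod (v e x - base x) \<le> 17 * C * e" .
      qed
    qed
  qed
  have odd: "eventually (\<lambda>e. \<forall>x. u e (rot (rot x)) = - u e x) (at_right 0)" by (rule eventually_odd[OF u])
  have "eventually (\<lambda>e. v e = u e) (at_right 0)"
  proof (rule eventually_unique[OF near_cross_mono[OF u order_refl] nb])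
    show "C \<le> 17 * C" using C by simp
    fix F assume F: "F \<le> at_right 0" and "two_solutions F u v (17 * C)"
    then interpret two_solutions F u v "17 * C" by simp
    show False
    proof (rule odd_unique)
      show "eventually (\<lambda>e. \<forall>x. u e (rot (rot x)) = - u e x \<and> v e (rot (rot x)) = - v e x) F"
        using ev[OF odd] by eventually_elim (simp add: v_def)
      show "eventually (\<lambda>e. cnj (u e (-1,0)) * v e (-1,0) = u e (-1,0) * cnj (v e (-1,0))) F"
        using ev[OF node]
      proof eventually_elim
        case (elim e)
        have rt: "rot (-1,0) = (0,-1)" by (simp add: rot_def)
        have "v e (-1,0) = sgn (r e) * u e (0,-1)" by (simp add: v_def c_def rt mult.assoc[symmetric])
        also have "\<dots> = of_real (1 / cmod (r e)) * u e (-1,0)"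
          using elim by (simp add: r_def sgn_eq norm_divide)
        finally show ?case by simp
      qed
    qed
  qed
  from this odd node small u.ev_small show ?thesis
  proof eventually_elim
    case (elim e)
    have c0: "c e \<noteq> 0" using elim(3) by auto
    have ci: "inverse (c e) * c e = 1" using c0 by simp
    have r1: "u e (rot x) = \<i> * inverse (c e) * u e x" for x
    proof -
      have "u e x = (- \<i> * c e) * u e (rot x)" using elim(1) by (metis v_def)
      then show ?thesis using c0 by (simp add: field_simps)
    qed
    have "u e (rot (rot (-1,0))) = - (inverse (c e) * inverse (c e)) * u e (-1,0)"
      by (simp add: r1 algebra_simps)
    then have "inverse (c e) * inverse (c e) = 1" using elim(2,3) by simp
    then have "c e * c e = 1" using c0 by (simp add: field_simps)
    then have "c e = 1 \<or> c e = -1" by (simp add: square_eq_1_iff)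
    moreover have "c e \<noteq> -1"
    proof
      assume "c e = -1"
      then have "2 \<le> 8 * (C * e)" using elim(3) by simp
      then show False using elim(4) by simp
    qed
    ultimately show ?case using r1 by simp
  qed
qed

section \<open>Expansion of the profile\<close>

text \<open>
  The common structure of the profile and of the two components of a mode: a field with a rotation character \<open>\<zeta>\<close> that solves a linear
  equation away from the nodes, up to a cubic term. Up to rotation, the sites with \<open>l1\<close> equal to one, two or three are the six that are
  named below.
\<close>

locale lin_field = germ F for F +
  fixes g cub :: "real \<Rightarrow> int \<times> int \<Rightarrow> complex" and M :: "real \<Rightarrow> complex" and \<zeta> \<zeta>' :: complex
  assumes M: "ord F 1 M" and chi: "\<zeta> * \<zeta>' = 1"
    and rotg: "eventually (\<lambda>e. \<forall>x. g e (rot x) = \<zeta> * g e x) F"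
    and eqg: "eventually (\<lambda>e. \<forall>x. x \<notin> set S0 \<longrightarrow> (1 - M e) * g e x = of_real e * nbr_sum (g e) x + cub e x) F"
    and far: "\<And>n x. l1 x \<ge> n + 1 \<Longrightarrow> ord F n (\<lambda>e. g e x)"
    and cubfar: "\<And>x. l1 x \<ge> 3 \<Longrightarrow> ord F 6 (\<lambda>e. cub e x)"
begin

abbreviation "gN e \<equiv> g e (-1,0)"
abbreviation "A e \<equiv> g e (-2,0)"
abbreviation "B e \<equiv> g e (-1,-1)"
abbreviation "C e \<equiv> g e (-3,0)"
abbreviation "D e \<equiv> g e (-2,-1)"
abbreviation "E e \<equiv> g e (-2,1)"

lemma ordA: "ord F 1 (\<lambda>e. A e)" "ord F 1 (\<lambda>e. B e)" "ord F 2 (\<lambda>e. C e)" "ord F 2 (\<lambda>e. D e)" "ord F 2 (\<lambda>e. E e)"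
  "ord F 3 (\<lambda>e. g e (-4,0))" "ord F 3 (\<lambda>e. g e (-3,-1))" "ord F 3 (\<lambda>e. g e (-3,1))" "ord F 3 (\<lambda>e. g e (-2,-2))"
  "ord F 4 (\<lambda>e. g e (-5,0))" "ord F 4 (\<lambda>e. g e (-4,1))" "ord F 4 (\<lambda>e. g e (-4,-1))" "ord F 4 (\<lambda>e. g e (-3,-2))"
  "ord F 4 (\<lambda>e. g e (-3,2))" "ord F 4 (\<lambda>e. g e (-2,-3))" "ord F 0 (\<lambda>e. gN e)"
  by (rule far; simp add: l1_def)+

lemma cub6: "ord F 6 (\<lambda>e. cub e (-3,0))" "ord F 6 (\<lambda>e. cub e (-2,-1))" "ord F 6 (\<lambda>e. cub e (-2,1))"
  "ord F 6 (\<lambda>e. cub e (-4,0))" "ord F 6 (\<lambda>e. cub e (-3,-1))" "ord F 6 (\<lambda>e. cub e (-3,1))" "ord F 6 (\<lambda>e. cub e (-2,-2))"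
  by (rule cubfar; simp add: l1_def)+

lemma sites: "eventually (\<lambda>e. g e (-1,1) = \<zeta>' * B e \<and> g e (-1,-2) = \<zeta> * E e \<and> g e (-2,2) = \<zeta>' * g e (-2,-2)
    \<and> g e (0,-1) = \<zeta> * gN e \<and> g e (0,1) = \<zeta>' * gN e \<and> g e (1,0) = \<zeta> * \<zeta> * gN e \<and> g e (0,0) = \<zeta> * g e (0,0)) F"
  using rotg
proof eventually_elim
  case (elim e)
  have r: "rot (-1,1) = (-1,-1)" "rot (-2,1) = (-1,-2)" "rot (-2,2) = (-2,-2)" "rot (-1,0) = (0,-1)" "rot (0,1) = (-1,0)"
    "rot (0,-1) = (1,0)" "rot (0,0) = (0,0)" by (simp_all add: rot_def)
  have inv: "x = \<zeta>' * y" if "y = \<zeta> * x" for x y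
    using chi unfolding that by (simp add: mult.assoc[symmetric] mult.commute[of \<zeta>' \<zeta>])
  have "g e (0,0) = \<zeta> * g e (0,0)" using elim[rule_format, of "(0,0)"] r by simp
  moreover have "g e (-1,1) = \<zeta>' * B e" "g e (-2,2) = \<zeta>' * g e (-2,-2)" "g e (0,1) = \<zeta>' * gN e"
    using inv[OF elim[rule_format, of "(-1,1)"]] inv[OF elim[rule_format, of "(-2,2)"]] inv[OF elim[rule_format, of "(0,1)"]] r by simp_all
  moreover have "g e (-1,-2) = \<zeta> * E e" "g e (0,-1) = \<zeta> * gN e" "g e (1,0) = \<zeta> * \<zeta> * gN e"
    using elim[rule_format, of "(-2,1)"] elim[rule_format, of "(-1,0)"] elim[rule_format, of "(0,-1)"] r by simp_all
  ultimately show ?case by blast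
qed

lemma off_near_sites: "(-4,0) \<notin> set S0" "(-3,-1) \<notin> set S0" "(-3,1) \<notin> set S0" "(-2,-2) \<notin> set S0" "(-3,0) \<notin> set S0"
  "(-2,-1) \<notin> set S0" "(-2,1) \<notin> set S0" "(-2,0) \<notin> set S0" "(-1,-1) \<notin> set S0" "(0,0) \<notin> set S0" by (simp_all add: set_S0)

lemma eqs: "eventually (\<lambda>e.
    (1 - M e) * A e = of_real e * (gN e + C e + D e + E e) + cub e (-2,0) \<and>
    (1 - M e) * B e = of_real e * ((1 + \<zeta>) * gN e + D e + \<zeta> * E e) + cub e (-1,-1) \<and>
    (1 - M e) * C e = of_real e * (A e + g e (-4,0) + g e (-3,1) + g e (-3,-1)) + cub e (-3,0) \<and>
    (1 - M e) * D e = of_real e * (A e + B e + g e (-3,-1) + g e (-2,-2)) + cub e (-2,-1) \<and>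
    (1 - M e) * E e = of_real e * (A e + \<zeta>' * B e + g e (-3,1) + \<zeta>' * g e (-2,-2)) + cub e (-2,1)) F"
  "eventually (\<lambda>e.
    (1 - M e) * g e (-4,0) = of_real e * (C e + g e (-5,0) + g e (-4,1) + g e (-4,-1)) + cub e (-4,0) \<and>
    (1 - M e) * g e (-3,-1) = of_real e * (C e + D e + g e (-4,-1) + g e (-3,-2)) + cub e (-3,-1) \<and>
    (1 - M e) * g e (-3,1) = of_real e * (C e + E e + g e (-4,1) + g e (-3,2)) + cub e (-3,1) \<and>
    (1 - M e) * g e (-2,-2) = of_real e * (D e + \<zeta> * E e + g e (-3,-2) + g e (-2,-3)) + cub e (-2,-2)) F"
proof -
  have nb: "eventually (\<lambda>e. nbr_sum (g e) (-2,0) = gN e + C e + D e + E e \<and>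
      nbr_sum (g e) (-1,-1) = (1 + \<zeta>) * gN e + D e + \<zeta> * E e \<and>
      nbr_sum (g e) (-3,0) = A e + g e (-4,0) + g e (-3,1) + g e (-3,-1) \<and>
      nbr_sum (g e) (-2,-1) = A e + B e + g e (-3,-1) + g e (-2,-2) \<and>
      nbr_sum (g e) (-2,1) = A e + \<zeta>' * B e + g e (-3,1) + \<zeta>' * g e (-2,-2) \<and>
      nbr_sum (g e) (-4,0) = C e + g e (-5,0) + g e (-4,1) + g e (-4,-1) \<and>
      nbr_sum (g e) (-3,-1) = C e + D e + g e (-4,-1) + g e (-3,-2) \<and>
      nbr_sum (g e) (-3,1) = C e + E e + g e (-4,1) + g e (-3,2) \<and>
      nbr_sum (g e) (-2,-2) = D e + \<zeta> * E e + g e (-3,-2) + g e (-2,-3)) F"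
    using sites by eventually_elim (simp add: nb_sites algebra_simps)
  note both = eventually_conj[OF eqg nb]
  show "eventually (\<lambda>e.
    (1 - M e) * A e = of_real e * (gN e + C e + D e + E e) + cub e (-2,0) \<and>
    (1 - M e) * B e = of_real e * ((1 + \<zeta>) * gN e + D e + \<zeta> * E e) + cub e (-1,-1) \<and>
    (1 - M e) * C e = of_real e * (A e + g e (-4,0) + g e (-3,1) + g e (-3,-1)) + cub e (-3,0) \<and>
    (1 - M e) * D e = of_real e * (A e + B e + g e (-3,-1) + g e (-2,-2)) + cub e (-2,-1) \<and>
    (1 - M e) * E e = of_real e * (A e + \<zeta>' * B e + g e (-3,1) + \<zeta>' * g e (-2,-2)) + cub e (-2,1)) F"
    using both by eventually_elim (metis off_near_sites)
  show "eventually (\<lambda>e.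
    (1 - M e) * g e (-4,0) = of_real e * (C e + g e (-5,0) + g e (-4,1) + g e (-4,-1)) + cub e (-4,0) \<and>
    (1 - M e) * g e (-3,-1) = of_real e * (C e + D e + g e (-4,-1) + g e (-3,-2)) + cub e (-3,-1) \<and>
    (1 - M e) * g e (-3,1) = of_real e * (C e + E e + g e (-4,1) + g e (-3,2)) + cub e (-3,1) \<and>
    (1 - M e) * g e (-2,-2) = of_real e * (D e + \<zeta> * E e + g e (-3,-2) + g e (-2,-3)) + cub e (-2,-2)) F"
    using both by eventually_elim (metis off_near_sites)
qed

text \<open>The sites at distance four see only the sites at distance three, up to fifth order.\<close>

lemma near4:
  "ord F 5 (\<lambda>e. g e (-4,0) - of_real e * (1 + M e) * C e)"
  "ord F 5 (\<lambda>e. g e (-3,-1) - of_real e * (1 + M e) * (C e + D e))"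
  "ord F 5 (\<lambda>e. g e (-3,1) - of_real e * (1 + M e) * (C e + E e))"
  "ord F 5 (\<lambda>e. g e (-2,-2) - of_real e * (1 + M e) * (D e + \<zeta> * E e))"
proof -
  have gen: "ord F 5 (\<lambda>e. x e - of_real e * (1 + M e) * y e)"
    if "eventually (\<lambda>e. (1 - M e) * x e = of_real e * (y e + r e) + c e) F" "ord F 2 y" "ord F 4 r" "ord F 6 c" for x y r c
  proof (rule ord_cancel)
    show "ord F 5 (\<lambda>e. (1 - M e) * (x e - of_real e * (1 + M e) * y e))"
    proof (rule ord_ev[OF that(1)])
      show "ord F 5 (\<lambda>e. of_real e * r e + c e + of_real e * M e * M e * y e)"
        by (rule ord_le, (rule that(2-) M ord_rules)+, simp)
    qed (simp add: algebra_simps)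
    have "ord F 1 (\<lambda>e. - M e)" by (rule ord_minus[OF M])
    then show "ord F 1 (\<lambda>e. (1 - M e) - 1)" by simp
  qed simp
  show "ord F 5 (\<lambda>e. g e (-4,0) - of_real e * (1 + M e) * C e)"
    by (rule gen[where r="\<lambda>e. g e (-5,0) + g e (-4,1) + g e (-4,-1)" and c="\<lambda>e. cub e (-4,0)"])
      (use eqs(2) in \<open>auto elim!: eventually_mono simp: add_ac\<close>, (rule ord_le, (rule ordA cub6 ord_rules)+, simp)+)
  show "ord F 5 (\<lambda>e. g e (-3,-1) - of_real e * (1 + M e) * (C e + D e))"
    by (rule gen[where r="\<lambda>e. g e (-4,-1) + g e (-3,-2)" and c="\<lambda>e. cub e (-3,-1)"])
      (use eqs(2) in \<open>auto elim!: eventually_mono simp: add_ac\<close>, (rule ord_le, (rule ordA cub6 ord_rules)+, simp)+)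
  show "ord F 5 (\<lambda>e. g e (-3,1) - of_real e * (1 + M e) * (C e + E e))"
    by (rule gen[where r="\<lambda>e. g e (-4,1) + g e (-3,2)" and c="\<lambda>e. cub e (-3,1)"])
      (use eqs(2) in \<open>auto elim!: eventually_mono simp: add_ac\<close>, (rule ord_le, (rule ordA cub6 ord_rules)+, simp)+)
  show "ord F 5 (\<lambda>e. g e (-2,-2) - of_real e * (1 + M e) * (D e + \<zeta> * E e))"
    by (rule gen[where r="\<lambda>e. g e (-3,-2) + g e (-2,-3)" and c="\<lambda>e. cub e (-2,-2)"])
      (use eqs(2) in \<open>auto elim!: eventually_mono simp: add_ac\<close>, (rule ord_le, (rule ordA cub6 ord_rules)+, simp)+)
qed

text \<open>Eliminating the sites at distance four.\<close>

lemma near3: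
  "ord F 6 (\<lambda>e. (1 - M e) * C e - of_real e * A e - of_real e ^ 2 * (1 + M e) * (3 * C e + D e + E e))"
  "ord F 6 (\<lambda>e. (1 - M e) * D e - of_real e * (A e + B e) - of_real e ^ 2 * (1 + M e) * (C e + 2 * D e + \<zeta> * E e))"
  "ord F 6 (\<lambda>e. (1 - M e) * E e - of_real e * (A e + \<zeta>' * B e) - of_real e ^ 2 * (1 + M e) * (C e + 2 * E e + \<zeta>' * D e))"
proof -
  let ?T = "\<lambda>e. g e (-4,0) - of_real e * (1 + M e) * C e" and ?F = "\<lambda>e. g e (-3,-1) - of_real e * (1 + M e) * (C e + D e)"
  let ?F' = "\<lambda>e. g e (-3,1) - of_real e * (1 + M e) * (C e + E e)" and ?G = "\<lambda>e. g e (-2,-2) - of_real e * (1 + M e) * (D e + \<zeta> * E e)"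
  show "ord F 6 (\<lambda>e. (1 - M e) * C e - of_real e * A e - of_real e ^ 2 * (1 + M e) * (3 * C e + D e + E e))"
  proof (rule ord_ev[OF eqs(1)])
    show "ord F 6 (\<lambda>e. of_real e * (?T e + ?F e + ?F' e) + cub e (-3,0))"
      by (rule ord_le, (rule near4 cub6 ord_rules)+, simp)
  qed (elim conjE, simp only:, simp add: algebra_simps power2_eq_square)
  show "ord F 6 (\<lambda>e. (1 - M e) * D e - of_real e * (A e + B e) - of_real e ^ 2 * (1 + M e) * (C e + 2 * D e + \<zeta> * E e))"
  proof (rule ord_ev[OF eqs(1)])
    show "ord F 6 (\<lambda>e. of_real e * (?F e + ?G e) + cub e (-2,-1))"
      by (rule ord_le, (rule near4 cub6 ord_rules)+, simp)
  qed (elim conjE, simp only:, simp add: algebra_simps power2_eq_square)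
  show "ord F 6 (\<lambda>e. (1 - M e) * E e - of_real e * (A e + \<zeta>' * B e) - of_real e ^ 2 * (1 + M e) * (C e + 2 * E e + \<zeta>' * D e))"
  proof (rule ord_ev[OF eqs(1)])
    show "ord F 6 (\<lambda>e. of_real e * (?F' e + \<zeta>' * ?G e) + cub e (-2,1))"
      by (rule ord_le, (rule near4 cub6 ord_rules)+, simp)
    fix e
    assume "(1 - M e) * A e = of_real e * (gN e + C e + D e + E e) + cub e (-2,0) \<and>
    (1 - M e) * B e = of_real e * ((1 + \<zeta>) * gN e + D e + \<zeta> * E e) + cub e (-1,-1) \<and>
    (1 - M e) * C e = of_real e * (A e + g e (-4,0) + g e (-3,1) + g e (-3,-1)) + cub e (-3,0) \<and>
    (1 - M e) * D e = of_real e * (A e + B e + g e (-3,-1) + g e (-2,-2)) + cub e (-2,-1) \<and>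
    (1 - M e) * E e = of_real e * (A e + \<zeta>' * B e + g e (-3,1) + \<zeta>' * g e (-2,-2)) + cub e (-2,1)"
    then have h: "(1 - M e) * E e = of_real e * (A e + \<zeta>' * B e + g e (-3,1) + \<zeta>' * g e (-2,-2)) + cub e (-2,1)" by blast
    show "(1 - M e) * E e - of_real e * (A e + \<zeta>' * B e) - of_real e ^ 2 * (1 + M e) * (C e + 2 * E e + \<zeta>' * D e)
      = of_real e * (?F' e + \<zeta>' * ?G e) + cub e (-2,1)"
      unfolding h using chi by algebra
  qed
qed

lemma near3':
  "ord F 4 (\<lambda>e. (1 - M e) * C e - of_real e * A e)"
  "ord F 4 (\<lambda>e. (1 - M e) * D e - of_real e * (A e + B e))"
  "ord F 4 (\<lambda>e. (1 - M e) * E e - of_real e * (A e + \<zeta>' * B e))"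
proof -
  have x: "ord F 4 (\<lambda>e. x e)" if "ord F 6 (\<lambda>e. x e - of_real e ^ 2 * (1 + M e) * y e)" "ord F 2 (\<lambda>e. y e)" for x y
  proof -
    have "ord F 4 (\<lambda>e. (x e - of_real e ^ 2 * (1 + M e) * y e) + of_real e ^ 2 * (1 + M e) * y e)"
      by (rule ord_le, (rule that M ord_rules)+, simp)
    then show ?thesis by simp
  qed
  show "ord F 4 (\<lambda>e. (1 - M e) * C e - of_real e * A e)" by (rule x[OF near3(1)], rule ord_le, (rule ordA ord_rules)+, simp)
  show "ord F 4 (\<lambda>e. (1 - M e) * D e - of_real e * (A e + B e))" by (rule x[OF near3(2)], rule ord_le, (rule ordA ord_rules)+, simp)
  show "ord F 4 (\<lambda>e. (1 - M e) * E e - of_real e * (A e + \<zeta>' * B e))" by (rule x[OF near3(3)], rule ord_le, (rule ordA ord_rules)+, simp)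
qed

end

lemma eq_from_diff: fixes a b h k c :: complex
  assumes "h = k" "a - b = c * (h - k)" shows "a = b"
  using assms by simp

text \<open>
  The solution divided by its value at the node \<open>(-1,0)\<close>; \<open>\<rho>\<close> is the squared modulus of that value. This removes the gauge freedom.
\<close>

locale profile = germ F for F +
  fixes f :: "real \<Rightarrow> int \<times> int \<Rightarrow> complex" and \<rho> :: "real \<Rightarrow> complex"
  assumes rho: "ord F 1 (\<lambda>e. \<rho> e - 1)"
    and fN: "eventually (\<lambda>e. f e (-1,0) = 1) F"
    and rotf: "eventually (\<lambda>e. \<forall>x. f e (rot x) = \<i> * f e x) F"
    and eqf: "eventually (\<lambda>e. \<forall>x. x \<notin> set S0 \<longrightarrow> f e x = of_real e * nbr_sum (f e) x + \<rho> e * f e x * f e x * cnj (f e x)) F"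
    and farf: "\<And>n x. l1 x \<ge> n + 1 \<Longrightarrow> ord F n (\<lambda>e. f e x)"
    and nodef: "eventually (\<lambda>e. 1 - \<rho> e = of_real e * nbr_sum (f e) (-1,0)) F"
begin

lemma rho0: "ord F 0 \<rho>"
proof -
  have "ord F 0 (\<lambda>e. (\<rho> e - 1) + 1)" by (rule ord_le, (rule rho ord_rules)+, simp)
  then show ?thesis by simp
qed

lemma far2: "l1 x \<ge> 3 \<Longrightarrow> ord F 2 (\<lambda>e. f e x)" by (rule farf) simp

sublocale f: lin_field F f "\<lambda>e x. \<rho> e * f e x * f e x * cnj (f e x)" "\<lambda>_. 0" \<i> "-\<i>"
proof
  show "ord F 1 (\<lambda>e. 0)" by (simp add: ord_def)
  show "\<i> * - \<i> = 1" by simp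
  show "eventually (\<lambda>e. \<forall>x. f e (rot x) = \<i> * f e x) F" by (rule rotf)
  show "eventually (\<lambda>e. \<forall>x. x \<notin> set S0 \<longrightarrow> (1 - 0) * f e x = of_real e * nbr_sum (f e) x + \<rho> e * f e x * f e x * cnj (f e x)) F"
    using eqf by simp
  show "ord F 6 (\<lambda>e. \<rho> e * f e x * f e x * cnj (f e x))" if "l1 x \<ge> 3" for x
    by (rule ord_le, (rule rho0 far2[OF that] ord_rules)+, simp)
qed (rule farf)

abbreviation "ee \<equiv> complex_of_real"

lemma f4: "ord F 4 (\<lambda>e. f.C e - ee e * f.A e)" "ord F 4 (\<lambda>e. f.D e - ee e * (f.A e + f.B e))" "ord F 4 (\<lambda>e. f.E e - ee e * (f.A e - \<i> * f.B e))"
  using f.near3' by simp_all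

lemma eqAB: "eventually (\<lambda>e. f.A e = ee e * (1 + f.C e + f.D e + f.E e) + \<rho> e * f.A e * f.A e * cnj (f.A e) \<and>
   f.B e = ee e * ((1 + \<i>) + f.D e + \<i> * f.E e) + \<rho> e * f.B e * f.B e * cnj (f.B e) \<and>
   1 - \<rho> e = ee e * (f.A e + (1 - \<i>) * f.B e)) F"
  using f.eqs(1) f.sites fN nodef
proof eventually_elim
  case (elim e)
  have O: "f e (0,0) = 0"
  proof -
    have "(1 - \<i>) * f e (0,0) = 0" using elim(2) by (simp add: algebra_simps)
    moreover have "1 - \<i> \<noteq> 0" by (simp add: complex_eq_iff)
    ultimately show ?thesis by simp
  qed
  have "nbr_sum (f e) (-1,0) = f.A e + (1 - \<i>) * f.B e" using elim(2) O by (simp add: nb_sites algebra_simps)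
  then show ?case using elim by simp
qed

text \<open>
  The expansion alternates: values next to the nodes are improved by two orders with the help of the values at distance three, and conversely.
\<close>

lemma fA3: "ord F 3 (\<lambda>e. f.A e - ee e)"
proof (rule ord_ev[OF eqAB])
  show "ord F 3 (\<lambda>e. ee e * (f.C e + f.D e + f.E e) + \<rho> e * f.A e * f.A e * cnj (f.A e))"
    by (rule ord_le, (rule f.ordA rho0 ord_rules)+, simp)
qed (elim conjE, simp only: diff_eq_eq, simp add: algebra_simps)

lemma fB3: "ord F 3 (\<lambda>e. f.B e - (1 + \<i>) * ee e)"
proof (rule ord_ev[OF eqAB])
  show "ord F 3 (\<lambda>e. ee e * (f.D e + \<i> * f.E e) + \<rho> e * f.B e * f.B e * cnj (f.B e))"
    by (rule ord_le, (rule f.ordA rho0 ord_rules)+, simp)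
  fix e assume "f.A e = ee e * (1 + f.C e + f.D e + f.E e) + \<rho> e * f.A e * f.A e * cnj (f.A e) \<and>
   f.B e = ee e * ((1 + \<i>) + f.D e + \<i> * f.E e) + \<rho> e * f.B e * f.B e * cnj (f.B e) \<and>
   1 - \<rho> e = ee e * (f.A e + (1 - \<i>) * f.B e)"
  then have h: "f.B e = ee e * ((1 + \<i>) + f.D e + \<i> * f.E e) + \<rho> e * f.B e * f.B e * cnj (f.B e)" by blast
  show "f.B e - (1 + \<i>) * ee e = ee e * (f.D e + \<i> * f.E e) + \<rho> e * f.B e * f.B e * cnj (f.B e)"
    using h by algebra
qed

lemma rho4: "ord F 4 (\<lambda>e. \<rho> e - 1 + 3 * ee e ^ 2)"
proof (rule ord_ev[OF eqAB])
  show "ord F 4 (\<lambda>e. - ee e * ((f.A e - ee e) + (1 - \<i>) * (f.B e - (1 + \<i>) * ee e)))"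
    by (rule ord_le, (rule fA3 fB3 ord_rules)+, simp)
  fix e assume "f.A e = ee e * (1 + f.C e + f.D e + f.E e) + \<rho> e * f.A e * f.A e * cnj (f.A e) \<and>
   f.B e = ee e * ((1 + \<i>) + f.D e + \<i> * f.E e) + \<rho> e * f.B e * f.B e * cnj (f.B e) \<and>
   1 - \<rho> e = ee e * (f.A e + (1 - \<i>) * f.B e)"
  then have h: "1 - \<rho> e = ee e * (f.A e + (1 - \<i>) * f.B e)" by blast
  have i: "\<i> * \<i> = -1" by simp
  show "\<rho> e - 1 + 3 * ee e ^ 2 = - ee e * ((f.A e - ee e) + (1 - \<i>) * (f.B e - (1 + \<i>) * ee e))"
    using h i by algebra
qed

lemma rho2: "ord F 2 (\<lambda>e. \<rho> e - 1)"
proof -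
  have "ord F 2 (\<lambda>e. (\<rho> e - 1 + 3 * ee e ^ 2) - 3 * ee e ^ 2)" by (rule ord_le, (rule rho4 ord_rules)+, simp)
  then show ?thesis by simp
qed

lemma fA5: "ord F 5 (\<lambda>e. f.A e - ee e - 6 * ee e ^ 3)"
proof (rule ord_ev[OF eqAB])
  let ?a = "\<lambda>e. f.A e - ee e" and ?b = "\<lambda>e. f.B e - (1 + \<i>) * ee e"
  let ?c = "\<lambda>e. f.C e - ee e * f.A e" and ?d = "\<lambda>e. f.D e - ee e * (f.A e + f.B e)" and ?e = "\<lambda>e. f.E e - ee e * (f.A e - \<i> * f.B e)"
  show "ord F 5 (\<lambda>e. ee e * (?c e + ?d e + ?e e) + ee e ^ 2 * (3 * ?a e + (1 - \<i>) * ?b e)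
     + ((\<rho> e - 1) * f.A e * f.A e * cnj (f.A e) + ?a e * f.A e * cnj (f.A e) + ee e * ?a e * cnj (f.A e) + ee e ^ 2 * cnj (?a e)))"
    by (rule ord_le, (rule f4 fA3 fB3 f.ordA rho2 ord_rules)+, simp)
  fix e assume "f.A e = ee e * (1 + f.C e + f.D e + f.E e) + \<rho> e * f.A e * f.A e * cnj (f.A e) \<and>
   f.B e = ee e * ((1 + \<i>) + f.D e + \<i> * f.E e) + \<rho> e * f.B e * f.B e * cnj (f.B e) \<and>
   1 - \<rho> e = ee e * (f.A e + (1 - \<i>) * f.B e)"
  then have h: "f.A e = ee e * (1 + f.C e + f.D e + f.E e) + \<rho> e * f.A e * f.A e * cnj (f.A e)" by blast
  have i: "\<i> * \<i> = -1" by simp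
  have c: "cnj (f.A e - ee e) = cnj (f.A e) - ee e" by simp
  show "f.A e - ee e - 6 * ee e ^ 3 = ee e * (?c e + ?d e + ?e e) + ee e ^ 2 * (3 * ?a e + (1 - \<i>) * ?b e)
     + ((\<rho> e - 1) * f.A e * f.A e * cnj (f.A e) + ?a e * f.A e * cnj (f.A e) + ee e * ?a e * cnj (f.A e) + ee e ^ 2 * cnj (?a e))"
    by (rule eq_from_diff[OF h, of _ _ 1], unfold c, simp add: algebra_simps power2_eq_square power3_eq_cube)
qed

lemma fB5: "ord F 5 (\<lambda>e. f.B e - (1 + \<i>) * (ee e + 5 * ee e ^ 3))"
proof (rule ord_ev[OF eqAB])
  let ?a = "\<lambda>e. f.A e - ee e" and ?b = "\<lambda>e. f.B e - (1 + \<i>) * ee e"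
  let ?d = "\<lambda>e. f.D e - ee e * (f.A e + f.B e)" and ?e = "\<lambda>e. f.E e - ee e * (f.A e - \<i> * f.B e)"
  show "ord F 5 (\<lambda>e. ee e * (?d e + \<i> * ?e e) + ee e ^ 2 * ((1 + \<i>) * ?a e + 2 * ?b e)
     + ((\<rho> e - 1) * f.B e * f.B e * cnj (f.B e) + ?b e * f.B e * cnj (f.B e) + (1 + \<i>) * ee e * ?b e * cnj (f.B e) + 2 * \<i> * ee e ^ 2 * cnj (?b e)))"
    by (rule ord_le, (rule f4 fA3 fB3 f.ordA rho2 ord_rules)+, simp)
  fix e assume "f.A e = ee e * (1 + f.C e + f.D e + f.E e) + \<rho> e * f.A e * f.A e * cnj (f.A e) \<and>
   f.B e = ee e * ((1 + \<i>) + f.D e + \<i> * f.E e) + \<rho> e * f.B e * f.B e * cnj (f.B e) \<and>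
   1 - \<rho> e = ee e * (f.A e + (1 - \<i>) * f.B e)"
  then have h: "f.B e = ee e * ((1 + \<i>) + f.D e + \<i> * f.E e) + \<rho> e * f.B e * f.B e * cnj (f.B e)" by blast
  have i: "\<i> * \<i> = -1" by simp
  have c: "cnj (f.B e - (1 + \<i>) * ee e) = cnj (f.B e) - (1 - \<i>) * ee e" by simp
  show "f.B e - (1 + \<i>) * (ee e + 5 * ee e ^ 3) = ee e * (?d e + \<i> * ?e e) + ee e ^ 2 * ((1 + \<i>) * ?a e + 2 * ?b e)
     + ((\<rho> e - 1) * f.B e * f.B e * cnj (f.B e) + ?b e * f.B e * cnj (f.B e) + (1 + \<i>) * ee e * ?b e * cnj (f.B e) + 2 * \<i> * ee e ^ 2 * cnj (?b e))"
    by (rule eq_from_diff[OF h, of _ _ 1], unfold c, simp add: algebra_simps power2_eq_square power3_eq_cube)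
qed

lemma rho6: "ord F 6 (\<lambda>e. \<rho> e - 1 + 3 * ee e ^ 2 + 16 * ee e ^ 4)"
proof (rule ord_ev[OF eqAB])
  show "ord F 6 (\<lambda>e. - ee e * ((f.A e - ee e - 6 * ee e ^ 3) + (1 - \<i>) * (f.B e - (1 + \<i>) * (ee e + 5 * ee e ^ 3))))"
    by (rule ord_le, (rule fA5 fB5 ord_rules)+, simp)
  fix e assume "f.A e = ee e * (1 + f.C e + f.D e + f.E e) + \<rho> e * f.A e * f.A e * cnj (f.A e) \<and>
   f.B e = ee e * ((1 + \<i>) + f.D e + \<i> * f.E e) + \<rho> e * f.B e * f.B e * cnj (f.B e) \<and>
   1 - \<rho> e = ee e * (f.A e + (1 - \<i>) * f.B e)"
  then have h: "1 - \<rho> e = ee e * (f.A e + (1 - \<i>) * f.B e)" by blast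
  have i: "\<i> * \<i> = -1" by simp
  show "\<rho> e - 1 + 3 * ee e ^ 2 + 16 * ee e ^ 4 = - ee e * ((f.A e - ee e - 6 * ee e ^ 3) + (1 - \<i>) * (f.B e - (1 + \<i>) * (ee e + 5 * ee e ^ 3)))"
    using h i by algebra
qed

text \<open>The coefficients with which the profile couples the two components of a mode at the sites next to the nodes.\<close>

lemma coef:
  "ord F 6 (\<lambda>e. \<rho> e * f.A e * cnj (f.A e) - ee e ^ 2 - 9 * ee e ^ 4)"
  "ord F 6 (\<lambda>e. \<rho> e * f.A e * f.A e - ee e ^ 2 - 9 * ee e ^ 4)"
  "ord F 6 (\<lambda>e. \<rho> e * f.B e * cnj (f.B e) - 2 * ee e ^ 2 - 14 * ee e ^ 4)"
  "ord F 6 (\<lambda>e. \<rho> e * f.B e * f.B e - 2 * \<i> * ee e ^ 2 - 14 * \<i> * ee e ^ 4)"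
proof -
  let ?a = "\<lambda>e. f.A e - ee e - 6 * ee e ^ 3" and ?b = "\<lambda>e. f.B e - (1 + \<i>) * (ee e + 5 * ee e ^ 3)" and ?r = "\<lambda>e. \<rho> e - 1 + 3 * ee e ^ 2"
  have i: "\<i> * \<i> = -1" by simp
  have ca: "cnj (?a e) = cnj (f.A e) - ee e - 6 * ee e ^ 3" for e by simp
  have cb: "cnj (?b e) = cnj (f.B e) - (1 - \<i>) * (ee e + 5 * ee e ^ 3)" for e by simp
  have "ord F 6 (\<lambda>e. ?r e * f.A e * cnj (f.A e) + (1 - 3 * ee e ^ 2) * (?a e * cnj (f.A e) + (ee e + 6 * ee e ^ 3) * cnj (?a e)) - 108 * ee e ^ 8)"
    by (rule ord_le, (rule rho4 fA5 f.ordA ord_rules)+, simp)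
  moreover have "?r e * f.A e * cnj (f.A e) + (1 - 3 * ee e ^ 2) * (?a e * cnj (f.A e) + (ee e + 6 * ee e ^ 3) * cnj (?a e)) - 108 * ee e ^ 8
    = \<rho> e * f.A e * cnj (f.A e) - ee e ^ 2 - 9 * ee e ^ 4" for e unfolding ca by algebra
  ultimately show "ord F 6 (\<lambda>e. \<rho> e * f.A e * cnj (f.A e) - ee e ^ 2 - 9 * ee e ^ 4)" by (simp only:)
  have "ord F 6 (\<lambda>e. ?r e * f.A e * f.A e + (1 - 3 * ee e ^ 2) * (?a e * f.A e + (ee e + 6 * ee e ^ 3) * ?a e) - 108 * ee e ^ 8)"
    by (rule ord_le, (rule rho4 fA5 f.ordA ord_rules)+, simp)
  moreover have "?r e * f.A e * f.A e + (1 - 3 * ee e ^ 2) * (?a e * f.A e + (ee e + 6 * ee e ^ 3) * ?a e) - 108 * ee e ^ 8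
    = \<rho> e * f.A e * f.A e - ee e ^ 2 - 9 * ee e ^ 4" for e by algebra
  ultimately show "ord F 6 (\<lambda>e. \<rho> e * f.A e * f.A e - ee e ^ 2 - 9 * ee e ^ 4)" by (simp only:)
  have "ord F 6 (\<lambda>e. ?r e * f.B e * cnj (f.B e) + (1 - 3 * ee e ^ 2) * (?b e * cnj (f.B e) + (1 + \<i>) * (ee e + 5 * ee e ^ 3) * cnj (?b e)) - 10 * ee e ^ 6 - 150 * ee e ^ 8)"
    by (rule ord_le, (rule rho4 fB5 f.ordA ord_rules)+, simp)
  moreover have "?r e * f.B e * cnj (f.B e) + (1 - 3 * ee e ^ 2) * (?b e * cnj (f.B e) + (1 + \<i>) * (ee e + 5 * ee e ^ 3) * cnj (?b e)) - 10 * ee e ^ 6 - 150 * ee e ^ 8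
    = \<rho> e * f.B e * cnj (f.B e) - 2 * ee e ^ 2 - 14 * ee e ^ 4" for e unfolding cb using i by algebra
  ultimately show "ord F 6 (\<lambda>e. \<rho> e * f.B e * cnj (f.B e) - 2 * ee e ^ 2 - 14 * ee e ^ 4)" by (simp only:)
  have "ord F 6 (\<lambda>e. ?r e * f.B e * f.B e + (1 - 3 * ee e ^ 2) * (?b e * f.B e + (1 + \<i>) * (ee e + 5 * ee e ^ 3) * ?b e) - 10 * \<i> * ee e ^ 6 - 150 * \<i> * ee e ^ 8)"
    by (rule ord_le, (rule rho4 fB5 f.ordA ord_rules)+, simp)
  moreover have "?r e * f.B e * f.B e + (1 - 3 * ee e ^ 2) * (?b e * f.B e + (1 + \<i>) * (ee e + 5 * ee e ^ 3) * ?b e) - 10 * \<i> * ee e ^ 6 - 150 * \<i> * ee e ^ 8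
    = \<rho> e * f.B e * f.B e - 2 * \<i> * ee e ^ 2 - 14 * \<i> * ee e ^ 4" for e using i by algebra
  ultimately show "ord F 6 (\<lambda>e. \<rho> e * f.B e * f.B e - 2 * \<i> * ee e ^ 2 - 14 * \<i> * ee e ^ 4)" by (simp only:)
qed

end

context lin_field begin

text \<open>Solving a linear equation \<open>(1 - M) r = h\<close> without loss of order.\<close>

lemma solve: assumes "ord F k h" "\<And>e. (1 - M e) * r e = h e" shows "ord F k r"
proof (rule ord_cancel)
  show "ord F k (\<lambda>e. (1 - M e) * r e)" using assms by simp
  show "ord F 1 (\<lambda>e. (1 - M e) - 1)" using ord_minus[OF M] by simp
qed simp

lemma solve_eq: assumes "eventually (\<lambda>e. l e = l' e) F" "ord F k h" "\<And>e. (1 - M e) * r e - h e = l e - l' e" shows "ord F k r"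
proof (rule solve)
  show "ord F k (\<lambda>e. (1 - M e) * r e)"
    by (rule ord_ev[OF assms(1) _ assms(2)]) (rule eq_from_diff[where c=1], assumption, simp add: assms(3))
qed simp

lemma eq_A: "eventually (\<lambda>e. (1 - M e) * A e = of_real e * (gN e + C e + D e + E e) + cub e (-2,0)) F"
  using eqs(1) by (rule eventually_mono) blast
lemma eq_B: "eventually (\<lambda>e. (1 - M e) * B e = of_real e * ((1 + \<zeta>) * gN e + D e + \<zeta> * E e) + cub e (-1,-1)) F"
  using eqs(1) by (rule eventually_mono) blast

abbreviation "Z e \<equiv> g e (0,0)"

lemma nbr_N: "eventually (\<lambda>e. nbr_sum (g e) (-1,0) = Z e + A e + (1 + \<zeta>') * B e) F"
  using sites by eventually_elim (simp add: nb_sites algebra_simps)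

lemma O0: assumes "\<zeta> \<noteq> 1" shows "eventually (\<lambda>e. Z e = 0) F"
  using sites
proof eventually_elim
  case (elim e)
  then have "(1 - \<zeta>) * Z e = 0" by (simp add: algebra_simps)
  then show ?case using assms by simp
qed

end

section \<open>Expansion of the modes\<close>

text \<open>
  The two components of \<open>\<psi>\<^sub>\<omega>(\<mu>)\<close>, divided by the components of the phase mode at the node \<open>(-1,0)\<close>. \<open>M\<close> stands for \<open>\<mu>\<close> and \<open>P\<close> for
  \<open>p\<^sub>\<omega>(\<mu>)\<close>; both are functions of \<open>\<epsilon>\<close>.
\<close>

locale mode = profile F f \<rho> +
  a: lin_field F \<alpha> "\<lambda>e x. 2 * (\<rho> e * f e x * cnj (f e x)) * \<alpha> e x - \<rho> e * f e x * f e x * \<beta> e x" M \<zeta> \<zeta>' +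
  b: lin_field F \<beta> "\<lambda>e x. 2 * (\<rho> e * f e x * cnj (f e x)) * \<beta> e x - cnj (\<rho> e * f e x * f e x) * \<alpha> e x" "\<lambda>e. - M e" \<xi> \<xi>'
  for F f \<rho> \<alpha> \<beta> M \<zeta> \<zeta>' \<xi> \<xi>' +
  fixes P :: "real \<Rightarrow> complex"
  assumes eq_Na: "eventually (\<lambda>e. (1 - 2 * \<rho> e - M e) * \<alpha> e (-1,0) + \<rho> e * \<beta> e (-1,0) - of_real e * nbr_sum (\<alpha> e) (-1,0) = P e) F"
    and eq_Nb: "eventually (\<lambda>e. (1 - 2 * \<rho> e + M e) * \<beta> e (-1,0) + \<rho> e * \<alpha> e (-1,0) - of_real e * nbr_sum (\<beta> e) (-1,0) = P e) F"
    and norm_xy: "eventually (\<lambda>e. \<alpha> e (-1,0) + \<beta> e (-1,0) = 2 * (1 - P e)) F"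
    and P: "ord F 1 P"
begin

abbreviation "x e \<equiv> \<alpha> e (-1,0)"
abbreviation "y e \<equiv> \<beta> e (-1,0)"
abbreviation "q e z \<equiv> \<rho> e * f e z * cnj (f e z)"
abbreviation "r e z \<equiv> \<rho> e * f e z * f e z"

lemmas M = a.M
lemmas ordN = a.ordA(16) b.ordA(16)

lemma i2: "\<i> * \<i> = -1" by simp

lemma coef0: "ord F 2 (\<lambda>e. q e (-2,0))" "ord F 2 (\<lambda>e. r e (-2,0))" "ord F 2 (\<lambda>e. q e (-1,-1))" "ord F 2 (\<lambda>e. r e (-1,-1))"
  by (rule ord_le, (rule rho0 f.ordA ord_rules)+, simp)+

lemma coefc: "ord F 6 (\<lambda>e. q e (-2,0) - (ee e ^ 2 + 9 * ee e ^ 4))"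
  "ord F 6 (\<lambda>e. r e (-2,0) - (ee e ^ 2 + 9 * ee e ^ 4))"
  "ord F 6 (\<lambda>e. cnj (r e (-2,0)) - (ee e ^ 2 + 9 * ee e ^ 4))"
  "ord F 6 (\<lambda>e. q e (-1,-1) - (2 * ee e ^ 2 + 14 * ee e ^ 4))"
  "ord F 6 (\<lambda>e. r e (-1,-1) - (\<i> * 2 * ee e ^ 2 + \<i> * 14 * ee e ^ 4))"
  "ord F 6 (\<lambda>e. cnj (r e (-1,-1)) - (- \<i> * 2 * ee e ^ 2 - \<i> * 14 * ee e ^ 4))"
  using coef ord_cnj[OF coef(2)] ord_cnj[OF coef(4)] by (simp_all add: algebra_simps)

lemmas coef' = coefc coef0 ord_cnj[OF coef0(2)] ord_cnj[OF coef0(4)]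

end

text \<open>
  The sector \<open>\<omega> = \<i>\<close>, where the first component has rotation character \<open>-1\<close> and the second \<open>1\<close>. The second one alone has a value at the origin and, at leading order, at the sites next to
  two nodes; hence the different diagonal terms \<open>\<epsilon>\<^sup>2\<close> and \<open>9\<epsilon>\<^sup>2\<close>. In the names of the expansions, the letters are the component and the site, and the number is the order of the remainder. Each is obtained
  from the equation at the site by inserting the preceding ones; the last summand of each right-hand side collects the monomials of high degree.
\<close>

locale mode_i = mode F f \<rho> \<alpha> \<beta> M "-1" "-1" 1 1 P for F f \<rho> \<alpha> \<beta> M P
begin

lemma im_eq_O: "eventually (\<lambda>e. (1 - - M e) * b.Z e = of_real e * (4 * y e)) F"
proof -
  have "\<i> \<noteq> 1" by (simp add: complex_eq_iff)
  from b.eqg b.sites f.O0[OF this] show ?thesis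
proof eventually_elim
  case (elim e)
  have n: "nbr_sum (\<beta> e) (0,0) = 4 * y e" using elim(2) by (simp add: nbr_sum_def)
  have "(0,0) \<notin> set S0" by (simp add: set_S0)
  then have "(1 - - M e) * b.Z e = of_real e * nbr_sum (\<beta> e) (0,0)"
    using elim(1)[rule_format, of "(0,0)"] elim(3) by (simp add: complex_eq_iff)
  then show ?case unfolding n .
qed
qed

lemma m1: "(-1::complex) \<noteq> 1" by simp

lemma im_eq_Na: "eventually (\<lambda>e. (1 - 2 * \<rho> e - M e) * x e + \<rho> e * y e - of_real e * a.A e = P e) F"
  using eq_Na a.nbr_N a.O0[OF m1] by eventually_elim simp

lemma im_eq_Nb: "eventually (\<lambda>e. (1 - 2 * \<rho> e + M e) * y e + \<rho> e * x e - of_real e * (b.A e + 2 * b.B e + b.Z e) = P e) F"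
  using eq_Nb b.nbr_N by eventually_elim (simp add: add_ac)

lemma im_aA3: "ord F 3 (\<lambda>e. a.A e - (ee e * (1 + M e) * x e))"
  apply (rule a.solve_eq[OF a.eq_A, where h="\<lambda>e. ee e * (a.C e + a.D e + a.E e) + (2 * q e (-2,0) * a.A e - r e (-2,0) * b.A e) + (ee e * M e ^ 2 * x e)"])
  subgoal by (rule ord_le, (rule  coef' M ordN a.ordA b.ordA ord_rules)+, simp)
  subgoal for e by (algebra | (use i2 in algebra))
  done

lemma im_aB3: "ord F 3 (\<lambda>e. a.B e)"
  apply (rule a.solve_eq[OF a.eq_B, where h="\<lambda>e. ee e * (a.D e + -1 * a.E e) + (2 * q e (-1,-1) * a.B e - r e (-1,-1) * b.B e)"])
  subgoal by (rule ord_le, (rule  coef' M ordN a.ordA b.ordA ord_rules)+, simp)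
  subgoal for e by (algebra | (use i2 in algebra))
  done

lemma im_bA3: "ord F 3 (\<lambda>e. b.A e - (ee e * (1 - M e) * y e))"
  apply (rule b.solve_eq[OF b.eq_A, where h="\<lambda>e. ee e * (b.C e + b.D e + b.E e) + (2 * q e (-2,0) * b.A e - cnj (r e (-2,0)) * a.A e) + (ee e * M e ^ 2 * y e)"])
  subgoal by (rule ord_le, (rule  coef' M ordN a.ordA b.ordA ord_rules)+, simp)
  subgoal for e by (algebra | (use i2 in algebra))
  done

lemma im_bB3: "ord F 3 (\<lambda>e. b.B e - (ee e * (2 - 2 * M e) * y e))"
  apply (rule b.solve_eq[OF b.eq_B, where h="\<lambda>e. ee e * (b.D e + b.E e) + (2 * q e (-1,-1) * b.B e - cnj (r e (-1,-1)) * a.B e) + (2 * ee e * M e ^ 2 * y e)"])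
  subgoal by (rule ord_le, (rule  coef' M ordN a.ordA b.ordA ord_rules)+, simp)
  subgoal for e by (algebra | (use i2 in algebra))
  done

lemmas im_3 = im_aA3 im_aB3 im_bA3 im_bB3

lemma im_aC4: "ord F 4 (\<lambda>e. a.C e - (ee e ^ 2 * (1 + 2 * M e) * x e))"
  apply (rule a.solve[where h="\<lambda>e. ((1 - (M e)) * a.C e - ee e * a.A e) + ee e * ((a.A e - (ee e * (1 + M e) * x e))) + (2 * ee e ^ 2 * M e ^ 2 * x e)"])
  subgoal by (rule ord_le, (rule a.near3' im_3 M ordN ord_rules)+, simp)
  subgoal for e by (algebra | (use i2 in algebra))
  done

lemma im_aD4: "ord F 4 (\<lambda>e. a.D e - (ee e ^ 2 * (1 + 2 * M e) * x e))"
  apply (rule a.solve[where h="\<lambda>e. ((1 - (M e)) * a.D e - ee e * (a.A e + a.B e)) + ee e * ((a.A e - (ee e * (1 + M e) * x e)) + a.B e) + (2 * ee e ^ 2 * M e ^ 2 * x e)"])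
  subgoal by (rule ord_le, (rule a.near3' im_3 M ordN ord_rules)+, simp)
  subgoal for e by (algebra | (use i2 in algebra))
  done

lemma im_aE4: "ord F 4 (\<lambda>e. a.E e - (ee e ^ 2 * (1 + 2 * M e) * x e))"
  apply (rule a.solve[where h="\<lambda>e. ((1 - (M e)) * a.E e - ee e * (a.A e + -1 * a.B e)) + ee e * ((a.A e - (ee e * (1 + M e) * x e)) + -1 * a.B e) + (2 * ee e ^ 2 * M e ^ 2 * x e)"])
  subgoal by (rule ord_le, (rule a.near3' im_3 M ordN ord_rules)+, simp)
  subgoal for e by (algebra | (use i2 in algebra))
  done

lemma im_bC4: "ord F 4 (\<lambda>e. b.C e - (ee e ^ 2 * (1 - 2 * M e) * y e))"
  apply (rule b.solve[where h="\<lambda>e. ((1 - (- M e)) * b.C e - ee e * b.A e) + ee e * ((b.A e - (ee e * (1 - M e) * y e))) + (2 * ee e ^ 2 * M e ^ 2 * y e)"])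
  subgoal by (rule ord_le, (rule b.near3' im_3 M ordN ord_rules)+, simp)
  subgoal for e by (algebra | (use i2 in algebra))
  done

lemma im_bD4: "ord F 4 (\<lambda>e. b.D e - (ee e ^ 2 * (3 - 6 * M e) * y e))"
  apply (rule b.solve[where h="\<lambda>e. ((1 - (- M e)) * b.D e - ee e * (b.A e + b.B e)) + ee e * ((b.A e - (ee e * (1 - M e) * y e)) + (b.B e - (ee e * (2 - 2 * M e) * y e))) + (6 * ee e ^ 2 * M e ^ 2 * y e)"])
  subgoal by (rule ord_le, (rule b.near3' im_3 M ordN ord_rules)+, simp)
  subgoal for e by (algebra | (use i2 in algebra))
  done

lemma im_bE4: "ord F 4 (\<lambda>e. b.E e - (ee e ^ 2 * (3 - 6 * M e) * y e))"
  apply (rule b.solve[where h="\<lambda>e. ((1 - (- M e)) * b.E e - ee e * (b.A e + 1 * b.B e)) + ee e * ((b.A e - (ee e * (1 - M e) * y e)) + (b.B e - (ee e * (2 - 2 * M e) * y e))) + (6 * ee e ^ 2 * M e ^ 2 * y e)"])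
  subgoal by (rule ord_le, (rule b.near3' im_3 M ordN ord_rules)+, simp)
  subgoal for e by (algebra | (use i2 in algebra))
  done

lemmas im_4 = im_aC4 im_aD4 im_aE4 im_bC4 im_bD4 im_bE4

lemma im_aA5: "ord F 5 (\<lambda>e. a.A e - (ee e * (1 + M e + M e ^ 2 + M e ^ 3) * x e - ee e ^ 3 * y e + ee e ^ 3 * (5 + 13 * M e) * x e))"
  apply (rule a.solve_eq[OF a.eq_A, where h="\<lambda>e. ee e * ((a.C e - (ee e ^ 2 * (1 + 2 * M e) * x e)) + (a.D e - (ee e ^ 2 * (1 + 2 * M e) * x e)) + (a.E e - (ee e ^ 2 * (1 + 2 * M e) * x e))) + (2 * (q e (-2,0) - (ee e ^ 2 + 9 * ee e ^ 4)) * a.A e + 2 * (ee e ^ 2 + 9 * ee e ^ 4) * (a.A e - (ee e * (1 + M e) * x e)) - (r e (-2,0) - (ee e ^ 2 + 9 * ee e ^ 4)) * b.A e - (ee e ^ 2 + 9 * ee e ^ 4) * (b.A e - (ee e * (1 - M e) * y e))) + (ee e * M e ^ 4 * x e + 13 * ee e ^ 3 * M e ^ 2 * x e - ee e ^ 5 * (9 - 9 * M e) * y e + ee e ^ 5 * (18 + 18 * M e) * x e)"])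
  subgoal by (rule ord_le, (rule im_3 im_4 coef' M ordN a.ordA b.ordA ord_rules)+, simp)
  subgoal for e by (algebra | (use i2 in algebra))
  done

lemma im_aB5: "ord F 5 (\<lambda>e. a.B e - (- \<i> * 4 * ee e ^ 3 * y e))"
  apply (rule a.solve_eq[OF a.eq_B, where h="\<lambda>e. ee e * ((a.D e - (ee e ^ 2 * (1 + 2 * M e) * x e)) + -1 * (a.E e - (ee e ^ 2 * (1 + 2 * M e) * x e))) + (2 * (q e (-1,-1) - (2 * ee e ^ 2 + 14 * ee e ^ 4)) * a.B e + 2 * (2 * ee e ^ 2 + 14 * ee e ^ 4) * a.B e - (r e (-1,-1) - (\<i> * 2 * ee e ^ 2 + \<i> * 14 * ee e ^ 4)) * b.B e - (\<i> * 2 * ee e ^ 2 + \<i> * 14 * ee e ^ 4) * (b.B e - (ee e * (2 - 2 * M e) * y e))) + (- \<i> * ee e ^ 5 * (28 - 28 * M e) * y e)"])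
  subgoal by (rule ord_le, (rule im_3 im_4 coef' M ordN a.ordA b.ordA ord_rules)+, simp)
  subgoal for e by (algebra | (use i2 in algebra))
  done

lemma im_bA5: "ord F 5 (\<lambda>e. b.A e - (ee e * (1 - M e + M e ^ 2 - M e ^ 3) * y e + ee e ^ 3 * (9 - 25 * M e) * y e - ee e ^ 3 * x e))"
  apply (rule b.solve_eq[OF b.eq_A, where h="\<lambda>e. ee e * ((b.C e - (ee e ^ 2 * (1 - 2 * M e) * y e)) + (b.D e - (ee e ^ 2 * (3 - 6 * M e) * y e)) + (b.E e - (ee e ^ 2 * (3 - 6 * M e) * y e))) + (2 * (q e (-2,0) - (ee e ^ 2 + 9 * ee e ^ 4)) * b.A e + 2 * (ee e ^ 2 + 9 * ee e ^ 4) * (b.A e - (ee e * (1 - M e) * y e)) - (cnj (r e (-2,0)) - (ee e ^ 2 + 9 * ee e ^ 4)) * a.A e - (ee e ^ 2 + 9 * ee e ^ 4) * (a.A e - (ee e * (1 + M e) * x e))) + (ee e * M e ^ 4 * y e + 25 * ee e ^ 3 * M e ^ 2 * y e + ee e ^ 5 * (18 - 18 * M e) * y e - ee e ^ 5 * (9 + 9 * M e) * x e)"])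
  subgoal by (rule ord_le, (rule im_3 im_4 coef' M ordN a.ordA b.ordA ord_rules)+, simp)
  subgoal for e by (algebra | (use i2 in algebra))
  done

lemma im_bB5: "ord F 5 (\<lambda>e. b.B e - (ee e * (2 - 2 * M e + 2 * M e ^ 2 - 2 * M e ^ 3) * y e + ee e ^ 3 * (14 - 34 * M e) * y e))"
  apply (rule b.solve_eq[OF b.eq_B, where h="\<lambda>e. ee e * ((b.D e - (ee e ^ 2 * (3 - 6 * M e) * y e)) + (b.E e - (ee e ^ 2 * (3 - 6 * M e) * y e))) + (2 * (q e (-1,-1) - (2 * ee e ^ 2 + 14 * ee e ^ 4)) * b.B e + 2 * (2 * ee e ^ 2 + 14 * ee e ^ 4) * (b.B e - (ee e * (2 - 2 * M e) * y e)) - (cnj (r e (-1,-1)) - (- \<i> * 2 * ee e ^ 2 - \<i> * 14 * ee e ^ 4)) * a.B e - (- \<i> * 2 * ee e ^ 2 - \<i> * 14 * ee e ^ 4) * a.B e) + (2 * ee e * M e ^ 4 * y e + 34 * ee e ^ 3 * M e ^ 2 * y e + ee e ^ 5 * (56 - 56 * M e) * y e)"])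
  subgoal by (rule ord_le, (rule im_3 im_4 coef' M ordN a.ordA b.ordA ord_rules)+, simp)
  subgoal for e by (algebra | (use i2 in algebra))
  done

lemmas im_5 = im_aA5 im_aB5 im_bA5 im_bB5

lemma im_aC6: "ord F 6 (\<lambda>e. a.C e - (ee e ^ 2 * (1 + 2 * M e + 3 * M e ^ 2 + 4 * M e ^ 3) * x e - ee e ^ 4 * (1 + M e) * y e + ee e ^ 4 * (10 + 38 * M e) * x e))"
  apply (rule a.solve[where h="\<lambda>e. ((1 - (M e)) * a.C e - ee e * a.A e - ee e ^ 2 * (1 + (M e)) * (3 * a.C e + a.D e + a.E e)) + ee e * ((a.A e - (ee e * (1 + M e + M e ^ 2 + M e ^ 3) * x e - ee e ^ 3 * y e + ee e ^ 3 * (5 + 13 * M e) * x e))) + ee e ^ 2 * (1 + (M e)) * (3 * (a.C e - (ee e ^ 2 * (1 + 2 * M e) * x e)) + (a.D e - (ee e ^ 2 * (1 + 2 * M e) * x e)) + (a.E e - (ee e ^ 2 * (1 + 2 * M e) * x e))) + (4 * ee e ^ 2 * M e ^ 4 * x e - ee e ^ 4 * M e ^ 2 * y e + 48 * ee e ^ 4 * M e ^ 2 * x e)"])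
  subgoal by (rule ord_le, (rule a.near3 im_5 im_4 M ordN ord_rules)+, simp)
  subgoal for e by (algebra | (use i2 in algebra))
  done

lemma im_aD6: "ord F 6 (\<lambda>e. a.D e - (ee e ^ 2 * (1 + 2 * M e + 3 * M e ^ 2 + 4 * M e ^ 3) * x e - ee e ^ 4 * (1 + M e) * y e - \<i> * ee e ^ 4 * (4 + 4 * M e) * y e + ee e ^ 4 * (7 + 26 * M e) * x e))"
  apply (rule a.solve[where h="\<lambda>e. ((1 - (M e)) * a.D e - ee e * (a.A e + a.B e) - ee e ^ 2 * (1 + (M e)) * (a.C e + 2 * a.D e + -1 * a.E e)) + ee e * ((a.A e - (ee e * (1 + M e + M e ^ 2 + M e ^ 3) * x e - ee e ^ 3 * y e + ee e ^ 3 * (5 + 13 * M e) * x e)) + (a.B e - (- \<i> * 4 * ee e ^ 3 * y e))) + ee e ^ 2 * (1 + (M e)) * ((a.C e - (ee e ^ 2 * (1 + 2 * M e) * x e)) + 2 * (a.D e - (ee e ^ 2 * (1 + 2 * M e) * x e)) + -1 * (a.E e - (ee e ^ 2 * (1 + 2 * M e) * x e))) + (4 * ee e ^ 2 * M e ^ 4 * x e - ee e ^ 4 * M e ^ 2 * y e - \<i> * 4 * ee e ^ 4 * M e ^ 2 * y e + 30 * ee e ^ 4 * M e ^ 2 * x e)"])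
  subgoal by (rule ord_le, (rule a.near3 im_5 im_4 M ordN ord_rules)+, simp)
  subgoal for e by (algebra | (use i2 in algebra))
  done

lemma im_aE6: "ord F 6 (\<lambda>e. a.E e - (ee e ^ 2 * (1 + 2 * M e + 3 * M e ^ 2 + 4 * M e ^ 3) * x e - ee e ^ 4 * (1 + M e) * y e + \<i> * ee e ^ 4 * (4 + 4 * M e) * y e + ee e ^ 4 * (7 + 26 * M e) * x e))"
  apply (rule a.solve[where h="\<lambda>e. ((1 - (M e)) * a.E e - ee e * (a.A e + -1 * a.B e) - ee e ^ 2 * (1 + (M e)) * (a.C e + 2 * a.E e + -1 * a.D e)) + ee e * ((a.A e - (ee e * (1 + M e + M e ^ 2 + M e ^ 3) * x e - ee e ^ 3 * y e + ee e ^ 3 * (5 + 13 * M e) * x e)) + -1 * (a.B e - (- \<i> * 4 * ee e ^ 3 * y e))) + ee e ^ 2 * (1 + (M e)) * ((a.C e - (ee e ^ 2 * (1 + 2 * M e) * x e)) + -1 * (a.D e - (ee e ^ 2 * (1 + 2 * M e) * x e)) + 2 * (a.E e - (ee e ^ 2 * (1 + 2 * M e) * x e))) + (4 * ee e ^ 2 * M e ^ 4 * x e - ee e ^ 4 * M e ^ 2 * y e + \<i> * 4 * ee e ^ 4 * M e ^ 2 * y e + 30 * ee e ^ 4 * M e ^ 2 * x e)"])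
  subgoal by (rule ord_le, (rule a.near3 im_5 im_4 M ordN ord_rules)+, simp)
  subgoal for e by (algebra | (use i2 in algebra))
  done

lemma im_bC6: "ord F 6 (\<lambda>e. b.C e - (ee e ^ 2 * (1 - 2 * M e + 3 * M e ^ 2 - 4 * M e ^ 3) * y e + ee e ^ 4 * (18 - 70 * M e) * y e - ee e ^ 4 * (1 - M e) * x e))"
  apply (rule b.solve[where h="\<lambda>e. ((1 - (- M e)) * b.C e - ee e * b.A e - ee e ^ 2 * (1 + (- M e)) * (3 * b.C e + b.D e + b.E e)) + ee e * ((b.A e - (ee e * (1 - M e + M e ^ 2 - M e ^ 3) * y e + ee e ^ 3 * (9 - 25 * M e) * y e - ee e ^ 3 * x e))) + ee e ^ 2 * (1 + (- M e)) * (3 * (b.C e - (ee e ^ 2 * (1 - 2 * M e) * y e)) + (b.D e - (ee e ^ 2 * (3 - 6 * M e) * y e)) + (b.E e - (ee e ^ 2 * (3 - 6 * M e) * y e))) + (4 * ee e ^ 2 * M e ^ 4 * y e + 88 * ee e ^ 4 * M e ^ 2 * y e - ee e ^ 4 * M e ^ 2 * x e)"])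
  subgoal by (rule ord_le, (rule b.near3 im_5 im_4 M ordN ord_rules)+, simp)
  subgoal for e by (algebra | (use i2 in algebra))
  done

lemma im_bD6: "ord F 6 (\<lambda>e. b.D e - (ee e ^ 2 * (3 - 6 * M e + 9 * M e ^ 2 - 12 * M e ^ 3) * y e + ee e ^ 4 * (33 - 122 * M e) * y e - ee e ^ 4 * (1 - M e) * x e))"
  apply (rule b.solve[where h="\<lambda>e. ((1 - (- M e)) * b.D e - ee e * (b.A e + b.B e) - ee e ^ 2 * (1 + (- M e)) * (b.C e + 2 * b.D e + 1 * b.E e)) + ee e * ((b.A e - (ee e * (1 - M e + M e ^ 2 - M e ^ 3) * y e + ee e ^ 3 * (9 - 25 * M e) * y e - ee e ^ 3 * x e)) + (b.B e - (ee e * (2 - 2 * M e + 2 * M e ^ 2 - 2 * M e ^ 3) * y e + ee e ^ 3 * (14 - 34 * M e) * y e))) + ee e ^ 2 * (1 + (- M e)) * ((b.C e - (ee e ^ 2 * (1 - 2 * M e) * y e)) + 2 * (b.D e - (ee e ^ 2 * (3 - 6 * M e) * y e)) + (b.E e - (ee e ^ 2 * (3 - 6 * M e) * y e))) + (12 * ee e ^ 2 * M e ^ 4 * y e + 142 * ee e ^ 4 * M e ^ 2 * y e - ee e ^ 4 * M e ^ 2 * x e)"])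
  subgoal by (rule ord_le, (rule b.near3 im_5 im_4 M ordN ord_rules)+, simp)
  subgoal for e by (algebra | (use i2 in algebra))
  done

lemma im_bE6: "ord F 6 (\<lambda>e. b.E e - (ee e ^ 2 * (3 - 6 * M e + 9 * M e ^ 2 - 12 * M e ^ 3) * y e + ee e ^ 4 * (33 - 122 * M e) * y e - ee e ^ 4 * (1 - M e) * x e))"
  apply (rule b.solve[where h="\<lambda>e. ((1 - (- M e)) * b.E e - ee e * (b.A e + 1 * b.B e) - ee e ^ 2 * (1 + (- M e)) * (b.C e + 2 * b.E e + 1 * b.D e)) + ee e * ((b.A e - (ee e * (1 - M e + M e ^ 2 - M e ^ 3) * y e + ee e ^ 3 * (9 - 25 * M e) * y e - ee e ^ 3 * x e)) + (b.B e - (ee e * (2 - 2 * M e + 2 * M e ^ 2 - 2 * M e ^ 3) * y e + ee e ^ 3 * (14 - 34 * M e) * y e))) + ee e ^ 2 * (1 + (- M e)) * ((b.C e - (ee e ^ 2 * (1 - 2 * M e) * y e)) + (b.D e - (ee e ^ 2 * (3 - 6 * M e) * y e)) + 2 * (b.E e - (ee e ^ 2 * (3 - 6 * M e) * y e))) + (12 * ee e ^ 2 * M e ^ 4 * y e + 142 * ee e ^ 4 * M e ^ 2 * y e - ee e ^ 4 * M e ^ 2 * x e)"])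
  subgoal by (rule ord_le, (rule b.near3 im_5 im_4 M ordN ord_rules)+, simp)
  subgoal for e by (algebra | (use i2 in algebra))
  done

lemmas im_6 = im_aC6 im_aD6 im_aE6 im_bC6 im_bD6 im_bE6

lemma im_aA7: "ord F 7 (\<lambda>e. a.A e - (ee e * (1 + M e + M e ^ 2 + M e ^ 3 + M e ^ 4 + M e ^ 5) * x e - ee e ^ 3 * (1 + M e ^ 2) * y e + ee e ^ 3 * (5 + 13 * M e + 24 * M e ^ 2 + 38 * M e ^ 3) * x e - ee e ^ 5 * (23 - 8 * M e) * y e + ee e ^ 5 * (53 + 187 * M e) * x e))"
  apply (rule a.solve_eq[OF a.eq_A, where h="\<lambda>e. ee e * ((a.C e - (ee e ^ 2 * (1 + 2 * M e + 3 * M e ^ 2 + 4 * M e ^ 3) * x e - ee e ^ 4 * (1 + M e) * y e + ee e ^ 4 * (10 + 38 * M e) * x e)) + (a.D e - (ee e ^ 2 * (1 + 2 * M e + 3 * M e ^ 2 + 4 * M e ^ 3) * x e - ee e ^ 4 * (1 + M e) * y e - \<i> * ee e ^ 4 * (4 + 4 * M e) * y e + ee e ^ 4 * (7 + 26 * M e) * x e)) + (a.E e - (ee e ^ 2 * (1 + 2 * M e + 3 * M e ^ 2 + 4 * M e ^ 3) * x e - ee e ^ 4 * (1 + M e) * y e + \<i> * ee e ^ 4 * (4 + 4 * M e) * y e + ee e ^ 4 * (7 + 26 * M e) * x e))) + (2 * (q e (-2,0) - (ee e ^ 2 + 9 * ee e ^ 4)) * a.A e + 2 * (ee e ^ 2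 + 9 * ee e ^ 4) * (a.A e - (ee e * (1 + M e + M e ^ 2 + M e ^ 3) * x e - ee e ^ 3 * y e + ee e ^ 3 * (5 + 13 * M e) * x e)) - (r e (-2,0) - (ee e ^ 2 + 9 * ee e ^ 4)) * b.A e - (ee e ^ 2 + 9 * ee e ^ 4) * (b.A e - (ee e * (1 - M e + M e ^ 2 - M e ^ 3) * y e + ee e ^ 3 * (9 - 25 * M e) * y e - ee e ^ 3 * x e))) + (ee e * M e ^ 6 * x e + 38 * ee e ^ 3 * M e ^ 4 * x e - ee e ^ 5 * M e ^ 2 * (1 - 9 * M e) * y e + ee e ^ 5 * M e ^ 2 * (205 + 18 * M e) * x e - ee e ^ 7 * (99 - 225 * M e) * y e + ee e ^ 7 * (99 + 234 * M e) * x e)"])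
  subgoal by (rule ord_le, (rule im_5 im_6 coef' M ordN a.ordA b.ordA ord_rules)+, simp)
  subgoal for e by (algebra | (use i2 in algebra))
  done

lemma im_aB7: "ord F 7 (\<lambda>e. a.B e - (- \<i> * ee e ^ 3 * (4 + 4 * M e ^ 2) * y e - \<i> * ee e ^ 5 * (80 - 8 * M e) * y e))"
  apply (rule a.solve_eq[OF a.eq_B, where h="\<lambda>e. ee e * ((a.D e - (ee e ^ 2 * (1 + 2 * M e + 3 * M e ^ 2 + 4 * M e ^ 3) * x e - ee e ^ 4 * (1 + M e) * y e - \<i> * ee e ^ 4 * (4 + 4 * M e) * y e + ee e ^ 4 * (7 + 26 * M e) * x e)) + -1 * (a.E e - (ee e ^ 2 * (1 + 2 * M e + 3 * M e ^ 2 + 4 * M e ^ 3) * x e - ee e ^ 4 * (1 + M e) * y e + \<i> * ee e ^ 4 * (4 + 4 * M e) * y e + ee e ^ 4 * (7 + 26 * M e) * x e))) + (2 * (q e (-1,-1) - (2 * ee e ^ 2 + 14 * ee e ^ 4)) * a.B e + 2 * (2 * ee e ^ 2 + 14 * ee e ^ 4) * (a.B e - (- \<i> * 4 * ee e ^ 3 * y e)) - (r e (-1,-1) - (\<i> * 2 * ee e ^ 2 + \<i> * 14 * ee e ^ 4)) * b.B e - (\<i> * 2 * ee e ^ 2 + \<i> * 14 * ee e ^ 4) * (b.B e - (ee e * (2 - 2 * M e + 2 * M e ^ 2 - 2 * M e ^ 3) * y e + ee e ^ 3 * (14 - 34 * M e) * y e))) + (- \<i> * ee e ^ 5 * M e ^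 2 * (20 - 28 * M e) * y e - \<i> * ee e ^ 7 * (308 - 476 * M e) * y e)"])
  subgoal by (rule ord_le, (rule im_5 im_6 coef' M ordN a.ordA b.ordA ord_rules)+, simp)
  subgoal for e by (algebra | (use i2 in algebra))
  done

lemma im_bA7: "ord F 7 (\<lambda>e. b.A e - (ee e * (1 - M e + M e ^ 2 - M e ^ 3 + M e ^ 4 - M e ^ 5) * y e + ee e ^ 3 * (9 - 25 * M e + 48 * M e ^ 2 - 78 * M e ^ 3) * y e - ee e ^ 3 * (1 + M e ^ 2) * x e + ee e ^ 5 * (121 - 503 * M e) * y e - 19 * ee e ^ 5 * x e))"
  apply (rule b.solve_eq[OF b.eq_A, where h="\<lambda>e. ee e * ((b.C e - (ee e ^ 2 * (1 - 2 * M e + 3 * M e ^ 2 - 4 * M e ^ 3) * y e + ee e ^ 4 * (18 - 70 * M e) * y e - ee e ^ 4 * (1 - M e) * x e)) + (b.D e - (ee e ^ 2 * (3 - 6 * M e + 9 * M e ^ 2 - 12 * M e ^ 3) * y e + ee e ^ 4 * (33 - 122 * M e) * y e - ee e ^ 4 * (1 - M e) * x e)) + (b.E e - (ee e ^ 2 * (3 - 6 * M e + 9 * M e ^ 2 - 12 * M e ^ 3) * y e + ee e ^ 4 * (33 - 122 * M e) * y e - ee e ^ 4 * (1 - M e) * x e))) + (2 * (q e (-2,0) - (ee e ^ 2 + 9 * ee e ^ 4)) * b.A e + 2 * (ee e ^ 2 + 9 * ee e ^ 4) * (b.A e - (ee e * (1 - M e + M e ^ 2 - M e ^ 3) * y e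 + ee e ^ 3 * (9 - 25 * M e) * y e - ee e ^ 3 * x e)) - (cnj (r e (-2,0)) - (ee e ^ 2 + 9 * ee e ^ 4)) * a.A e - (ee e ^ 2 + 9 * ee e ^ 4) * (a.A e - (ee e * (1 + M e + M e ^ 2 + M e ^ 3) * x e - ee e ^ 3 * y e + ee e ^ 3 * (5 + 13 * M e) * x e))) + (ee e * M e ^ 6 * y e + 78 * ee e ^ 3 * M e ^ 4 * y e + ee e ^ 5 * M e ^ 2 * (521 - 18 * M e) * y e - ee e ^ 5 * M e ^ 2 * (9 + 9 * M e) * x e + ee e ^ 7 * (171 - 450 * M e) * y e - ee e ^ 7 * (63 + 117 * M e) * x e)"])
  subgoal by (rule ord_le, (rule im_5 im_6 coef' M ordN a.ordA b.ordA ord_rules)+, simp)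
  subgoal for e by (algebra | (use i2 in algebra))
  done

lemma im_bB7: "ord F 7 (\<lambda>e. b.B e - (ee e * (2 - 2 * M e + 2 * M e ^ 2 - 2 * M e ^ 3 + 2 * M e ^ 4 - 2 * M e ^ 5) * y e + ee e ^ 3 * (14 - 34 * M e + 60 * M e ^ 2 - 92 * M e ^ 3) * y e + ee e ^ 5 * (186 - 622 * M e) * y e - ee e ^ 5 * (2 - 4 * M e) * x e))"
  apply (rule b.solve_eq[OF b.eq_B, where h="\<lambda>e. ee e * ((b.D e - (ee e ^ 2 * (3 - 6 * M e + 9 * M e ^ 2 - 12 * M e ^ 3) * y e + ee e ^ 4 * (33 - 122 * M e) * y e - ee e ^ 4 * (1 - M e) * x e)) + (b.E e - (ee e ^ 2 * (3 - 6 * M e + 9 * M e ^ 2 - 12 * M e ^ 3) * y e + ee e ^ 4 * (33 - 122 * M e) * y e - ee e ^ 4 * (1 - M e) * x e))) + (2 * (q e (-1,-1) - (2 * ee e ^ 2 + 14 * ee e ^ 4)) * b.B e + 2 * (2 * ee e ^ 2 + 14 * ee e ^ 4) * (b.B e - (ee e * (2 - 2 * M e + 2 * M e ^ 2 - 2 * M e ^ 3) * y e + ee e ^ 3 * (14 - 34 * M e) * y e)) - (cnj (r e (-1,-1)) - (- \<i> * 2 * ee e ^ 2 - \<i> * 14 * ee e ^ 4)) * a.B e - (- \<i> * 2 * ee e ^ 2 - \<i> * 14 * ee e ^ 4) * (a.B e - (- \<i> * 4 * ee e ^ 3 * y e))) + (2 * ee e * M e ^ 6 * y e + 92 * ee e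 ^ 3 * M e ^ 4 * y e + ee e ^ 5 * M e ^ 2 * (678 - 56 * M e) * y e - 4 * ee e ^ 5 * M e ^ 2 * x e + ee e ^ 7 * (448 - 952 * M e) * y e)"])
  subgoal by (rule ord_le, (rule im_5 im_6 coef' M ordN a.ordA b.ordA ord_rules)+, simp)
  subgoal for e by (algebra | (use i2 in algebra))
  done

lemmas im_7 = im_aA7 im_aB7 im_bA7 im_bB7

lemma im_bO: "ord F 7 (\<lambda>e. b.Z e - (ee e * (4 - 4 * M e + 4 * M e ^ 2 - 4 * M e ^ 3 + 4 * M e ^ 4 - 4 * M e ^ 5) * y e))"
  apply (rule b.solve_eq[OF im_eq_O, where h="\<lambda>e. 4 * ee e * M e ^ 6 * y e"])
  subgoal by (rule ord_le, (rule M ordN ord_rules)+, simp)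
  subgoal for e by algebra
  done

lemma im_node_a: "ord F 8 (\<lambda>e. (1 - 2 * \<rho> e - M e) * x e + \<rho> e * y e - P e - (ee e ^ 2 * (1 + M e + M e ^ 2 + M e ^ 3 + M e ^ 4 + M e ^ 5) * x e - ee e ^ 4 * (1 + M e ^ 2) * y e + ee e ^ 4 * (5 + 13 * M e + 24 * M e ^ 2 + 38 * M e ^ 3) * x e - ee e ^ 6 * (23 - 8 * M e) * y e + ee e ^ 6 * (53 + 187 * M e) * x e))"
  apply (rule ord_ev[OF im_eq_Na, where g="\<lambda>e. ee e * ((a.A e - (ee e * (1 + M e + M e ^ 2 + M e ^ 3 + M e ^ 4 + M e ^ 5) * x e - ee e ^ 3 * (1 + M e ^ 2) * y e + ee e ^ 3 * (5 + 13 * M e + 24 * M e ^ 2 + 38 * M e ^ 3) * x e - ee e ^ 5 * (23 - 8 * M e) * y e + ee e ^ 5 * (53 + 187 * M e) * x e)))"])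
  subgoal for e by (erule eq_from_diff[where c=1], (algebra | (use i2 in algebra)))
  subgoal by (rule ord_le, (rule im_7 ord_rules)+, simp)
  done

lemma im_node_b: "ord F 8 (\<lambda>e. (1 - 2 * \<rho> e + M e) * y e + \<rho> e * x e - P e - (ee e ^ 2 * (9 - 9 * M e + 9 * M e ^ 2 - 9 * M e ^ 3 + 9 * M e ^ 4 - 9 * M e ^ 5) * y e + ee e ^ 4 * (37 - 93 * M e + 168 * M e ^ 2 - 262 * M e ^ 3) * y e - ee e ^ 4 * (1 + M e ^ 2) * x e + ee e ^ 6 * (493 - 1747 * M e) * y e - ee e ^ 6 * (23 - 8 * M e) * x e))"
  apply (rule ord_ev[OF im_eq_Nb, where g="\<lambda>e. ee e * ((b.A e - (ee e * (1 - M e + M e ^ 2 - M e ^ 3 + M e ^ 4 - M e ^ 5) * y e + ee e ^ 3 * (9 - 25 * M e + 48 * M e ^ 2 - 78 * M e ^ 3) * y e - ee e ^ 3 * (1 + M e ^ 2) * x e + ee e ^ 5 * (121 - 503 * M e) * y e - 19 * ee e ^ 5 * x e)) + 2 * (b.B e - (ee e * (2 - 2 * M e + 2 * M e ^ 2 - 2 * M e ^ 3 + 2 * M e ^ 4 - 2 * M e ^ 5) * y e + ee e ^ 3 * (14 - 34 * M e + 60 * M e ^ 2 - 92 * M e ^ 3) * y e + ee e ^ 5 * (186 - 622 * M e) * y e - ee e ^ 5 * (2 - 4 * M e) * x e)) + (b.Z e - (ee e * (4 - 4 * M e + 4 * M e ^ 2 - 4 * M e ^ 3 + 4 * M e ^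 4 - 4 * M e ^ 5) * y e)))"])
  subgoal for e by (erule eq_from_diff[where c=1], (algebra | (use i2 in algebra)))
  subgoal by (rule ord_le, (rule im_7 im_bO ord_rules)+, simp)
  done

end

text \<open>The sector \<open>\<omega> = -1\<close>.\<close>

locale mode_m = mode F f \<rho> \<alpha> \<beta> M "-\<i>" \<i> \<i> "-\<i>" P for F f \<rho> \<alpha> \<beta> M P
begin

lemma mo_eq_Na: "eventually (\<lambda>e. (1 - 2 * \<rho> e - M e) * x e + \<rho> e * y e - of_real e * (a.A e + (1 + \<i>) * a.B e) = P e) F"
proof -
  have "- \<i> \<noteq> 1" by (simp add: complex_eq_iff)
  from a.O0[OF this] eq_Na a.nbr_N show ?thesis by eventually_elim simp
qed

lemma mo_eq_Nb: "eventually (\<lambda>e. (1 - 2 * \<rho> e + M e) * y e + \<rho> e * x e - of_real e * (b.A e + (1 + - \<i>) * b.B e) = P e) F"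
proof -
  have "\<i> \<noteq> 1" by (simp add: complex_eq_iff)
  from b.O0[OF this] eq_Nb b.nbr_N show ?thesis by eventually_elim simp
qed

lemma mo_aA3: "ord F 3 (\<lambda>e. a.A e - (ee e * (1 + M e) * x e))"
  apply (rule a.solve_eq[OF a.eq_A, where h="\<lambda>e. ee e * (a.C e + a.D e + a.E e) + (2 * q e (-2,0) * a.A e - r e (-2,0) * b.A e) + (ee e * M e ^ 2 * x e)"])
  subgoal by (rule ord_le, (rule  coef' M ordN a.ordA b.ordA ord_rules)+, simp)
  subgoal for e by (algebra | (use i2 in algebra))
  done

lemma mo_aB3: "ord F 3 (\<lambda>e. a.B e - (ee e * (1 + M e) * x e - \<i> * ee e * (1 + M e) * x e))"
  apply (rule a.solve_eq[OF a.eq_B, where h="\<lambda>e. ee e * (a.D e + -\<i> * a.E e) + (2 * q e (-1,-1) * a.B e - r e (-1,-1) * b.B e) + (ee e * M e ^ 2 * x e - \<i> * ee e * M e ^ 2 * x e)"])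
  subgoal by (rule ord_le, (rule  coef' M ordN a.ordA b.ordA ord_rules)+, simp)
  subgoal for e by (algebra | (use i2 in algebra))
  done

lemma mo_bA3: "ord F 3 (\<lambda>e. b.A e - (ee e * (1 - M e) * y e))"
  apply (rule b.solve_eq[OF b.eq_A, where h="\<lambda>e. ee e * (b.C e + b.D e + b.E e) + (2 * q e (-2,0) * b.A e - cnj (r e (-2,0)) * a.A e) + (ee e * M e ^ 2 * y e)"])
  subgoal by (rule ord_le, (rule  coef' M ordN a.ordA b.ordA ord_rules)+, simp)
  subgoal for e by (algebra | (use i2 in algebra))
  done

lemma mo_bB3: "ord F 3 (\<lambda>e. b.B e - (ee e * (1 - M e) * y e + \<i> * ee e * (1 - M e) * y e))"
  apply (rule b.solve_eq[OF b.eq_B, where h="\<lambda>e. ee e * (b.D e + \<i> * b.E e) + (2 * q e (-1,-1) * b.B e - cnj (r e (-1,-1)) * a.B e) + (ee e * M e ^ 2 * y e + \<i> * ee e * M e ^ 2 * y e)"])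
  subgoal by (rule ord_le, (rule  coef' M ordN a.ordA b.ordA ord_rules)+, simp)
  subgoal for e by (algebra | (use i2 in algebra))
  done

lemmas mo_3 = mo_aA3 mo_aB3 mo_bA3 mo_bB3

lemma mo_aC4: "ord F 4 (\<lambda>e. a.C e - (ee e ^ 2 * (1 + 2 * M e) * x e))"
  apply (rule a.solve[where h="\<lambda>e. ((1 - (M e)) * a.C e - ee e * a.A e) + ee e * ((a.A e - (ee e * (1 + M e) * x e))) + (2 * ee e ^ 2 * M e ^ 2 * x e)"])
  subgoal by (rule ord_le, (rule a.near3' mo_3 M ordN ord_rules)+, simp)
  subgoal for e by (algebra | (use i2 in algebra))
  done

lemma mo_aD4: "ord F 4 (\<lambda>e. a.D e - (ee e ^ 2 * (2 + 4 * M e) * x e - \<i> * ee e ^ 2 * (1 + 2 * M e) * x e))"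
  apply (rule a.solve[where h="\<lambda>e. ((1 - (M e)) * a.D e - ee e * (a.A e + a.B e)) + ee e * ((a.A e - (ee e * (1 + M e) * x e)) + (a.B e - (ee e * (1 + M e) * x e - \<i> * ee e * (1 + M e) * x e))) + (4 * ee e ^ 2 * M e ^ 2 * x e - \<i> * 2 * ee e ^ 2 * M e ^ 2 * x e)"])
  subgoal by (rule ord_le, (rule a.near3' mo_3 M ordN ord_rules)+, simp)
  subgoal for e by (algebra | (use i2 in algebra))
  done

lemma mo_aE4: "ord F 4 (\<lambda>e. a.E e - (ee e ^ 2 * (2 + 4 * M e) * x e + \<i> * ee e ^ 2 * (1 + 2 * M e) * x e))"
  apply (rule a.solve[where h="\<lambda>e. ((1 - (M e)) * a.E e - ee e * (a.A e + \<i> * a.B e)) + ee e * ((a.A e - (ee e * (1 + M e) * x e)) + \<i> * (a.B e - (ee e * (1 + M e) * x e - \<i> * ee e * (1 + M e) * x e))) + (4 * ee e ^ 2 * M e ^ 2 * x e + \<i> * 2 * ee e ^ 2 * M e ^ 2 * x e)"])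
  subgoal by (rule ord_le, (rule a.near3' mo_3 M ordN ord_rules)+, simp)
  subgoal for e by (algebra | (use i2 in algebra))
  done

lemma mo_bC4: "ord F 4 (\<lambda>e. b.C e - (ee e ^ 2 * (1 - 2 * M e) * y e))"
  apply (rule b.solve[where h="\<lambda>e. ((1 - (- M e)) * b.C e - ee e * b.A e) + ee e * ((b.A e - (ee e * (1 - M e) * y e))) + (2 * ee e ^ 2 * M e ^ 2 * y e)"])
  subgoal by (rule ord_le, (rule b.near3' mo_3 M ordN ord_rules)+, simp)
  subgoal for e by (algebra | (use i2 in algebra))
  done

lemma mo_bD4: "ord F 4 (\<lambda>e. b.D e - (ee e ^ 2 * (2 - 4 * M e) * y e + \<i> * ee e ^ 2 * (1 - 2 * M e) * y e))"
  apply (rule b.solve[where h="\<lambda>e. ((1 - (- M e)) * b.D e - ee e * (b.A e + b.B e)) + ee e * ((b.A e - (ee e * (1 - M e) * y e)) + (b.B e - (ee e * (1 - M e) * y e + \<i> * ee e * (1 - M e) * y e))) + (4 * ee e ^ 2 * M e ^ 2 * y e + \<i> * 2 * ee e ^ 2 * M e ^ 2 * y e)"])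
  subgoal by (rule ord_le, (rule b.near3' mo_3 M ordN ord_rules)+, simp)
  subgoal for e by (algebra | (use i2 in algebra))
  done

lemma mo_bE4: "ord F 4 (\<lambda>e. b.E e - (ee e ^ 2 * (2 - 4 * M e) * y e - \<i> * ee e ^ 2 * (1 - 2 * M e) * y e))"
  apply (rule b.solve[where h="\<lambda>e. ((1 - (- M e)) * b.E e - ee e * (b.A e + -\<i> * b.B e)) + ee e * ((b.A e - (ee e * (1 - M e) * y e)) + -\<i> * (b.B e - (ee e * (1 - M e) * y e + \<i> * ee e * (1 - M e) * y e))) + (4 * ee e ^ 2 * M e ^ 2 * y e - \<i> * 2 * ee e ^ 2 * M e ^ 2 * y e)"])
  subgoal by (rule ord_le, (rule b.near3' mo_3 M ordN ord_rules)+, simp)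
  subgoal for e by (algebra | (use i2 in algebra))
  done

lemmas mo_4 = mo_aC4 mo_aD4 mo_aE4 mo_bC4 mo_bD4 mo_bE4

lemma mo_aA5: "ord F 5 (\<lambda>e. a.A e - (ee e * (1 + M e + M e ^ 2 + M e ^ 3) * x e - ee e ^ 3 * y e + ee e ^ 3 * (7 + 19 * M e) * x e))"
  apply (rule a.solve_eq[OF a.eq_A, where h="\<lambda>e. ee e * ((a.C e - (ee e ^ 2 * (1 + 2 * M e) * x e)) + (a.D e - (ee e ^ 2 * (2 + 4 * M e) * x e - \<i> * ee e ^ 2 * (1 + 2 * M e) * x e)) + (a.E e - (ee e ^ 2 * (2 + 4 * M e) * x e + \<i> * ee e ^ 2 * (1 + 2 * M e) * x e))) + (2 * (q e (-2,0) - (ee e ^ 2 + 9 * ee e ^ 4)) * a.A e + 2 * (ee e ^ 2 + 9 * ee e ^ 4) * (a.A e - (ee e * (1 + M e) * x e)) - (r e (-2,0) - (ee e ^ 2 + 9 * ee e ^ 4)) * b.A e - (ee e ^ 2 + 9 * ee e ^ 4) * (b.A e - (ee e * (1 - M e) * y e))) + (ee e * M e ^ 4 * x e + 19 * ee e ^ 3 * M e ^ 2 * x e - ee e ^ 5 * (9 - 9 * M e) * y e + ee e ^ 5 * (18 + 18 * M e) * x e)"])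
  subgoal by (rule ord_le, (rule mo_3 mo_4 coef' M ordN a.ordA b.ordA ord_rules)+, simp)
  subgoal for e by (algebra | (use i2 in algebra))
  done

lemma mo_aB5: "ord F 5 (\<lambda>e. a.B e - (ee e * (1 + M e + M e ^ 2 + M e ^ 3) * x e - \<i> * ee e * (1 + M e + M e ^ 2 + M e ^ 3) * x e + 2 * ee e ^ 3 * y e - \<i> * 2 * ee e ^ 3 * y e + ee e ^ 3 * (7 + 17 * M e) * x e - \<i> * ee e ^ 3 * (7 + 17 * M e) * x e))"
  apply (rule a.solve_eq[OF a.eq_B, where h="\<lambda>e. ee e * ((a.D e - (ee e ^ 2 * (2 + 4 * M e) * x e - \<i> * ee e ^ 2 * (1 + 2 * M e) * x e)) + -\<i> * (a.E e - (ee e ^ 2 * (2 + 4 * M e) * x e + \<i> * ee e ^ 2 * (1 + 2 * M e) * x e))) + (2 * (q e (-1,-1) - (2 * ee e ^ 2 + 14 * ee e ^ 4)) * a.B e + 2 * (2 * ee e ^ 2 + 14 * ee e ^ 4) * (a.B e - (ee e * (1 + M e) * x e - \<i> * ee e * (1 + M e) * x e)) - (r e (-1,-1) - (\<i> * 2 * ee e ^ 2 + \<i> * 14 * ee e ^ 4)) * b.B e - (\<i> * 2 * ee e ^ 2 + \<i> * 14 * ee e ^ 4) * (b.B e - (ee e * (1 - M e) * y e + \<i> * ee e * (1 - M e) * y e))) + (ee e * M e ^ 4 * x e - \<i> * ee e * M e ^ 4 * x e + 17 * ee e ^ 3 * M e ^ 2 * x e - \<i> * 17 * ee e ^ 3 *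 M e ^ 2 * x e + ee e ^ 5 * (14 - 14 * M e) * y e - \<i> * ee e ^ 5 * (14 - 14 * M e) * y e + ee e ^ 5 * (28 + 28 * M e) * x e - \<i> * ee e ^ 5 * (28 + 28 * M e) * x e)"])
  subgoal by (rule ord_le, (rule mo_3 mo_4 coef' M ordN a.ordA b.ordA ord_rules)+, simp)
  subgoal for e by (algebra | (use i2 in algebra))
  done

lemma mo_bA5: "ord F 5 (\<lambda>e. b.A e - (ee e * (1 - M e + M e ^ 2 - M e ^ 3) * y e + ee e ^ 3 * (7 - 19 * M e) * y e - ee e ^ 3 * x e))"
  apply (rule b.solve_eq[OF b.eq_A, where h="\<lambda>e. ee e * ((b.C e - (ee e ^ 2 * (1 - 2 * M e) * y e)) + (b.D e - (ee e ^ 2 * (2 - 4 * M e) * y e + \<i> * ee e ^ 2 * (1 - 2 * M e) * y e)) + (b.E e - (ee e ^ 2 * (2 - 4 * M e) * y e - \<i> * ee e ^ 2 * (1 - 2 * M e) * y e))) + (2 * (q e (-2,0) - (ee e ^ 2 + 9 * ee e ^ 4)) * b.A e + 2 * (ee e ^ 2 + 9 * ee e ^ 4) * (b.A e - (ee e * (1 - M e) * y e)) - (cnj (r e (-2,0)) - (ee e ^ 2 + 9 * ee e ^ 4)) * a.A e - (ee e ^ 2 + 9 * ee e ^ 4) * (a.A e - (ee e * (1 + M e) * x e))) + (ee e * M e ^ 4 * y e + 19 * ee e ^ 3 * M e ^ 2 * y e + ee e ^ 5 * (18 - 18 * M e) * y e - ee e ^ 5 * (9 + 9 * M e) * x e)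"])
  subgoal by (rule ord_le, (rule mo_3 mo_4 coef' M ordN a.ordA b.ordA ord_rules)+, simp)
  subgoal for e by (algebra | (use i2 in algebra))
  done

lemma mo_bB5: "ord F 5 (\<lambda>e. b.B e - (ee e * (1 - M e + M e ^ 2 - M e ^ 3) * y e + \<i> * ee e * (1 - M e + M e ^ 2 - M e ^ 3) * y e + ee e ^ 3 * (7 - 17 * M e) * y e + \<i> * ee e ^ 3 * (7 - 17 * M e) * y e + 2 * ee e ^ 3 * x e + \<i> * 2 * ee e ^ 3 * x e))"
  apply (rule b.solve_eq[OF b.eq_B, where h="\<lambda>e. ee e * ((b.D e - (ee e ^ 2 * (2 - 4 * M e) * y e + \<i> * ee e ^ 2 * (1 - 2 * M e) * y e)) + \<i> * (b.E e - (ee e ^ 2 * (2 - 4 * M e) * y e - \<i> * ee e ^ 2 * (1 - 2 * M e) * y e))) + (2 * (q e (-1,-1) - (2 * ee e ^ 2 + 14 * ee e ^ 4)) * b.B e + 2 * (2 * ee e ^ 2 + 14 * ee e ^ 4) * (b.B e - (ee e * (1 - M e) * y e + \<i> * ee e * (1 - M e) * y e)) - (cnj (r e (-1,-1)) - (- \<i> * 2 * ee e ^ 2 - \<i> * 14 * ee e ^ 4)) * a.B e - (- \<i> * 2 * ee e ^ 2 - \<i> * 14 * ee e ^ 4) * (a.B e - (ee e * (1 + M e) * x e - \<i> * ee e * (1 + M e) * x e))) + (ee e * M e ^ 4 * y e + \<i> * ee e * M e ^ 4 * y e + 17 * ee e ^ 3 * M e ^ 2 * y e + \<i> * 17 * ee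 e ^ 3 * M e ^ 2 * y e + ee e ^ 5 * (28 - 28 * M e) * y e + \<i> * ee e ^ 5 * (28 - 28 * M e) * y e + ee e ^ 5 * (14 + 14 * M e) * x e + \<i> * ee e ^ 5 * (14 + 14 * M e) * x e)"])
  subgoal by (rule ord_le, (rule mo_3 mo_4 coef' M ordN a.ordA b.ordA ord_rules)+, simp)
  subgoal for e by (algebra | (use i2 in algebra))
  done

lemmas mo_5 = mo_aA5 mo_aB5 mo_bA5 mo_bB5

lemma mo_node_a: "ord F 6 (\<lambda>e. (1 - 2 * \<rho> e - M e) * x e + \<rho> e * y e - P e - (ee e ^ 2 * (3 + 3 * M e + 3 * M e ^ 2 + 3 * M e ^ 3) * x e + 3 * ee e ^ 4 * y e + ee e ^ 4 * (21 + 53 * M e) * x e))"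
  apply (rule ord_ev[OF mo_eq_Na, where g="\<lambda>e. ee e * ((a.A e - (ee e * (1 + M e + M e ^ 2 + M e ^ 3) * x e - ee e ^ 3 * y e + ee e ^ 3 * (7 + 19 * M e) * x e)) + (1 + \<i>) * (a.B e - (ee e * (1 + M e + M e ^ 2 + M e ^ 3) * x e - \<i> * ee e * (1 + M e + M e ^ 2 + M e ^ 3) * x e + 2 * ee e ^ 3 * y e - \<i> * 2 * ee e ^ 3 * y e + ee e ^ 3 * (7 + 17 * M e) * x e - \<i> * ee e ^ 3 * (7 + 17 * M e) * x e)))"])
  subgoal for e by (erule eq_from_diff[where c=1], (algebra | (use i2 in algebra)))
  subgoal by (rule ord_le, (rule mo_5 ord_rules)+, simp)
  done

lemma mo_node_b: "ord F 6 (\<lambda>e. (1 - 2 * \<rho> e + M e) * y e + \<rho> e * x e - P e - (ee e ^ 2 * (3 - 3 * M e + 3 * M e ^ 2 - 3 * M e ^ 3) * y e + ee e ^ 4 * (21 - 53 * M e) * y e + 3 * ee e ^ 4 * x e))"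
  apply (rule ord_ev[OF mo_eq_Nb, where g="\<lambda>e. ee e * ((b.A e - (ee e * (1 - M e + M e ^ 2 - M e ^ 3) * y e + ee e ^ 3 * (7 - 19 * M e) * y e - ee e ^ 3 * x e)) + (1 + - \<i>) * (b.B e - (ee e * (1 - M e + M e ^ 2 - M e ^ 3) * y e + \<i> * ee e * (1 - M e + M e ^ 2 - M e ^ 3) * y e + ee e ^ 3 * (7 - 17 * M e) * y e + \<i> * ee e ^ 3 * (7 - 17 * M e) * y e + 2 * ee e ^ 3 * x e + \<i> * 2 * ee e ^ 3 * x e)))"])
  subgoal for e by (erule eq_from_diff[where c=1], (algebra | (use i2 in algebra)))
  subgoal by (rule ord_le, (rule mo_5 ord_rules)+, simp)
  done

end

context germ begin

lemma ord_eq: assumes "ord F k g" "\<And>e. h e = g e" shows "ord F k h"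
  using assms by presburger

section \<open>The determinants of the node equations\<close>

text \<open>
  Cramer's rule, summed over the two unknowns, so that the normalisation \<open>x + y = 2 (1 - P)\<close> eliminates them.
\<close>

lemma cramer:
  assumes r: "ord F n (\<lambda>e. a e * x e + b e * y e - P e)" "ord F n (\<lambda>e. c e * x e + d e * y e - P e)"
    and o: "ord F 0 a" "ord F 0 b" "ord F 0 c" "ord F 0 d" and s: "eventually (\<lambda>e. x e + y e = 2 * (1 - P e)) F"
  shows "ord F n (\<lambda>e. 2 * (1 - P e) * (a e * d e - b e * c e) - P e * (a e + d e - b e - c e))"
proof (rule ord_ev[OF s])
  show "ord F n (\<lambda>e. (d e - c e) * (a e * x e + b e * y e - P e) + (a e - b e) * (c e * x e + d e * y e - P e))"
    by (rule ord_le, (rule r o ord_rules)+, simp)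
  fix e assume h: "x e + y e = 2 * (1 - P e)"
  show "2 * (1 - P e) * (a e * d e - b e * c e) - P e * (a e + d e - b e - c e)
    = (d e - c e) * (a e * x e + b e * y e - P e) + (a e - b e) * (c e * x e + d e * y e - P e)"
    unfolding h[symmetric] by algebra
qed

text \<open>
  At zero coupling the trace-like factor \<open>S\<close> is \<open>-4\<close>, so \<open>P\<close> is minus half of the determinant at leading order.
\<close>

lemma cramer_rhs:
  assumes c: "ord F n (\<lambda>e. 2 * (1 - P e) * D e - P e * S e)" and P: "ord F 1 P" and S: "ord F 1 (\<lambda>e. S e + 4)"
    and D: "ord F j D" and j: "j + 1 \<le> n"
  shows "ord F (j + 1) (\<lambda>e. 2 * P e + D e)"
proof -
  have "ord F j (\<lambda>e. 2 * (1 - P e) * D e - (2 * (1 - P e) * D e - P e * S e))"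
    by (rule ord_le, (rule c P D ord_rules)+, use j in simp)
  then have "ord F j (\<lambda>e. S e * P e)" by (rule ord_eq) simp
  then have P': "ord F j P" using S ord_cancel[of j S P "-4"] by simp
  have "ord F (j + 1) (\<lambda>e. 1/2 * (2 * (1 - P e) * D e - P e * S e) + P e * D e + 1/2 * ((S e + 4) * P e))"
  proof (rule ord_le)
    show "ord F (min (min (0 + n) (1 + j)) (0 + (1 + j))) (\<lambda>e. 1/2 * (2 * (1 - P e) * D e - P e * S e) + P e * D e + 1/2 * ((S e + 4) * P e))"
      by (intro ord_add ord_mult ord_const c P D S P')
  qed (use j in simp)
  then show ?thesis by (rule ord_eq) (simp add: field_simps)
qed

lemma square_roots_apart: assumes "ord F 4 (\<lambda>e. M e ^ 2 - 4 * of_real e ^ 2)" "ord F 4 (\<lambda>e. M e ^ 2)" shows "F = bot"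
proof (rule ccontr)
  assume "F \<noteq> bot"
  have "ord F 4 (\<lambda>e. M e ^ 2 - (M e ^ 2 - 4 * of_real e ^ 2))" by (rule ord_le, (rule assms ord_rules)+, simp)
  then have "ord F 4 (\<lambda>e. of_real e ^ 2 * 4)" by (rule ord_eq) simp
  then have "ord F 2 (\<lambda>e. 4)" by (rule ord_div) simp
  then have "ord F 1 (\<lambda>e. 4)" by (rule ord_le) simp
  then show False using not_ord[OF \<open>F \<noteq> bot\<close>] by fastforce
qed

end

text \<open>The coefficients of the node equations, with \<open>E\<close> for the coupling.\<close>

definition "i11 E \<rho> M = 1 - 2 * \<rho> - M - (E ^ 2 * (1 + M + M ^ 2 + M ^ 3 + M ^ 4 + M ^ 5) + E ^ 4 * (5 + 13 * M + 24 * M ^ 2 + 38 * M ^ 3) + E ^ 6 * (53 + 187 * M))" for E \<rho> M :: complex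

definition "i12 E \<rho> M = \<rho> - (-1 * E ^ 4 * (1 + M ^ 2) - E ^ 6 * (23 - 8 * M))" for E \<rho> M :: complex

definition "i21 E \<rho> M = \<rho> - (-1 * E ^ 4 * (1 + M ^ 2) - E ^ 6 * (23 - 8 * M))" for E \<rho> M :: complex

definition "i22 E \<rho> M = 1 - 2 * \<rho> + M - (E ^ 2 * (9 - 9 * M + 9 * M ^ 2 - 9 * M ^ 3 + 9 * M ^ 4 - 9 * M ^ 5) + E ^ 4 * (37 - 93 * M + 168 * M ^ 2 - 262 * M ^ 3) + E ^ 6 * (493 - 1747 * M))" for E \<rho> M :: complex

definition "det_i E \<rho> M = i11 E \<rho> M * i22 E \<rho> M - i12 E \<rho> M * i21 E \<rho> M" for E \<rho> M :: complex

lemmas i_entries = i11_def i12_def i21_def i22_def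

definition "m11 E \<rho> M = 1 - 2 * \<rho> - M - (E ^ 2 * (3 + 3 * M + 3 * M ^ 2 + 3 * M ^ 3) + E ^ 4 * (21 + 53 * M))" for E \<rho> M :: complex

definition "m12 E \<rho> M = \<rho> - (3 * E ^ 4)" for E \<rho> M :: complex

definition "m21 E \<rho> M = \<rho> - (3 * E ^ 4)" for E \<rho> M :: complex

definition "m22 E \<rho> M = 1 - 2 * \<rho> + M - (E ^ 2 * (3 - 3 * M + 3 * M ^ 2 - 3 * M ^ 3) + E ^ 4 * (21 - 53 * M))" for E \<rho> M :: complex

definition "det_m E \<rho> M = m11 E \<rho> M * m22 E \<rho> M - m12 E \<rho> M * m21 E \<rho> M" for E \<rho> M :: complex

lemmas m_entries = m11_def m12_def m21_def m22_def

context profile begin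

lemma det_i_leading: assumes M: "ord F 1 M" shows "ord F 4 (\<lambda>e. det_i (ee e) (\<rho> e) (M e) - (4 * ee e ^ 2 - M e ^ 2))"
  apply (rule ord_eq[where g="\<lambda>e. (- 10 * ee e ^ 2 * M e ^ 6 + ee e ^ 4 * (16 + 33 * M e ^ 2 - 32 * M e ^ 3 - 351 * M e ^ 4 + 48 * M e ^ 5 - 9 * M e ^ 6 - 9 * M e ^ 8 - 9 * M e ^ 10) + ee e ^ 6 * (336 - 608 * M e - 2824 * M e ^ 2 + 1392 * M e ^ 3 - 348 * M e ^ 4 + 48 * M e ^ 5 - 430 * M e ^ 6 + 32 * M e ^ 7 - 604 * M e ^ 8) - ee e ^ 8 * (1984 - 9280 * M e + 1943 * M e ^ 2 + 5369 * M e ^ 4 - 48 * M e ^ 5 + 13386 * M e ^ 6) + ee e ^ 10 * (4380 - 320 * M e - 19412 * M e ^ 2 - 5648 * M e ^ 3 - 115380 * M e ^ 4) + ee e ^ 12 * (25600 - 32 * M e - 326753 * M e ^ 2)) + (\<rho> e - 1 + 3 * ee e ^ 2) * (2 + ee e ^ 2 * (2 - 16 * M e + 20 * M e ^ 2 - 16 * M e ^ 3 + 20 * M e ^ 4 - 16 * M e ^ 5) + ee e ^ 4 * (82 - 160 * M e + 382 * M e ^ 2 - 448 * M e ^ 3) + ee e ^ 6 * (1046 - 3104 * M e)) + (\<rho> e - 1 + 3 * ee e ^ 2) ^ 2 * (3)"])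
  subgoal by (rule ord_le, (rule rho4 M ord_rules)+, simp)
  subgoal for e unfolding det_i_def i_entries by algebra
  done

text \<open>The terms of the determinant that are odd in \<open>M\<close> cancel up to degree six.\<close>

lemma det_i_odd: assumes M: "ord F 1 M" shows "ord F 8 (\<lambda>e. det_i (ee e) (\<rho> e) (M e) - det_i (ee e) (\<rho> e) (- M e) + 64 * ee e ^ 4 * M e ^ 3 + 704 * ee e ^ 6 * M e)"
  apply (rule ord_eq[where g="\<lambda>e. (96 * ee e ^ 4 * M e ^ 5 + ee e ^ 6 * M e ^ 3 * (3296 + 608 * M e ^ 2 + 64 * M e ^ 4) + ee e ^ 8 * M e * (23680 + 14336 * M e ^ 2 + 96 * M e ^ 4) + ee e ^ 10 * M e * (98688 - 11296 * M e ^ 2) - 64 * ee e ^ 12 * M e) + (\<rho> e - 1 + 3 * ee e ^ 2 + 16 * ee e ^ 4) * (-1 * ee e ^ 2 * M e * (32 + 32 * M e ^ 2 + 32 * M e ^ 4) - ee e ^ 4 * M e * (320 + 896 * M e ^ 2) - 6208 * ee e ^ 6 * M e)"])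
  subgoal by (rule ord_le, (rule rho6 M ord_rules)+, simp)
  subgoal for e unfolding det_i_def i_entries by algebra
  done

lemma det_m_leading: assumes M: "ord F 1 M" shows "ord F 6 (\<lambda>e. det_m (ee e) (\<rho> e) (M e) - (16 * ee e ^ 4 - M e ^ 2))"
  apply (rule ord_eq[where g="\<lambda>e. (- 6 * ee e ^ 2 * M e ^ 4 - ee e ^ 4 * M e ^ 2 * (133 + 9 * M e ^ 2 + 9 * M e ^ 4) - ee e ^ 6 * (48 + 384 * M e ^ 2 + 318 * M e ^ 4) - ee e ^ 8 * (240 + 2809 * M e ^ 2)) + (\<rho> e - 1 + 3 * ee e ^ 2 + 16 * ee e ^ 4) * (2 - ee e ^ 2 * (6 - 12 * M e ^ 2) - 6 * ee e ^ 4) + (\<rho> e - 1 + 3 * ee e ^ 2 + 16 * ee e ^ 4) ^ 2 * (3)"])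
  subgoal by (rule ord_le, (rule rho6 M ord_rules)+, simp)
  subgoal for e unfolding det_m_def m_entries by algebra
  done

text \<open>
  At a zero \<open>M\<^sup>2\<close> is \<open>4\<epsilon>\<^sup>2\<close>, so the odd part of the determinant is \<open>-480 \<epsilon>\<^sup>6 M\<close>. If it vanishes to the eighth order, then \<open>M\<close> is of second order, a contradiction.
\<close>

lemma det_i_no_opposite_roots:
  assumes M: "ord F 1 M" and d: "ord F 8 (\<lambda>e. det_i (ee e) (\<rho> e) (M e))" "ord F 8 (\<lambda>e. det_i (ee e) (\<rho> e) (- M e))"
  shows "F = bot"
proof -
  have "ord F 4 (\<lambda>e. det_i (ee e) (\<rho> e) (M e) - (det_i (ee e) (\<rho> e) (M e) - (4 * ee e ^ 2 - M e ^ 2)))"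
    by (rule ord_le, (rule d det_i_leading[OF M] ord_rules)+, simp)
  from ord_minus[OF this] have M2: "ord F 4 (\<lambda>e. M e ^ 2 - 4 * ee e ^ 2)" by (rule ord_eq) simp
  have "ord F 8 (\<lambda>e. (det_i (ee e) (\<rho> e) (M e) - det_i (ee e) (\<rho> e) (- M e) + 64 * ee e ^ 4 * M e ^ 3 + 704 * ee e ^ 6 * M e)
    - det_i (ee e) (\<rho> e) (M e) + det_i (ee e) (\<rho> e) (- M e) - 64 * ee e ^ 4 * M e * (M e ^ 2 - 4 * ee e ^ 2))"
    by (rule ord_le, (rule det_i_odd[OF M] d M M2 ord_rules)+, simp)
  then have "ord F 8 (\<lambda>e. ee e ^ 6 * (960 * M e))" by (rule ord_eq) algebra
  then have "ord F 2 (\<lambda>e. 960 * M e)" by (rule ord_div) simp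
  then have "ord F 2 (\<lambda>e. 1/960 * (960 * M e))" by (rule ord_le[OF ord_mult[OF ord_const]]) simp
  then have "ord F 4 (\<lambda>e. M e ^ 2)" using ord_power[of 2 M 2] by simp
  with M2 show "F = bot" by (rule square_roots_apart)
qed

end

context mode_i begin

lemma entries0: "ord F 0 (\<lambda>e. i11 (ee e) (\<rho> e) (M e))" "ord F 0 (\<lambda>e. i12 (ee e) (\<rho> e) (M e))"
  "ord F 0 (\<lambda>e. i21 (ee e) (\<rho> e) (M e))" "ord F 0 (\<lambda>e. i22 (ee e) (\<rho> e) (M e))"
  unfolding i_entries by (rule ord_le, (rule M rho0 ord_rules)+, simp)+

lemma cramer_i: "ord F 8 (\<lambda>e. 2 * (1 - P e) * det_i (ee e) (\<rho> e) (M e) - P e * (i11 (ee e) (\<rho> e) (M e) + i22 (ee e) (\<rho> e) (M e) - i12 (ee e) (\<rho> e) (M e) - i21 (ee e) (\<rho> e) (M e)))"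
  unfolding det_i_def
proof (rule cramer[OF _ _ entries0 norm_xy])
  show "ord F 8 (\<lambda>e. i11 (ee e) (\<rho> e) (M e) * x e + i12 (ee e) (\<rho> e) (M e) * y e - P e)"
    by (rule ord_eq[OF im_node_a]) (simp add: i_entries algebra_simps)
  show "ord F 8 (\<lambda>e. i21 (ee e) (\<rho> e) (M e) * x e + i22 (ee e) (\<rho> e) (M e) * y e - P e)"
    by (rule ord_eq[OF im_node_b]) (simp add: i_entries algebra_simps)
qed

lemma root_i: assumes "P = (\<lambda>_. 0)" shows "ord F 8 (\<lambda>e. det_i (ee e) (\<rho> e) (M e))"
  using ord_mult[OF ord_const[of "1/2"] cramer_i] by (simp add: assms)

lemma root_i_square: assumes "P = (\<lambda>_. 0)" shows "ord F 4 (\<lambda>e. M e ^ 2 - 4 * ee e ^ 2)"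
proof -
  have "ord F 4 (\<lambda>e. (det_i (ee e) (\<rho> e) (M e) - (4 * ee e ^ 2 - M e ^ 2)) - det_i (ee e) (\<rho> e) (M e))"
    by (rule ord_le, (rule det_i_leading[OF M] root_i[OF assms] ord_rules)+, simp)
  then show ?thesis by (rule ord_eq) simp
qed

lemma value_i: assumes "M = (\<lambda>_. 0)" shows "ord F 3 (\<lambda>e. P e + 2 * ee e ^ 2)"
proof -
  have d: "ord F 4 (\<lambda>e. det_i (ee e) (\<rho> e) (M e) - 4 * ee e ^ 2)" using det_i_leading[OF M] by (simp add: assms)
  have "ord F 2 (\<lambda>e. (det_i (ee e) (\<rho> e) (M e) - 4 * ee e ^ 2) + 4 * ee e ^ 2)" by (rule ord_le, (rule d ord_rules)+, simp)
  then have d2: "ord F 2 (\<lambda>e. det_i (ee e) (\<rho> e) (M e))" by simp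
  have S: "ord F 1 (\<lambda>e. i11 (ee e) (\<rho> e) (M e) + i22 (ee e) (\<rho> e) (M e) - i12 (ee e) (\<rho> e) (M e) - i21 (ee e) (\<rho> e) (M e) + 4)"
    apply (rule ord_eq[where g="\<lambda>e. - 6 * (\<rho> e - 1) - (ee e ^ 2 * (10 - 8 * M e + 10 * M e ^ 2 - 8 * M e ^ 3 + 10 * M e ^ 4 - 8 * M e ^ 5) + ee e ^ 4 * (44 - 80 * M e + 194 * M e ^ 2 - 224 * M e ^ 3) + ee e ^ 6 * (592 - 1576 * M e))"])
    subgoal by (rule ord_le, (rule rho M ord_rules)+, simp)
    subgoal for e unfolding i_entries by algebra
    done
  from cramer_rhs[OF cramer_i P S d2] have "ord F 3 (\<lambda>e. 2 * P e + det_i (ee e) (\<rho> e) (M e))" by simp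
  then have "ord F 3 (\<lambda>e. 1/2 * ((2 * P e + det_i (ee e) (\<rho> e) (M e)) - (det_i (ee e) (\<rho> e) (M e) - 4 * ee e ^ 2)))"
    by (rule ord_le[OF ord_mult[OF ord_const ord_diff[OF _ d]]]) simp
  then show ?thesis by (rule ord_eq) (simp add: field_simps)
qed

end

context mode_m begin

lemma entries0: "ord F 0 (\<lambda>e. m11 (ee e) (\<rho> e) (M e))" "ord F 0 (\<lambda>e. m12 (ee e) (\<rho> e) (M e))"
  "ord F 0 (\<lambda>e. m21 (ee e) (\<rho> e) (M e))" "ord F 0 (\<lambda>e. m22 (ee e) (\<rho> e) (M e))"
  unfolding m_entries by (rule ord_le, (rule M rho0 ord_rules)+, simp)+

lemma cramer_m: "ord F 6 (\<lambda>e. 2 * (1 - P e) * det_m (ee e) (\<rho> e) (M e) - P e * (m11 (ee e) (\<rho> e) (M e) + m22 (ee e) (\<rho> e) (M e) - m12 (ee e) (\<rho> e) (M e) - m21 (ee e) (\<rho> e) (M e)))"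
  unfolding det_m_def
proof (rule cramer[OF _ _ entries0 norm_xy])
  show "ord F 6 (\<lambda>e. m11 (ee e) (\<rho> e) (M e) * x e + m12 (ee e) (\<rho> e) (M e) * y e - P e)"
    by (rule ord_eq[OF mo_node_a]) (simp add: m_entries algebra_simps)
  show "ord F 6 (\<lambda>e. m21 (ee e) (\<rho> e) (M e) * x e + m22 (ee e) (\<rho> e) (M e) * y e - P e)"
    by (rule ord_eq[OF mo_node_b]) (simp add: m_entries algebra_simps)
qed

lemma root_m_square: assumes "P = (\<lambda>_. 0)" shows "ord F 6 (\<lambda>e. M e ^ 2 - 16 * ee e ^ 4)"
proof -
  have d: "ord F 6 (\<lambda>e. det_m (ee e) (\<rho> e) (M e))"
    using ord_mult[OF ord_const[of "1/2"] cramer_m] by (simp add: assms)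
  have "ord F 6 (\<lambda>e. (det_m (ee e) (\<rho> e) (M e) - (16 * ee e ^ 4 - M e ^ 2)) - det_m (ee e) (\<rho> e) (M e))"
    by (rule ord_le, (rule det_m_leading[OF M] d ord_rules)+, simp)
  then show ?thesis by (rule ord_eq) simp
qed

lemma value_m: assumes "M = (\<lambda>_. 0)" shows "ord F 5 (\<lambda>e. P e + 8 * ee e ^ 4)"
proof -
  have d: "ord F 6 (\<lambda>e. det_m (ee e) (\<rho> e) (M e) - 16 * ee e ^ 4)" using det_m_leading[OF M] by (simp add: assms)
  have "ord F 4 (\<lambda>e. (det_m (ee e) (\<rho> e) (M e) - 16 * ee e ^ 4) + 16 * ee e ^ 4)" by (rule ord_le, (rule d ord_rules)+, simp)
  then have d2: "ord F 4 (\<lambda>e. det_m (ee e) (\<rho> e) (M e))" by simp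
  have S: "ord F 1 (\<lambda>e. m11 (ee e) (\<rho> e) (M e) + m22 (ee e) (\<rho> e) (M e) - m12 (ee e) (\<rho> e) (M e) - m21 (ee e) (\<rho> e) (M e) + 4)"
    apply (rule ord_eq[where g="\<lambda>e. - 6 * (\<rho> e - 1) - (ee e ^ 2 * (6 + 6 * M e ^ 2) + 36 * ee e ^ 4)"])
    subgoal by (rule ord_le, (rule rho M ord_rules)+, simp)
    subgoal for e unfolding m_entries by algebra
    done
  from cramer_rhs[OF cramer_m P S d2] have "ord F 5 (\<lambda>e. 2 * P e + det_m (ee e) (\<rho> e) (M e))" by simp
  then have "ord F 5 (\<lambda>e. 1/2 * ((2 * P e + det_m (ee e) (\<rho> e) (M e)) - (det_m (ee e) (\<rho> e) (M e) - 16 * ee e ^ 4)))"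
    by (rule ord_le[OF ord_mult[OF ord_const ord_diff[OF _ d]]]) simp
  then show ?thesis by (rule ord_eq) (simp add: field_simps)
qed

end

section \<open>The modes of the linearised operator\<close>

context cross begin

lemma norm_ev_le: assumes "\<omega>^4 = 1" shows "norm (ev \<omega>) \<le> 8"
proof (rule norm_hil_le)
  fix F :: "(int \<times> int) set" assume F: "finite F"
  have b: "(norm (vl (ev \<omega>) x))\<^sup>2 \<le> 16" for x
  proof -
    have "cmod (wt \<omega> x) * cmod (u x) \<le> 1 * 2" by (intro mult_mono wt_cmod[OF assms] u_le) auto
    then have "norm (vl (ev \<omega>) x) \<le> 4"
      using norm_pair_le_sum[of "vl (ev \<omega>) x"] by (simp add: vl_ev[OF assms] norm_mult mult.commute)
    then have "(norm (vl (ev \<omega>) x))\<^sup>2 \<le> 4\<^sup>2" by (rule power_mono) simp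
    then show ?thesis by simp
  qed
  have "(\<Sum>x\<in>F. (norm (vl (ev \<omega>) x))\<^sup>2) = (\<Sum>x\<in>F \<inter> set S0. (norm (vl (ev \<omega>) x))\<^sup>2)"
    using F by (intro sum.mono_neutral_right) (auto simp: vl_ev[OF assms] wt_off norm_prod_def)
  also have "\<dots> \<le> of_nat (card (F \<inter> set S0)) * 16" by (rule sum_bounded_above) (rule b)
  also have "\<dots> \<le> 64"
  proof -
    have "card (F \<inter> set S0) \<le> card (set S0)" by (intro card_mono) auto
    then show ?thesis by (simp add: set_S0)
  qed
  finally show "(\<Sum>x\<in>F. (norm (vl (ev \<omega>) x))\<^sup>2) \<le> 8\<^sup>2" by simp
qed simp

text \<open>
  The components of \<open>\<psi>\<close> and the solution, in the normalisation of the locales \<open>mode\<close> and \<open>profile\<close>.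
\<close>

definition "pa \<omega> m x = fst (vl (psi \<omega> m) x) / (\<i> * u NN)"
definition "pb \<omega> m x = snd (vl (psi \<omega> m) x) / (- \<i> * cnj (u NN))"
definition "pf x = u x / u NN"
definition "rho = u NN * cnj (u NN)"

lemma pa_pb_le: assumes "\<omega>^4 = 1" "\<bar>m\<bar> \<le> 1/4" shows "cmod (pa \<omega> m x) \<le> 32" "cmod (pb \<omega> m x) \<le> 32"
proof -
  have "norm (vl (psi \<omega> m) x) \<le> norm (psi \<omega> m)" by (rule norm_rep_le)
  also have "\<dots> \<le> 2 * norm (ev \<omega>)" unfolding psi_eq[OF assms(1)] by (rule G_les[OF assms(2)])
  also have "\<dots> \<le> 16" using norm_ev_le[OF assms(1)] by simp
  finally have n: "norm (vl (psi \<omega> m) x) \<le> 16" .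
  have "\<bar>1 - (cmod (u NN))\<^sup>2\<bar> \<le> h" by (rule on) (simp add: set_S0)
  then have "(cmod (u NN))\<^sup>2 \<ge> (1/2)\<^sup>2" using small eps by (simp add: power2_eq_square)
  then have N: "cmod (u NN) \<ge> 1/2" by (rule power2_le_imp_le) simp
  have d: "z / cmod (u NN) \<le> 32" if "z \<le> 16" for z
  proof -
    have "z \<le> 32 * cmod (u NN)" using that N by linarith
    then show ?thesis using N by (simp add: divide_le_eq)
  qed
  have "cmod (fst (vl (psi \<omega> m) x)) \<le> 16" "cmod (snd (vl (psi \<omega> m) x)) \<le> 16"
    using n norm_fst_le[of "fst (vl (psi \<omega> m) x)" "snd (vl (psi \<omega> m) x)"] norm_snd_le[of "snd (vl (psi \<omega> m) x)" "fst (vl (psi \<omega> m) x)"] by simp_all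
  then show "cmod (pa \<omega> m x) \<le> 32" "cmod (pb \<omega> m x) \<le> 32"
    unfolding pa_def pb_def by (simp_all add: norm_divide norm_mult d)
qed

lemma pa_pb_rot: assumes "\<omega>^4 = 1" "\<bar>m\<bar> \<le> 1/4"
  shows "pa \<omega> m (rot x) = (\<i> * \<omega>) * pa \<omega> m x" "pb \<omega> m (rot x) = (- \<i> * \<omega>) * pb \<omega> m x"
  using sect_rot[OF sect_psi[OF assms]] by (simp_all add: pa_def pb_def)

lemma pa_pb_sum: assumes "\<omega>^4 = 1" "\<bar>m\<bar> \<le> 1/4" shows "pa \<omega> m NN + pb \<omega> m NN = 2 * (1 - of_real (p \<omega> m))"
  using pc_psi[OF assms] by (simp add: pc_def al_def be_def pa_def pb_def)

lemma pa_pb_eq: assumes w: "\<omega>^4 = 1" and m: "\<bar>m\<bar> \<le> 1/4"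
  shows "(1 - of_real m) * pa \<omega> m x = of_real \<epsilon> * nbr_sum (pa \<omega> m) x
      + (2 * (rho * pf x * cnj (pf x)) * pa \<omega> m x - rho * pf x * pf x * pb \<omega> m x) + of_real (p \<omega> m) * (wt \<omega> x * pf x)" (is ?A)
    and "(1 + of_real m) * pb \<omega> m x = of_real \<epsilon> * nbr_sum (pb \<omega> m) x
      + (2 * (rho * pf x * cnj (pf x)) * pb \<omega> m x - cnj (rho * pf x * pf x) * pa \<omega> m x) + of_real (p \<omega> m) * (wt \<omega> x * cnj (pf x))" (is ?B)
proof -
  define U a b where "U = u NN" and "a = (\<lambda>x. fst (vl (psi \<omega> m) x))" and "b = (\<lambda>x. snd (vl (psi \<omega> m) x))"
  have U: "U \<noteq> 0" "cnj U \<noteq> 0" using uN by (simp_all add: U_def)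
  have e: "vl (H (psi \<omega> m) - m *\<^sub>R sg (psi \<omega> m)) x = vl (p \<omega> m *\<^sub>R ev \<omega>) x" using eig[OF w m] by simp
  have c: "complex_of_real ((cmod (u x))\<^sup>2) = u x * cnj (u x)" by (rule complex_norm_square)
  have 1: "(1 - 2 * (u x * cnj (u x))) * a x - (u x)\<^sup>2 * b x - of_real \<epsilon> * nbr_sum a x - of_real m * a x = of_real (p \<omega> m) * (wt \<omega> x * (\<i> * u x))"
    using arg_cong[OF e, of fst] by (simp add: vl_H hloc_def vl_ev[OF w] nbr_sum_moves scaleR_conv_of_real a_def b_def complex_norm_square[symmetric])
  have 2: "(1 - 2 * (u x * cnj (u x))) * b x - (cnj (u x))\<^sup>2 * a x - of_real \<epsilon> * nbr_sum b x + of_real m * b x = of_real (p \<omega> m) * (wt \<omega> x * (- \<i> * cnj (u x)))"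
    using arg_cong[OF e, of snd] by (simp add: vl_H hloc_def vl_ev[OF w] nbr_sum_moves scaleR_conv_of_real a_def b_def complex_norm_square[symmetric])
  define \<alpha> \<beta> f where "\<alpha> = pa \<omega> m" and "\<beta> = pb \<omega> m" and "f = pf"
  have A: "a y = \<i> * U * \<alpha> y" "b y = - \<i> * cnj U * \<beta> y" "u y = U * f y" for y
    using U by (simp_all add: a_def b_def \<alpha>_def \<beta>_def f_def pa_def pb_def pf_def U_def)
  have n: "nbr_sum a x = \<i> * U * nbr_sum \<alpha> x" "nbr_sum b x = - \<i> * cnj U * nbr_sum \<beta> x"
    by (simp_all add: nbr_sum_moves A algebra_simps)
  have r: "rho = U * cnj U" by (simp add: rho_def U_def)
  define g V N1 N2 Q k where "g = cnj (f x)" and "V = cnj U" and "N1 = nbr_sum \<alpha> x" and "N2 = nbr_sum \<beta> x"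
    and "Q = complex_of_real (p \<omega> m)" and "k = complex_of_real \<epsilon>"
  have cu: "cnj (u x) = V * g" by (simp add: A V_def g_def)
  have i2: "\<i> * \<i> = -1" by simp
  have "\<i> * U * ((1 - of_real m) * \<alpha> x - (k * N1 + (2 * (U * V * f x * g) * \<alpha> x - U * V * f x * f x * \<beta> x) + Q * (wt \<omega> x * f x))) = 0"
    using 1[unfolded cu] unfolding n A N1_def[symmetric] V_def[symmetric] Q_def[symmetric] k_def[symmetric] by algebra
  then have "(1 - of_real m) * \<alpha> x = k * N1 + (2 * (U * V * f x * g) * \<alpha> x - U * V * f x * f x * \<beta> x) + Q * (wt \<omega> x * f x)"
    using U by simp
  then show ?A unfolding r \<alpha>_def[symmetric] \<beta>_def[symmetric] f_def[symmetric] g_def V_def N1_def Q_def k_def .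
  have "\<i> * V * ((1 + of_real m) * \<beta> x - (k * N2 + (2 * (U * V * f x * g) * \<beta> x - V * U * g * g * \<alpha> x) + Q * (wt \<omega> x * g))) = 0"
    using 2[unfolded cu] unfolding n A N2_def[symmetric] V_def[symmetric] Q_def[symmetric] k_def[symmetric] by algebra
  then have "(1 + of_real m) * \<beta> x = k * N2 + (2 * (U * V * f x * g) * \<beta> x - V * U * g * g * \<alpha> x) + Q * (wt \<omega> x * g)"
    using U by (simp add: V_def)
  then show ?B unfolding r complex_cnj_mult complex_cnj_cnj \<alpha>_def[symmetric] \<beta>_def[symmetric] f_def[symmetric] g_def V_def N2_def Q_def k_def .
qed

lemma pf_eq: "pf x = of_real \<epsilon> * nbr_sum pf x + rho * pf x * pf x * cnj (pf x)"
proof -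
  have U: "u NN \<noteq> 0" by (rule uN)
  have "of_real (1 - (cmod (u x))\<^sup>2) * u x = of_real \<epsilon> * nbr_sum u x" using stat unfolding stationary_def by blast
  then have 1: "(1 - u x * cnj (u x)) * u x = of_real \<epsilon> * nbr_sum u x" by (simp only: of_real_diff of_real_1 complex_norm_square)
  have A: "u y = u NN * pf y" for y using U by (simp add: pf_def)
  have n: "nbr_sum u x = u NN * nbr_sum pf x" by (subst nbr_sum_moves, subst (1 2 3 4) A) (simp add: nbr_sum_moves algebra_simps)
  define U f g V N where "U = u NN" and "f = pf x" and "g = cnj (pf x)" and "V = cnj (u NN)" and "N = nbr_sum pf x"
  have "(1 - U * f * (V * g)) * (U * f) = of_real \<epsilon> * (U * N)"
    using 1 unfolding n A[of x] by (simp add: U_def f_def g_def V_def N_def)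
  then have "U * (f - (of_real \<epsilon> * N + U * V * f * f * g)) = 0" by algebra
  then have "f = of_real \<epsilon> * N + U * V * f * f * g" using U by (simp add: U_def)
  then show ?thesis by (simp add: rho_def f_def g_def U_def V_def N_def)
qed

lemma pf_N: "pf NN = 1" using uN by (simp add: pf_def)
lemma pf_rot: "pf (rot x) = \<i> * pf x" by (simp add: pf_def rot)

end

locale cross_family = near_cross F u C for F u C +
  fixes K :: real
  assumes cr: "eventually (\<lambda>e. cross e (K * e) (u e)) F"
begin

definition "fu e = cross.pf (u e)"
definition "ru e = cross.rho (u e)"

lemma u_inv: "ord F 0 (\<lambda>e. inverse (u e (-1,0)))"
  using base_nodes(1) by (rule ord_inverse(1)) simp

sublocale profile F fu ru
proof
  show "ord F 1 (\<lambda>e. ru e - 1)"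
  proof (rule ord_ev[OF cr])
    show "ord F 1 (\<lambda>e. (u e (-1,0) - 1) * cnj (u e (-1,0)) + cnj (u e (-1,0) - 1))"
      by (rule ord_le, (rule base_nodes u0 ord_rules)+, simp)
    show "cross e (K * e) (u e) \<Longrightarrow> ru e - 1 = (u e (-1,0) - 1) * cnj (u e (-1,0)) + cnj (u e (-1,0) - 1)" for e
      by (simp add: ru_def cross.rho_def algebra_simps)
  qed
  show "eventually (\<lambda>e. fu e (-1,0) = 1) F"
    using cr by eventually_elim (simp add: fu_def cross.pf_N)
  show "eventually (\<lambda>e. \<forall>x. fu e (rot x) = \<i> * fu e x) F"
    using cr by eventually_elim (simp add: fu_def cross.pf_rot)
  show "eventually (\<lambda>e. \<forall>x. x \<notin> set S0 \<longrightarrow> fu e x = of_real e * nbr_sum (fu e) x + ru e * fu e x * fu e x * cnj (fu e x)) F"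
    using cr by eventually_elim (unfold fu_def ru_def, blast intro: cross.pf_eq)
  show "ord F n (\<lambda>e. fu e x)" if "l1 x \<ge> n + 1" for n x
  proof (rule ord_ev[OF cr])
    show "ord F n (\<lambda>e. u e x * inverse (u e (-1,0)))"
      by (rule ord_le, (rule u_far[OF that] u_inv ord_rules)+, simp)
  qed (simp add: fu_def cross.pf_def divide_inverse)
  show "eventually (\<lambda>e. 1 - ru e = of_real e * nbr_sum (fu e) (-1,0)) F"
    using cr
  proof eventually_elim
    case (elim e)
    show ?case using cross.pf_eq[OF elim, of "(-1,0)"] cross.pf_N[OF elim] unfolding fu_def ru_def by (simp add: diff_eq_eq)
  qed
qed

end

text \<open>
  The bound \<open>p1\<close> on the reduced function holds in both cases of interest: at \<open>m = 0\<close> and at its zeros.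
\<close>

locale cross_mode = cross_family F u C K for F u C K +
  fixes \<omega> :: complex and m :: "real \<Rightarrow> real"
  assumes w: "\<omega>^4 = 1" and m: "ord F 1 (\<lambda>e. of_real (m e))"
    and p1: "ord F 1 (\<lambda>e. of_real (cross.p e (u e) \<omega> (m e)))"
begin

definition "am e = cross.pa e (u e) \<omega> (m e)"
definition "bm e = cross.pb e (u e) \<omega> (m e)"
abbreviation "Mm \<equiv> \<lambda>e. complex_of_real (m e)"
abbreviation "Pm \<equiv> \<lambda>e. complex_of_real (cross.p e (u e) \<omega> (m e))"

lemma crm: "eventually (\<lambda>e. cross e (K * e) (u e) \<and> \<bar>m e\<bar> \<le> 1/4) F"
  using cr ord1_small[OF m, of "1/4"] by (simp add: eventually_conj_iff)

abbreviation "ca e x \<equiv> 2 * (ru e * fu e x * cnj (fu e x)) * am e x - ru e * fu e x * fu e x * bm e x"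
abbreviation "cb e x \<equiv> 2 * (ru e * fu e x * cnj (fu e x)) * bm e x - cnj (ru e * fu e x * fu e x) * am e x"

lemma mode_eqs: "eventually (\<lambda>e. \<forall>x.
    (1 - Mm e) * am e x = of_real e * nbr_sum (am e) x + ca e x + Pm e * (wt \<omega> x * fu e x) \<and>
    (1 + Mm e) * bm e x = of_real e * nbr_sum (bm e) x + cb e x + Pm e * (wt \<omega> x * cnj (fu e x))) F"
  using crm
proof eventually_elim
  case (elim e)
  then interpret cross e "K * e" "u e" by simp
  show ?case using pa_pb_eq[OF w] elim unfolding am_def bm_def fu_def ru_def by blast
qed

lemma eq_off:
  "eventually (\<lambda>e. \<forall>x. x \<notin> set S0 \<longrightarrow> (1 - Mm e) * am e x = of_real e * nbr_sum (am e) x + ca e x) F"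
  "eventually (\<lambda>e. \<forall>x. x \<notin> set S0 \<longrightarrow> (1 - - Mm e) * bm e x = of_real e * nbr_sum (bm e) x + cb e x) F"
  using mode_eqs by (eventually_elim, simp add: wt_off)+

text \<open>
  The norm bound on \<open>\<psi>\<close> starts the induction; each step away from the nodes gains a factor \<open>\<epsilon>\<close>.
\<close>

lemma far_ab: "l1 x \<ge> n + 1 \<Longrightarrow> ord F n (\<lambda>e. am e x) \<and> ord F n (\<lambda>e. bm e x)"
proof (induction n arbitrary: x)
  case 0
  have "eventually (\<lambda>e. cmod (am e x) \<le> 32 * e ^ 0 \<and> cmod (bm e x) \<le> 32 * e ^ 0) F"
    using crm
  proof eventually_elim
    case (elim e)
    then interpret cross e "K * e" "u e" by simp
    show ?case using pa_pb_le[OF w, of "m e" x] elim by (simp add: am_def bm_def)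
  qed
  then show ?case by (auto simp: eventually_conj_iff intro: ordI)
next
  case (Suc n)
  have x: "x \<notin> set S0" using Suc.prems by (intro l1_S0) simp
  have "l1 (east x) \<ge> n + 1" "l1 (west x) \<ge> n + 1" "l1 (north x) \<ge> n + 1" "l1 (south x) \<ge> n + 1" "l1 x \<ge> n + 1"
    using l1_moves[of x] Suc.prems by linarith+
  note nb = this[THEN Suc.IH, THEN conjunct1] this[THEN Suc.IH, THEN conjunct2]
  have f: "ord F 1 (\<lambda>e. fu e x)" by (rule f.far) (use Suc.prems in simp)
  have "ord F (Suc n) (\<lambda>e. am e x)"
  proof (rule ord_cancel)
    show "ord F (Suc n) (\<lambda>e. (1 - Mm e) * am e x)"
    proof (rule ord_ev[OF eq_off(1)])
      show "ord F (Suc n) (\<lambda>e. of_real e * (am e (east x) + am e (west x) + am e (north x) + am e (south x)) + ca e x)"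
        by (rule ord_le, (rule nb f rho0 ord_rules)+, simp)
    qed (use x in \<open>simp add: nbr_sum_moves\<close>)
    show "ord F 1 (\<lambda>e. (1 - Mm e) - 1)" using ord_minus[OF m] by simp
  qed simp
  moreover have "ord F (Suc n) (\<lambda>e. bm e x)"
  proof (rule ord_cancel)
    show "ord F (Suc n) (\<lambda>e. (1 - - Mm e) * bm e x)"
    proof (rule ord_ev[OF eq_off(2)])
      show "ord F (Suc n) (\<lambda>e. of_real e * (bm e (east x) + bm e (west x) + bm e (north x) + bm e (south x)) + cb e x)"
        by (rule ord_le, (rule nb f rho0 ord_rules)+, simp)
    qed (use x in \<open>simp add: nbr_sum_moves\<close>)
    show "ord F 1 (\<lambda>e. (1 - - Mm e) - 1)" using m by simp
  qed simp
  ultimately show ?case ..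
qed

lemma cubic_far: assumes "l1 x \<ge> 3" shows "ord F 6 (\<lambda>e. ca e x)" "ord F 6 (\<lambda>e. cb e x)"
proof -
  have f: "ord F 2 (\<lambda>e. fu e x)" "ord F 2 (\<lambda>e. am e x)" "ord F 2 (\<lambda>e. bm e x)"
    using far_ab[of 2 x] f.far[of 2 x] assms by simp_all
  show "ord F 6 (\<lambda>e. ca e x)" "ord F 6 (\<lambda>e. cb e x)" by (rule ord_le, (rule f rho0 ord_rules)+, simp)+
qed

lemma is_mode: assumes z: "\<zeta> = \<i> * \<omega>" "\<xi> = - \<i> * \<omega>" "\<zeta> * \<zeta>' = 1" "\<xi> * \<xi>' = 1"
  shows "mode F fu ru am bm Mm \<zeta> \<zeta>' \<xi> \<xi>' Pm"
proof
  show "ord F 1 Mm" by (rule m)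
  show "\<zeta> * \<zeta>' = 1" "\<xi> * \<xi>' = 1" by (rule z)+
  show "ord F 1 (\<lambda>e. - Mm e)" by (rule ord_minus[OF m])
  have rots: "eventually (\<lambda>e. \<forall>x. am e (rot x) = \<zeta> * am e x \<and> bm e (rot x) = \<xi> * bm e x) F"
    using crm
  proof eventually_elim
    case (elim e)
    then interpret cross e "K * e" "u e" by simp
    show ?case using pa_pb_rot[OF w, of "m e"] elim by (simp add: am_def bm_def z)
  qed
  show "eventually (\<lambda>e. \<forall>x. am e (rot x) = \<zeta> * am e x) F" "eventually (\<lambda>e. \<forall>x. bm e (rot x) = \<xi> * bm e x) F"
    using rots by (eventually_elim, blast)+
  show "eventually (\<lambda>e. \<forall>x. x \<notin> set S0 \<longrightarrow> (1 - Mm e) * am e x = of_real e * nbr_sum (am e) x + ca e x) F"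
    "eventually (\<lambda>e. \<forall>x. x \<notin> set S0 \<longrightarrow> (1 - - Mm e) * bm e x = of_real e * nbr_sum (bm e) x + cb e x) F"
    by (rule eq_off)+
  show "ord F n (\<lambda>e. am e x)" if "l1 x \<ge> n + 1" for n x using far_ab[of n x] that by simp
  show "ord F n (\<lambda>e. bm e x)" if "l1 x \<ge> n + 1" for n x using far_ab[of n x] that by simp
  show "ord F 6 (\<lambda>e. ca e x)" if "l1 x \<ge> 3" for x by (rule cubic_far[OF that])
  show "ord F 6 (\<lambda>e. cb e x)" if "l1 x \<ge> 3" for x by (rule cubic_far[OF that])
  have nodes: "eventually (\<lambda>e. (1 - 2 * ru e - Mm e) * am e (-1,0) + ru e * bm e (-1,0) - of_real e * nbr_sum (am e) (-1,0) = Pm e \<and>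
      (1 - 2 * ru e + Mm e) * bm e (-1,0) + ru e * am e (-1,0) - of_real e * nbr_sum (bm e) (-1,0) = Pm e) F"
    using mode_eqs fN cr
  proof eventually_elim
    case (elim e)
    have r: "cnj (ru e) = ru e" by (simp add: ru_def cross.rho_def[OF elim(3)])
    have wN: "wt \<omega> (-1,0) = 1" by (simp add: wt_def)
    note eqs = elim(1)[rule_format, of "(-1,0)"]
    have "(1 - Mm e) * am e (-1,0) = of_real e * nbr_sum (am e) (-1,0) + (2 * ru e * am e (-1,0) - ru e * bm e (-1,0)) + Pm e"
      using eqs by (simp add: elim(2) wN)
    moreover have "(1 + Mm e) * bm e (-1,0) = of_real e * nbr_sum (bm e) (-1,0) + (2 * ru e * bm e (-1,0) - ru e * am e (-1,0)) + Pm e"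
      using eqs by (simp add: elim(2) wN r)
    ultimately show ?case by algebra
  qed
  show "eventually (\<lambda>e. (1 - 2 * ru e - Mm e) * am e (-1,0) + ru e * bm e (-1,0) - of_real e * nbr_sum (am e) (-1,0) = Pm e) F"
    "eventually (\<lambda>e. (1 - 2 * ru e + Mm e) * bm e (-1,0) + ru e * am e (-1,0) - of_real e * nbr_sum (bm e) (-1,0) = Pm e) F"
    using nodes by (eventually_elim, blast)+
  show "eventually (\<lambda>e. am e (-1,0) + bm e (-1,0) = 2 * (1 - Pm e)) F"
    using crm
  proof eventually_elim
    case (elim e)
    then interpret cross e "K * e" "u e" by simp
    show ?case using pa_pb_sum[OF w, of "m e"] elim by (simp add: am_def bm_def)
  qed
  show "ord F 1 Pm" by (rule p1)
qed

lemma is_mode_i: "\<omega> = \<i> \<Longrightarrow> mode_i F fu ru am bm Mm Pm"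
  unfolding mode_i_def by (rule is_mode) simp_all

lemma is_mode_m: "\<omega> = -1 \<Longrightarrow> mode_m F fu ru am bm Mm Pm"
  unfolding mode_m_def by (rule is_mode) simp_all

end

section \<open>Signs, simplicity and asymptotics of the zeros\<close>

lemma (in mode) zero_rhs:
  assumes z: "eventually (\<lambda>e. P e = 0) F" shows "mode F f \<rho> \<alpha> \<beta> M \<zeta> \<zeta>' \<xi> \<xi>' (\<lambda>_. 0)"
proof unfold_locales
  show "eventually (\<lambda>e. (1 - 2 * \<rho> e - M e) * x e + \<rho> e * y e - of_real e * nbr_sum (\<alpha> e) (-1,0) = 0) F"
    using eq_Na z by eventually_elim simp
  show "eventually (\<lambda>e. (1 - 2 * \<rho> e + M e) * y e + \<rho> e * x e - of_real e * nbr_sum (\<beta> e) (-1,0) = 0) F"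
    using eq_Nb z by eventually_elim simp
  show "eventually (\<lambda>e. x e + y e = 2 * (1 - 0)) F"
    using norm_xy z by eventually_elim simp
  show "ord F 1 (\<lambda>_. 0)" by (simp add: ord_def)
qed

text \<open>
  A choice of exceptional parameters turns "for some \<open>m\<close>" into a function \<open>m\<close> of \<open>\<epsilon>\<close> along the filter of exceptional \<open>\<epsilon>\<close>.
\<close>

lemma eventually_no_exception:
  assumes "\<And>F' m. F' \<le> F \<Longrightarrow> eventually (\<lambda>e. Q e (m e)) F' \<Longrightarrow> F' = bot"
  shows "eventually (\<lambda>e. \<forall>m. \<not> Q e m) F"
proof -
  define G where "G = inf F (principal {e. \<exists>m. Q e m})"
  have "G = bot"
  proof (rule assms)
    show "G \<le> F" by (simp add: G_def)
    show "eventually (\<lambda>e. Q e (SOME m. Q e m)) G"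
      unfolding G_def eventually_inf_principal by (intro always_eventually) (auto intro: someI)
  qed
  then have "eventually (\<lambda>e. False) G" by simp
  then show ?thesis unfolding G_def eventually_inf_principal by simp
qed

lemma cross_family_mono: assumes "cross_family F u C K" "F' \<le> F" shows "cross_family F' u C K"
proof -
  interpret cross_family F u C K by fact
  show ?thesis
  proof
    show "F' \<le> at_right 0" using F assms(2) by (rule order_trans[rotated])
    show "eventually (\<lambda>e. stationary e (u e)) F'" "eventually (\<lambda>e. \<forall>x. cmod (u e x - base x) \<le> C * e) F'"
      "eventually (\<lambda>e. cross e (K * e) (u e)) F'"
      using st_u near_u cr filter_leD[OF assms(2)] by blast+
  qed
qed

context cross_family begin

abbreviation "pu e \<omega> m \<equiv> cross.p e (u e) \<omega> m"

lemma p0_ord: assumes w: "\<omega>^4 = 1" shows "ord F 1 (\<lambda>e. of_real (pu e \<omega> 0))"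
proof (rule ordI)
  show "eventually (\<lambda>e. norm (complex_of_real (pu e \<omega> 0)) \<le> (12 * K + 8) * e ^ 1) F"
    using cr
  proof eventually_elim
    case (elim e)
    then interpret cross e "K * e" "u e" .
    show ?case using reg_pencil.p0_bound[OF reg[OF w]] by (simp add: \<eta>_def algebra_simps)
  qed
qed

lemma p_i_0: "ord F 3 (\<lambda>e. of_real (pu e \<i> 0) + 2 * of_real e ^ 2)"
proof -
  interpret cm: cross_mode F u C K \<i> "\<lambda>_. 0"
    by unfold_locales (use p0_ord[of \<i>] in \<open>simp_all add: ord_def\<close>)
  interpret mode_i F fu ru cm.am cm.bm cm.Mm cm.Pm by (rule cm.is_mode_i) simp
  show ?thesis by (rule value_i) simp
qed

lemma p_m_0: "ord F 5 (\<lambda>e. of_real (pu e (-1) 0) + 8 * of_real e ^ 4)"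
proof -
  interpret cm: cross_mode F u C K "-1" "\<lambda>_. 0"
    by unfold_locales (use p0_ord[of "-1"] in \<open>simp_all add: ord_def\<close>)
  interpret mode_m F fu ru cm.am cm.bm cm.Mm cm.Pm by (rule cm.is_mode_m) simp
  show ?thesis by (rule value_m) simp
qed

lemma p_0_small: assumes "\<omega> = \<i> \<or> \<omega> = -1" shows "ord F 2 (\<lambda>e. of_real (pu e \<omega> 0))"
proof -
  have "ord F 2 (\<lambda>e. (of_real (pu e \<i> 0) + 2 * of_real e ^ 2) - 2 * of_real e ^ 2)"
    by (rule ord_le, (rule p_i_0 ord_rules)+, simp)
  moreover have "ord F 2 (\<lambda>e. (of_real (pu e (-1) 0) + 8 * of_real e ^ 4) - 8 * of_real e ^ 4)"
    by (rule ord_le, (rule p_m_0 ord_rules)+, simp)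
  ultimately show ?thesis using assms by auto
qed

text \<open>
  With \<open>p(0) = O(\<epsilon>\<^sup>2)\<close> the quadratic inequality \<open>root_bound\<close> gives \<open>m = O(\<epsilon>)\<close>, which makes the expansions applicable.
\<close>

lemma root_small:
  assumes w: "\<omega> = \<i> \<or> \<omega> = -1" and m: "eventually (\<lambda>e. \<bar>m e\<bar> \<le> 1/60 \<and> pu e \<omega> (m e) = 0) F"
  shows "ord F 1 (\<lambda>e. of_real (m e))"
proof -
  have w4: "\<omega>^4 = 1" using w by auto
  obtain L where L: "L > 0" "eventually (\<lambda>e. norm (complex_of_real (pu e \<omega> 0)) \<le> L * e ^ 2) F"
    using ordD[OF p_0_small[OF w]] .
  define A where "A = 20 * (6 * K + 4)"
  show ?thesis
  proof (rule ordI)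
    show "eventually (\<lambda>e. norm (complex_of_real (m e)) \<le> (4 * L + 1 + \<bar>A\<bar>) * e ^ 1) F"
      using L(2) m cr ev_small
    proof eventually_elim
      case (elim e)
      then interpret cross e "K * e" "u e" by simp
      have e: "e > 0" using elim by simp
      have "(m e)\<^sup>2 \<le> 4 * \<bar>p \<omega> 0\<bar> + 20 * \<eta> * \<bar>m e\<bar>"
        using elim by (intro reg_pencil.root_bound[OF reg[OF w4]]) auto
      also have "20 * \<eta> = A * e" by (simp add: \<eta>_def A_def algebra_simps)
      finally have b: "\<bar>m e\<bar> * \<bar>m e\<bar> \<le> 4 * (L * e\<^sup>2) + A * e * \<bar>m e\<bar>" using elim by (simp add: power2_eq_square)
      show ?case
      proof (cases "\<bar>m e\<bar> \<le> e")
        case True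
        have "1 * e \<le> (4 * L + 1 + \<bar>A\<bar>) * e" using L e by (intro mult_right_mono) auto
        with True show ?thesis by simp
      next
        case False
        have "e\<^sup>2 \<le> e * \<bar>m e\<bar>" using False e unfolding power2_eq_square by (intro mult_left_mono) auto
        then have "4 * (L * e\<^sup>2) \<le> 4 * L * e * \<bar>m e\<bar>" using L by (simp add: mult.assoc)
        moreover have "A * e * \<bar>m e\<bar> \<le> \<bar>A\<bar> * e * \<bar>m e\<bar>" using e by (intro mult_right_mono) auto
        ultimately have "\<bar>m e\<bar> * \<bar>m e\<bar> \<le> ((4 * L + \<bar>A\<bar>) * e) * \<bar>m e\<bar>" using b by (simp add: algebra_simps)
        then have "\<bar>m e\<bar> \<le> (4 * L + \<bar>A\<bar>) * e" by (rule mult_right_le_imp_le) (use False e in linarith)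
        then show ?thesis using e by (simp add: algebra_simps)
      qed
    qed
  qed
qed

lemma ord_zero_ev: "eventually (\<lambda>e. h e = 0) F \<Longrightarrow> ord F k (\<lambda>e. complex_of_real (h e))"
  by (rule ord_ev[where g="\<lambda>_. 0"]) (auto simp: ord_def)

lemma root_modes:
  assumes m: "ord F 1 (\<lambda>e. of_real (m e))" and p: "eventually (\<lambda>e. pu e \<omega> (m e) = 0) F"
  shows "\<omega> = \<i> \<Longrightarrow> \<exists>\<alpha> \<beta>. mode_i F fu ru \<alpha> \<beta> (\<lambda>e. of_real (m e)) (\<lambda>_. 0)"
    and "\<omega> = -1 \<Longrightarrow> \<exists>\<alpha> \<beta>. mode_m F fu ru \<alpha> \<beta> (\<lambda>e. of_real (m e)) (\<lambda>_. 0)"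
proof -
  have cm: "cross_mode F u C K \<omega> m" if "\<omega>^4 = 1"
    by unfold_locales (rule that m ord_zero_ev[OF p])+
  have z: "eventually (\<lambda>e. complex_of_real (pu e \<omega> (m e)) = 0) F" using p by eventually_elim simp
  show "\<exists>\<alpha> \<beta>. mode_i F fu ru \<alpha> \<beta> (\<lambda>e. of_real (m e)) (\<lambda>_. 0)" if w: "\<omega> = \<i>"
  proof -
    interpret cm: cross_mode F u C K \<omega> m by (rule cm) (simp add: w)
    interpret mode_i F fu ru cm.am cm.bm cm.Mm cm.Pm by (rule cm.is_mode_i[OF w])
    have "mode_i F fu ru cm.am cm.bm cm.Mm (\<lambda>_. 0)" by (rule mode_i.intro[OF zero_rhs[OF z]])
    then show ?thesis by blast
  qed
  show "\<exists>\<alpha> \<beta>. mode_m F fu ru \<alpha> \<beta> (\<lambda>e. of_real (m e)) (\<lambda>_. 0)" if w: "\<omega> = -1"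
  proof -
    interpret cm: cross_mode F u C K \<omega> m by (rule cm) (simp add: w)
    interpret mode_m F fu ru cm.am cm.bm cm.Mm cm.Pm by (rule cm.is_mode_m[OF w])
    have "mode_m F fu ru cm.am cm.bm cm.Mm (\<lambda>_. 0)" by (rule mode_m.intro[OF zero_rhs[OF z]])
    then show ?thesis by blast
  qed
qed

lemma root_square_i:
  assumes "eventually (\<lambda>e. \<bar>m e\<bar> \<le> 1/60 \<and> pu e \<i> (m e) = 0) F"
  shows "ord F 4 (\<lambda>e. of_real (m e) ^ 2 - 4 * of_real e ^ 2)" "ord F 8 (\<lambda>e. det_i (of_real e) (ru e) (of_real (m e)))"
proof -
  have "eventually (\<lambda>e. pu e \<i> (m e) = 0) F" using assms by eventually_elim simp
  then obtain \<alpha> \<beta> where "mode_i F fu ru \<alpha> \<beta> (\<lambda>e. of_real (m e)) (\<lambda>_. 0)"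
    using root_modes(1)[OF root_small[OF _ assms]] by blast
  then interpret mi: mode_i F fu ru \<alpha> \<beta> "\<lambda>e. of_real (m e)" "\<lambda>_. 0" .
  show "ord F 4 (\<lambda>e. of_real (m e) ^ 2 - 4 * of_real e ^ 2)" by (rule mi.root_i_square) simp
  show "ord F 8 (\<lambda>e. det_i (of_real e) (ru e) (of_real (m e)))" by (rule mi.root_i) simp
qed

lemma root_square_m:
  assumes "eventually (\<lambda>e. \<bar>m e\<bar> \<le> 1/60 \<and> pu e (-1) (m e) = 0) F"
  shows "ord F 6 (\<lambda>e. of_real (m e) ^ 2 - 16 * of_real e ^ 4)"
proof -
  have "eventually (\<lambda>e. pu e (-1) (m e) = 0) F" using assms by eventually_elim simp
  then obtain \<alpha> \<beta> where "mode_m F fu ru \<alpha> \<beta> (\<lambda>e. of_real (m e)) (\<lambda>_. 0)"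
    using root_modes(2)[OF root_small[OF _ assms]] by blast
  then interpret mi: mode_m F fu ru \<alpha> \<beta> "\<lambda>e. of_real (m e)" "\<lambda>_. 0" .
  show "ord F 6 (\<lambda>e. of_real (m e) ^ 2 - 16 * of_real e ^ 4)" by (rule mi.root_m_square) simp
qed

end

text \<open>
  A common zero of two sectors would contradict either the odd part of the determinant or the different sizes \<open>4\<epsilon>\<^sup>2\<close> and
  \<open>16\<epsilon>\<^sup>4\<close> of the squares.
\<close>

lemma (in cross_family) simple_roots:
  "eventually (\<lambda>e. \<forall>m. \<not> (\<bar>m\<bar> \<le> 1/60 \<and> pu e \<i> m = 0 \<and> (pu e \<i> (- m) = 0 \<or> pu e (-1) m = 0))) F"
proof -
  have 1: "eventually (\<lambda>e. \<forall>m. \<not> (\<bar>m\<bar> \<le> 1/60 \<and> pu e \<i> m = 0 \<and> pu e \<i> (- m) = 0)) F"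
  proof (rule eventually_no_exception)
    fix F' m assume "F' \<le> F" and m: "eventually (\<lambda>e. \<bar>m e\<bar> \<le> 1/60 \<and> pu e \<i> (m e) = 0 \<and> pu e \<i> (- m e) = 0) F'"
    then interpret c: cross_family F' u C K by (intro cross_family_mono[OF cross_family_axioms])
    have a: "eventually (\<lambda>e. \<bar>m e\<bar> \<le> 1/60 \<and> pu e \<i> (m e) = 0) F'"
      and b: "eventually (\<lambda>e. \<bar>- m e\<bar> \<le> 1/60 \<and> pu e \<i> (- m e) = 0) F'" using m by (auto elim: eventually_mono)
    show "F' = bot"
      using c.det_i_no_opposite_roots[OF c.root_small[OF _ a] c.root_square_i(2)[OF a]] c.root_square_i(2)[OF b] by simp
  qed
  have 2: "eventually (\<lambda>e. \<forall>m. \<not> (\<bar>m\<bar> \<le> 1/60 \<and> pu e \<i> m = 0 \<and> pu e (-1) m = 0)) F"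
  proof (rule eventually_no_exception)
    fix F' m assume "F' \<le> F" and m: "eventually (\<lambda>e. \<bar>m e\<bar> \<le> 1/60 \<and> pu e \<i> (m e) = 0 \<and> pu e (-1) (m e) = 0) F'"
    then interpret c: cross_family F' u C K by (intro cross_family_mono[OF cross_family_axioms])
    have a: "eventually (\<lambda>e. \<bar>m e\<bar> \<le> 1/60 \<and> pu e \<i> (m e) = 0) F'"
      and b: "eventually (\<lambda>e. \<bar>m e\<bar> \<le> 1/60 \<and> pu e (-1) (m e) = 0) F'" using m by (auto elim: eventually_mono)
    have "ord F' 4 (\<lambda>e. (of_real (m e) ^ 2 - 16 * of_real e ^ 4) + 16 * of_real e ^ 4)"
      by (rule c.ord_le, (rule c.root_square_m[OF b] c.ord_rules)+, simp)
    then show "F' = bot" by (intro c.square_roots_apart[OF c.root_square_i(1)[OF a]]) simp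
  qed
  from 1 2 show ?thesis by eventually_elim blast
qed

context germ begin

text \<open>
  Divide \<open>m\<^sup>2 - (c \<epsilon>\<^sup>j)\<^sup>2\<close> by \<open>m + c \<epsilon>\<^sup>j\<close>, which is at least \<open>c \<epsilon>\<^sup>j\<close>.
\<close>

lemma sqrt_asymptotics:
  assumes "ord F (k + 2 * j) (\<lambda>e. of_real (m e) ^ 2 - of_real (c * e ^ j) ^ 2)" "c > 0" "eventually (\<lambda>e. m e > 0) F"
  shows "ord F (k + j) (\<lambda>e. of_real (m e) - of_real (c * e ^ j))"
proof -
  obtain L where L: "L > 0" "eventually (\<lambda>e. norm (complex_of_real (m e) ^ 2 - of_real (c * e ^ j) ^ 2) \<le> L * e ^ (k + 2 * j)) F"
    using ordD[OF assms(1)] .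
  show ?thesis
  proof (rule ordI)
    show "eventually (\<lambda>e. norm (complex_of_real (m e) - of_real (c * e ^ j)) \<le> (L / c) * e ^ (k + j)) F"
      using L(2) assms(3) ev_small
    proof eventually_elim
      case (elim e)
      have n: "complex_of_real (m e) ^ 2 - of_real (c * e ^ j) ^ 2 = of_real ((m e - c * e ^ j) * (m e + c * e ^ j))"
        by (simp add: power2_eq_square algebra_simps)
      have pos: "c * e ^ j > 0" using elim assms(2) by simp
      have "\<bar>m e - c * e ^ j\<bar> * (c * e ^ j) \<le> \<bar>m e - c * e ^ j\<bar> * \<bar>m e + c * e ^ j\<bar>"
        using elim pos by (intro mult_left_mono) auto
      also have "\<dots> \<le> L * e ^ (k + 2 * j)" using elim(1) unfolding n norm_of_real abs_mult .
      also have "\<dots> = (L / c * e ^ (k + j)) * (c * e ^ j)" using assms(2) by (simp add: power_add mult_2)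
      finally have "\<bar>m e - c * e ^ j\<bar> \<le> L / c * e ^ (k + j)" using pos by (simp only: mult_le_cancel_right_pos)
      then show ?case by (simp only: of_real_diff[symmetric] norm_of_real)
    qed
  qed
qed

lemma eventually_neg:
  assumes "ord F (k + 1) (\<lambda>e. of_real (h e) + of_real (c * e ^ k))" "c > 0" shows "eventually (\<lambda>e. h e < 0) F"
proof -
  obtain L where L: "L > 0" "eventually (\<lambda>e. norm (complex_of_real (h e) + of_real (c * e ^ k)) \<le> L * e ^ (k + 1)) F"
    using ordD[OF assms(1)] .
  have "eventually (\<lambda>e. e < c / L) (at_right 0)"
    using L assms(2) by (auto simp: eventually_at_right_field intro!: exI[of _ "c / L"])
  from ev[OF this] L(2) ev_small show ?thesis
  proof eventually_elim
    case (elim e)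
    have "complex_of_real (h e) + of_real (c * e ^ k) = of_real (h e + c * e ^ k)" by simp
    then have "\<bar>h e + c * e ^ k\<bar> \<le> L * e ^ (k + 1)" using elim(2) by (simp only: norm_of_real)
    then have "h e + c * e ^ k \<le> L * e * e ^ k" by (simp add: mult.assoc)
    also have "\<dots> < c * e ^ k" using elim L by (intro mult_strict_right_mono) (auto simp: field_simps)
    finally show ?case by simp
  qed
qed

end

lemma base_values: "cmod (base x) \<le> 1" "x \<in> set S0 \<Longrightarrow> cmod (base x) = 1"
  by (auto simp: base_def set_S0)

text \<open>
  The constant \<open>K = 3C\<close> covers \<open>|u|\<^sup>2 \<le> (C\<epsilon>)\<^sup>2\<close> off the nodes and \<open>|1 - |u|\<^sup>2| \<le> 3C\<epsilon>\<close> on them once \<open>C\<epsilon> \<le> 1\<close>.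
\<close>

lemma vortex_cross_near_nodes:
  assumes "vortex_cross_family \<Phi>"
  obtains C K where "cross_family (at_right 0) \<Phi> C K"
proof -
  obtain C r where C: "C > 0" "r > 0" and near: "\<And>\<epsilon> x. 0 < \<epsilon> \<Longrightarrow> \<epsilon> < r \<Longrightarrow> cmod (\<Phi> \<epsilon> x - base x) \<le> C * \<epsilon>"
    and st: "\<And>\<epsilon>. 0 < \<epsilon> \<Longrightarrow> \<epsilon> < r \<Longrightarrow> \<Phi> \<epsilon> \<in> ell2 \<and> stationary \<epsilon> (\<Phi> \<epsilon>)"
    using vortex_cross_near[OF assms] by blast
  define K where "K = 3 * C"
  define s where "s = min (min r (1 / C)) (1 / (100000 * (6 * K + 4)))"
  have s: "s > 0" using C by (simp add: s_def K_def)
  have small: "eventually (\<lambda>e. 0 < e \<and> e < s) (at_right 0)"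
    using s by (auto simp: eventually_at_right_field)
  have nc: "near_cross (at_right 0) \<Phi> C"
  proof
    show "eventually (\<lambda>e. stationary e (\<Phi> e)) (at_right 0)" using small by eventually_elim (use st in \<open>simp add: s_def\<close>)
    show "eventually (\<lambda>e. \<forall>x. cmod (\<Phi> e x - base x) \<le> C * e) (at_right 0)" using small by eventually_elim (use near in \<open>simp add: s_def\<close>)
  qed simp
  have "eventually (\<lambda>e. cross e (K * e) (\<Phi> e)) (at_right 0)"
    using small eventually_rot[OF nc]
  proof eventually_elim
    case (elim e)
    have e: "0 < e" "e < r" "e < 1 / C" "e < 1 / (100000 * (6 * K + 4))" using elim by (simp_all add: s_def)
    have Ce: "C * e \<le> 1" "0 \<le> C * e" using e(1,3) C by (simp_all add: field_simps)
    have n: "cmod (\<Phi> e x - base x) \<le> C * e" for x by (rule near[OF e(1,2)])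
    show ?case
    proof
      show "0 < e" "\<Phi> e \<in> ell2" "stationary e (\<Phi> e)" using e st by auto
      show "\<Phi> e (rot x) = \<i> * \<Phi> e x" for x using elim by blast
      show "(cmod (\<Phi> e x))\<^sup>2 \<le> K * e" if "x \<notin> set S0" for x
      proof -
        have "cmod (\<Phi> e x) \<le> C * e" using n[of x] by (simp add: base_off[OF that])
        then have "cmod (\<Phi> e x) * cmod (\<Phi> e x) \<le> (C * e) * 1" using Ce by (intro mult_mono) auto
        then show ?thesis using Ce(2) by (simp add: K_def power2_eq_square)
      qed
      show "\<bar>1 - (cmod (\<Phi> e x))\<^sup>2\<bar> \<le> K * e" if "x \<in> set S0" for x
      proof -
        have d: "\<bar>cmod (\<Phi> e x) - 1\<bar> \<le> C * e"
          using n[of x] norm_triangle_ineq3[of "\<Phi> e x" "base x"] by (simp add: base_values(2)[OF that])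
        have "\<bar>1 - (cmod (\<Phi> e x))\<^sup>2\<bar> = \<bar>cmod (\<Phi> e x) - 1\<bar> * (cmod (\<Phi> e x) + 1)"
        proof -
          have "1 - (cmod (\<Phi> e x))\<^sup>2 = - ((cmod (\<Phi> e x) - 1) * (cmod (\<Phi> e x) + 1))" by (simp add: algebra_simps power2_eq_square)
          then show ?thesis by (simp add: abs_mult)
        qed
        also have "\<dots> \<le> (C * e) * 3" using d Ce by (intro mult_mono) auto
        finally show ?thesis by (simp add: K_def)
      qed
      show "0 \<le> K * e" using Ce(2) by (simp add: K_def)
      have K4: "6 * K + 4 > 0" using C by (simp add: K_def)
      then have "e * (100000 * (6 * K + 4)) < 1" using e(4) by (simp add: pos_less_divide_eq)
      then show "6 * (K * e) + 4 * e \<le> 1 / 100000" by (simp add: algebra_simps)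
    qed
  qed
  with nc have "cross_family (at_right 0) \<Phi> C K" by (simp add: cross_family_def cross_family_axioms_def)
  then show thesis by (rule that)
qed

text \<open>
  The conclusions of \<open>spectral_picture\<close> as one predicate, so that the zeros can be chosen as functions of \<open>\<epsilon>\<close>.
\<close>

definition roots_at :: "real \<Rightarrow> (int \<times> int \<Rightarrow> complex) \<Rightarrow> real \<Rightarrow> real \<Rightarrow> real \<Rightarrow> bool" where
  "roots_at \<epsilon> u a b c \<longleftrightarrow> a < 0 \<and> 0 < b \<and> 0 < c \<and>
     \<bar>a\<bar> \<le> 1/60 \<and> \<bar>b\<bar> \<le> 1/60 \<and> \<bar>c\<bar> \<le> 1/60 \<and>
     cross.p \<epsilon> u \<i> a = 0 \<and> cross.p \<epsilon> u \<i> b = 0 \<and> cross.p \<epsilon> u (-1) c = 0 \<and>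
     distinct [a, -a, b, -b, c, -c] \<and>
     (\<forall>m\<in>{a, -a, b, -b, c, -c}. negative_krein \<epsilon> u (- \<i> * of_real m)) \<and>
     (\<forall>z\<in>spectrum (lin_op \<epsilon> u). z \<noteq> 0 \<longrightarrow> z \<notin> (\<lambda>m. - \<i> * of_real m) ` {a, -a, b, -b, c, -c}
        \<longrightarrow> 1/60 \<le> cmod z \<and> Re z = 0) \<and>
     alg_mult (lin_op \<epsilon> u) 0 = 2 \<and> geom_mult (lin_op \<epsilon> u) 0 = 1"

lemma (in cross_family) eventually_roots: "eventually (\<lambda>e. \<exists>a b c. roots_at e (u e) a b c) F"
proof -
  have i: "eventually (\<lambda>e. pu e \<i> 0 < 0) F"
    by (rule eventually_neg[where k=2 and c=2]) (use p_i_0 in simp_all)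
  have m: "eventually (\<lambda>e. pu e (-1) 0 < 0) F"
    by (rule eventually_neg[where k=4 and c=8]) (use p_m_0 in simp_all)
  from i m simple_roots cr show ?thesis
  proof eventually_elim
    case (elim e)
    interpret cross e "K * e" "u e" by (rule elim(4))
    have s: "p \<i> (- m) \<noteq> 0 \<and> p (-1) m \<noteq> 0" if "\<bar>m\<bar> \<le> 1/60" "p \<i> m = 0" for m using elim(3) that by blast
    show ?case
    proof (rule spectral_picture[OF elim(1,2) s])
      fix a b c
      assume h: "a < 0" "0 < b" "0 < c" "\<bar>a\<bar> \<le> 1/60" "\<bar>b\<bar> \<le> 1/60" "\<bar>c\<bar> \<le> 1/60"
        "p \<i> a = 0" "p \<i> b = 0" "p (-1) c = 0" "distinct [a, -a, b, -b, c, -c]"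
        and kr: "\<And>m. m \<in> {a, -a, b, -b, c, -c} \<Longrightarrow> negative_krein e (u e) (- \<i> * of_real m)"
        and sp: "\<And>z. z \<in> spectrum (lin_op e (u e)) \<Longrightarrow> z \<noteq> 0 \<Longrightarrow> z \<notin> (\<lambda>m. - \<i> * of_real m) ` {a, -a, b, -b, c, -c}
           \<Longrightarrow> 1/60 \<le> cmod z \<and> Re z = 0"
        and mult: "alg_mult (lin_op e (u e)) 0 = 2" "geom_mult (lin_op e (u e)) 0 = 1"
      have k: "\<forall>m\<in>{a, -a, b, -b, c, -c}. negative_krein e (u e) (- \<i> * of_real m)" using kr by (rule ballI)
      have t: "\<forall>z\<in>spectrum (lin_op e (u e)). z \<noteq> 0 \<longrightarrow> z \<notin> (\<lambda>m. - \<i> * of_real m) ` {a, -a, b, -b, c, -c}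
        \<longrightarrow> 1/60 \<le> cmod z \<and> Re z = 0" by (intro ballI impI sp)
      have "roots_at e (u e) a b c" unfolding roots_at_def by (intro conjI h k t mult)
      then show ?thesis by (intro exI)
    qed
  qed
qed

lemma (in cross_family) root_asymptotics:
  assumes r: "eventually (\<lambda>e. roots_at e (u e) (a e) (b e) (c e)) F"
  shows "ord F 3 (\<lambda>e. of_real (a e) + 2 * of_real e)" "ord F 3 (\<lambda>e. of_real (b e) - 2 * of_real e)"
    "ord F 4 (\<lambda>e. of_real (c e) - 4 * of_real e ^ 2)"
proof -
  have ra: "eventually (\<lambda>e. \<bar>a e\<bar> \<le> 1/60 \<and> pu e \<i> (a e) = 0) F" and rb: "eventually (\<lambda>e. \<bar>b e\<bar> \<le> 1/60 \<and> pu e \<i> (b e) = 0) F"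
    and rc: "eventually (\<lambda>e. \<bar>c e\<bar> \<le> 1/60 \<and> pu e (-1) (c e) = 0) F"
    and pos: "eventually (\<lambda>e. - a e > 0) F" "eventually (\<lambda>e. b e > 0) F" "eventually (\<lambda>e. c e > 0) F"
    using r by (auto simp: roots_at_def elim: eventually_mono)
  have "ord F (2 + 1) (\<lambda>e. of_real (- a e) - of_real (2 * e ^ 1))"
    using root_square_i(1)[OF ra] by (intro sqrt_asymptotics[OF _ _ pos(1)]) (simp_all add: power_mult_distrib)
  from ord_minus[OF this] show "ord F 3 (\<lambda>e. of_real (a e) + 2 * of_real e)" by (simp add: numeral_3_eq_3 add.commute)
  have "ord F (2 + 1) (\<lambda>e. of_real (b e) - of_real (2 * e ^ 1))"
    using root_square_i(1)[OF rb] by (intro sqrt_asymptotics[OF _ _ pos(2)]) (simp_all add: power_mult_distrib)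
  then show "ord F 3 (\<lambda>e. of_real (b e) - 2 * of_real e)" by simp
  have "ord F (2 + 2) (\<lambda>e. of_real (c e) - of_real (4 * e ^ 2))"
    using root_square_m[OF rc] by (intro sqrt_asymptotics[OF _ _ pos(3)]) (simp_all add: power_mult_distrib)
  then show "ord F 4 (\<lambda>e. of_real (c e) - 4 * of_real e ^ 2)" by simp
qed

theorem proposition3p2:
  fixes \<Phi> :: "real \<Rightarrow> int \<times> int \<Rightarrow> complex"
  assumes "vortex_cross_family \<Phi>"
  shows "\<exists>\<epsilon>0>0. \<exists>\<delta>>0. \<exists>lam :: nat \<Rightarrow> real \<Rightarrow> complex.
    (\<lambda>\<epsilon>. lam 1 \<epsilon> - 2 * \<i> * of_real \<epsilon>) \<in> O[at_right 0](\<lambda>\<epsilon>. of_real (\<epsilon> ^ 2)) \<and>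
    (\<lambda>\<epsilon>. lam 3 \<epsilon> - 2 * \<i> * of_real \<epsilon>) \<in> O[at_right 0](\<lambda>\<epsilon>. of_real (\<epsilon> ^ 2)) \<and>
    (\<lambda>\<epsilon>. lam 5 \<epsilon> - 4 * \<i> * of_real (\<epsilon> ^ 2)) \<in> O[at_right 0](\<lambda>\<epsilon>. of_real (\<epsilon> ^ 3)) \<and>
    (\<forall>\<epsilon>\<in>{0<..<\<epsilon>0}.
       alg_mult (lin_op \<epsilon> (\<Phi> \<epsilon>)) 0 = 2 \<and> geom_mult (lin_op \<epsilon> (\<Phi> \<epsilon>)) 0 = 1 \<and>
       lam 2 \<epsilon> = - lam 1 \<epsilon> \<and> lam 4 \<epsilon> = - lam 3 \<epsilon> \<and> lam 6 \<epsilon> = - lam 5 \<epsilon> \<and>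
       inj_on (\<lambda>j. lam j \<epsilon>) {1..6} \<and>
       (\<forall>j\<in>{1..6}. Re (lam j \<epsilon>) = 0 \<and> negative_krein \<epsilon> (\<Phi> \<epsilon>) (lam j \<epsilon>)) \<and>
       (\<forall>z\<in>spectrum (lin_op \<epsilon> (\<Phi> \<epsilon>)) - ({0} \<union> (\<lambda>j. lam j \<epsilon>) ` {1..6}).
          \<delta> \<le> cmod z \<and> Re z = 0))"
proof -
  obtain C K where "cross_family (at_right 0) \<Phi> C K" using vortex_cross_near_nodes[OF assms] .
  then interpret cn: cross_family "at_right 0" \<Phi> C K .
  \<comment> \<open>Zeros of the reduced functions, chosen for each \<open>\<epsilon>\<close>.\<close>
  define t where "t e = (SOME (a, b, c). roots_at e (\<Phi> e) a b c)" for e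
  define a b c where "a e = fst (t e)" and "b e = fst (snd (t e))" and "c e = snd (snd (t e))" for e
  have R: "eventually (\<lambda>e. roots_at e (\<Phi> e) (a e) (b e) (c e)) (at_right 0)"
    using cn.eventually_roots
  proof eventually_elim
    case (elim e)
    then have "\<exists>s. case s of (a, b, c) \<Rightarrow> roots_at e (\<Phi> e) a b c" by auto
    then have "case t e of (a, b, c) \<Rightarrow> roots_at e (\<Phi> e) a b c" unfolding t_def by (rule someI_ex)
    then show ?case by (simp add: a_def b_def c_def split: prod.splits)
  qed
  then obtain \<epsilon>0 where e0: "\<epsilon>0 > 0" "\<And>e. 0 < e \<Longrightarrow> e < \<epsilon>0 \<Longrightarrow> roots_at e (\<Phi> e) (a e) (b e) (c e)"
    by (auto simp: eventually_at_right_field)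
  \<comment> \<open>\<open>a\<close> is near \<open>-2\<epsilon>\<close>, so \<open>-\<i> a\<close> is near \<open>2 \<i> \<epsilon>\<close>; likewise for \<open>-b\<close> and \<open>-c\<close>.\<close>
  define lam :: "nat \<Rightarrow> real \<Rightarrow> complex" where "lam j e = - \<i> * of_real
    ((if j = 1 then a else if j = 2 then - a else if j = 3 then - b else if j = 4 then b else if j = 5 then - c else c) e)" for j e
  have lam: "lam 1 e = - \<i> * of_real (a e)" "lam 2 e = - \<i> * of_real (- a e)" "lam 3 e = - \<i> * of_real (- b e)"
    "lam 4 e = - \<i> * of_real (b e)" "lam 5 e = - \<i> * of_real (- c e)" "lam 6 e = - \<i> * of_real (c e)" for e
    by (simp_all add: lam_def)
  have six: "{1..6::nat} = {1, 2, 3, 4, 5, 6}" by auto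
  have img: "(\<lambda>j. lam j e) ` {1..6} = (\<lambda>m. - \<i> * of_real m) ` {a e, - a e, b e, - b e, c e, - c e}" for e
    unfolding six image_insert image_empty lam by blast
  note asy = cn.root_asymptotics[OF R]
  have "ord (at_right 0) 2 (\<lambda>e. - \<i> * (of_real (a e) + 2 * of_real e))"
    by (rule cn.ord_le, (rule asy cn.ord_rules)+, simp)
  then have 1: "(\<lambda>e. lam 1 e - 2 * \<i> * of_real e) \<in> O[at_right 0](\<lambda>e. of_real (e ^ 2))"
    unfolding ord_def lam by (simp add: algebra_simps)
  have "ord (at_right 0) 2 (\<lambda>e. \<i> * (of_real (b e) - 2 * of_real e))"
    by (rule cn.ord_le, (rule asy cn.ord_rules)+, simp)
  then have 3: "(\<lambda>e. lam 3 e - 2 * \<i> * of_real e) \<in> O[at_right 0](\<lambda>e. of_real (e ^ 2))"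
    unfolding ord_def lam by (simp add: algebra_simps)
  have "ord (at_right 0) 3 (\<lambda>e. \<i> * (of_real (c e) - 4 * of_real e ^ 2))"
    by (rule cn.ord_le, (rule asy cn.ord_rules)+, simp)
  then have 5: "(\<lambda>e. lam 5 e - 4 * \<i> * of_real (e ^ 2)) \<in> O[at_right 0](\<lambda>e. of_real (e ^ 3))"
    unfolding ord_def lam by (simp add: algebra_simps)
  have rest: "alg_mult (lin_op e (\<Phi> e)) 0 = 2 \<and> geom_mult (lin_op e (\<Phi> e)) 0 = 1 \<and>
       lam 2 e = - lam 1 e \<and> lam 4 e = - lam 3 e \<and> lam 6 e = - lam 5 e \<and>
       inj_on (\<lambda>j. lam j e) {1..6} \<and>
       (\<forall>j\<in>{1..6}. Re (lam j e) = 0 \<and> negative_krein e (\<Phi> e) (lam j e)) \<and>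
       (\<forall>z\<in>spectrum (lin_op e (\<Phi> e)) - ({0} \<union> (\<lambda>j. lam j e) ` {1..6}). 1/60 \<le> cmod z \<and> Re z = 0)"
    if e: "e \<in> {0<..<\<epsilon>0}" for e
  proof -
    have r: "roots_at e (\<Phi> e) (a e) (b e) (c e)" using e0(2) e by simp
    have d: "distinct [a e, - a e, b e, - b e, c e, - c e]" using r by (simp add: roots_at_def)
    have inj: "inj_on (\<lambda>j. lam j e) {1..6}"
    proof (rule eq_card_imp_inj_on)
      have "card ((\<lambda>m. - \<i> * complex_of_real m) ` set [a e, - a e, b e, - b e, c e, - c e]) = 6"
        using distinct_card[OF d] by (subst card_image) (simp_all add: inj_on_def del: distinct.simps)
      then show "card ((\<lambda>j. lam j e) ` {1..6}) = card {1..6::nat}" unfolding img by simp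
    qed simp
    have kr: "Re (lam j e) = 0 \<and> negative_krein e (\<Phi> e) (lam j e)" if j: "j \<in> {1..6}" for j
    proof -
      have "lam j e \<in> (\<lambda>m. - \<i> * of_real m) ` {a e, - a e, b e, - b e, c e, - c e}"
        using imageI[OF j, of "\<lambda>j. lam j e"] unfolding img .
      then obtain m where m: "m \<in> {a e, - a e, b e, - b e, c e, - c e}" "lam j e = - \<i> * of_real m" by blast
      have "\<forall>m\<in>{a e, - a e, b e, - b e, c e, - c e}. negative_krein e (\<Phi> e) (- \<i> * of_real m)"
        using r unfolding roots_at_def by blast
      then have "negative_krein e (\<Phi> e) (lam j e)" using m(1) unfolding m(2) by (rule bspec)
      then show ?thesis by (simp add: m(2))
    qed
    have sp: "\<forall>z\<in>spectrum (lin_op e (\<Phi> e)) - ({0} \<union> (\<lambda>j. lam j e) ` {1..6}). 1/60 \<le> cmod z \<and> Re z = 0"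
      unfolding img using r unfolding roots_at_def by blast
    have am: "alg_mult (lin_op e (\<Phi> e)) 0 = 2" "geom_mult (lin_op e (\<Phi> e)) 0 = 1" using r by (simp_all add: roots_at_def)
    have "lam 2 e = - lam 1 e" "lam 4 e = - lam 3 e" "lam 6 e = - lam 5 e" unfolding lam by simp_all
    then show ?thesis using am inj kr sp by blast
  qed
  have "(0::real) < 1/60" by simp
  with e0(1) 1 3 5 rest show ?thesis by blast
qed

end
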